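(* Let $r\ge b$ be positive integers such that $\frac{1}{3}\leq \frac{b}{r} \leq\frac{4}{5}$, and let $N=r+b$. Given $r$ red points and $b$ blue points in the plane in general position, a $K_{1,3}$-covering of a subset of at least $\frac{8}{9}(r+b)-4$ of the points can be computed in $O(N^{4/3}\log^3 N)$ time.
   Context: General position: no three points collinear. A $K_{1,3}$-covering of a set $X$ of red and blue points is a partition of $X$ into subsets of size $4$, each consisting of one point (the center) of one color and three points of the other color, such that the straight-line segments joining each center to the three other points of its subset are pairwise non-crossing (no two intersect except at a common endpoint). *)

theory Defs
  imports "HOL-Analysis.Analysis" "HOL-Library.Disjoint_Sets" "HOL-Library.Landau_Symbols"
begin

section \<open>Coverings by non-crossing stars\<close>

type_synonym point = "real \<times> real"

definition general_position :: "point set \<Rightarrow> bool" where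
  "general_position X \<longleftrightarrow>
     (\<forall>x\<in>X. \<forall>y\<in>X. \<forall>z\<in>X. x \<noteq> y \<and> y \<noteq> z \<and> x \<noteq> z \<longrightarrow> \<not> collinear {x, y, z})"

text \<open>A star is a pair of its center and the set of its three leaves.\<close>

type_synonym star = "point \<times> point set"

definition is_K13 :: "point set \<Rightarrow> point set \<Rightarrow> star \<Rightarrow> bool" where
  "is_K13 R B = (\<lambda>(c, L). card L = 3 \<and> (c \<in> R \<and> L \<subseteq> B \<or> c \<in> B \<and> L \<subseteq> R))"

definition star_vertices :: "star \<Rightarrow> point set" where
  "star_vertices = (\<lambda>(c, L). insert c L)"

definition star_edges :: "star \<Rightarrow> (point \<times> point) set" where
  "star_edges = (\<lambda>(c, L). {c} \<times> L)"

definition noncrossing :: "(point \<times> point) set \<Rightarrow> bool" where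
  "noncrossing E \<longleftrightarrow>
     (\<forall>(a, b)\<in>E. \<forall>(c, d)\<in>E. (a, b) \<noteq> (c, d) \<longrightarrow>
        closed_segment a b \<inter> closed_segment c d \<subseteq> {a, b} \<inter> {c, d})"

text \<open>
  For disjoint color classes a set of points determines its center, so distinct stars in
  \<open>S\<close> have distinct vertex sets and the image below does not identify parts.
\<close>

definition K13_covering :: "point set \<Rightarrow> point set \<Rightarrow> point set \<Rightarrow> star set \<Rightarrow> bool" where
  "K13_covering R B X S \<longleftrightarrow>
     partition_on X (star_vertices ` S) \<and>
     (\<forall>s\<in>S. is_K13 R B s) \<and>
     noncrossing (\<Union>s\<in>S. star_edges s)"

section \<open>The real RAM\<close>

text \<open>
  A deterministic unit-cost real RAM: a fixed finite program acts on word registers, real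
  registers, and two memories (of words and of reals) that are addressed by words. Reals admit
  the field operations and comparison only; there is no rounding from reals to words, and the only
  real constants are those computable from words. Words are naturals; \<^const>\<open>minus\<close>
  on them truncates, and division by zero yields zero. Their size is
  restricted in \<open>computes_within\<close> below.
\<close>

datatype word_op = WAdd | WSub | WMul | WDiv | WMod
datatype real_op = RAdd | RSub | RMul | RDiv

datatype instr =
    WConst nat nat
  | WArith word_op nat nat nat
  | WLoad nat nat
  | WStore nat nat
  | RCast nat nat
  | RArith real_op nat nat nat
  | RLoad nat nat
  | RStore nat nat
  | Jump nat
  | JumpWLess nat nat nat
  | JumpRLess nat nat nat

record state =
  pc :: nat
  wreg :: "nat \<Rightarrow> nat"
  rreg :: "nat \<Rightarrow> real"
  wmem :: "nat \<Rightarrow> nat"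
  rmem :: "nat \<Rightarrow> real"

fun word_arith :: "word_op \<Rightarrow> nat \<Rightarrow> nat \<Rightarrow> nat" where
  "word_arith WAdd x y = x + y"
| "word_arith WSub x y = x - y"
| "word_arith WMul x y = x * y"
| "word_arith WDiv x y = x div y"
| "word_arith WMod x y = x mod y"

fun real_arith :: "real_op \<Rightarrow> real \<Rightarrow> real \<Rightarrow> real" where
  "real_arith RAdd x y = x + y"
| "real_arith RSub x y = x - y"
| "real_arith RMul x y = x * y"
| "real_arith RDiv x y = x / y"

definition goto :: "nat \<Rightarrow> state \<Rightarrow> state" where
  "goto l s = s\<lparr>pc := l\<rparr>"

definition next_pc :: "state \<Rightarrow> state" where
  "next_pc s = goto (pc s + 1) s"

fun exec :: "instr \<Rightarrow> state \<Rightarrow> state" where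
  "exec (WConst i n) s = next_pc (s\<lparr>wreg := (wreg s)(i := n)\<rparr>)"
| "exec (WArith f i j k) s =
     next_pc (s\<lparr>wreg := (wreg s)(i := word_arith f (wreg s j) (wreg s k))\<rparr>)"
| "exec (WLoad i j) s = next_pc (s\<lparr>wreg := (wreg s)(i := wmem s (wreg s j))\<rparr>)"
| "exec (WStore i j) s = next_pc (s\<lparr>wmem := (wmem s)(wreg s i := wreg s j)\<rparr>)"
| "exec (RCast i j) s = next_pc (s\<lparr>rreg := (rreg s)(i := real (wreg s j))\<rparr>)"
| "exec (RArith f i j k) s =
     next_pc (s\<lparr>rreg := (rreg s)(i := real_arith f (rreg s j) (rreg s k))\<rparr>)"
| "exec (RLoad i j) s = next_pc (s\<lparr>rreg := (rreg s)(i := rmem s (wreg s j))\<rparr>)"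
| "exec (RStore i j) s = next_pc (s\<lparr>rmem := (rmem s)(wreg s i := rreg s j)\<rparr>)"
| "exec (Jump l) s = goto l s"
| "exec (JumpWLess i j l) s = (if wreg s i < wreg s j then goto l s else next_pc s)"
| "exec (JumpRLess i j l) s = (if rreg s i < rreg s j then goto l s else next_pc s)"

definition halted :: "instr list \<Rightarrow> state \<Rightarrow> bool" where
  "halted P s \<longleftrightarrow> length P \<le> pc s"

definition step :: "instr list \<Rightarrow> state \<Rightarrow> state" where
  "step P s = (if halted P s then s else exec (P ! pc s) s)"

definition words_bounded :: "nat \<Rightarrow> state \<Rightarrow> bool" where
  "words_bounded M s \<longleftrightarrow> (\<forall>i. wreg s i \<le> M) \<and> (\<forall>a. wmem s a \<le> M)"

text \<open>
  Started in \<open>s\<close>, program \<open>P\<close> halts in \<open>s'\<close> after at most \<open>t\<close> instructions, with no word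
  ever exceeding \<open>M\<close>. For inputs of size \<open>N\<close> one takes \<open>M = N ^ k\<close> with constant \<open>k\<close>, i.e.\ words
  of \<open>O(log N)\<close> bits, which prevents hiding superconstant work in unit-cost word arithmetic.
\<close>

definition computes_within :: "instr list \<Rightarrow> nat \<Rightarrow> nat \<Rightarrow> state \<Rightarrow> state \<Rightarrow> bool" where
  "computes_within P M t s s' \<longleftrightarrow>
     (\<exists>n\<le>t. (step P ^^ n) s = s' \<and> halted P s' \<and>
            (\<forall>m\<le>n. words_bounded M ((step P ^^ m) s)))"

section \<open>Input and output conventions\<close>

text \<open>
  The numbers of red and blue points are in word registers 0 and 1; the real memory holds the
  coordinates of the red points followed by those of the blue points.
\<close>

definition input_state :: "point list \<Rightarrow> point list \<Rightarrow> state" where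
  "input_state rs bs =
     \<lparr>pc = 0,
      wreg = (\<lambda>_. 0)(0 := length rs, 1 := length bs),
      rreg = (\<lambda>_. 0),
      wmem = (\<lambda>_. 0),
      rmem = (\<lambda>a. if a < 2 * length (rs @ bs)
                  then (if even a then fst else snd) ((rs @ bs) ! (a div 2)) else 0)\<rparr>"

text \<open>
  On termination word register 0 holds the number of stars; the word memory lists, for each star,
  the input index of its center followed by those of its leaves.
\<close>

definition outputs_stars :: "point list \<Rightarrow> state \<Rightarrow> star list \<Rightarrow> bool" where
  "outputs_stars ps s S \<longleftrightarrow>
     length S = wreg s 0 \<and>
     (\<forall>a < 4 * length S. wmem s a < length ps) \<and>
     (\<forall>j < length S. S ! j =
        (ps ! wmem s (4 * j),
         {ps ! wmem s (4 * j + 1), ps ! wmem s (4 * j + 2), ps ! wmem s (4 * j + 3)}))"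

end

theory Submission
  imports Defs "HOL-Library.Multiset" "HOL-Real_Asymp.Real_Asymp"
begin

text \<open>Existence: \<open>n\<close> points with enough of both colors contain about \<open>2n/9\<close> disjoint, mutually
  non-crossing stars. If one color has at least three times as many points as there
  are to be stars, assign three leaves to each center with minimal total length; such an assignment has no crossings. Otherwise a
  ham-sandwich line halves both colors, a translate of it cuts off a prescribed number of points
  while keeping the colors nearly balanced, and induction applies on both sides. Cutting
  off a multiple of 18 points loses no star.

  Algorithm: cut cells of points by lines until they have constant size and solve those by exhaustive search. To cut
  a cell of \<open>n\<close> points, pair the left half with the right half, take the median slope of the pairs and the larger of the two
  lower quartiles in the direction of that slope; this yields a point \<open>o\<close> such that every line through \<open>o\<close> has a
  constant fraction of the cell on both sides. Turning a line about \<open>o\<close> through half a turn exchanges its sides, so by a discrete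
  intermediate value argument some position has nearly the color ratio of the cell. The cost is dominated
  by sorting, which gives \<open>O(N log\<^sup>2 N)\<close> in total.\<close>

section \<open>Existence of star packings\<close>

text \<open>The two tasks are kept apart. The existence bound uses exact ham-sandwich lines, but it
  is applied only to cells of constant size, where it guarantees that exhaustive search succeeds.
  The algorithm never computes a ham-sandwich line, and its cuts may be off balance by a constant
  number of points. This is affordable because \<open>n\<close> points need only \<open>2n/9\<close>
  of each color, while the hypotheses provide \<open>N/4\<close>: the gap \<open>n/36\<close>
  absorbs a bounded deficit once \<open>n\<close> is large. The number 18 originates in nine points,
  five of one color and four of the other: they always contain two stars, and two such sets give
  four stars on 18 points, the exact rate \<open>2/9\<close>. The obstacle is rounding. A star lost
  at every cut would add up to a linear loss. Hence the algorithm cuts at multiples of 18 only, so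
  that a single remainder modulo 18 is left to pay for. It costs at most one star, which is the 4 in
  the bound. For the same reason the existence proof runs through residues of the number of stars,
  with a few small values treated by hand.\<close>

definition star_on :: "point set \<Rightarrow> point set \<Rightarrow> point list \<Rightarrow> bool" where
  "star_on R B s \<longleftrightarrow> length s = 4 \<and> distinct s \<and>
     (hd s \<in> R \<and> set (tl s) \<subseteq> B \<or> hd s \<in> B \<and> set (tl s) \<subseteq> R)"

text \<open>Whole edges are disjoint, endpoints included. Since every vertex of a star lies on one
  of its edges, the two stars are then disjoint as point sets, so \<open>packing\<close> needs no
  separate disjointness condition. Edges of one star are not compared: in general position they meet
  in the center only.\<close>

definition apart :: "point list \<Rightarrow> point list \<Rightarrow> bool" where
  "apart s t \<longleftrightarrow> (\<forall>p\<in>set (tl s). \<forall>q\<in>set (tl t).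
     closed_segment (hd s) p \<inter> closed_segment (hd t) q = {})"

definition packing :: "point set \<Rightarrow> point set \<Rightarrow> point list list \<Rightarrow> bool" where
  "packing R B qs \<longleftrightarrow> (\<forall>s\<in>set qs. star_on R B s) \<and> sorted_wrt apart qs"

definition packs :: "nat \<Rightarrow> point set \<Rightarrow> point set \<Rightarrow> bool" where
  "packs m R B \<longleftrightarrow> (\<exists>qs. length qs = m \<and> packing R B qs)"

lemma star_on_mono: "star_on R B s \<Longrightarrow> R \<subseteq> R' \<Longrightarrow> B \<subseteq> B' \<Longrightarrow> star_on R' B' s"
  unfolding star_on_def by blast

lemma star_on_swap: "star_on R B s \<Longrightarrow> star_on B R s"
  unfolding star_on_def by blast

lemma star_on_subset: "star_on R B s \<Longrightarrow> set s \<subseteq> R \<union> B"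
  unfolding star_on_def by (cases s) auto

lemma packing_mono: "packing R B qs \<Longrightarrow> R \<subseteq> R' \<Longrightarrow> B \<subseteq> B' \<Longrightarrow> packing R' B' qs"
  unfolding packing_def using star_on_mono by blast

lemma packs_mono: "packs m R B \<Longrightarrow> R \<subseteq> R' \<Longrightarrow> B \<subseteq> B' \<Longrightarrow> packs m R' B'"
  unfolding packs_def using packing_mono by blast

lemma packs_swap: "packs m R B \<Longrightarrow> packs m B R"
  unfolding packs_def packing_def using star_on_swap by blast

lemma apartI_hull:
  assumes "set s \<subseteq> U" "set t \<subseteq> V" "convex hull U \<inter> convex hull V = {}" "s \<noteq> []" "t \<noteq> []"
  shows "apart s t"
  unfolding apart_def
proof (intro ballI)
  fix p q assume "p \<in> set (tl s)" "q \<in> set (tl t)"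
  then have "hd s \<in> U" "p \<in> U" "hd t \<in> V" "q \<in> V"
    using assms by (auto dest: list.set_sel(2))
  then have "closed_segment (hd s) p \<subseteq> convex hull U" "closed_segment (hd t) q \<subseteq> convex hull V"
    by (simp_all add: closed_segment_subset hull_inc)
  then show "closed_segment (hd s) p \<inter> closed_segment (hd t) q = {}" using assms(3) by blast
qed

lemma packing_append:
  assumes p: "packing R1 B1 qs1" and q: "packing R2 B2 qs2"
    and hull: "\<forall>s\<in>set qs1. \<forall>t\<in>set qs2. apart s t"
    and sub: "R1 \<subseteq> R" "R2 \<subseteq> R" "B1 \<subseteq> B" "B2 \<subseteq> B"
  shows "packing R B (qs1 @ qs2)"
proof -
  have "packing R B qs1" "packing R B qs2"
    using packing_mono[OF p] packing_mono[OF q] sub by blast+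
  then show ?thesis using hull unfolding packing_def by (auto simp: sorted_wrt_append)
qed

lemma packs_union:
  assumes "packs m1 R1 B1" "packs m2 R2 B2"
    and hull: "convex hull (R1 \<union> B1) \<inter> convex hull (R2 \<union> B2) = {}"
    and sub: "R1 \<subseteq> R" "R2 \<subseteq> R" "B1 \<subseteq> B" "B2 \<subseteq> B"
  shows "packs (m1 + m2) R B"
proof -
  obtain qs1 qs2 where q: "length qs1 = m1" "packing R1 B1 qs1" "length qs2 = m2" "packing R2 B2 qs2"
    using assms(1,2) unfolding packs_def by blast
  have "apart s t" if "s \<in> set qs1" "t \<in> set qs2" for s t
  proof -
    have "star_on R1 B1 s" "star_on R2 B2 t" using q that unfolding packing_def by blast+
    then show ?thesis
      using apartI_hull[OF star_on_subset star_on_subset hull] unfolding star_on_def by fastforce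
  qed
  then have "packing R B (qs1 @ qs2)" using packing_append q sub by blast
  then show ?thesis unfolding packs_def using q by (metis length_append)
qed

section \<open>Stars with centers of one color: assignments of minimal length\<close>

lemma general_position_subset: "general_position X \<Longrightarrow> Y \<subseteq> X \<Longrightarrow> general_position Y"
  unfolding general_position_def by blast

lemma general_positionD:
  "general_position X \<Longrightarrow> x \<in> X \<Longrightarrow> y \<in> X \<Longrightarrow> z \<in> X \<Longrightarrow> x \<noteq> y \<Longrightarrow> y \<noteq> z \<Longrightarrow> x \<noteq> z \<Longrightarrow>
     \<not> collinear {x, y, z}"
  unfolding general_position_def by blast

lemma collinear_between:
  fixes x a b :: "'a::euclidean_space"
  assumes "x \<in> closed_segment a b"
  shows "collinear {x, a, b}"
proof -
  have "collinear {a, x, b}" using between_imp_collinear assms by (simp add: between_mem_segment)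
  moreover have "{a, x, b} = {x, a, b}" by blast
  ultimately show ?thesis by simp
qed

text \<open>Route both new edges through the crossing point \<open>z\<close>: by the triangle
  inequality neither gets longer than its route. The edge from \<open>a\<close> to \<open>d\<close>
  is strictly shorter, because \<open>z\<close> on it would make \<open>a\<close>, \<open>b\<close>,
  \<open>d\<close> collinear, or \<open>a\<close>, \<open>c\<close>, \<open>d\<close> in case
  \<open>z = a\<close>.\<close>

lemma swap_shortens:
  fixes a b c d z :: "'a::euclidean_space"
  assumes z: "z \<in> closed_segment a b" "z \<in> closed_segment c d"
    and nc: "\<not> collinear {a, b, d}" "\<not> collinear {a, c, d}"
  shows "dist a d + dist c b < dist a b + dist c d"
proof -
  have zad: "z \<notin> closed_segment a d"
  proof
    assume zd: "z \<in> closed_segment a d"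
    show False
    proof (cases "z = a")
      case True
      then show False using collinear_between[OF z(2)] nc by simp
    next
      case False
      have "collinear {a, z, b}" "collinear {a, z, d}"
        using collinear_between[OF z(1)] collinear_between[OF zd] by (simp_all add: insert_commute)
      then have "collinear {a, b, d}"
        using collinear_3_trans[of b a z d] False by (simp add: insert_commute)
      then show False using nc by simp
    qed
  qed
  have "dist a d < dist a z + dist z d"
    using zad dist_triangle[of a d z] by (metis between between_mem_segment order_le_less)
  moreover have "dist c b \<le> dist c z + dist z b" by (rule dist_triangle)
  moreover have "dist a b = dist a z + dist z b" "dist c d = dist c z + dist z d"
    using z by (metis between between_mem_segment)+
  ultimately show ?thesis by linarith
qed

lemma sum_swap_less:
  fixes f g :: "nat \<Rightarrow> real"
  assumes "finite A" "i \<in> A" "j \<in> A" "i \<noteq> j" "\<And>k. k \<in> A \<Longrightarrow> k \<noteq> i \<Longrightarrow> k \<noteq> j \<Longrightarrow> g k = f k"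
    and "g i + g j < f i + f j"
  shows "sum g A < sum f A"
proof -
  have "sum h A = h i + h j + sum h (A - {i, j})" for h :: "nat \<Rightarrow> real"
  proof -
    have "sum h A = h i + sum h (A - {i})" using assms by (simp add: sum.remove)
    also have "sum h (A - {i}) = h j + sum h (A - {i} - {j})"
      using assms by (simp add: sum.remove)
    also have "A - {i} - {j} = A - {i, j}" by blast
    finally show ?thesis by simp
  qed
  moreover have "sum g (A - {i, j}) = sum f (A - {i, j})" using assms(5) by (intro sum.cong) auto
  ultimately show ?thesis using assms(6) by (metis add_less_cancel_right)
qed

text \<open>A star packing whose centers all have one color: take an assignment of leaves to centers
  of minimal total length; exchanging the leaves of two crossing edges would shorten it.\<close>

lemma packs_pure:
  assumes "finite R" "finite B" "R \<inter> B = {}" "general_position (R \<union> B)" "3 * m \<le> card R" "m \<le> card B"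
  shows "packs m R B"
proof -
  obtain C where C: "C \<subseteq> B" "card C = m" by (metis assms(6) obtain_subset_with_card_n)
  obtain L where L: "L \<subseteq> R" "card L = 3 * m" by (metis assms(5) obtain_subset_with_card_n)
  have fin: "finite C" "finite L" using C L assms finite_subset by blast+
  obtain cs where cs: "set cs = C" "distinct cs" using fin(1) finite_distinct_list by blast
  have lcs: "length cs = m" using cs C distinct_card by fastforce
  \<comment> \<open>An assignment is an enumeration of the leaves: the entries at
    \<open>3 * i\<close>, \<open>3 * i + 1\<close> and \<open>3 * i + 2\<close> belong to the center
    \<open>cs ! i\<close>. Exchanging two leaves is then a swap of two entries and stays in
    \<open>W\<close>.\<close>
  define W where "W = {ls. set ls = L \<and> distinct ls}"
  have lenW: "length ls = 3 * m" if "ls \<in> W" for ls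
    using that L(2) distinct_card unfolding W_def by fastforce
  have "finite W"
    by (rule finite_subset[OF _ finite_lists_length_eq[OF fin(2), of "3 * m"]])
      (use lenW W_def in auto)
  moreover have "W \<noteq> {}" using finite_distinct_list[OF fin(2)] unfolding W_def by auto
  ultimately obtain ls where ls: "ls \<in> W" and
    mn: "\<And>ls'. ls' \<in> W \<Longrightarrow> (\<Sum>k<3*m. dist (cs ! (k div 3)) (ls ! k)) \<le> (\<Sum>k<3*m. dist (cs ! (k div 3)) (ls' ! k))"
    using arg_min_if_finite(1)[of W "\<lambda>ls. \<Sum>k<3*m. dist (cs ! (k div 3)) (ls ! k)"]
      arg_min_least[of W _ "\<lambda>ls. \<Sum>k<3*m. dist (cs ! (k div 3)) (ls ! k)"] by blast
  have len: "length ls = 3 * m" using lenW ls by simp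
  have dls: "distinct ls" and sls: "set ls = L" using ls W_def by auto
  have inR: "ls ! k \<in> R" if "k < 3 * m" for k using that len sls L by (metis nth_mem subsetD)
  have inB: "cs ! k \<in> B" if "k < m" for k using that lcs cs C by (metis nth_mem subsetD)
  have nocross: "closed_segment (cs ! (i div 3)) (ls ! i) \<inter> closed_segment (cs ! (j div 3)) (ls ! j) = {}"
    if ij: "i < 3 * m" "j < 3 * m" "i div 3 \<noteq> j div 3" for i j
  proof (rule ccontr)
    assume "\<not> ?thesis"
    then obtain z where z: "z \<in> closed_segment (cs ! (i div 3)) (ls ! i)" "z \<in> closed_segment (cs ! (j div 3)) (ls ! j)"
      by blast
    have dm: "i div 3 < m" "j div 3 < m" using ij by auto
    have ne: "ls ! i \<noteq> ls ! j" "cs ! (i div 3) \<noteq> cs ! (j div 3)"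
      using ij dm dls len lcs cs(2) by (auto simp: nth_eq_iff_index_eq)
    have neRB: "cs ! a \<noteq> ls ! b" if "a < m" "b < 3 * m" for a b
      using inR[OF that(2)] inB[OF that(1)] assms(3) by (metis disjoint_iff)
    have mem: "cs ! (i div 3) \<in> R \<union> B" "cs ! (j div 3) \<in> R \<union> B" "ls ! i \<in> R \<union> B" "ls ! j \<in> R \<union> B"
      using inR inB ij dm by simp_all
    have "\<not> collinear {cs ! (i div 3), ls ! i, ls ! j}" "\<not> collinear {cs ! (i div 3), cs ! (j div 3), ls ! j}"
      using general_positionD[OF assms(4)] mem ne neRB dm ij by metis+
    from swap_shortens[OF z this]
    have less: "dist (cs ! (i div 3)) (ls ! j) + dist (cs ! (j div 3)) (ls ! i)
      < dist (cs ! (i div 3)) (ls ! i) + dist (cs ! (j div 3)) (ls ! j)" .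
    define ls' where "ls' = ls[i := ls ! j, j := ls ! i]"
    have "set ls' = L" "distinct ls'" unfolding ls'_def using ij len dls sls
      by (simp_all add: set_swap distinct_swap)
    then have "ls' \<in> W" unfolding W_def by simp
    moreover have "(\<Sum>k<3*m. dist (cs ! (k div 3)) (ls' ! k)) < (\<Sum>k<3*m. dist (cs ! (k div 3)) (ls ! k))"
      by (rule sum_swap_less[of _ i j]) (use ij less len in \<open>auto simp: ls'_def nth_list_update\<close>)
    ultimately show False using mn by fastforce
  qed
  define qs where "qs = map (\<lambda>k. [cs ! k, ls ! (3*k), ls ! (3*k+1), ls ! (3*k+2)]) [0..<m]"
  have star: "star_on R B [cs ! k, ls ! (3*k), ls ! (3*k+1), ls ! (3*k+2)]" if k: "k < m" for k
  proof -
    have "ls ! (3*k) \<in> R" "ls ! (3*k+1) \<in> R" "ls ! (3*k+2) \<in> R" "cs ! k \<in> B"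
      using inR inB k by auto
    moreover from this have "cs ! k \<noteq> ls ! (3*k)" "cs ! k \<noteq> ls ! (3*k+1)" "cs ! k \<noteq> ls ! (3*k+2)"
      using assms(3) by (metis disjoint_iff)+
    moreover have "ls ! (3*k) \<noteq> ls ! (3*k+1)" "ls ! (3*k) \<noteq> ls ! (3*k+2)" "ls ! (3*k+1) \<noteq> ls ! (3*k+2)"
      using k dls len by (auto simp: nth_eq_iff_index_eq)
    ultimately show ?thesis unfolding star_on_def by simp
  qed
  have ap: "apart [cs ! k, ls ! (3*k), ls ! (3*k+1), ls ! (3*k+2)] [cs ! l, ls ! (3*l), ls ! (3*l+1), ls ! (3*l+2)]"
    if "k < l" "l < m" for k l
  proof -
    have "closed_segment (cs ! k) (ls ! (3*k+x)) \<inter> closed_segment (cs ! l) (ls ! (3*l+y)) = {}"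
      if "x < 3" "y < 3" for x y
      using nocross[of "3*k+x" "3*l+y"] that \<open>k < l\<close> \<open>l < m\<close> by simp
    from this[of 0 0] this[of 0 1] this[of 0 2] this[of 1 0] this[of 1 1] this[of 1 2]
      this[of 2 0] this[of 2 1] this[of 2 2]
    show ?thesis unfolding apart_def by simp
  qed
  have "packing R B qs" unfolding packing_def qs_def
    using star ap by (auto simp: sorted_wrt_iff_nth_less)
  then show ?thesis unfolding packs_def by (intro exI[of _ qs]) (simp add: qs_def)
qed

section \<open>Weak separation by a line and disjoint convex hulls\<close>

lemma perp_plane:
  fixes d u :: point
  assumes "u \<noteq> 0" "u \<bullet> d = 0"
  shows "\<exists>c. d = c *\<^sub>R (- snd u, fst u)"
proof -
  obtain a b where u: "u = (a, b)" by (cases u)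
  obtain p q where d: "d = (p, q)" by (cases d)
  have e: "a * p + b * q = 0" using assms u d by (simp add: inner_Pair)
  have ab: "a \<noteq> 0 \<or> b \<noteq> 0" using assms u by (simp add: zero_prod_def)
  show ?thesis
  proof (cases "a = 0")
    case True
    then have "q = 0" using ab e by simp
    then show ?thesis using True ab u d by (intro exI[of _ "- p / b"]) simp
  next
    case False
    have "p = - (q / a) * b" using e False by (simp add: field_simps add_eq_0_iff2)
    then show ?thesis using False u d by (intro exI[of _ "q / a"]) simp
  qed
qed

lemma collinear_level:
  fixes u p q r :: point
  assumes "u \<noteq> 0" "u \<bullet> p = v" "u \<bullet> q = v" "u \<bullet> r = v"
  shows "collinear {p, q, r}"
  unfolding collinear_def
proof (intro exI[of _ "(- snd u, fst u)"] ballI)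
  fix x y assume "x \<in> {p, q, r}" "y \<in> {p, q, r}"
  then have "u \<bullet> (x - y) = 0" using assms by (auto simp: inner_diff_right)
  then show "\<exists>c. x - y = c *\<^sub>R (- snd u, fst u)" using perp_plane assms(1) by blast
qed

text \<open>The weighted slacks \<open>c x * (v - u \<bullet> x)\<close> are nonnegative and their
  sum \<open>v - u \<bullet> z\<close> is not positive, so all of them vanish and the weight sits on
  the face.\<close>

lemma hull_face:
  fixes u :: "'a::euclidean_space"
  assumes "finite A" "z \<in> convex hull A" "\<And>a. a \<in> A \<Longrightarrow> u \<bullet> a \<le> v" "v \<le> u \<bullet> z"
  shows "z \<in> convex hull {a \<in> A. u \<bullet> a = v}"
proof -
  obtain c where c: "\<And>x. x \<in> A \<Longrightarrow> 0 \<le> c x" "sum c A = 1" "(\<Sum>x\<in>A. c x *\<^sub>R x) = z"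
    using assms(2) unfolding convex_hull_finite[OF assms(1)] by blast
  have "u \<bullet> z = (\<Sum>x\<in>A. c x * (u \<bullet> x))" unfolding c(3)[symmetric] by (simp add: inner_sum_right)
  then have "(\<Sum>x\<in>A. c x * (v - u \<bullet> x)) = v - u \<bullet> z"
    using c(2) by (simp add: right_diff_distrib sum_subtractf flip: sum_distrib_right)
  then have "(\<Sum>x\<in>A. c x * (v - u \<bullet> x)) \<le> 0" using assms(4) by simp
  moreover have nn: "\<And>x. x \<in> A \<Longrightarrow> 0 \<le> c x * (v - u \<bullet> x)" using c(1) assms(3) by simp
  ultimately have "(\<Sum>x\<in>A. c x * (v - u \<bullet> x)) = 0" by (intro antisym sum_nonneg) auto
  then have z: "c x = 0" if "x \<in> A" "u \<bullet> x \<noteq> v" for x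
    using sum_nonneg_eq_0_iff[OF assms(1) nn] that by auto
  let ?A = "{a \<in> A. u \<bullet> a = v}"
  have "sum c ?A = 1" using c(2) by (subst sum.mono_neutral_left[OF assms(1)]) (use z in auto)
  moreover have "(\<Sum>x\<in>?A. c x *\<^sub>R x) = z" using c(3)
    by (subst sum.mono_neutral_left[OF assms(1)]) (use z in auto)
  moreover have "finite ?A" using assms(1) by simp
  ultimately show ?thesis using c(1) by (subst convex_hull_finite) auto
qed

text \<open>Ham-sandwich lines pass through given points and sort keys may tie, so only weak
  separation is available. A common point of the hulls would lie on the separating line and in the
  hull of the points of each side on that line. By general position these are one point
  \<open>a\<close> of \<open>A\<close> and one point \<open>c\<close> of \<open>C\<close>, and they
  differ.\<close>

lemma hull_disjoint_weak:
  fixes u :: point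
  assumes "u \<noteq> 0" "general_position X" "A \<subseteq> X" "C \<subseteq> X" "A \<inter> C = {}" "finite A" "finite C"
    and le: "\<And>a c. a \<in> A \<Longrightarrow> c \<in> C \<Longrightarrow> u \<bullet> a \<le> u \<bullet> c"
  shows "convex hull A \<inter> convex hull C = {}"
proof (rule ccontr)
  assume "\<not> ?thesis"
  then obtain z where z: "z \<in> convex hull A" "z \<in> convex hull C" by blast
  have ne: "A \<noteq> {}" "C \<noteq> {}" using z by auto
  define v where "v = Max ((\<bullet>) u ` A)"
  have vA: "u \<bullet> a \<le> v" if "a \<in> A" for a using that assms(6) unfolding v_def by simp
  have "v \<in> (\<bullet>) u ` A" unfolding v_def using assms(6) ne by (intro Max_in) auto
  then obtain a0 where "a0 \<in> A" "v = u \<bullet> a0" by blast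
  then have vC: "v \<le> u \<bullet> c" if "c \<in> C" for c using le that by simp
  have "convex hull A \<subseteq> {x. u \<bullet> x \<le> v}" using vA by (intro hull_minimal) (auto simp: convex_halfspace_le)
  moreover have "convex hull C \<subseteq> {x. u \<bullet> x \<ge> v}" using vC by (intro hull_minimal) (auto simp: convex_halfspace_ge)
  ultimately have "u \<bullet> z \<le> v" "v \<le> u \<bullet> z" using z by blast+
  then have uz: "u \<bullet> z = v" by simp
  have zA: "z \<in> convex hull {a \<in> A. u \<bullet> a = v}" using hull_face[OF assms(6) z(1), of u v] vA uz by simp
  have zC: "z \<in> convex hull {a \<in> C. (- u) \<bullet> a = - v}"
    using hull_face[OF assms(7) z(2), of "- u" "- v"] vC uz by simp
  obtain a where a: "a \<in> A" "u \<bullet> a = v" using zA by (metis (mono_tags, lifting) convex_hull_eq_empty empty_iff equals0I mem_Collect_eq)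
  obtain c where c: "c \<in> C" "u \<bullet> c = v" using zC
    by (metis (mono_tags, lifting) convex_hull_eq_empty empty_iff equals0I mem_Collect_eq inner_minus_left neg_equal_iff_equal)
  have ac: "a \<noteq> c" using a c assms(5) by blast
  have "a' = a" if "a' \<in> A" "u \<bullet> a' = v" for a'
  proof (rule ccontr)
    assume "a' \<noteq> a"
    moreover have "a' \<noteq> c" using that c assms(5) by blast
    moreover have "a \<in> X" "a' \<in> X" "c \<in> X" using a c that assms by blast+
    ultimately have "\<not> collinear {a, a', c}" using ac general_positionD[OF assms(2)] by metis
    then show False using collinear_level[OF assms(1) a(2) that(2) c(2)] by simp
  qed
  then have "{a \<in> A. u \<bullet> a = v} = {a}" using a by blast
  moreover have "c' = c" if "c' \<in> C" "u \<bullet> c' = v" for c'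
  proof (rule ccontr)
    assume "c' \<noteq> c"
    moreover have "c' \<noteq> a" using that a assms(5) by blast
    moreover have "a \<in> X" "c' \<in> X" "c \<in> X" using a c that assms by blast+
    ultimately have "\<not> collinear {a, c', c}" using ac general_positionD[OF assms(2)] by metis
    then show False using collinear_level[OF assms(1) a(2) that(2) c(2)] by simp
  qed
  then have "{a \<in> C. u \<bullet> a = v} = {c}" using c by blast
  then have "{a \<in> C. (- u) \<bullet> a = - v} = {c}" by simp
  ultimately show False using zA zC ac by simp
qed

section \<open>Medians of projections and the ham-sandwich theorem\<close>

lemma continuous_on_Min_finite:
  fixes f :: "'i \<Rightarrow> 'a::topological_space \<Rightarrow> real"
  assumes "finite I" "I \<noteq> {}" "\<And>i. i \<in> I \<Longrightarrow> continuous_on S (f i)"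
  shows "continuous_on S (\<lambda>x. Min ((\<lambda>i. f i x) ` I))"
  using assms
proof (induction rule: finite_ne_induct)
  case (insert i I)
  then have "continuous_on S (\<lambda>x. min (f i x) (Min ((\<lambda>i. f i x) ` I)))"
    by (intro continuous_on_min) auto
  then show ?case using insert by simp
qed simp

lemma continuous_on_Max_finite:
  fixes f :: "'i \<Rightarrow> 'a::topological_space \<Rightarrow> real"
  assumes "finite I" "I \<noteq> {}" "\<And>i. i \<in> I \<Longrightarrow> continuous_on S (f i)"
  shows "continuous_on S (\<lambda>x. Max ((\<lambda>i. f i x) ` I))"
  using assms
proof (induction rule: finite_ne_induct)
  case (insert i I)
  then have "continuous_on S (\<lambda>x. max (f i x) (Max ((\<lambda>i. f i x) ` I)))"
    by (intro continuous_on_max) auto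
  then show ?case using insert by simp
qed simp

lemma ex_subset_card: "n \<le> card A \<Longrightarrow> \<exists>T\<subseteq>A. card T = n"
  by (metis obtain_subset_with_card_n)

text \<open>The order statistic of rank \<open>k\<close>, counted from zero, written as a minimum of
  maxima over subsets. In this form continuity in the direction \<open>u\<close> is immediate, which
  it is not for an entry of a sorted list.\<close>

definition median :: "nat \<Rightarrow> 'a::euclidean_space set \<Rightarrow> 'a \<Rightarrow> real" where
  "median k A u = Min ((\<lambda>T. Max ((\<lambda>p. u \<bullet> p) ` T)) ` {T. T \<subseteq> A \<and> card T = k + 1})"

definition is_median :: "nat \<Rightarrow> 'a::euclidean_space set \<Rightarrow> 'a \<Rightarrow> real \<Rightarrow> bool" where
  "is_median k A u v \<longleftrightarrow> card {p \<in> A. u \<bullet> p < v} \<le> k \<and> card {p \<in> A. u \<bullet> p > v} \<le> k \<and> (\<exists>p\<in>A. u \<bullet> p = v)"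

lemma is_median_median:
  assumes "finite A" "card A = 2 * k + 1"
  shows "is_median k A u (median k A u)"
proof -
  let ?I = "{T. T \<subseteq> A \<and> card T = k + 1}"
  let ?F = "\<lambda>T. Max ((\<lambda>p. u \<bullet> p) ` T)"
  define v where "v = median k A u"
  have fI: "finite ?I" using assms(1) by simp
  have "\<exists>T. T \<subseteq> A \<and> card T = k + 1" using assms ex_subset_card[of "k + 1" A] by simp
  then have neI: "?I \<noteq> {}" by blast
  have "v \<in> ?F ` ?I" unfolding v_def median_def by (rule Min_in) (use fI neI in auto)
  then obtain T where T: "T \<subseteq> A" "card T = k + 1" "v = ?F T" by blast
  have fT: "finite T" "T \<noteq> {}" using T assms finite_subset by auto
  have "v \<in> (\<lambda>p. u \<bullet> p) ` T" unfolding T(3) by (rule Max_in) (use fT in auto)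
  then have ex: "\<exists>p\<in>A. u \<bullet> p = v" using T(1) by auto
  have Tle: "u \<bullet> p \<le> v" if "p \<in> T" for p unfolding T(3) using that fT by simp
  have "card {p \<in> A. u \<bullet> p > v} \<le> card (A - T)"
    by (rule card_mono) (use assms Tle in \<open>auto simp: not_less[symmetric]\<close>)
  also have "\<dots> = k" using T assms fT by (simp add: card_Diff_subset)
  finally have gt: "card {p \<in> A. u \<bullet> p > v} \<le> k" .
  have lt: "card {p \<in> A. u \<bullet> p < v} \<le> k"
  proof (rule ccontr)
    assume "\<not> ?thesis"
    then have "k + 1 \<le> card {p \<in> A. u \<bullet> p < v}" by simp
    then obtain T' where T': "T' \<subseteq> {p \<in> A. u \<bullet> p < v}" "card T' = k + 1"
      using ex_subset_card by blast
    have "T' \<noteq> {}" "finite T'" using T' card.infinite by force+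
    then have "?F T' \<in> (\<lambda>p. u \<bullet> p) ` T'" by (intro Max_in) auto
    then have "?F T' < v" using T' by auto
    moreover have "v \<le> ?F T'" unfolding v_def median_def by (rule Min_le) (use T' fI in auto)
    ultimately show False by simp
  qed
  show ?thesis using lt gt ex unfolding is_median_def v_def by blast
qed

text \<open>For \<open>v < w\<close> the points above \<open>v\<close> and those below
  \<open>w\<close> together exhaust \<open>A\<close>, but they number at most \<open>2 * k\<close>.
  Uniqueness makes the median change sign with the direction; this is why the ham-sandwich argument
  is first carried out for odd sets.\<close>

lemma is_median_unique:
  assumes "finite A" "card A = 2 * k + 1" "is_median k A u v" "is_median k A u w"
  shows "v = w"
proof -
  have "False" if "v < w" "is_median k A u v" "is_median k A u w" for v w
  proof -
    have "A = {p \<in> A. u \<bullet> p > v} \<union> {p \<in> A. u \<bullet> p < w}" using that(1) by auto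
    then have "card A \<le> card {p \<in> A. u \<bullet> p > v} + card {p \<in> A. u \<bullet> p < w}"
      using card_Un_le[of "{p \<in> A. u \<bullet> p > v}" "{p \<in> A. u \<bullet> p < w}"] by simp
    then show False using that(2,3) assms(2) unfolding is_median_def by linarith
  qed
  then show ?thesis using assms(3,4) by (meson linorder_neqE_linordered_idom)
qed

lemma median_uminus:
  assumes "finite A" "card A = 2 * k + 1"
  shows "median k A (- u) = - median k A u"
proof (rule is_median_unique[OF assms is_median_median[OF assms]])
  have "is_median k A u (median k A u)" by (rule is_median_median[OF assms])
  then show "is_median k A (- u) (- median k A u)" unfolding is_median_def by simp
qed

lemma continuous_median:
  assumes "finite A" "card A = 2 * k + 1" "continuous_on S f"
  shows "continuous_on S (\<lambda>t. median k A (f t))"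
  unfolding median_def
proof (rule continuous_on_Min_finite)
  show "finite {T. T \<subseteq> A \<and> card T = k + 1}" using assms(1) by simp
  show "{T. T \<subseteq> A \<and> card T = k + 1} \<noteq> {}"
    using assms ex_subset_card[of "k + 1" A] by simp
  fix T assume "T \<in> {T. T \<subseteq> A \<and> card T = k + 1}"
  then have "finite T" "T \<noteq> {}" using assms(1) finite_subset by auto
  then show "continuous_on S (\<lambda>t. Max ((\<lambda>p. f t \<bullet> p) ` T))"
    by (intro continuous_on_Max_finite) (auto intro!: continuous_intros assms(3))
qed

lemma ham_sandwich_odd:
  fixes R B :: "point set"
  assumes "finite R" "finite B" "card R = 2 * k + 1" "card B = 2 * l + 1"
  obtains u v where "u \<noteq> 0" "is_median k R u v" "is_median l B u v"
proof -
  define f :: "real \<Rightarrow> point" where "f t = (cos t, sin t)" for t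
  \<comment> \<open>A half turn negates both medians, so \<open>D\<close> changes sign and has a
    zero. In that direction both medians lie on one line.\<close>
  define D where "D t = median k R (f t) - median l B (f t)" for t
  have cf: "continuous_on {0..pi} f" unfolding f_def by (intro continuous_intros)
  have cD: "continuous_on {0..pi} D" unfolding D_def
    by (intro continuous_on_diff continuous_median assms cf)
  have "f pi = - f 0" unfolding f_def by simp
  then have "D pi = - D 0" unfolding D_def using assms by (simp add: median_uminus)
  then have "\<exists>t. 0 \<le> t \<and> t \<le> pi \<and> D t = 0"
    using IVT'[of D 0 0 pi, OF _ _ _ cD] IVT2'[of D pi 0 0, OF _ _ _ cD]
    by (cases "D 0 \<le> 0") auto
  then obtain t where t: "D t = 0" by blast
  have "f t \<noteq> 0" unfolding f_def using sin_zero_abs_cos_one[of t] by (auto simp: zero_prod_def)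
  moreover have "is_median k R (f t) (median k R (f t))" "is_median l B (f t) (median k R (f t))"
    using is_median_median assms t unfolding D_def by (metis eq_iff_diff_eq_0)+
  ultimately show thesis using that by blast
qed

lemma odd_subset:
  assumes "finite A" "A \<noteq> {}"
  obtains A' k where "A' \<subseteq> A" "card A' = 2 * k + 1" "card A \<le> 2 * k + 2"
proof (cases "odd (card A)")
  case True
  then show thesis using that[of A "card A div 2"] by (auto elim!: oddE)
next
  case False
  obtain a where "a \<in> A" using assms by blast
  then have "card (A - {a}) = card A - 1" "card A > 0" using assms by (auto simp: card_gt_0_iff)
  then show thesis using that[of "A - {a}" "card A div 2 - 1"] False by (auto elim!: evenE)
qed

text \<open>A point that was dropped to make the size odd may return to either side. That side then
  grows from \<open>k\<close> to at most \<open>k + 1\<close>, which is still half of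
  \<open>2 * k + 2\<close>.\<close>

lemma card_level_bound:
  fixes A :: "'a set"
  assumes "finite A" "A' \<subseteq> A" "card A' = 2 * k + 1" "card A \<le> 2 * k + 2"
    and "card {p \<in> A'. P p} \<le> k"
  shows "2 * card {p \<in> A. P p} \<le> card A"
proof -
  have "{p \<in> A. P p} \<subseteq> {p \<in> A'. P p} \<union> (A - A')" by blast
  then have "card {p \<in> A. P p} \<le> card ({p \<in> A'. P p} \<union> (A - A'))"
    using assms by (intro card_mono) (auto intro: finite_subset)
  also have "\<dots> \<le> card {p \<in> A'. P p} + card (A - A')" by (rule card_Un_le)
  also have "card (A - A') = card A - card A'" using assms by (meson card_Diff_subset finite_subset)
  finally have "card {p \<in> A. P p} \<le> k + (card A - card A')" using assms(5) by linarith
  moreover have "card A' \<le> card A" using card_mono[OF assms(1,2)] .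
  ultimately show ?thesis using assms(3,4) by linarith
qed

lemma ham_sandwich:
  fixes R B :: "point set"
  assumes "finite R" "finite B" "R \<noteq> {}" "B \<noteq> {}"
  obtains u v r b where "u \<noteq> 0" "r \<in> R" "b \<in> B" "u \<bullet> r = v" "u \<bullet> b = v"
    "2 * card {p \<in> R. u \<bullet> p < v} \<le> card R" "2 * card {p \<in> R. u \<bullet> p > v} \<le> card R"
    "2 * card {p \<in> B. u \<bullet> p < v} \<le> card B" "2 * card {p \<in> B. u \<bullet> p > v} \<le> card B"
proof -
  obtain R' k where R': "R' \<subseteq> R" "card R' = 2 * k + 1" "card R \<le> 2 * k + 2"
    using odd_subset[OF assms(1,3)] by blast
  obtain B' l where B': "B' \<subseteq> B" "card B' = 2 * l + 1" "card B \<le> 2 * l + 2"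
    using odd_subset[OF assms(2,4)] by blast
  have "finite R'" "finite B'" using R' B' assms finite_subset by blast+
  then obtain u v where uv: "u \<noteq> 0" "is_median k R' u v" "is_median l B' u v"
    using ham_sandwich_odd R' B' by metis
  obtain r b where "r \<in> R" "u \<bullet> r = v" "b \<in> B" "u \<bullet> b = v"
    using uv R' B' unfolding is_median_def by blast
  moreover have "2 * card {p \<in> R. u \<bullet> p < v} \<le> card R" "2 * card {p \<in> R. u \<bullet> p > v} \<le> card R"
    using uv(2) unfolding is_median_def by (auto intro!: card_level_bound[OF assms(1) R'])
  moreover have "2 * card {p \<in> B. u \<bullet> p < v} \<le> card B" "2 * card {p \<in> B. u \<bullet> p > v} \<le> card B"
    using uv(3) unfolding is_median_def by (auto intro!: card_level_bound[OF assms(2) B'])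
  ultimately show thesis using that uv(1) by blast
qed

section \<open>Cutting along a linear order of the points\<close>

lemma packs_halfplane:
  assumes u: "u \<noteq> 0" and gp: "general_position (R \<union> B)" and fin: "finite R" "finite B"
    and le: "\<And>p q. p \<in> P \<Longrightarrow> q \<in> (R \<union> B) - P \<Longrightarrow> u \<bullet> p \<le> u \<bullet> q"
    and "packs m1 (R \<inter> P) (B \<inter> P)" "packs m2 (R - P) (B - P)"
  shows "packs (m1 + m2) R B"
proof (rule packs_union[OF assms(6,7)])
  show "convex hull (R \<inter> P \<union> B \<inter> P) \<inter> convex hull (R - P \<union> (B - P)) = {}"
    by (rule hull_disjoint_weak[OF u gp]) (use fin in \<open>blast | intro le\<close>)+
qed blast+

lemma level_pair:
  fixes u :: point
  assumes "u \<noteq> 0" "general_position X" "r \<in> X" "b \<in> X" "r \<noteq> b" "u \<bullet> r = v" "u \<bullet> b = v" "p \<in> X" "u \<bullet> p = v"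
  shows "p = r \<or> p = b"
  using general_positionD[OF assms(2,3,4,8)] collinear_level[OF assms(1,6,7,9)] assms(5) by blast

lemma card_level_split:
  fixes u :: point
  assumes "finite A" "a \<in> A" "u \<bullet> a = v" "\<And>p. p \<in> A \<Longrightarrow> u \<bullet> p = v \<Longrightarrow> p = a"
  shows "card A = card {p \<in> A. u \<bullet> p < v} + card {p \<in> A. u \<bullet> p > v} + 1"
proof -
  have "A = insert a ({p \<in> A. u \<bullet> p < v} \<union> {p \<in> A. u \<bullet> p > v})"
  proof (rule set_eqI)
    fix p
    show "p \<in> A \<longleftrightarrow> p \<in> insert a ({p \<in> A. u \<bullet> p < v} \<union> {p \<in> A. u \<bullet> p > v})"
      using assms(2) assms(4)[of p] by (cases "u \<bullet> p" v rule: linorder_cases) blast+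
  qed
  then have "card A = card (insert a ({p \<in> A. u \<bullet> p < v} \<union> {p \<in> A. u \<bullet> p > v}))" by simp
  also have "\<dots> = Suc (card ({p \<in> A. u \<bullet> p < v} \<union> {p \<in> A. u \<bullet> p > v}))"
    by (rule card_insert_disjoint) (use assms(1,3) in simp_all)
  also have "card ({p \<in> A. u \<bullet> p < v} \<union> {p \<in> A. u \<bullet> p > v})
      = card {p \<in> A. u \<bullet> p < v} + card {p \<in> A. u \<bullet> p > v}"
    by (rule card_Un_disjoint) (use assms(1) in \<open>simp_all add: disjoint_iff\<close>)
  finally show ?thesis by simp
qed

lemma ex_sorted_list:
  fixes f :: "'a \<Rightarrow> real"
  assumes "finite A"
  obtains xs where "set xs = A" "distinct xs" "sorted_wrt (\<lambda>p q. f p \<le> f q) xs"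
proof -
  obtain ys where "set ys = A" "distinct ys" using assms finite_distinct_list by blast
  then show thesis using that[of "sort_key f ys"] sorted_sort_key[of f ys]
    by (simp add: sorted_wrt_map)
qed

text \<open>The ham-sandwich line carries exactly one red and one blue point, and these two may be
  ordered freely in the sorted list. This freedom compensates the rounding, so that the first half
  of the list has exactly half of the blue points, rounded down.\<close>

lemma ham_order:
  assumes fin: "finite R" "finite B" and ne: "R \<noteq> {}" "B \<noteq> {}" and dj: "R \<inter> B = {}"
    and gp: "general_position (R \<union> B)"
  obtains u :: point and xs where "u \<noteq> 0" "sorted_wrt (\<lambda>p q. u \<bullet> p \<le> u \<bullet> q) xs" "distinct xs" "set xs = R \<union> B"
    "card (B \<inter> set (take ((card R + card B) div 2) xs)) = card B div 2"
proof -
  note result = that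
  obtain u v r b where u: "u \<noteq> 0" and rb: "r \<in> R" "b \<in> B" "u \<bullet> r = v" "u \<bullet> b = v"
    and half: "2 * card {p \<in> R. u \<bullet> p < v} \<le> card R" "2 * card {p \<in> R. u \<bullet> p > v} \<le> card R"
      "2 * card {p \<in> B. u \<bullet> p < v} \<le> card B" "2 * card {p \<in> B. u \<bullet> p > v} \<le> card B"
    by (rule ham_sandwich[OF fin ne])
  have neq: "r \<noteq> b" using rb dj by blast
  have lev: "p = r \<or> p = b" if "p \<in> R \<union> B" "u \<bullet> p = v" for p
    using level_pair[OF u gp, of r b v p] rb that neq by blast
  have cR: "card R = card {p \<in> R. u \<bullet> p < v} + card {p \<in> R. u \<bullet> p > v} + 1"
    by (rule card_level_split[OF fin(1) rb(1,3)]) (use lev rb dj in blast)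
  have cB: "card B = card {p \<in> B. u \<bullet> p < v} + card {p \<in> B. u \<bullet> p > v} + 1"
    by (rule card_level_split[OF fin(2) rb(2,4)]) (use lev rb dj in blast)
  obtain ls where ls: "set ls = {p \<in> R \<union> B. u \<bullet> p < v}" "distinct ls" "sorted_wrt (\<lambda>p q. u \<bullet> p \<le> u \<bullet> q) ls"
    using ex_sorted_list[of "{p \<in> R \<union> B. u \<bullet> p < v}" "(\<bullet>) u"] fin by auto
  obtain gs where gs: "set gs = {p \<in> R \<union> B. u \<bullet> p > v}" "distinct gs" "sorted_wrt (\<lambda>p q. u \<bullet> p \<le> u \<bullet> q) gs"
    using ex_sorted_list[of "{p \<in> R \<union> B. u \<bullet> p > v}" "(\<bullet>) u"] fin by auto
  define ar ab where "ar = card {p \<in> R. u \<bullet> p < v}" and "ab = card {p \<in> B. u \<bullet> p < v}"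
  have "length ls = card ({p \<in> R. u \<bullet> p < v} \<union> {p \<in> B. u \<bullet> p < v})"
  proof -
    have "{p \<in> R \<union> B. u \<bullet> p < v} = {p \<in> R. u \<bullet> p < v} \<union> {p \<in> B. u \<bullet> p < v}" by blast
    then show ?thesis using distinct_card[OF ls(2)] ls(1) by simp
  qed
  also have "\<dots> = ar + ab" unfolding ar_def ab_def
    by (rule card_Un_disjoint) (use fin dj in \<open>simp, simp, blast\<close>)
  finally have len: "length ls = ar + ab" .
  \<comment> \<open>\<open>es\<close> is the chosen order of the two points on the line, and
    \<open>j\<close> of them fall into the first half.\<close>
  have order: thesis if es: "es = [r, b] \<or> es = [b, r]" and h: "(card R + card B) div 2 = ar + ab + j"
    and cj: "card (B \<inter> set (take j es)) + ab = card B div 2" for es j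
  proof (rule result[OF u])
    let ?xs = "ls @ es @ gs"
    have sv: "set es = {r, b}" "distinct es" using es neq by auto
    have ev: "u \<bullet> p = v" if "p \<in> set es" for p using that sv(1) rb(3,4) by auto
    show "sorted_wrt (\<lambda>p q. u \<bullet> p \<le> u \<bullet> q) ?xs"
    proof -
      have "sorted_wrt (\<lambda>p q. u \<bullet> p \<le> u \<bullet> q) es" using es rb by auto
      moreover have "u \<bullet> p \<le> u \<bullet> q" if "p \<in> set ls" "q \<in> set es \<union> set gs" for p q
      proof -
        have "u \<bullet> p < v" using that(1) ls(1) by blast
        moreover have "v \<le> u \<bullet> q" using that(2) ev[of q] gs(1) by (cases "q \<in> set es") simp_all
        ultimately show ?thesis by linarith
      qed
      moreover have "u \<bullet> p \<le> u \<bullet> q" if "p \<in> set es" "q \<in> set gs" for p q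
      proof -
        have "u \<bullet> q > v" using that(2) gs(1) by blast
        then show ?thesis using ev[OF that(1)] by simp
      qed
      ultimately show ?thesis using ls(3) gs(3) by (simp add: sorted_wrt_append)
    qed
    have "set ls \<inter> (set es \<union> set gs) = {}"
    proof -
      have "u \<bullet> p < v" if "p \<in> set ls" for p using that ls(1) by blast
      moreover have "\<not> u \<bullet> p < v" if "p \<in> set es \<union> set gs" for p using that ev[of p] gs(1) by auto
      ultimately show ?thesis by blast
    qed
    moreover have "set es \<inter> set gs = {}"
    proof -
      have "u \<bullet> p > v" if "p \<in> set gs" for p using that gs(1) by blast
      then show ?thesis using ev by force
    qed
    ultimately show "distinct ?xs" using ls(2) gs(2) sv(2) by simp
    have "p \<in> set ?xs \<longleftrightarrow> p \<in> R \<union> B" for p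
      using lev[of p] rb ls(1) gs(1) sv(1) by (cases "u \<bullet> p" v rule: linorder_cases) auto
    then show "set ?xs = R \<union> B" by blast
    have "take (ar + ab + j) ?xs = ls @ take j (es @ gs)" using len by simp
    moreover have "j \<le> 2"
    proof -
      have "ar + ab + j \<le> (card R + card B) div 2" using h by simp
      then show ?thesis using cR cB half unfolding ar_def ab_def by linarith
    qed
    then have "take j (es @ gs) = take j es" using es by auto
    ultimately have tk: "set (take ((card R + card B) div 2) ?xs) = set ls \<union> set (take j es)" unfolding h by (simp only: set_append)
    have "B \<inter> (set ls \<union> set (take j es)) = {p \<in> B. u \<bullet> p < v} \<union> (B \<inter> set (take j es))"
      using ls(1) by blast
    moreover have "card ({p \<in> B. u \<bullet> p < v} \<union> (B \<inter> set (take j es))) = ab + card (B \<inter> set (take j es))"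
      unfolding ab_def
    proof (rule card_Un_disjoint)
      have "\<not> u \<bullet> p < v" if "p \<in> set (take j es)" for p using ev[of p] in_set_takeD[OF that] by simp
      then show "{p \<in> B. u \<bullet> p < v} \<inter> (B \<inter> set (take j es)) = {}" by blast
    qed (use fin in simp_all)
    ultimately show "card (B \<inter> set (take ((card R + card B) div 2) ?xs)) = card B div 2"
      using tk cj by simp
  qed
  have Bb: "B \<inter> {r} = {}" "B \<inter> {b} = {b}" "B \<inter> {r, b} = {b}" "B \<inter> {b, r} = {b}" using rb dj by blast+
  \<comment> \<open>Strictly below the line lies at most half of each color, and at least half after
    adding the point on the line. So both the blue count and the red count are short by zero or one,
    which gives four cases.\<close>
  have "ab \<le> card B div 2" "card B div 2 \<le> ab + 1" using cB half unfolding ab_def by linarith+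
  moreover have "ar + card B div 2 \<le> (card R + card B) div 2" "(card R + card B) div 2 \<le> ar + card B div 2 + 1"
    using cR half unfolding ar_def by linarith+
  ultimately consider "card B div 2 = ab" "(card R + card B) div 2 = ar + ab"
    | "card B div 2 = ab" "(card R + card B) div 2 = ar + ab + 1"
    | "card B div 2 = ab + 1" "(card R + card B) div 2 = ar + ab + 1"
    | "card B div 2 = ab + 1" "(card R + card B) div 2 = ar + ab + 2" by linarith
  then show thesis
  proof cases
    case 1 then show thesis using order[of "[r, b]" 0] by simp
  next
    case 2 then show thesis using order[of "[r, b]" 1] Bb by simp
  next
    case 3 then show thesis using order[of "[b, r]" 1] Bb by simp
  next
    case 4 then show thesis using order[of "[b, r]" 2] Bb by simp
  qed
qed

section \<open>How many points guarantee a given number of stars\<close>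

definition ensures :: "nat \<Rightarrow> nat \<Rightarrow> nat \<Rightarrow> bool" where
  "ensures m r b \<longleftrightarrow> (\<forall>R B. finite R \<and> finite B \<and> R \<inter> B = {} \<and> general_position (R \<union> B) \<and>
     r \<le> card R \<and> b \<le> card B \<longrightarrow> packs m R B)"

lemma ensuresD:
  "ensures m r b \<Longrightarrow> finite R \<Longrightarrow> finite B \<Longrightarrow> R \<inter> B = {} \<Longrightarrow> general_position (R \<union> B) \<Longrightarrow>
     r \<le> card R \<Longrightarrow> b \<le> card B \<Longrightarrow> packs m R B"
  unfolding ensures_def by blast

lemma ensures_pure: "3 * m \<le> r \<Longrightarrow> m \<le> b \<Longrightarrow> ensures m r b"
  unfolding ensures_def using packs_pure by (meson le_trans)

lemma ensures_mono: "ensures m r b \<Longrightarrow> r \<le> r' \<Longrightarrow> b \<le> b' \<Longrightarrow> ensures m r' b'"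
  unfolding ensures_def by (meson le_trans)

lemma ensures_swap:
  assumes "ensures m r b"
  shows "ensures m b r"
  unfolding ensures_def
proof (intro allI impI)
  fix R B :: "point set"
  assume "finite R \<and> finite B \<and> R \<inter> B = {} \<and> general_position (R \<union> B) \<and> b \<le> card R \<and> r \<le> card B"
  then have "packs m B R" using ensuresD[OF assms, of B R] by (simp add: Un_commute Int_commute)
  then show "packs m R B" by (rule packs_swap)
qed

lemma ensuresI_exact:
  assumes "\<And>R B. finite R \<Longrightarrow> finite B \<Longrightarrow> R \<inter> B = {} \<Longrightarrow> general_position (R \<union> B) \<Longrightarrow>
     card R = r \<Longrightarrow> card B = b \<Longrightarrow> packs m R B"
  shows "ensures m r b"
  unfolding ensures_def
proof (intro allI impI)
  fix R B :: "point set"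
  assume h: "finite R \<and> finite B \<and> R \<inter> B = {} \<and> general_position (R \<union> B) \<and> r \<le> card R \<and> b \<le> card B"
  obtain R' B' where s: "R' \<subseteq> R" "card R' = r" "B' \<subseteq> B" "card B' = b" using h ex_subset_card by metis
  have "packs m R' B'"
  proof (rule assms)
    show "general_position (R' \<union> B')" using general_position_subset[of "R \<union> B"] h s by blast
  qed (use h s finite_subset in blast)+
  then show "packs m R B" using packs_mono s by blast
qed

text \<open>The interface between geometry and arithmetic. \<open>c k\<close> is the number of blue
  points among the first \<open>k\<close> in the order of \<open>ham_order\<close>. Of this order
  only three facts survive: \<open>c\<close> is monotone, grows by at most one per step and has the
  right value in the middle. Everything up to \<open>quota_enough\<close> is then a choice of
  \<open>k\<close>, \<open>m1\<close> and \<open>m2\<close> for an unknown \<open>c\<close>.\<close>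

lemma ensures_cut:
  assumes pos: "1 \<le> r" "1 \<le> b"
    and cut: "\<And>c :: nat \<Rightarrow> nat. (\<And>i j. i \<le> j \<Longrightarrow> c i \<le> c j) \<Longrightarrow> (\<And>i j. i \<le> j \<Longrightarrow> c j \<le> c i + (j - i)) \<Longrightarrow>
      c 0 = 0 \<Longrightarrow> c ((r + b) div 2) = b div 2 \<Longrightarrow>
      \<exists>k\<le>r + b. \<exists>m1 m2. m = m1 + m2 \<and> ensures m1 (k - c k) (c k) \<and> ensures m2 (r - (k - c k)) (b - c k)"
  shows "ensures m r b"
proof (rule ensuresI_exact)
  fix R B :: "point set"
  assume fin: "finite R" "finite B" and dj: "R \<inter> B = {}" and gp: "general_position (R \<union> B)"
    and card: "card R = r" "card B = b"
  have "R \<noteq> {}" "B \<noteq> {}" using card pos by auto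
  then obtain u xs where u: "u \<noteq> 0" and xs: "sorted_wrt (\<lambda>p q. u \<bullet> p \<le> u \<bullet> q) xs" "distinct xs" "set xs = R \<union> B"
    and mid: "card (B \<inter> set (take ((r + b) div 2) xs)) = b div 2"
    using ham_order[OF fin _ _ dj gp] card by metis
  define c where "c k = card (B \<inter> set (take k xs))" for k
  have len: "length xs = r + b" using distinct_card[OF xs(2)] xs(3) card fin dj by (simp add: card_Un_disjoint)
  have mono: "c i \<le> c j" if "i \<le> j" for i j
  proof -
    have "B \<inter> set (take i xs) \<subseteq> B \<inter> set (take j xs)" using set_take_subset_set_take[OF that, of xs] by blast
    then show ?thesis unfolding c_def using fin by (simp add: card_mono)
  qed
  have lip: "c j \<le> c i + (j - i)" if "i \<le> j" for i j
  proof -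
    have "take j xs = take i xs @ take (j - i) (drop i xs)" using that by (metis le_add_diff_inverse take_add)
    then have "B \<inter> set (take j xs) \<subseteq> (B \<inter> set (take i xs)) \<union> set (take (j - i) (drop i xs))" by auto
    then have "c j \<le> card ((B \<inter> set (take i xs)) \<union> set (take (j - i) (drop i xs)))"
      unfolding c_def by (rule card_mono[rotated]) simp
    also have "\<dots> \<le> c i + card (set (take (j - i) (drop i xs)))" unfolding c_def by (rule card_Un_le)
    also have "card (set (take (j - i) (drop i xs))) \<le> j - i"
      using card_length[of "take (j - i) (drop i xs)"] by simp
    finally show ?thesis by simp
  qed
  have "c 0 = 0" unfolding c_def by simp
  moreover have "c ((r + b) div 2) = b div 2" unfolding c_def using mid .
  ultimately obtain k m1 m2 where k: "k \<le> r + b" "m = m1 + m2" and e1: "ensures m1 (k - c k) (c k)"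
    and e2: "ensures m2 (r - (k - c k)) (b - c k)" using cut[OF mono lip] by blast
  let ?P = "set (take k xs)"
  have PX: "?P \<subseteq> R \<union> B" using xs(3) by (metis set_take_subset)
  have "card ?P = k" using distinct_card[OF distinct_take[OF xs(2)]] len k(1) by simp
  moreover have "card ?P = card (R \<inter> ?P) + card (B \<inter> ?P)"
  proof -
    have "?P = (R \<inter> ?P) \<union> (B \<inter> ?P)" using PX by blast
    moreover have "card ((R \<inter> ?P) \<union> (B \<inter> ?P)) = card (R \<inter> ?P) + card (B \<inter> ?P)"
      by (rule card_Un_disjoint) (use dj in auto)
    ultimately show ?thesis by simp
  qed
  ultimately have cRP: "card (R \<inter> ?P) = k - c k" unfolding c_def by simp
  show "packs m R B" unfolding k(2)
  proof (rule packs_halfplane[OF u gp fin])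
    fix p q assume p: "p \<in> ?P" and q: "q \<in> (R \<union> B) - ?P"
    have "q \<in> set (drop k xs)" using q xs(3) by (metis Diff_iff Un_iff append_take_drop_id set_append)
    then show "u \<bullet> p \<le> u \<bullet> q" using xs(1) p by (metis append_take_drop_id sorted_wrt_append)
  next
    show "packs m1 (R \<inter> ?P) (B \<inter> ?P)"
    proof (rule ensuresD[OF e1])
      show "general_position (R \<inter> ?P \<union> B \<inter> ?P)" by (rule general_position_subset[OF gp]) blast
    qed (use fin dj cRP c_def in auto)
    show "packs m2 (R - ?P) (B - ?P)"
    proof (rule ensuresD[OF e2])
      show "general_position (R - ?P \<union> (B - ?P))" by (rule general_position_subset[OF gp]) blast
      show "r - (k - c k) \<le> card (R - ?P)" using cRP card by (simp add: card_Diff_subset_Int)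
      show "b - c k \<le> card (B - ?P)" unfolding c_def card(2)[symmetric] by (simp add: card_Diff_subset_Int)
    qed (use fin dj in blast)+
  qed
qed

text \<open>A line through one blue point that halves the five red ones leaves two red points on
  each side and carries \<open>r\<close> and \<open>b\<close>. However the other three blue points
  are distributed, \<open>r\<close> and \<open>b\<close> can be assigned to the sides so that one
  side has three red points and a blue one and the other two red and three blue, or
  conversely.\<close>

lemma ensures_2_5_4: "ensures 2 5 4"
proof (rule ensuresI_exact)
  fix R B :: "point set"
  assume fin: "finite R" "finite B" and dj: "R \<inter> B = {}" and gp: "general_position (R \<union> B)"
    and card: "card R = 5" "card B = 4"
  have "B \<noteq> {}" using card by auto
  then obtain b where b: "b \<in> B" by blast
  have "R \<noteq> {}" using card by auto
  obtain u v r b' where u: "u \<noteq> 0" and rv: "r \<in> R" and b': "b' \<in> {b}" and rv2: "u \<bullet> r = v" and bv': "u \<bullet> b' = v"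
    and half: "2 * card {p \<in> R. u \<bullet> p < v} \<le> card R" "2 * card {p \<in> R. u \<bullet> p > v} \<le> card R"
      "2 * card {p \<in> {b}. u \<bullet> p < v} \<le> card {b}" "2 * card {p \<in> {b}. u \<bullet> p > v} \<le> card {b}"
    by (rule ham_sandwich[of R "{b}"]) (use fin \<open>R \<noteq> {}\<close> in simp_all)
  note rv = rv rv2
  have bv: "u \<bullet> b = v" using b' bv' by simp
  have neq: "r \<noteq> b" using rv b dj by blast
  have lev: "p = r \<or> p = b" if "p \<in> R \<union> B" "u \<bullet> p = v" for p
    using level_pair[OF u gp, of r b v p] rv b bv that neq by blast
  let ?Rl = "{p \<in> R. u \<bullet> p < v}" let ?Rg = "{p \<in> R. u \<bullet> p > v}"
  let ?Bl = "{p \<in> B. u \<bullet> p < v}" let ?Bg = "{p \<in> B. u \<bullet> p > v}"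
  have cR: "card R = card ?Rl + card ?Rg + 1"
    by (rule card_level_split[OF fin(1) rv]) (use lev b dj in blast)
  have cB: "card B = card ?Bl + card ?Bg + 1"
    by (rule card_level_split[OF fin(2) b bv]) (use lev rv dj in blast)
  have c2: "card ?Rl = 2" "card ?Rg = 2" using cR half card by linarith+
  \<comment> \<open>\<open>E\<close> consists of those of the two points on the line that are
    assigned to the lower side.\<close>
  have finish: "packs 2 R B" if E: "E \<subseteq> {r, b}"
    and p: "packs 1 (?Rl \<union> (R \<inter> E)) (?Bl \<union> (B \<inter> E))"
       "packs 1 (?Rg \<union> (R \<inter> ({r, b} - E))) (?Bg \<union> (B \<inter> ({r, b} - E)))" for E
  proof -
    let ?P = "{p \<in> R \<union> B. u \<bullet> p < v} \<union> E"
    have "packs (1 + 1) R B"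
    proof (rule packs_halfplane[OF u gp fin, of ?P])
      fix p q assume "p \<in> ?P" "q \<in> R \<union> B - ?P"
      then have "u \<bullet> p \<le> v" "v \<le> u \<bullet> q" using E rv bv by auto
      then show "u \<bullet> p \<le> u \<bullet> q" by simp
    next
      have "?Rl \<union> (R \<inter> E) \<subseteq> R \<inter> ?P" "?Bl \<union> (B \<inter> E) \<subseteq> B \<inter> ?P" by blast+
      then show "packs 1 (R \<inter> ?P) (B \<inter> ?P)" using packs_mono p(1) by blast
      have "?Rg \<union> (R \<inter> ({r, b} - E)) \<subseteq> R - ?P" "?Bg \<union> (B \<inter> ({r, b} - E)) \<subseteq> B - ?P"
        using rv bv E by auto
      then show "packs 1 (R - ?P) (B - ?P)" using packs_mono p(2) by blast
    qed
    then show ?thesis by (simp add: numeral_2_eq_2)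
  qed
  have one: "packs 1 R' B'" if "R' \<subseteq> R" "B' \<subseteq> B" "3 \<le> card R' \<and> 1 \<le> card B' \<or> 1 \<le> card R' \<and> 3 \<le> card B'" for R' B'
  proof -
    have "general_position (R' \<union> B')" by (rule general_position_subset[OF gp]) (use that in blast)
    moreover have "finite R'" "finite B'" "R' \<inter> B' = {}" using that fin dj finite_subset by blast+
    moreover have "ensures 1 3 1" "ensures 1 1 3" using ensures_pure[of 1 3 1] ensures_swap by auto
    ultimately show ?thesis using that(3) ensuresD[of 1 3 1 R' B'] ensuresD[of 1 1 3 R' B'] by blast
  qed
  have ins: "card ({p \<in> A. u \<bullet> p < v} \<union> {x}) = card {p \<in> A. u \<bullet> p < v} + 1"
    "card ({p \<in> A. u \<bullet> p > v} \<union> {x}) = card {p \<in> A. u \<bullet> p > v} + 1"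
    if "finite A" "u \<bullet> x = v" for A x using that by simp_all
  have int: "R \<inter> {r, b} = {r}" "B \<inter> {r, b} = {b}" "R \<inter> {r} = {r}" "R \<inter> {b} = {}" "B \<inter> {r} = {}" "B \<inter> {b} = {b}"
    "{r, b} - {r} = {b}" "{r, b} - {b} = {r}"
    using rv b dj neq by blast+
  have sub: "?Rl \<union> {r} \<subseteq> R" "?Rg \<union> {r} \<subseteq> R" "?Bl \<union> {b} \<subseteq> B" "?Bg \<union> {b} \<subseteq> B"
    "?Rl \<subseteq> R" "?Rg \<subseteq> R" "?Bl \<subseteq> B" "?Bg \<subseteq> B" using rv b by blast+
  note cs = ins[OF fin(1) rv(2)] ins[OF fin(2) bv] c2
  consider "card ?Bl = 0" "card ?Bg = 3" | "card ?Bl = 1" "card ?Bg = 2" | "card ?Bl = 2" "card ?Bg = 1"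
    | "card ?Bl = 3" "card ?Bg = 0" using cB card by linarith
  then show "packs 2 R B"
  proof cases
    case 1
    have "packs 1 (?Rl \<union> {r}) (?Bl \<union> {b})" by (rule one) (use sub cs 1 in simp_all)
    moreover have "packs 1 ?Rg ?Bg" by (rule one) (use sub cs 1 in simp_all)
    ultimately show ?thesis using finish[of "{r, b}"] int by simp
  next
    case 2
    have "packs 1 (?Rl \<union> {r}) ?Bl" by (rule one) (use sub cs 2 in simp_all)
    moreover have "packs 1 ?Rg (?Bg \<union> {b})" by (rule one) (use sub cs 2 in simp_all)
    ultimately show ?thesis using finish[of "{r}"] int by simp
  next
    case 3
    have "packs 1 ?Rl (?Bl \<union> {b})" by (rule one) (use sub cs 3 in simp_all)
    moreover have "packs 1 (?Rg \<union> {r}) ?Bg" by (rule one) (use sub cs 3 in simp_all)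
    ultimately show ?thesis using finish[of "{b}"] int by simp
  next
    case 4
    have "packs 1 ?Rl ?Bl" by (rule one) (use sub cs 4 in simp_all)
    moreover have "packs 1 (?Rg \<union> {r}) (?Bg \<union> {b})" by (rule one) (use sub cs 4 in simp_all)
    ultimately show ?thesis using finish[of "{}"] int by simp
  qed
qed

text \<open>Four stars cost 18 points. Five points with both colors contain one star, nine contain
  two by \<open>ensures_2_5_4\<close>, and fourteen are five and nine. For larger \<open>m\<close>
  with remainder 2 the value \<open>18 * i + 10\<close> is twice that of a remainder 1; the gain of
  a point occurs at \<open>m = 2\<close> alone.\<close>

definition quota :: "nat \<Rightarrow> nat" where
  "quota m = 18 * (m div 4) + (if m mod 4 = 0 then 0 else if m mod 4 = 1 then 5
     else if m mod 4 = 3 then 14 else if m = 2 then 9 else 10)"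

lemma quota_simps:
  "quota (4 * i) = 18 * i" "quota (4 * i + 1) = 18 * i + 5" "quota (4 * i + 3) = 18 * i + 14"
  "quota (4 * i + 2) = (if i = 0 then 9 else 18 * i + 10)"
proof -
  have "(4 * i + 1) div 4 = i" "(4 * i + 2) div 4 = i" "(4 * i + 3) div 4 = i"
    "(4 * i + 1) mod 4 = 1" "(4 * i + 2) mod 4 = 2" "(4 * i + 3) mod 4 = 3" by presburger+
  then show "quota (4 * i) = 18 * i" "quota (4 * i + 1) = 18 * i + 5" "quota (4 * i + 3) = 18 * i + 14"
    "quota (4 * i + 2) = (if i = 0 then 9 else 18 * i + 10)" unfolding quota_def by auto
qed

definition quota_enough :: "nat \<Rightarrow> bool" where
  "quota_enough m \<longleftrightarrow> (\<forall>r b. m \<le> r \<and> m \<le> b \<and> quota m \<le> r + b \<longrightarrow> ensures m r b)"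

lemma quota_enoughD: "quota_enough m \<Longrightarrow> m \<le> r \<Longrightarrow> m \<le> b \<Longrightarrow> quota m \<le> r + b \<Longrightarrow> ensures m r b"
  unfolding quota_enough_def by blast

lemma quota_ge: "2 * m \<le> quota m"
proof -
  obtain i x where m: "m = 4 * i + x" "x < 4" using that[of "m div 4" "m mod 4"] by simp
  then consider "x = 0" | "x = 1" | "x = 2" | "x = 3" by linarith
  then show ?thesis by cases (use m quota_simps[of i] in auto)
qed

text \<open>Surplus points can be thrown away and the colors exchanged, and
  \<open>ensures_pure\<close> covers a majority of at least \<open>3 * m\<close>. What remains are
  exact totals in which neither color dominates.\<close>

lemma quota_enoughI:
  assumes "\<And>r b. b \<le> r \<Longrightarrow> r + b = quota m \<Longrightarrow> m \<le> b \<Longrightarrow> r < 3 * m \<Longrightarrow> ensures m r b"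
  shows "quota_enough m"
proof -
  have exact: "ensures m r b" if "m \<le> r" "m \<le> b" "r + b = quota m" for r b
  proof (cases "b \<le> r")
    case True
    then show ?thesis using assms[of b r] ensures_pure[of m r b] that by (cases "r < 3 * m") auto
  next
    case False
    then have "ensures m b r" using assms[of r b] ensures_pure[of m b r] that by (cases "b < 3 * m") auto
    then show ?thesis by (rule ensures_swap)
  qed
  show ?thesis unfolding quota_enough_def
  proof (intro allI impI)
    fix r b assume h: "m \<le> r \<and> m \<le> b \<and> quota m \<le> r + b"
    define r' where "r' = min r (quota m - m)"
    have "m \<le> r'" "m \<le> quota m - r'" "r' + (quota m - r') = quota m" "r' \<le> r" "quota m - r' \<le> b"
      using h quota_ge[of m] unfolding r'_def by (auto simp: min_def)
    then show "ensures m r b" using exact ensures_mono by blast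
  qed
qed

text \<open>Before the middle, \<open>c k\<close> lies between
  \<open>b div 2 - ((r + b) div 2 - k)\<close> and \<open>b div 2\<close>. The numerical hypotheses
  say that at every value in this range each side keeps enough points of both colors for its
  quota.\<close>

lemma ensures_near_cut:
  assumes "quota_enough m1" "quota_enough m2" "k \<le> (r + b) div 2" "quota m1 \<le> k" "quota m2 + k \<le> r + b"
    "m1 + ((r + b) div 2 - k) \<le> b div 2" "m1 + b div 2 \<le> k" "m2 + b div 2 \<le> b" "m2 + (r + b) div 2 \<le> r + b div 2"
    "1 \<le> r" "1 \<le> b"
  shows "ensures (m1 + m2) r b"
proof (rule ensures_cut)
  fix c :: "nat \<Rightarrow> nat"
  assume mono: "\<And>i j. i \<le> j \<Longrightarrow> c i \<le> c j" and lip: "\<And>i j. i \<le> j \<Longrightarrow> c j \<le> c i + (j - i)"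
    and mid: "c ((r + b) div 2) = b div 2"
  have c: "c k \<le> b div 2" "b div 2 \<le> c k + ((r + b) div 2 - k)" using mono[OF assms(3)] lip[OF assms(3)] mid by simp_all
  have "ensures m1 (k - c k) (c k)" by (rule quota_enoughD[OF assms(1)]) (use c assms in linarith)+
  moreover have "ensures m2 (r - (k - c k)) (b - c k)"
    by (rule quota_enoughD[OF assms(2)]) (use c assms in linarith)+
  ultimately show "\<exists>k\<le>r + b. \<exists>n1 n2. m1 + m2 = n1 + n2 \<and> ensures n1 (k - c k) (c k) \<and> ensures n2 (r - (k - c k)) (b - c k)"
    using assms(5) by (intro exI[of _ k]) auto
qed (use assms in simp_all)

text \<open>For the four values of \<open>m\<close> below a cut near the middle may leave too few blue points
  on one side; a longer prefix then is so rich in red that it can be packed with blue centers only.\<close>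

lemma ensures_11:
  assumes "\<And>i. i < 11 \<Longrightarrow> quota_enough i" "b \<le> r" "r + b = 50" "r < 33"
  shows "ensures 11 r b"
proof (rule ensures_cut)
  fix c :: "nat \<Rightarrow> nat"
  assume mono: "\<And>i j. i \<le> j \<Longrightarrow> c i \<le> c j" and lip: "\<And>i j. i \<le> j \<Longrightarrow> c j \<le> c i + (j - i)"
    and mid: "c ((r + b) div 2) = b div 2"
  have q: "quota 4 = 18" "quota 7 = 32" "quota 6 = 28" unfolding quota_def by simp_all
  have m25: "c 25 = b div 2" using mid assms(3) by simp
  have B: "18 \<le> b" "b \<le> 25" "25 \<le> r" using assms by linarith+
  show "\<exists>k\<le>r + b. \<exists>m1 m2. 11 = m1 + m2 \<and> ensures m1 (k - c k) (c k) \<and> ensures m2 (r - (k - c k)) (b - c k)"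
  proof (cases "4 \<le> c 18")
    case True
    have "c 18 \<le> b div 2" using mono[of 18 25] m25 by simp
    then have "ensures 4 (18 - c 18) (c 18)" "ensures 7 (r - (18 - c 18)) (b - c 18)"
      using True B q assms(3) by (auto intro!: quota_enoughD assms(1))
    then show ?thesis using assms(3) by (intro exI[of _ 18] conjI exI[of _ 4] exI[of _ 7]) auto
  next
    case False
    \<comment> \<open>From \<open>c 18 \<le> 3\<close> at most six of the first 21 points are blue,
      so at least 15 are red: five stars with blue centers. Closeness to the middle provides the
      five centers.\<close>
    have "c 21 \<le> 6" "b div 2 \<le> c 21 + 4" using lip[of 18 21] lip[of 21 25] m25 False by simp_all
    note F = this B q assms(3)
      have "ensures 5 (21 - c 21) (c 21)" by (rule ensures_pure) (use F in linarith)+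
      moreover have "ensures 6 (r - (21 - c 21)) (b - c 21)" by (rule quota_enoughD[OF assms(1)]) (use F in linarith)+
    ultimately show ?thesis using assms(3) by (intro exI[of _ 21] conjI exI[of _ 5] exI[of _ 6]) auto
  qed
qed (use assms in simp_all)

lemma ensures_12:
  assumes "\<And>i. i < 12 \<Longrightarrow> quota_enough i" "b \<le> r" "r + b = 54" "r < 36"
  shows "ensures 12 r b"
proof (rule ensures_cut)
  fix c :: "nat \<Rightarrow> nat"
  assume mono: "\<And>i j. i \<le> j \<Longrightarrow> c i \<le> c j" and lip: "\<And>i j. i \<le> j \<Longrightarrow> c j \<le> c i + (j - i)"
    and mid: "c ((r + b) div 2) = b div 2"
  have q: "quota 4 = 18" "quota 8 = 36" "quota 7 = 32" "quota 6 = 28" unfolding quota_def by simp_all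
  have m27: "c 27 = b div 2" using mid assms(3) by simp
  have B: "19 \<le> b" "b \<le> 27" "27 \<le> r" using assms by linarith+
  show "\<exists>k\<le>r + b. \<exists>m1 m2. 12 = m1 + m2 \<and> ensures m1 (k - c k) (c k) \<and> ensures m2 (r - (k - c k)) (b - c k)"
  proof (cases "4 \<le> c 18")
    case True
    have "c 18 \<le> b div 2" using mono[of 18 27] m27 by simp
    then have "ensures 4 (18 - c 18) (c 18)" "ensures 8 (r - (18 - c 18)) (b - c 18)"
      using True B q assms(3) by (auto intro!: quota_enoughD assms(1))
    then show ?thesis using assms(3) by (intro exI[of _ 18] conjI exI[of _ 4] exI[of _ 8]) auto
  next
    case c18: False
    show ?thesis
    proof (cases "5 \<le> c 22")
      case True
      have "c 22 \<le> 7" using lip[of 18 22] c18 by simp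
      note F = this True B q assms(3)
      have "ensures 5 (22 - c 22) (c 22)" by (rule ensures_pure) (use F in linarith)+
      moreover have "ensures 7 (r - (22 - c 22)) (b - c 22)" by (rule quota_enoughD[OF assms(1)]) (use F in linarith)+
      ultimately show ?thesis using assms(3) by (intro exI[of _ 22] conjI exI[of _ 5] exI[of _ 7]) auto
    next
      case False
      \<comment> \<open>At most four of the first 22 points are blue, hence at most eight of the
        first 26. The other 18 are the leaves of six stars with blue centers.\<close>
      have "c 26 \<le> 8" "b div 2 \<le> c 26 + 1" using lip[of 22 26] lip[of 26 27] m27 False by simp_all
      note F = this B q assms(3)
      have "ensures 6 (26 - c 26) (c 26)" by (rule ensures_pure) (use F in linarith)+
      moreover have "ensures 6 (r - (26 - c 26)) (b - c 26)" by (rule quota_enoughD[OF assms(1)]) (use F in linarith)+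
      ultimately show ?thesis using assms(3) by (intro exI[of _ 26] conjI exI[of _ 6] exI[of _ 6]) auto
    qed
  qed
qed (use assms in simp_all)

lemma ensures_13:
  assumes "\<And>i. i < 13 \<Longrightarrow> quota_enough i" "b \<le> r" "r + b = 59" "r < 39"
  shows "ensures 13 r b"
proof (rule ensures_cut)
  fix c :: "nat \<Rightarrow> nat"
  assume mono: "\<And>i j. i \<le> j \<Longrightarrow> c i \<le> c j" and lip: "\<And>i j. i \<le> j \<Longrightarrow> c j \<le> c i + (j - i)"
    and mid: "c ((r + b) div 2) = b div 2"
  have q: "quota 4 = 18" "quota 8 = 36" "quota 7 = 32" "quota 9 = 41" unfolding quota_def by simp_all
  have m29: "c 29 = b div 2" using mid assms(3) by simp
  have B: "21 \<le> b" "b \<le> 29" "30 \<le> r" using assms by linarith+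
  show "\<exists>k\<le>r + b. \<exists>m1 m2. 13 = m1 + m2 \<and> ensures m1 (k - c k) (c k) \<and> ensures m2 (r - (k - c k)) (b - c k)"
  proof (cases "4 \<le> c 18")
    case True
    have "c 18 \<le> b div 2" using mono[of 18 29] m29 by simp
    then have "ensures 4 (18 - c 18) (c 18)" "ensures 9 (r - (18 - c 18)) (b - c 18)"
      using True B q assms(3) by (auto intro!: quota_enoughD assms(1))
    then show ?thesis using assms(3) by (intro exI[of _ 18] conjI exI[of _ 4] exI[of _ 9]) auto
  next
    case c18: False
    show ?thesis
    proof (cases "5 \<le> c 23")
      case True
      have "c 23 \<le> 8" using lip[of 18 23] c18 by simp
      note F = this True B q assms(3)
      have "ensures 5 (23 - c 23) (c 23)" by (rule ensures_pure) (use F in linarith)+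
      moreover have "ensures 8 (r - (23 - c 23)) (b - c 23)" by (rule quota_enoughD[OF assms(1)]) (use F in linarith)+
      ultimately show ?thesis using assms(3) by (intro exI[of _ 23] conjI exI[of _ 5] exI[of _ 8]) auto
    next
      case False
      have "c 27 \<le> 8" "b div 2 \<le> c 27 + 2" using lip[of 23 27] lip[of 27 29] m29 False by simp_all
      note F = this B q assms(3)
      have "ensures 6 (27 - c 27) (c 27)" by (rule ensures_pure) (use F in linarith)+
      moreover have "ensures 7 (r - (27 - c 27)) (b - c 27)" by (rule quota_enoughD[OF assms(1)]) (use F in linarith)+
      ultimately show ?thesis using assms(3) by (intro exI[of _ 27] conjI exI[of _ 6] exI[of _ 7]) auto
    qed
  qed
qed (use assms in simp_all)

lemma ensures_20:
  assumes "\<And>i. i < 20 \<Longrightarrow> quota_enough i" "b \<le> r" "r + b = 90" "r < 60"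
  shows "ensures 20 r b"
proof (rule ensures_cut)
  fix c :: "nat \<Rightarrow> nat"
  assume mono: "\<And>i j. i \<le> j \<Longrightarrow> c i \<le> c j" and lip: "\<And>i j. i \<le> j \<Longrightarrow> c j \<le> c i + (j - i)"
    and mid: "c ((r + b) div 2) = b div 2"
  have q: "quota 8 = 36" "quota 12 = 54" "quota 11 = 50" unfolding quota_def by simp_all
  have m45: "c 45 = b div 2" using mid assms(3) by simp
  have B: "31 \<le> b" "b \<le> 45" "45 \<le> r" using assms by linarith+
  show "\<exists>k\<le>r + b. \<exists>m1 m2. 20 = m1 + m2 \<and> ensures m1 (k - c k) (c k) \<and> ensures m2 (r - (k - c k)) (b - c k)"
  proof (cases "8 \<le> c 36")
    case True
    have "c 36 \<le> b div 2" using mono[of 36 45] m45 by simp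
    then have "ensures 8 (36 - c 36) (c 36)" "ensures 12 (r - (36 - c 36)) (b - c 36)"
      using True B q assms(3) by (auto intro!: quota_enoughD assms(1))
    then show ?thesis using assms(3) by (intro exI[of _ 36] conjI exI[of _ 8] exI[of _ 12]) auto
  next
    case False
    \<comment> \<open>At least 29 of the first 40 points are red, enough for the 27 leaves of nine
      stars.\<close>
    have "c 40 \<le> 11" "b div 2 \<le> c 40 + 5" using lip[of 36 40] lip[of 40 45] m45 False by simp_all
    note F = this B q assms(3)
      have "ensures 9 (40 - c 40) (c 40)" by (rule ensures_pure) (use F in linarith)+
      moreover have "ensures 11 (r - (40 - c 40)) (b - c 40)" by (rule quota_enoughD[OF assms(1)]) (use F in linarith)+
    ultimately show ?thesis using assms(3) by (intro exI[of _ 40] conjI exI[of _ 9] exI[of _ 11]) auto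
  qed
qed (use assms in simp_all)

text \<open>Cut near the middle so that the quotas of the two parts add up exactly. Halving
  interacts with the period four of \<open>quota\<close>, hence the cases modulo eight. The values
  11, 12, 13 and 20 do not satisfy the inequalities of \<open>ensures_near_cut\<close>, because with
  few points the distance of the cut from the middle exceeds what the minority color can
  spare.\<close>

lemma quota_enough: "quota_enough m"
proof (induction m rule: less_induct)
  case (less m)
  show ?case
  proof (rule quota_enoughI)
    fix r b assume rb: "b \<le> r" "r + b = quota m" "m \<le> b" "r < 3 * m"
    have near: "ensures m r b" if "m = m1 + m2" "m1 < m" "m2 < m" "k \<le> (r + b) div 2" "quota m1 \<le> k"
      "quota m2 + k \<le> r + b" "m1 + ((r + b) div 2 - k) \<le> b div 2" "m1 + b div 2 \<le> k"
      "m2 + b div 2 \<le> b" "m2 + (r + b) div 2 \<le> r + b div 2" for m1 m2 k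
      using ensures_near_cut[of m1 m2 k r b] that less rb by simp
    have q2: "quota 2 = 9" unfolding quota_def by simp
    define l where "l = m div 8"
    have "m = 8 * l + m mod 8" "m mod 8 < 8" unfolding l_def by simp_all
    moreover from this(2) have "m mod 8 \<in> {0, 1, 2, 3, 4, 5, 6, 7}" by auto
    ultimately consider "m = 4 * (2 * l)" | "m = 4 * (2 * l) + 1" | "m = 4 * (2 * l) + 2" | "m = 4 * (2 * l) + 3"
      | "m = 4 * (2 * l + 1)" | "m = 4 * (2 * l + 1) + 1" | "m = 4 * (2 * l + 1) + 2" | "m = 4 * (2 * l + 1) + 3"
      by force
    then show "ensures m r b"
    proof cases
      case 1
      show ?thesis by (rule near[of "4 * l" "4 * l" "18 * l"]) (use 1 rb quota_simps(1)[of l] quota_simps(1)[of "2 * l"] in auto)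
    next
      case 2
      show ?thesis
      proof (cases "l = 0")
        case True
        then have "ensures m r b" using ensures_pure[of 1 r b] 2 rb quota_simps(2)[of 0] by simp
        then show ?thesis .
      next
        case False
        have "(36 * l + 5) div 2 = 18 * l + 2" by presburger
        then show ?thesis by (intro near[of "4 * l" "4 * l + 1" "18 * l"]) (use 2 False rb quota_simps(1)[of l] quota_simps(2)[of l] quota_simps(2)[of "2 * l"] in auto)
      qed
    next
      case 3
      show ?thesis
      proof (cases "l = 0")
        case True
        then have "r + b = 9" "m = 2" using 3 rb quota_simps(4)[of 0] by simp_all
        then have "r = 5" "b = 4" using rb by auto
        then show ?thesis using ensures_2_5_4 \<open>m = 2\<close> by simp
      next
        case False
        show ?thesis by (rule near[of "4 * l + 1" "4 * l + 1" "18 * l + 5"]) (use 3 False rb quota_simps(2)[of l] quota_simps(4)[of "2 * l"] in auto)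
      qed
    next
      case 4
      have q: "quota m = 36 * l + 14" using 4 quota_simps(3)[of "2 * l"] by simp
      show ?thesis
      proof (cases "l = 0 \<or> l = 1")
        case True
        then show ?thesis
        proof
          assume "l = 0"
          then show ?thesis by (intro near[of 1 2 5]) (use 4 rb quota_simps(2)[of 0] quota_simps(4)[of 0] q q2 in auto)
        next
          assume "l = 1"
          then show ?thesis using ensures_11[of b r] less 4 rb q by simp
        qed
      next
        case False
        show ?thesis by (rule near[of "4 * l" "4 * l + 3" "18 * l"]) (use 4 False rb quota_simps(1)[of l] quota_simps(3)[of l] q q2 in auto)
      qed
    next
      case 5
      have q: "quota m = 36 * l + 18" using 5 quota_simps(1)[of "2 * l + 1"] by simp
      consider "l = 0" | "l = 1" | "l = 2" | "3 \<le> l" by linarith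
      then show ?thesis
      proof cases
        case a: 1
        then show ?thesis by (intro near[of 2 2 9]) (use 5 rb quota_simps(4)[of 0] q q2 in auto)
      next
        case a: 2
        then show ?thesis using ensures_12[of b r] less 5 rb q by simp
      next
        case a: 3
        then show ?thesis using ensures_20[of b r] less 5 rb q by simp
      next
        case a: 4
        show ?thesis by (rule near[of "4 * l" "4 * (l + 1)" "18 * l"]) (use 5 a rb quota_simps(1)[of l] quota_simps(1)[of "l + 1"] q q2 in auto)
      qed
    next
      case 6
      have q: "quota m = 36 * l + 23" using 6 quota_simps(2)[of "2 * l + 1"] by simp
      consider "l = 0" | "l = 1" | "2 \<le> l" by linarith
      then show ?thesis
      proof cases
        case a: 1
        then show ?thesis by (intro near[of 2 3 9]) (use 6 rb quota_simps(4)[of 0] quota_simps(3)[of 0] q q2 in auto)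
      next
        case a: 2
        then show ?thesis using ensures_13[of b r] less 6 rb q by simp
      next
        case a: 3
        show ?thesis by (rule near[of "4 * l + 1" "4 * (l + 1)" "18 * l + 5"]) (use 6 a rb quota_simps(2)[of l] quota_simps(1)[of "l + 1"] q q2 in auto)
      qed
    next
      case 7
      have q: "quota m = 36 * l + 28" using 7 quota_simps(4)[of "2 * l + 1"] by simp
      show ?thesis by (rule near[of "4 * l + 3" "4 * l + 3" "18 * l + 14"]) (use 7 rb quota_simps(3)[of l] q q2 in auto)
    next
      case 8
      have q: "quota m = 36 * l + 32" using 8 quota_simps(3)[of "2 * l + 1"] by simp
      show ?thesis by (rule near[of "4 * l + 3" "4 * (l + 1)" "18 * l + 14"]) (use 8 rb quota_simps(3)[of l] quota_simps(1)[of "l + 1"] q q2 in auto)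
    qed
  qed
qed

text \<open>A converse of \<open>quota\<close> in closed form, since the program has to evaluate it:
  the last summand steps at the remainders 5, 10 and 14. Truncated subtraction gives zero at
  remainder 0.\<close>

definition star_count :: "nat \<Rightarrow> nat" where
  "star_count n = 4 * (n div 18) + (2 * (n mod 18) - 1) div 9"

lemma quota_star_count: "quota (star_count n) \<le> n"
proof -
  define i x where "i = n div 18" and "x = n mod 18"
  have n: "n = 18 * i + x" "x < 18" unfolding i_def x_def by simp_all
  have s: "star_count n = 4 * i + (2 * x - 1) div 9" unfolding star_count_def i_def x_def ..
  consider "x < 5" | "5 \<le> x" "x < 10" | "10 \<le> x" "x < 14" | "14 \<le> x" by linarith
  then show ?thesis
  proof cases
    case 1
    then have "(2 * x - 1) div 9 = 0" by simp
    then show ?thesis using s n quota_simps(1)[of i] by simp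
  next
    case 2
    then have "(2 * x - 1) div 9 = 1" by presburger
    then show ?thesis using s n quota_simps(2)[of i] 2 by simp
  next
    case 3
    then have "(2 * x - 1) div 9 = 2" by presburger
    then show ?thesis using s n quota_simps(4)[of i] 3 by (simp split: if_splits)
  next
    case 4
    then have "(2 * x - 1) div 9 = 3" using n(2) by presburger
    then show ?thesis using s n quota_simps(3)[of i] 4 by simp
  qed
qed

theorem packs_star_count:
  assumes "finite R" "finite B" "R \<inter> B = {}" "general_position (R \<union> B)"
    and "star_count (card R + card B) \<le> card R" "star_count (card R + card B) \<le> card B"
  shows "packs (star_count (card R + card B)) R B"
  by (rule ensuresD[OF quota_enoughD[OF quota_enough assms(5,6) quota_star_count] assms(1-4)]) simp_all

section \<open>Programs for the real RAM\<close>

record mst =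
  rw :: "nat \<Rightarrow> nat"
  rx :: "nat \<Rightarrow> real"
  mw :: "nat \<Rightarrow> nat"
  mx :: "nat \<Rightarrow> real"

datatype wexp = WC nat | WR nat | WB word_op wexp wexp | WM wexp
datatype rexp = RC wexp | RR nat | RB real_op rexp rexp | RM wexp
datatype bexp = WL wexp wexp | RL rexp rexp
datatype com = SetW nat wexp | SetR nat rexp | StoreW wexp wexp | StoreR wexp rexp
  | Seq com com (infixr ";;" 60) | Cond bexp com com | While bexp com

fun wv :: "wexp \<Rightarrow> mst \<Rightarrow> nat" where
  "wv (WC n) s = n"
| "wv (WR i) s = rw s i"
| "wv (WB f a b) s = word_arith f (wv a s) (wv b s)"
| "wv (WM a) s = mw s (wv a s)"

fun rv :: "rexp \<Rightarrow> mst \<Rightarrow> real" where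
  "rv (RC a) s = real (wv a s)"
| "rv (RR i) s = rx s i"
| "rv (RB f a b) s = real_arith f (rv a s) (rv b s)"
| "rv (RM a) s = mx s (wv a s)"

fun bv :: "bexp \<Rightarrow> mst \<Rightarrow> bool" where
  "bv (WL a b) s \<longleftrightarrow> wv a s < wv b s"
| "bv (RL a b) s \<longleftrightarrow> rv a s < rv b s"

text \<open>Program variables are the registers below 50; the compiler uses the others as temporaries.
  Subtraction, division and remainder cannot overflow, so only sums and products are checked.\<close>

fun okw :: "nat \<Rightarrow> wexp \<Rightarrow> mst \<Rightarrow> bool" where
  "okw M (WC n) s \<longleftrightarrow> n \<le> M"
| "okw M (WR i) s \<longleftrightarrow> i < 50"
| "okw M (WB f a b) s \<longleftrightarrow> okw M a s \<and> okw M b s \<and>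
     ((f = WAdd \<or> f = WMul) \<longrightarrow> word_arith f (wv a s) (wv b s) \<le> M)"
| "okw M (WM a) s \<longleftrightarrow> okw M a s"

fun okr :: "nat \<Rightarrow> rexp \<Rightarrow> mst \<Rightarrow> bool" where
  "okr M (RC a) s \<longleftrightarrow> okw M a s"
| "okr M (RR i) s \<longleftrightarrow> i < 50"
| "okr M (RB f a b) s \<longleftrightarrow> okr M a s \<and> okr M b s"
| "okr M (RM a) s \<longleftrightarrow> okw M a s"

fun okb :: "nat \<Rightarrow> bexp \<Rightarrow> mst \<Rightarrow> bool" where
  "okb M (WL a b) s \<longleftrightarrow> okw M a s \<and> okw M b s"
| "okb M (RL a b) s \<longleftrightarrow> okr M a s \<and> okr M b s"

text \<open>The value ends up in register \<open>d\<close>, and registers below \<open>d\<close> are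
  preserved, so a second operand can be evaluated in \<open>Suc d\<close>. There is no move
  instruction; a copy is an addition of zero.\<close>

fun cw :: "wexp \<Rightarrow> nat \<Rightarrow> instr list" where
  "cw (WC n) d = [WConst d n]"
| "cw (WR i) d = [WConst d 0, WArith WAdd d i d]"
| "cw (WB f a b) d = cw a d @ cw b (Suc d) @ [WArith f d d (Suc d)]"
| "cw (WM a) d = cw a d @ [WLoad d d]"

fun cr :: "rexp \<Rightarrow> nat \<Rightarrow> instr list" where
  "cr (RC a) d = cw a d @ [RCast d d]"
| "cr (RR i) d = [WConst d 0, RCast d d, RArith RAdd d i d]"
| "cr (RB f a b) d = cr a d @ cr b (Suc d) @ [RArith f d d (Suc d)]"
| "cr (RM a) d = cw a d @ [RLoad d d]"

fun cb :: "bexp \<Rightarrow> nat \<Rightarrow> instr list" where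
  "cb (WL a b) l = cw a 50 @ cw b 51 @ [JumpWLess 50 51 l]"
| "cb (RL a b) l = cr a 50 @ cr b 51 @ [JumpRLess 50 51 l]"

fun clen :: "com \<Rightarrow> nat" where
  "clen (SetW i e) = length (cw e 50) + 2"
| "clen (SetR i e) = length (cr e 50) + 3"
| "clen (StoreW a e) = length (cw a 50) + length (cw e 51) + 1"
| "clen (StoreR a e) = length (cw a 50) + length (cr e 51) + 1"
| "clen (c ;; d) = clen c + clen d"
| "clen (Cond b c d) = length (cb b 0) + clen d + 1 + clen c"
| "clen (While b c) = length (cb b 0) + 1 + clen c + 1"

text \<open>Jump targets are absolute, so the code depends on its address \<open>l\<close>; its
  length does not, which makes the targets known in advance. A conditional jump is taken when the
  test holds, hence the else branch comes first.\<close>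

fun cc :: "com \<Rightarrow> nat \<Rightarrow> instr list" where
  "cc (SetW i e) l = cw e 50 @ [WConst 51 0, WArith WAdd i 50 51]"
| "cc (SetR i e) l = cr e 50 @ [WConst 51 0, RCast 51 51, RArith RAdd i 50 51]"
| "cc (StoreW a e) l = cw a 50 @ cw e 51 @ [WStore 50 51]"
| "cc (StoreR a e) l = cw a 50 @ cr e 51 @ [RStore 50 51]"
| "cc (c ;; d) l = cc c l @ cc d (l + clen c)"
| "cc (Cond b c d) l = cb b (l + length (cb b 0) + clen d + 1) @ cc d (l + length (cb b 0)) @
     [Jump (l + length (cb b 0) + clen d + 1 + clen c)] @ cc c (l + length (cb b 0) + clen d + 1)"
| "cc (While b c) l = cb b (l + length (cb b 0) + 1) @ [Jump (l + length (cb b 0) + 1 + clen c + 1)] @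
     cc c (l + length (cb b 0) + 1) @ [Jump l]"

lemma length_cb: "length (cb b l) = length (cb b 0)"
  by (cases b) simp_all

lemma length_cc [simp]: "length (cc c l) = clen c"
  by (induction c arbitrary: l) (simp_all add: length_cb[of _ "Suc _"])

text \<open>Temporaries are shown as zero, so that two machine states which agree on all program
  variables and on memory have equal views.\<close>

definition view :: "state \<Rightarrow> mst" where
  "view \<sigma> = \<lparr>rw = (\<lambda>i. if i < 50 then wreg \<sigma> i else 0), rx = (\<lambda>i. if i < 50 then rreg \<sigma> i else 0),
     mw = wmem \<sigma>, mx = rmem \<sigma>\<rparr>"

lemma view_simps [simp]:
  "view (\<sigma>\<lparr>pc := l\<rparr>) = view \<sigma>"
  "view (\<sigma>\<lparr>wmem := m\<rparr>) = (view \<sigma>)\<lparr>mw := m\<rparr>"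
  "view (\<sigma>\<lparr>rmem := r\<rparr>) = (view \<sigma>)\<lparr>mx := r\<rparr>"
  "mw (view \<sigma>) = wmem \<sigma>" "mx (view \<sigma>) = rmem \<sigma>"
  by (auto simp: view_def cong: if_cong)

section \<open>Correctness of the compiled code\<close>

definition code_at :: "instr list \<Rightarrow> nat \<Rightarrow> instr list \<Rightarrow> bool" where
  "code_at P l cs \<longleftrightarrow> (\<forall>i<length cs. l + i < length P \<and> P ! (l + i) = cs ! i)"

lemma code_at_Nil [simp]: "code_at P l []"
  unfolding code_at_def by simp

lemma code_at_Cons [simp]: "code_at P l (c # cs) \<longleftrightarrow> l < length P \<and> P ! l = c \<and> code_at P (Suc l) cs"
proof
  assume "code_at P l (c # cs)"
  then have h: "\<And>i. i < Suc (length cs) \<Longrightarrow> l + i < length P \<and> P ! (l + i) = (c # cs) ! i"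
    unfolding code_at_def by simp
  show "l < length P \<and> P ! l = c \<and> code_at P (Suc l) cs"
    using h[of 0] h[of "Suc _"] unfolding code_at_def by auto
next
  assume h: "l < length P \<and> P ! l = c \<and> code_at P (Suc l) cs"
  show "code_at P l (c # cs)" unfolding code_at_def
  proof (intro allI impI)
    fix i assume "i < length (c # cs)"
    then show "l + i < length P \<and> P ! (l + i) = (c # cs) ! i"
      using h unfolding code_at_def by (cases i) auto
  qed
qed

lemma code_at_append [simp]:
  "code_at P l (as @ bs) \<longleftrightarrow> code_at P l as \<and> code_at P (l + length as) bs"
  by (induction as arbitrary: l) auto

definition steps :: "instr list \<Rightarrow> nat \<Rightarrow> state \<Rightarrow> nat \<Rightarrow> state \<Rightarrow> bool" where
  "steps P M \<sigma> n \<sigma>' \<longleftrightarrow> (step P ^^ n) \<sigma> = \<sigma>' \<and> (\<forall>m\<le>n. words_bounded M ((step P ^^ m) \<sigma>))"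

lemma steps_bounded: "steps P M \<sigma> n \<sigma>' \<Longrightarrow> words_bounded M \<sigma>'"
  unfolding steps_def by blast

lemma steps_trans:
  assumes "steps P M \<sigma> n \<sigma>1" "steps P M \<sigma>1 k \<sigma>2"
  shows "steps P M \<sigma> (n + k) \<sigma>2"
proof -
  have add: "(step P ^^ (n + i)) \<sigma> = (step P ^^ i) \<sigma>1" for i
    using assms(1) unfolding steps_def by (simp add: funpow_add add.commute[of n])
  have "words_bounded M ((step P ^^ m) \<sigma>)" if "m \<le> n + k" for m
  proof (cases "m \<le> n")
    case True then show ?thesis using assms(1) unfolding steps_def by blast
  next
    case False
    then have "(step P ^^ m) \<sigma> = (step P ^^ (m - n)) \<sigma>1" using add[of "m - n"] by simp
    moreover have "m - n \<le> k" using that by simp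
    ultimately show ?thesis using assms(2) unfolding steps_def by simp
  qed
  then show ?thesis using add[of k] assms(2) unfolding steps_def by blast
qed

lemma steps_exec:
  assumes "pc \<sigma> < length P" "P ! pc \<sigma> = i" "words_bounded M \<sigma>" "words_bounded M (exec i \<sigma>)"
  shows "steps P M \<sigma> 1 (exec i \<sigma>)"
proof -
  have "step P \<sigma> = exec i \<sigma>" using assms unfolding step_def halted_def by simp
  then have "words_bounded M ((step P ^^ m) \<sigma>)" if "m \<le> 1" for m
    using that assms by (cases m) auto
  then show ?thesis using \<open>step P \<sigma> = exec i \<sigma>\<close> unfolding steps_def by simp
qed

definition frame :: "nat \<Rightarrow> state \<Rightarrow> state \<Rightarrow> bool" where
  "frame d \<sigma> \<sigma>' \<longleftrightarrow> (\<forall>i<d. wreg \<sigma>' i = wreg \<sigma> i \<and> rreg \<sigma>' i = rreg \<sigma> i) \<and> wmem \<sigma>' = wmem \<sigma> \<and> rmem \<sigma>' = rmem \<sigma>"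

lemma frame_trans: "frame d \<sigma> \<sigma>1 \<Longrightarrow> frame d' \<sigma>1 \<sigma>2 \<Longrightarrow> d \<le> d' \<Longrightarrow> frame d \<sigma> \<sigma>2"
  unfolding frame_def by simp

lemma frame_view: "frame d \<sigma> \<sigma>' \<Longrightarrow> 50 \<le> d \<Longrightarrow> view \<sigma>' = view \<sigma>"
  unfolding frame_def view_def by auto

lemma cw_correct:
  assumes "code_at P (pc \<sigma>) (cw e d)" "50 \<le> d" "words_bounded M \<sigma>" "okw M e (view \<sigma>)"
  shows "\<exists>\<sigma>'. steps P M \<sigma> (length (cw e d)) \<sigma>' \<and> pc \<sigma>' = pc \<sigma> + length (cw e d) \<and>
     wreg \<sigma>' d = wv e (view \<sigma>) \<and> frame d \<sigma> \<sigma>' \<and> rreg \<sigma>' = rreg \<sigma>"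
  using assms
proof (induction e arbitrary: d \<sigma>)
  case (WC n)
  let ?s = "exec (WConst d n) \<sigma>"
  have "steps P M \<sigma> 1 ?s"
    by (rule steps_exec) (use WC in \<open>auto simp: words_bounded_def next_pc_def goto_def\<close>)
  then show ?case by (intro exI[of _ ?s]) (auto simp: frame_def next_pc_def goto_def)
next
  case (WR i)
  let ?s1 = "exec (WConst d 0) \<sigma>" let ?s = "exec (WArith WAdd d i d) ?s1"
  have i: "i < 50" using WR by simp
  have 1: "steps P M \<sigma> 1 ?s1"
    by (rule steps_exec) (use WR in \<open>auto simp: words_bounded_def next_pc_def goto_def\<close>)
  have "steps P M ?s1 1 ?s"
    by (rule steps_exec) (use WR i in \<open>auto simp: words_bounded_def next_pc_def goto_def\<close>)
  from steps_trans[OF 1 this] show ?case using i WR(2)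
    by (intro exI[of _ ?s]) (auto simp: frame_def next_pc_def goto_def view_def)
next
  case (WB f a b)
  obtain s1 where s1: "steps P M \<sigma> (length (cw a d)) s1" "pc s1 = pc \<sigma> + length (cw a d)"
    "wreg s1 d = wv a (view \<sigma>)" "frame d \<sigma> s1" "rreg s1 = rreg \<sigma>"
    using WB.IH(1)[of \<sigma> d] WB.prems by auto
  have v1: "view s1 = view \<sigma>" using frame_view s1(4) WB.prems(2) by blast
  obtain s2 where s2: "steps P M s1 (length (cw b (Suc d))) s2" "pc s2 = pc s1 + length (cw b (Suc d))"
    "wreg s2 (Suc d) = wv b (view s1)" "frame (Suc d) s1 s2" "rreg s2 = rreg s1"
    using WB.IH(2)[of s1 "Suc d"] WB.prems s1 v1 steps_bounded[OF s1(1)] by (auto simp: add.assoc)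
  let ?s = "exec (WArith f d d (Suc d)) s2"
  have val: "wreg s2 d = wv a (view \<sigma>)" "wreg s2 (Suc d) = wv b (view \<sigma>)"
    using s1 s2 v1 unfolding frame_def by auto
  have b2: "words_bounded M s2" using steps_bounded[OF s2(1)] .
  \<comment> \<open>Difference, quotient and remainder never exceed the left operand, and that one
    is bounded because it sits in a register. Sums and products are bounded by
    \<open>okw\<close>.\<close>
  have "word_arith f (wv a (view \<sigma>)) (wv b (view \<sigma>)) \<le> M"
  proof -
    have "wv a (view \<sigma>) \<le> M" using val b2 unfolding words_bounded_def by metis
    moreover have "x - y \<le> M" "x div y \<le> M" "x mod y \<le> M" if "x \<le> M" for x y :: nat
      using that div_le_dividend[of x y] mod_less_eq_dividend[of x y] by linarith+
    ultimately show ?thesis using WB.prems(4) by (cases f) auto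
  qed
  then have "words_bounded M ?s" using b2 val by (auto simp: words_bounded_def next_pc_def goto_def)
  then have "steps P M s2 1 ?s"
    by (intro steps_exec) (use WB.prems s1 s2 b2 in \<open>auto simp: add.assoc\<close>)
  from steps_trans[OF steps_trans[OF s1(1) s2(1)] this] show ?case
    using val s1 s2 frame_trans[OF s1(4) s2(4)]
    by (intro exI[of _ ?s]) (auto simp: frame_def next_pc_def goto_def add.assoc)
next
  case (WM a)
  obtain s1 where s1: "steps P M \<sigma> (length (cw a d)) s1" "pc s1 = pc \<sigma> + length (cw a d)"
    "wreg s1 d = wv a (view \<sigma>)" "frame d \<sigma> s1" "rreg s1 = rreg \<sigma>"
    using WM.IH[of \<sigma> d] WM.prems by auto
  let ?s = "exec (WLoad d d) s1"
  have b1: "words_bounded M s1" using steps_bounded[OF s1(1)] .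
  then have "words_bounded M ?s" by (auto simp: words_bounded_def next_pc_def goto_def)
  then have "steps P M s1 1 ?s"
    by (intro steps_exec) (use WM.prems s1 b1 in auto)
  from steps_trans[OF s1(1) this] show ?case
    using s1 by (intro exI[of _ ?s]) (auto simp: frame_def next_pc_def goto_def view_def)
qed

lemma cr_correct:
  assumes "code_at P (pc \<sigma>) (cr e d)" "50 \<le> d" "words_bounded M \<sigma>" "okr M e (view \<sigma>)"
  shows "\<exists>\<sigma>'. steps P M \<sigma> (length (cr e d)) \<sigma>' \<and> pc \<sigma>' = pc \<sigma> + length (cr e d) \<and>
     rreg \<sigma>' d = rv e (view \<sigma>) \<and> frame d \<sigma> \<sigma>'"
  using assms
proof (induction e arbitrary: d \<sigma>)
  case (RC a)
  obtain s1 where s1: "steps P M \<sigma> (length (cw a d)) s1" "pc s1 = pc \<sigma> + length (cw a d)"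
    "wreg s1 d = wv a (view \<sigma>)" "frame d \<sigma> s1" "rreg s1 = rreg \<sigma>"
    using cw_correct[of P \<sigma> a d M] RC by auto
  let ?s = "exec (RCast d d) s1"
  have b1: "words_bounded M s1" using steps_bounded[OF s1(1)] .
  then have "words_bounded M ?s" by (auto simp: words_bounded_def next_pc_def goto_def)
  then have "steps P M s1 1 ?s" by (intro steps_exec) (use RC s1 b1 in auto)
  from steps_trans[OF s1(1) this] show ?case
    using s1 by (intro exI[of _ ?s]) (auto simp: frame_def next_pc_def goto_def)
next
  case (RR i)
  let ?s1 = "exec (WConst d 0) \<sigma>" let ?s2 = "exec (RCast d d) ?s1" let ?s = "exec (RArith RAdd d i d) ?s2"
  have i: "i < 50" using RR by simp
  have 1: "steps P M \<sigma> 1 ?s1"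
    by (rule steps_exec) (use RR in \<open>auto simp: words_bounded_def next_pc_def goto_def\<close>)
  have 2: "steps P M ?s1 1 ?s2"
    by (rule steps_exec) (use RR i in \<open>auto simp: words_bounded_def next_pc_def goto_def\<close>)
  have 3: "steps P M ?s2 1 ?s"
    by (rule steps_exec) (use RR i in \<open>auto simp: words_bounded_def next_pc_def goto_def\<close>)
  from steps_trans[OF steps_trans[OF 1 2] 3] show ?case using i RR(2)
    by (intro exI[of _ ?s]) (auto simp: frame_def next_pc_def goto_def view_def numeral_3_eq_3)
next
  case (RB f a b)
  obtain s1 where s1: "steps P M \<sigma> (length (cr a d)) s1" "pc s1 = pc \<sigma> + length (cr a d)"
    "rreg s1 d = rv a (view \<sigma>)" "frame d \<sigma> s1"
    using RB.IH(1)[of \<sigma> d] RB.prems by auto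
  have v1: "view s1 = view \<sigma>" using frame_view s1(4) RB.prems(2) by blast
  obtain s2 where s2: "steps P M s1 (length (cr b (Suc d))) s2" "pc s2 = pc s1 + length (cr b (Suc d))"
    "rreg s2 (Suc d) = rv b (view s1)" "frame (Suc d) s1 s2"
    using RB.IH(2)[of s1 "Suc d"] RB.prems s1 v1 steps_bounded[OF s1(1)] by (auto simp: add.assoc)
  let ?s = "exec (RArith f d d (Suc d)) s2"
  have val: "rreg s2 d = rv a (view \<sigma>)" "rreg s2 (Suc d) = rv b (view \<sigma>)"
    using s1 s2 v1 unfolding frame_def by auto
  have b2: "words_bounded M s2" using steps_bounded[OF s2(1)] .
  then have "words_bounded M ?s" by (auto simp: words_bounded_def next_pc_def goto_def)
  then have "steps P M s2 1 ?s"
    by (intro steps_exec) (use RB.prems s1 s2 b2 in \<open>auto simp: add.assoc\<close>)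
  from steps_trans[OF steps_trans[OF s1(1) s2(1)] this] show ?case
    using val s1 s2 frame_trans[OF s1(4) s2(4)]
    by (intro exI[of _ ?s]) (auto simp: frame_def next_pc_def goto_def add.assoc)
next
  case (RM a)
  obtain s1 where s1: "steps P M \<sigma> (length (cw a d)) s1" "pc s1 = pc \<sigma> + length (cw a d)"
    "wreg s1 d = wv a (view \<sigma>)" "frame d \<sigma> s1" "rreg s1 = rreg \<sigma>"
    using cw_correct[of P \<sigma> a d M] RM by auto
  let ?s = "exec (RLoad d d) s1"
  have b1: "words_bounded M s1" using steps_bounded[OF s1(1)] .
  then have "words_bounded M ?s" by (auto simp: words_bounded_def next_pc_def goto_def)
  then have "steps P M s1 1 ?s" by (intro steps_exec) (use RM s1 b1 in auto)
  from steps_trans[OF s1(1) this] show ?case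
    using s1 by (intro exI[of _ ?s]) (auto simp: frame_def next_pc_def goto_def view_def)
qed

lemma cb_correct:
  assumes "code_at P (pc \<sigma>) (cb b l)" "words_bounded M \<sigma>" "okb M b (view \<sigma>)"
  shows "\<exists>\<sigma>'. steps P M \<sigma> (length (cb b 0)) \<sigma>' \<and>
     pc \<sigma>' = (if bv b (view \<sigma>) then l else pc \<sigma> + length (cb b 0)) \<and> view \<sigma>' = view \<sigma>"
proof (cases b)
  case (WL a c)
  obtain s1 where s1: "steps P M \<sigma> (length (cw a 50)) s1" "pc s1 = pc \<sigma> + length (cw a 50)"
    "wreg s1 50 = wv a (view \<sigma>)" "frame 50 \<sigma> s1"
    using cw_correct[of P \<sigma> a 50 M] assms WL by auto
  have v1: "view s1 = view \<sigma>" using frame_view[OF s1(4)] by simp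
  obtain s2 where s2: "steps P M s1 (length (cw c 51)) s2" "pc s2 = pc s1 + length (cw c 51)"
    "wreg s2 51 = wv c (view s1)" "frame 51 s1 s2"
    using cw_correct[of P s1 c 51 M] assms WL s1 v1 steps_bounded[OF s1(1)] by (auto simp: add.assoc)
  have val: "wreg s2 50 = wv a (view \<sigma>)" "wreg s2 51 = wv c (view \<sigma>)"
    using s1 s2 v1 unfolding frame_def by auto
  have v2: "view s2 = view \<sigma>" using frame_view[OF s2(4)] v1 by simp
  let ?s = "exec (JumpWLess 50 51 l) s2"
  have b2: "words_bounded M s2" using steps_bounded[OF s2(1)] .
  then have "words_bounded M ?s" by (auto simp: words_bounded_def next_pc_def goto_def)
  then have "steps P M s2 1 ?s"
    by (intro steps_exec) (use assms WL s1 s2 b2 in \<open>auto simp: add.assoc\<close>)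
  from steps_trans[OF steps_trans[OF s1(1) s2(1)] this] show ?thesis
    using val v2 s1 s2 WL by (intro exI[of _ ?s]) (auto simp: next_pc_def goto_def add.assoc)
next
  case (RL a c)
  obtain s1 where s1: "steps P M \<sigma> (length (cr a 50)) s1" "pc s1 = pc \<sigma> + length (cr a 50)"
    "rreg s1 50 = rv a (view \<sigma>)" "frame 50 \<sigma> s1"
    using cr_correct[of P \<sigma> a 50 M] assms RL by auto
  have v1: "view s1 = view \<sigma>" using frame_view[OF s1(4)] by simp
  obtain s2 where s2: "steps P M s1 (length (cr c 51)) s2" "pc s2 = pc s1 + length (cr c 51)"
    "rreg s2 51 = rv c (view s1)" "frame 51 s1 s2"
    using cr_correct[of P s1 c 51 M] assms RL s1 v1 steps_bounded[OF s1(1)] by (auto simp: add.assoc)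
  have val: "rreg s2 50 = rv a (view \<sigma>)" "rreg s2 51 = rv c (view \<sigma>)"
    using s1 s2 v1 unfolding frame_def by auto
  have v2: "view s2 = view \<sigma>" using frame_view[OF s2(4)] v1 by simp
  let ?s = "exec (JumpRLess 50 51 l) s2"
  have b2: "words_bounded M s2" using steps_bounded[OF s2(1)] .
  then have "words_bounded M ?s" by (auto simp: words_bounded_def next_pc_def goto_def)
  then have "steps P M s2 1 ?s"
    by (intro steps_exec) (use assms RL s1 s2 b2 in \<open>auto simp: add.assoc\<close>)
  from steps_trans[OF steps_trans[OF s1(1) s2(1)] this] show ?thesis
    using val v2 s1 s2 RL by (intro exI[of _ ?s]) (auto simp: next_pc_def goto_def add.assoc)
qed

text \<open>Total correctness with a time bound, for the code placed at any address of any program,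
  which makes the rules compositional. The bound is real so that it may contain logarithms.\<close>

definition runs :: "nat \<Rightarrow> com \<Rightarrow> mst \<Rightarrow> real \<Rightarrow> (mst \<Rightarrow> bool) \<Rightarrow> bool" where
  "runs M c s t Q \<longleftrightarrow> (\<forall>P \<sigma>. code_at P (pc \<sigma>) (cc c (pc \<sigma>)) \<and> words_bounded M \<sigma> \<and> view \<sigma> = s \<longrightarrow>
     (\<exists>n \<sigma>'. steps P M \<sigma> n \<sigma>' \<and> real n \<le> t \<and> pc \<sigma>' = pc \<sigma> + clen c \<and> Q (view \<sigma>')))"

lemma runsI:
  assumes "\<And>P \<sigma>. code_at P (pc \<sigma>) (cc c (pc \<sigma>)) \<Longrightarrow> words_bounded M \<sigma> \<Longrightarrow> view \<sigma> = s \<Longrightarrow>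
     \<exists>n \<sigma>'. steps P M \<sigma> n \<sigma>' \<and> real n \<le> t \<and> pc \<sigma>' = pc \<sigma> + clen c \<and> Q (view \<sigma>')"
  shows "runs M c s t Q"
  unfolding runs_def using assms by blast

lemma runsE:
  assumes "runs M c (view \<sigma>) t Q" "code_at P (pc \<sigma>) (cc c (pc \<sigma>))" "words_bounded M \<sigma>"
  obtains n \<sigma>' where "steps P M \<sigma> n \<sigma>'" "real n \<le> t" "pc \<sigma>' = pc \<sigma> + clen c" "Q (view \<sigma>')"
  using assms unfolding runs_def by blast

lemma runs_conseq:
  assumes "runs M c s t Q" "t \<le> t'" "\<And>s'. Q s' \<Longrightarrow> Q' s'"
  shows "runs M c s t' Q'"
proof (rule runsI)
  fix P \<sigma> assume h: "code_at P (pc \<sigma>) (cc c (pc \<sigma>))" "words_bounded M \<sigma>" "view \<sigma> = s"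
  obtain n \<sigma>' where "steps P M \<sigma> n \<sigma>'" "real n \<le> t" "pc \<sigma>' = pc \<sigma> + clen c" "Q (view \<sigma>')"
    by (rule runsE[of M c \<sigma> t Q P]) (use assms(1) h in auto)
  then show "\<exists>n \<sigma>'. steps P M \<sigma> n \<sigma>' \<and> real n \<le> t' \<and> pc \<sigma>' = pc \<sigma> + clen c \<and> Q' (view \<sigma>')"
    using assms(2,3) by (meson order_trans)
qed

lemma runs_SetW:
  assumes "i < 50" "okw M e s" "Q (s\<lparr>rw := (rw s)(i := wv e s)\<rparr>)" "real (clen (SetW i e)) \<le> t"
  shows "runs M (SetW i e) s t Q"
proof (rule runsI)
  fix P \<sigma> assume c: "code_at P (pc \<sigma>) (cc (SetW i e) (pc \<sigma>))" and b: "words_bounded M \<sigma>" and v: "view \<sigma> = s"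
  obtain s1 where s1: "steps P M \<sigma> (length (cw e 50)) s1" "pc s1 = pc \<sigma> + length (cw e 50)"
    "wreg s1 50 = wv e s" "frame 50 \<sigma> s1" using cw_correct[of P \<sigma> e 50 M] c b v assms by auto
  let ?s2 = "exec (WConst 51 0) s1" let ?s = "exec (WArith WAdd i 50 51) ?s2"
  have b1: "words_bounded M s1" using steps_bounded[OF s1(1)] .
  have vb: "wreg s1 50 \<le> M" using b1 unfolding words_bounded_def by blast
  have 2: "steps P M s1 1 ?s2"
    by (rule steps_exec) (use c s1 b1 in \<open>auto simp: words_bounded_def next_pc_def goto_def\<close>)
  have 3: "steps P M ?s2 1 ?s"
    by (rule steps_exec) (use c s1 b1 vb in \<open>auto simp: words_bounded_def next_pc_def goto_def\<close>)
  have "view s1 = s" using frame_view[OF s1(4)] v by simp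
  then have "view ?s = s\<lparr>rw := (rw s)(i := wv e s)\<rparr>" using assms(1) s1(3)
    by (auto simp: view_def next_pc_def goto_def fun_eq_iff)
  then show "\<exists>n \<sigma>'. steps P M \<sigma> n \<sigma>' \<and> real n \<le> t \<and> pc \<sigma>' = pc \<sigma> + clen (SetW i e) \<and> Q (view \<sigma>')"
    using steps_trans[OF steps_trans[OF s1(1) 2] 3] assms s1
    by (intro exI[of _ "length (cw e 50) + 1 + 1"] exI[of _ ?s]) (auto simp: next_pc_def goto_def)
qed

lemma runs_SetR:
  assumes "i < 50" "okr M e s" "Q (s\<lparr>rx := (rx s)(i := rv e s)\<rparr>)" "real (clen (SetR i e)) \<le> t"
  shows "runs M (SetR i e) s t Q"
proof (rule runsI)
  fix P \<sigma> assume c: "code_at P (pc \<sigma>) (cc (SetR i e) (pc \<sigma>))" and b: "words_bounded M \<sigma>" and v: "view \<sigma> = s"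
  obtain s1 where s1: "steps P M \<sigma> (length (cr e 50)) s1" "pc s1 = pc \<sigma> + length (cr e 50)"
    "rreg s1 50 = rv e s" "frame 50 \<sigma> s1" using cr_correct[of P \<sigma> e 50 M] c b v assms by auto
  let ?s2 = "exec (WConst 51 0) s1" let ?s3 = "exec (RCast 51 51) ?s2" let ?s = "exec (RArith RAdd i 50 51) ?s3"
  have b1: "words_bounded M s1" using steps_bounded[OF s1(1)] .
  have vb: "wreg s1 50 \<le> M" using b1 unfolding words_bounded_def by blast
  have 2: "steps P M s1 1 ?s2"
    by (rule steps_exec) (use c s1 b1 in \<open>auto simp: words_bounded_def next_pc_def goto_def\<close>)
  have 3: "steps P M ?s2 1 ?s3"
    by (rule steps_exec) (use c s1 b1 in \<open>auto simp: words_bounded_def next_pc_def goto_def\<close>)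
  have 4: "steps P M ?s3 1 ?s"
    by (rule steps_exec) (use c s1 b1 in \<open>auto simp: words_bounded_def next_pc_def goto_def\<close>)
  have "view s1 = s" using frame_view[OF s1(4)] v by simp
  then have "view ?s = s\<lparr>rx := (rx s)(i := rv e s)\<rparr>" using assms(1) s1(3)
    by (auto simp: view_def next_pc_def goto_def fun_eq_iff)
  then show "\<exists>n \<sigma>'. steps P M \<sigma> n \<sigma>' \<and> real n \<le> t \<and> pc \<sigma>' = pc \<sigma> + clen (SetR i e) \<and> Q (view \<sigma>')"
    using steps_trans[OF steps_trans[OF steps_trans[OF s1(1) 2] 3] 4] assms s1
    by (intro exI[of _ "length (cr e 50) + 1 + 1 + 1"] exI[of _ ?s]) (auto simp: next_pc_def goto_def)
qed

lemma runs_StoreW: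
  assumes "okw M a s" "okw M e s" "Q (s\<lparr>mw := (mw s)(wv a s := wv e s)\<rparr>)" "real (clen (StoreW a e)) \<le> t"
  shows "runs M (StoreW a e) s t Q"
proof (rule runsI)
  fix P \<sigma> assume c: "code_at P (pc \<sigma>) (cc (StoreW a e) (pc \<sigma>))" and b: "words_bounded M \<sigma>" and v: "view \<sigma> = s"
  obtain s1 where s1: "steps P M \<sigma> (length (cw a 50)) s1" "pc s1 = pc \<sigma> + length (cw a 50)"
    "wreg s1 50 = wv a s" "frame 50 \<sigma> s1" using cw_correct[of P \<sigma> a 50 M] c b v assms by auto
  have v1: "view s1 = s" using frame_view[OF s1(4)] v by simp
  obtain s2 where s2: "steps P M s1 (length (cw e 51)) s2" "pc s2 = pc s1 + length (cw e 51)"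
    "wreg s2 51 = wv e s" "frame 51 s1 s2"
    using cw_correct[of P s1 e 51 M] c s1 v1 assms steps_bounded[OF s1(1)] by auto
  have v2: "view s2 = s" using frame_view[OF s2(4)] v1 by simp
  have val: "wreg s2 50 = wv a s" using s1 s2 unfolding frame_def by auto
  let ?s = "exec (WStore 50 51) s2"
  have b2: "words_bounded M s2" using steps_bounded[OF s2(1)] .
  have vb: "wreg s2 51 \<le> M" using b2 unfolding words_bounded_def by blast
  have 3: "steps P M s2 1 ?s"
    by (rule steps_exec) (use c s1 s2 b2 vb in \<open>auto simp: words_bounded_def next_pc_def goto_def add.assoc\<close>)
  have "view ?s = s\<lparr>mw := (mw s)(wv a s := wv e s)\<rparr>" using s2(3) val v2
    by (auto simp: next_pc_def goto_def)
  then show "\<exists>n \<sigma>'. steps P M \<sigma> n \<sigma>' \<and> real n \<le> t \<and> pc \<sigma>' = pc \<sigma> + clen (StoreW a e) \<and> Q (view \<sigma>')"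
    using steps_trans[OF steps_trans[OF s1(1) s2(1)] 3] assms s1 s2
    by (intro exI[of _ "length (cw a 50) + length (cw e 51) + 1"] exI[of _ ?s]) (auto simp: next_pc_def goto_def)
qed

lemma runs_StoreR:
  assumes "okw M a s" "okr M e s" "Q (s\<lparr>mx := (mx s)(wv a s := rv e s)\<rparr>)" "real (clen (StoreR a e)) \<le> t"
  shows "runs M (StoreR a e) s t Q"
proof (rule runsI)
  fix P \<sigma> assume c: "code_at P (pc \<sigma>) (cc (StoreR a e) (pc \<sigma>))" and b: "words_bounded M \<sigma>" and v: "view \<sigma> = s"
  obtain s1 where s1: "steps P M \<sigma> (length (cw a 50)) s1" "pc s1 = pc \<sigma> + length (cw a 50)"
    "wreg s1 50 = wv a s" "frame 50 \<sigma> s1" using cw_correct[of P \<sigma> a 50 M] c b v assms by auto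
  have v1: "view s1 = s" using frame_view[OF s1(4)] v by simp
  obtain s2 where s2: "steps P M s1 (length (cr e 51)) s2" "pc s2 = pc s1 + length (cr e 51)"
    "rreg s2 51 = rv e s" "frame 51 s1 s2"
    using cr_correct[of P s1 e 51 M] c s1 v1 assms steps_bounded[OF s1(1)] by auto
  have v2: "view s2 = s" using frame_view[OF s2(4)] v1 by simp
  have val: "wreg s2 50 = wv a s" using s1 s2 unfolding frame_def by auto
  let ?s = "exec (RStore 50 51) s2"
  have b2: "words_bounded M s2" using steps_bounded[OF s2(1)] .
  have vb: "wreg s2 51 \<le> M" using b2 unfolding words_bounded_def by blast
  have 3: "steps P M s2 1 ?s"
    by (rule steps_exec) (use c s1 s2 b2 vb in \<open>auto simp: words_bounded_def next_pc_def goto_def add.assoc\<close>)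
  have "view ?s = s\<lparr>mx := (mx s)(wv a s := rv e s)\<rparr>" using s2(3) val v2
    by (auto simp: next_pc_def goto_def)
  then show "\<exists>n \<sigma>'. steps P M \<sigma> n \<sigma>' \<and> real n \<le> t \<and> pc \<sigma>' = pc \<sigma> + clen (StoreR a e) \<and> Q (view \<sigma>')"
    using steps_trans[OF steps_trans[OF s1(1) s2(1)] 3] assms s1 s2
    by (intro exI[of _ "length (cw a 50) + length (cr e 51) + 1"] exI[of _ ?s]) (auto simp: next_pc_def goto_def)
qed

lemma runs_Seq:
  assumes "runs M c s t1 (\<lambda>s'. runs M d s' t2 Q)" "t1 + t2 \<le> t"
  shows "runs M (c ;; d) s t Q"
proof (rule runsI)
  fix P \<sigma> assume c: "code_at P (pc \<sigma>) (cc (c ;; d) (pc \<sigma>))" and b: "words_bounded M \<sigma>" and v: "view \<sigma> = s"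
  obtain n s1 where s1: "steps P M \<sigma> n s1" "real n \<le> t1" "pc s1 = pc \<sigma> + clen c" "runs M d (view s1) t2 Q"
    by (rule runsE[of M c \<sigma> t1 "\<lambda>s'. runs M d s' t2 Q" P]) (use c b v assms in auto)
  obtain m s2 where s2: "steps P M s1 m s2" "real m \<le> t2" "pc s2 = pc s1 + clen d" "Q (view s2)"
    by (rule runsE[OF s1(4)]) (use c s1 steps_bounded[OF s1(1)] in auto)
  show "\<exists>n \<sigma>'. steps P M \<sigma> n \<sigma>' \<and> real n \<le> t \<and> pc \<sigma>' = pc \<sigma> + clen (c ;; d) \<and> Q (view \<sigma>')"
    using steps_trans[OF s1(1) s2(1)] s1 s2 assms(2)
    by (intro exI[of _ "n + m"] exI[of _ s2]) auto
qed

lemma steps_Jump: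
  assumes "pc \<sigma> < length P" "P ! pc \<sigma> = Jump l" "words_bounded M \<sigma>"
  shows "steps P M \<sigma> 1 (\<sigma>\<lparr>pc := l\<rparr>)"
  using steps_exec[OF assms] assms(3) by (simp add: goto_def words_bounded_def)

lemma runs_Cond:
  assumes "okb M b s" "bv b s \<Longrightarrow> runs M c s t Q" "\<not> bv b s \<Longrightarrow> runs M d s t Q"
    and "t + real (length (cb b 0) + 1) \<le> t'"
  shows "runs M (Cond b c d) s t' Q"
proof (rule runsI)
  fix P \<sigma> assume c: "code_at P (pc \<sigma>) (cc (Cond b c d) (pc \<sigma>))" and bd: "words_bounded M \<sigma>" and v: "view \<sigma> = s"
  let ?l = "pc \<sigma> + length (cb b 0) + clen d + 1"
  have c': "code_at P (pc \<sigma>) (cb b ?l)" "code_at P (pc \<sigma> + length (cb b 0)) (cc d (pc \<sigma> + length (cb b 0)))"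
    "pc \<sigma> + length (cb b 0) + clen d < length P" "P ! (pc \<sigma> + length (cb b 0) + clen d) = Jump (?l + clen c)"
    "code_at P ?l (cc c ?l)"
    using c by (simp_all add: length_cb[of _ "_ + _"] length_cb[of _ "Suc _"])
  obtain s1 where s1: "steps P M \<sigma> (length (cb b 0)) s1" "pc s1 = (if bv b s then ?l else pc \<sigma> + length (cb b 0))"
    "view s1 = s" using cb_correct[OF c'(1) bd] assms(1) v by auto
  have b1: "words_bounded M s1" using steps_bounded[OF s1(1)] .
  show "\<exists>n \<sigma>'. steps P M \<sigma> n \<sigma>' \<and> real n \<le> t' \<and> pc \<sigma>' = pc \<sigma> + clen (Cond b c d) \<and> Q (view \<sigma>')"
  proof (cases "bv b s")
    case True
    obtain m s2 where s2: "steps P M s1 m s2" "real m \<le> t" "pc s2 = pc s1 + clen c" "Q (view s2)"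
      by (rule runsE[of M c s1 t Q P]) (use assms(2) True c' s1 b1 in auto)
    show ?thesis using steps_trans[OF s1(1) s2(1)] s1 s2 True assms(4)
      by (intro exI[of _ "length (cb b 0) + m"] exI[of _ s2]) auto
  next
    case False
    obtain m s2 where s2: "steps P M s1 m s2" "real m \<le> t" "pc s2 = pc s1 + clen d" "Q (view s2)"
      by (rule runsE[of M d s1 t Q P]) (use assms(3) False c' s1 b1 in auto)
    have s3: "steps P M s2 1 (s2\<lparr>pc := ?l + clen c\<rparr>)"
      by (rule steps_Jump) (use s2 s1 False c' steps_bounded[OF s2(1)] in auto)
    show ?thesis using steps_trans[OF steps_trans[OF s1(1) s2(1)] s3] s1 s2 False assms(4)
      by (intro exI[of _ "length (cb b 0) + m + 1"] exI[of _ "s2\<lparr>pc := ?l + clen c\<rparr>"]) auto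
  qed
qed

definition bcost :: "bexp \<Rightarrow> real" where
  "bcost b = real (length (cb b 0) + 1)"

lemma bcost_ge: "1 \<le> bcost b"
  unfolding bcost_def by simp

lemma runs_While_unfold:
  assumes "okb M b s" "\<not> bv b s \<Longrightarrow> Q s \<and> bcost b \<le> t"
    and "bv b s \<Longrightarrow> runs M c s t1 (\<lambda>s'. runs M (While b c) s' t2 Q)"
    and "bv b s \<Longrightarrow> t1 + t2 + bcost b \<le> t"
  shows "runs M (While b c) s t Q"
proof (rule runsI)
  fix P \<sigma> assume c: "code_at P (pc \<sigma>) (cc (While b c) (pc \<sigma>))" and bd: "words_bounded M \<sigma>" and v: "view \<sigma> = s"
  let ?l = "pc \<sigma> + length (cb b 0) + 1"
  have c': "code_at P (pc \<sigma>) (cb b ?l)" 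
    "pc \<sigma> + length (cb b 0) < length P" "P ! (pc \<sigma> + length (cb b 0)) = Jump (?l + clen c + 1)"
    "code_at P ?l (cc c ?l)" "?l + clen c < length P" "P ! (?l + clen c) = Jump (pc \<sigma>)"
    using c by (simp_all add: length_cb[of _ "_ + _"] length_cb[of _ "Suc _"])
  obtain s1 where s1: "steps P M \<sigma> (length (cb b 0)) s1" "pc s1 = (if bv b s then ?l else pc \<sigma> + length (cb b 0))"
    "view s1 = s" using cb_correct[OF c'(1) bd] assms(1) v by auto
  have b1: "words_bounded M s1" using steps_bounded[OF s1(1)] .
  show "\<exists>n \<sigma>'. steps P M \<sigma> n \<sigma>' \<and> real n \<le> t \<and> pc \<sigma>' = pc \<sigma> + clen (While b c) \<and> Q (view \<sigma>')"
  proof (cases "bv b s")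
    case True
    obtain m s2 where s2: "steps P M s1 m s2" "real m \<le> t1" "pc s2 = pc s1 + clen c" "runs M (While b c) (view s2) t2 Q"
      by (rule runsE[of M c s1 t1 "\<lambda>s'. runs M (While b c) s' t2 Q" P]) (use assms(3) True c' s1 b1 in auto)
    let ?s3 = "s2\<lparr>pc := pc \<sigma>\<rparr>"
    have s3: "steps P M s2 1 ?s3"
      by (rule steps_Jump) (use s2 s1 True c' steps_bounded[OF s2(1)] in auto)
    obtain k s4 where s4: "steps P M ?s3 k s4" "real k \<le> t2" "pc s4 = pc ?s3 + clen (While b c)" "Q (view s4)"
      by (rule runsE[of M "While b c" ?s3 t2 Q P]) (use s2(4) c steps_bounded[OF s3] in auto)
    show ?thesis using steps_trans[OF steps_trans[OF steps_trans[OF s1(1) s2(1)] s3] s4(1)] s1 s2 s4 assms(4)[OF True]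
      by (intro exI[of _ "length (cb b 0) + m + 1 + k"] exI[of _ s4]) (auto simp: bcost_def)
  next
    case False
    have s3: "steps P M s1 1 (s1\<lparr>pc := ?l + clen c + 1\<rparr>)"
      by (rule steps_Jump) (use s1 False c' b1 in auto)
    show ?thesis using steps_trans[OF s1(1) s3] s1 False assms(2)[OF False]
      by (intro exI[of _ "length (cb b 0) + 1"] exI[of _ "s1\<lparr>pc := ?l + clen c + 1\<rparr>"]) (auto simp: bcost_def)
  qed
qed

text \<open>\<open>n\<close> only bounds the number of rounds, and the postcondition leaves open
  which \<open>k\<close> was reached. This serves loops that stop as soon as a test succeeds;
  \<open>runs_for\<close> is the version for a counter that runs to its end.\<close>

lemma runs_iter:
  assumes "I a s" "a \<le> n" "0 \<le> K"
    and cond: "\<And>k s. I k s \<Longrightarrow> a \<le> k \<Longrightarrow> k \<le> n \<Longrightarrow> okb M b s \<and> (bv b s \<longrightarrow> k < n)"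
    and body: "\<And>k s. I k s \<Longrightarrow> a \<le> k \<Longrightarrow> k < n \<Longrightarrow> bv b s \<Longrightarrow> runs M c s K (I (Suc k))"
    and "real (n - a) * (K + bcost b) + bcost b \<le> t"
  shows "runs M (While b c) s t (\<lambda>s'. (\<exists>k. a \<le> k \<and> k \<le> n \<and> I k s') \<and> \<not> bv b s')"
proof -
  let ?Q = "\<lambda>s'. (\<exists>k. a \<le> k \<and> k \<le> n \<and> I k s') \<and> \<not> bv b s'"
  have main: "runs M (While b c) s (real d * (K + bcost b) + bcost b) ?Q"
    if "I k s" "a \<le> k" "k \<le> n" "n - k = d" for d k s
    using that
  proof (induction d arbitrary: k s)
    case 0
    then have "\<not> bv b s" "okb M b s" using cond[of k s] by auto
    then show ?case using 0 by (intro runs_While_unfold) auto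
  next
    case (Suc d)
    show ?case
    proof (rule runs_While_unfold)
      show "okb M b s" using cond Suc.prems by blast
      show "\<not> bv b s \<Longrightarrow> ?Q s \<and> bcost b \<le> real (Suc d) * (K + bcost b) + bcost b"
        using Suc.prems assms(3) bcost_ge[of b] by auto
      show "runs M c s K (\<lambda>s'. runs M (While b c) s' (real d * (K + bcost b) + bcost b) ?Q)" if "bv b s"
      proof (rule runs_conseq[OF body[of k]])
        show "runs M (While b c) s' (real d * (K + bcost b) + bcost b) ?Q" if "I (Suc k) s'" for s'
          using Suc.IH[of "Suc k" s'] Suc.prems that by simp
      qed (use Suc.prems that in auto)
      show "K + (real d * (K + bcost b) + bcost b) + bcost b \<le> real (Suc d) * (K + bcost b) + bcost b"
        by (simp add: algebra_simps)
    qed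
  qed
  show ?thesis by (rule runs_conseq[OF main[OF assms(1) order_refl assms(2) refl] assms(6)])
qed

lemma runs_for:
  assumes "I a s" "rw s i = a" "a \<le> n" "0 \<le> K"
    and cond: "\<And>k s. I k s \<Longrightarrow> rw s i = k \<Longrightarrow> a \<le> k \<Longrightarrow> k \<le> n \<Longrightarrow> okb M b s \<and> (bv b s \<longleftrightarrow> k < n)"
    and body: "\<And>k s. I k s \<Longrightarrow> rw s i = k \<Longrightarrow> a \<le> k \<Longrightarrow> k < n \<Longrightarrow> runs M c s K (\<lambda>s'. I (Suc k) s' \<and> rw s' i = Suc k)"
    and "real (n - a) * (K + bcost b) + bcost b \<le> t"
  shows "runs M (While b c) s t (\<lambda>s'. I n s' \<and> rw s' i = n)"
proof -
  have "runs M (While b c) s t (\<lambda>s'. (\<exists>k. a \<le> k \<and> k \<le> n \<and> I k s' \<and> rw s' i = k) \<and> \<not> bv b s')"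
  proof (rule runs_iter[where K = K])
    show "okb M b s \<and> (bv b s \<longrightarrow> k < n)" if "I k s \<and> rw s i = k" "a \<le> k" "k \<le> n" for k s
      using cond[of k s] that by blast
    show "runs M c s K (\<lambda>s'. I (Suc k) s' \<and> rw s' i = Suc k)" if "I k s \<and> rw s i = k" "a \<le> k" "k < n" for k s
      using body[of k s] that by blast
  qed (use assms in auto)
  then show ?thesis
  proof (rule runs_conseq)
    fix s' assume "(\<exists>k. a \<le> k \<and> k \<le> n \<and> I k s' \<and> rw s' i = k) \<and> \<not> bv b s'"
    then obtain k where k: "a \<le> k" "k \<le> n" "I k s'" "rw s' i = k" "\<not> bv b s'" by blast
    then have "k = n" using cond[of k s'] by auto
    then show "I n s' \<and> rw s' i = n" using k by simp
  qed simp
qed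

text \<open>Weakest precondition of loop-free code, so that the simplifier can execute straight-line
  parts symbolically. A loop has precondition \<open>False\<close> and has to be treated by a rule
  of its own.\<close>

fun wp :: "nat \<Rightarrow> com \<Rightarrow> mst \<Rightarrow> (mst \<Rightarrow> bool) \<Rightarrow> bool" where
  "wp M (SetW i e) s Q \<longleftrightarrow> i < 50 \<and> okw M e s \<and> Q (s\<lparr>rw := (rw s)(i := wv e s)\<rparr>)"
| "wp M (SetR i e) s Q \<longleftrightarrow> i < 50 \<and> okr M e s \<and> Q (s\<lparr>rx := (rx s)(i := rv e s)\<rparr>)"
| "wp M (StoreW a e) s Q \<longleftrightarrow> okw M a s \<and> okw M e s \<and> Q (s\<lparr>mw := (mw s)(wv a s := wv e s)\<rparr>)"
| "wp M (StoreR a e) s Q \<longleftrightarrow> okw M a s \<and> okr M e s \<and> Q (s\<lparr>mx := (mx s)(wv a s := rv e s)\<rparr>)"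
| "wp M (c ;; d) s Q \<longleftrightarrow> wp M c s (\<lambda>s'. wp M d s' Q)"
| "wp M (Cond b c d) s Q \<longleftrightarrow> okb M b s \<and> (if bv b s then wp M c s Q else wp M d s Q)"
| "wp M (While b c) s Q \<longleftrightarrow> False"

lemma wp_mono: "wp M c s Q \<Longrightarrow> (\<And>s'. Q s' \<Longrightarrow> Q' s') \<Longrightarrow> wp M c s Q'"
proof (induction c arbitrary: s Q Q')
  case (Seq c d)
  have "wp M c s (\<lambda>s'. wp M d s' Q)" using Seq.prems(1) by simp
  then have "wp M c s (\<lambda>s'. wp M d s' Q')" by (rule Seq.IH(1)) (use Seq.IH(2) Seq.prems(2) in blast)
  then show ?case by simp
qed (auto split: if_splits)

text \<open>Without loops every instruction is executed at most once, so the length of the code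
  bounds its running time.\<close>

lemma runs_wp:
  assumes "wp M c s Q" "real (clen c) \<le> t"
  shows "runs M c s t Q"
  using assms
proof (induction c arbitrary: s Q t)
  case (SetW i e) then show ?case by (intro runs_SetW) auto
next
  case (SetR i e) then show ?case by (intro runs_SetR) auto
next
  case (StoreW a e) then show ?case by (intro runs_StoreW) auto
next
  case (StoreR a e) then show ?case by (intro runs_StoreR) auto
next
  case (Seq c d)
  have "runs M c s (real (clen c)) (\<lambda>s'. runs M d s' (real (clen d)) Q)"
  proof (rule Seq.IH(1))
    have "wp M c s (\<lambda>s'. wp M d s' Q)" using Seq.prems by simp
    then show "wp M c s (\<lambda>s'. runs M d s' (real (clen d)) Q)"
      by (rule wp_mono) (use Seq.IH(2) in blast)
  qed simp
  then show ?case by (rule runs_Seq) (use Seq.prems in simp)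
next
  case (Cond b c d)
  show ?case
  proof (rule runs_Cond[of _ _ _ _ "t - real (length (cb b 0) + 1)"])
    show "runs M c s (t - real (length (cb b 0) + 1)) Q" if "bv b s"
      using Cond.IH(1) Cond.prems that by simp
    show "runs M d s (t - real (length (cb b 0) + 1)) Q" if "\<not> bv b s"
      using Cond.IH(2) Cond.prems that by simp
  qed (use Cond.prems in simp_all)
next
  case (While b c) then show ?case by simp
qed

lemma runs_Seq_wp:
  assumes "wp M c s (\<lambda>s'. runs M d s' t2 Q)" "real (clen c) + t2 \<le> t"
  shows "runs M (c ;; d) s t Q"
  by (rule runs_Seq[OF runs_wp[OF assms(1) order_refl] assms(2)])

lemma computes_within_runs:
  assumes "runs M c (view \<sigma>) (real t) Q" "pc \<sigma> = 0" "words_bounded M \<sigma>"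
  shows "\<exists>\<sigma>'. computes_within (cc c 0) M t \<sigma> \<sigma>' \<and> Q (view \<sigma>')"
proof -
  have "code_at (cc c 0) (pc \<sigma>) (cc c (pc \<sigma>))" unfolding assms(2) code_at_def by simp
  then obtain n \<sigma>' where n: "steps (cc c 0) M \<sigma> n \<sigma>'" "real n \<le> real t" "pc \<sigma>' = pc \<sigma> + clen c" "Q (view \<sigma>')"
    using runsE[OF assms(1) _ assms(3)] by blast
  then have "computes_within (cc c 0) M t \<sigma> \<sigma>'" unfolding computes_within_def steps_def halted_def
    using assms(2) by (intro exI[of _ n]) auto
  then show ?thesis using n(4) by blast
qed

section \<open>Merge sort\<close>

definition seg :: "(nat \<Rightarrow> 'a) \<Rightarrow> nat \<Rightarrow> nat \<Rightarrow> 'a list" where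
  "seg m a n = map (\<lambda>k. m (a + k)) [0..<n]"

lemma length_seg [simp]: "length (seg m a n) = n"
  unfolding seg_def by simp

lemma nth_seg [simp]: "k < n \<Longrightarrow> seg m a n ! k = m (a + k)"
  unfolding seg_def by simp

lemma seg_0 [simp]: "seg m a 0 = []"
  unfolding seg_def by simp

lemma seg_Suc: "seg m a (Suc n) = seg m a n @ [m (a + n)]"
  unfolding seg_def by simp

lemma seg_cong: "(\<And>k. k < n \<Longrightarrow> m (a + k) = m' (a' + k)) \<Longrightarrow> seg m a n = seg m' a' n"
  unfolding seg_def by auto

lemma seg_add: "seg m a (n + k) = seg m a n @ seg m (a + n) k"
  by (induction k) (simp_all add: seg_Suc add.assoc)

lemma set_seg: "set (seg m a n) = (\<lambda>k. m (a + k)) ` {..<n}"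
  unfolding seg_def by auto

lemma seg_upd_outside [simp]: "x < a \<or> a + n \<le> x \<Longrightarrow> seg (m(x := v)) a n = seg m a n"
  by (rule seg_cong) auto

definition slice :: "nat \<Rightarrow> nat \<Rightarrow> 'a list \<Rightarrow> 'a list" where
  "slice i j xs = take (j - i) (drop i xs)"

lemma slice_empty [simp]: "j \<le> i \<Longrightarrow> slice i j xs = []"
  unfolding slice_def by simp

lemma slice_Cons: "i < j \<Longrightarrow> j \<le> length xs \<Longrightarrow> slice i j xs = xs ! i # slice (Suc i) j xs"
  unfolding slice_def by (metis Cons_nth_drop_Suc Suc_diff_Suc less_le_trans take_Suc_Cons)

fun mrg :: "('a \<Rightarrow> real) \<Rightarrow> 'a list \<Rightarrow> 'a list \<Rightarrow> 'a list" where
  "mrg key [] ys = ys"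
| "mrg key (x # xs) [] = x # xs"
| "mrg key (x # xs) (y # ys) = (if key y < key x then y # mrg key (x # xs) ys else x # mrg key xs (y # ys))"

lemma mset_mrg: "mset (mrg key xs ys) = mset xs + mset ys"
  by (induction key xs ys rule: mrg.induct) auto

lemma length_mrg [simp]: "length (mrg key xs ys) = length xs + length ys"
  by (induction key xs ys rule: mrg.induct) auto

lemma set_mrg: "set (mrg key xs ys) = set xs \<union> set ys"
  by (induction key xs ys rule: mrg.induct) auto

lemma mrg_Nil2 [simp]: "mrg key xs [] = xs"
  by (cases xs) auto

lemma sorted_mrg: "sorted (map key xs) \<Longrightarrow> sorted (map key ys) \<Longrightarrow> sorted (map key (mrg key xs ys))"
  by (induction key xs ys rule: mrg.induct) (auto simp: set_mrg intro: order_trans less_imp_le)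

text \<open>The list function computed by one pass: neighboring runs of width \<open>w\<close> are
  merged in pairs. The guard \<open>w = 0\<close> makes the recursion terminate.\<close>

function passf :: "('a \<Rightarrow> real) \<Rightarrow> nat \<Rightarrow> 'a list \<Rightarrow> 'a list" where
  "passf key w xs = (if w = 0 \<or> xs = [] then xs
     else mrg key (take w xs) (take w (drop w xs)) @ passf key w (drop (2 * w) xs))"
  by pat_completeness auto
termination by (relation "Wellfounded.measure (\<lambda>(_, _, xs). length xs)") auto

declare passf.simps [simp del]

text \<open>The invariant between passes: every block of width \<open>w\<close> is sorted. It holds
  trivially for width 1 and is sortedness once \<open>w\<close> reaches the length.\<close>

function bsorted :: "('a \<Rightarrow> real) \<Rightarrow> nat \<Rightarrow> 'a list \<Rightarrow> bool" where
  "bsorted key w xs = (if w = 0 \<or> xs = [] then True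
     else sorted (map key (take w xs)) \<and> bsorted key w (drop w xs))"
  by pat_completeness auto
termination by (relation "Wellfounded.measure (\<lambda>(_, _, xs). length xs)") auto

declare bsorted.simps [simp del]

lemma passf_Nil [simp]: "passf key w [] = []"
  by (simp add: passf.simps)

lemma mset_passf: "mset (passf key w xs) = mset xs"
proof (induction key w xs rule: passf.induct)
  case (1 key w xs)
  show ?case
  proof (cases "w = 0 \<or> xs = []")
    case True then show ?thesis by (simp add: passf.simps)
  next
    case False
    have "xs = take w xs @ take w (drop w xs) @ drop (2 * w) xs"
      by (metis append_take_drop_id drop_drop mult_2)
    then have "mset xs = mset (take w xs) + (mset (take w (drop w xs)) + mset (drop (2 * w) xs))"
      by (metis mset_append)
    then show ?thesis using False 1 by (subst passf.simps) (simp add: mset_mrg add.assoc)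
  qed
qed

lemma length_passf [simp]: "length (passf key w xs) = length xs"
  using mset_passf[of key w xs] mset_eq_length by blast

lemma bsorted_passf: "bsorted key w xs \<Longrightarrow> bsorted key (2 * w) (passf key w xs)"
proof (induction key w xs rule: passf.induct)
  case (1 key w xs)
  show ?case
  proof (cases "w = 0 \<or> xs = []")
    case True then show ?thesis by (auto simp: bsorted.simps[of _ "2 * w"] bsorted.simps[of _ 0] passf.simps)
  next
    case False
    let ?m = "mrg key (take w xs) (take w (drop w xs))" let ?r = "passf key w (drop (2 * w) xs)"
    have s1: "sorted (map key (take w xs))" "bsorted key w (drop w xs)"
      using 1(2) False by (subst (asm) bsorted.simps; simp)+
    have s2: "sorted (map key (take w (drop w xs)))" "bsorted key w (drop (2 * w) xs)"
    proof -
      show "sorted (map key (take w (drop w xs)))"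
        using s1(2) False by (cases "drop w xs = []") (auto simp: bsorted.simps[of key w "drop w xs"])
      show "bsorted key w (drop (2 * w) xs)"
      proof (cases "drop w xs = []")
        case True then show ?thesis by (simp add: bsorted.simps)
      next
        case nn: False
        have "bsorted key w (drop w (drop w xs))" using s1(2) False nn by (subst (asm) bsorted.simps) simp
        then show ?thesis by (simp add: mult_2)
      qed
    qed
    have sm: "sorted (map key ?m)" using sorted_mrg s1(1) s2(1) by blast
    have br: "bsorted key (2 * w) ?r" using 1(1) False s2(2) by blast
    have td: "take (2 * w) (?m @ ?r) = ?m \<and> drop (2 * w) (?m @ ?r) = ?r"
    proof (cases "2 * w \<le> length xs")
      case True
      then have "length ?m = 2 * w" by simp
      then show ?thesis by simp
    next
      case nf: False
      then have "?r = []" "length ?m \<le> 2 * w" by simp_all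
      then show ?thesis by simp
    qed
    have "passf key w xs = ?m @ ?r" using False by (subst passf.simps) simp
    then have "take (2 * w) (passf key w xs) = ?m" "drop (2 * w) (passf key w xs) = ?r" using td by simp_all
    then show ?thesis using sm br by (subst bsorted.simps) (simp del: length_mrg)
  qed
qed

lemma bsorted_1: "bsorted key 1 xs"
proof (induction xs)
  case (Cons x xs) then show ?case by (subst bsorted.simps) simp
qed (simp add: bsorted.simps)

lemma bsorted_ge: "bsorted key w xs \<Longrightarrow> length xs \<le> w \<Longrightarrow> sorted (map key xs)"
  by (subst (asm) bsorted.simps) (auto split: if_splits)

section \<open>Merge sort as a program\<close>

abbreviation "wadd \<equiv> WB WAdd"
abbreviation "wsub \<equiv> WB WSub"
abbreviation "wmul \<equiv> WB WMul"

text \<open>Register 2 holds the number \<open>N\<close> of points; the real memory holds the sort key of point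
  \<open>p\<close> at address \<open>2 * N + p\<close>.\<close>

definition key_at :: "wexp \<Rightarrow> rexp" where
  "key_at a = RM (wadd (wadd (WR 2) (WR 2)) (WM a))"

text \<open>With truncated subtraction \<open>a - (a - b)\<close> is the minimum of \<open>a\<close>
  and \<open>b\<close>.\<close>

definition wmin :: "wexp \<Rightarrow> wexp \<Rightarrow> wexp" where
  "wmin a b = wsub a (wsub a b)"

lemma wv_wmin [simp]: "wv (wmin a b) s = min (wv a s) (wv b s)"
  unfolding wmin_def by auto

definition pass_take :: "nat \<Rightarrow> nat \<Rightarrow> nat \<Rightarrow> com" where
  "pass_take sr dr i = StoreW (wadd (WR dr) (WR 14)) (WM (wadd (WR sr) (WR i))) ;;
     SetW i (wadd (WR i) (WC 1)) ;; SetW 14 (wadd (WR 14) (WC 1))"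

definition pass_block :: com where
  "pass_block = Cond (WL (WR 14) (WR 18)) (SetW 14 (WR 14))
     (SetW 15 (WR 18) ;; SetW 16 (wmin (wadd (WR 18) (WR 13)) (WR 11)) ;; SetW 17 (WR 16) ;;
      SetW 18 (wmin (wadd (WR 16) (WR 13)) (WR 11)))"

definition pass_choose :: "nat \<Rightarrow> nat \<Rightarrow> com" where
  "pass_choose sr dr = Cond (WL (WR 15) (WR 16))
     (Cond (WL (WR 17) (WR 18))
        (Cond (RL (key_at (wadd (WR sr) (WR 17))) (key_at (wadd (WR sr) (WR 15))))
           (pass_take sr dr 17) (pass_take sr dr 15))
        (pass_take sr dr 15))
     (pass_take sr dr 17)"

text \<open>One pass of bottom-up merge sort from the array at register \<open>sr\<close> to the one at \<open>dr\<close>: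
  14 is the output position, 15--16 and 17--18 delimit the rests of the two runs being merged.\<close>

definition pass :: "nat \<Rightarrow> nat \<Rightarrow> com" where
  "pass sr dr = (SetW 14 (WC 0) ;; SetW 15 (WC 0) ;; SetW 16 (WC 0) ;; SetW 17 (WC 0) ;; SetW 18 (WC 0)) ;;
     While (WL (WR 14) (WR 11)) (pass_block ;; pass_choose sr dr)"

definition pass_cost :: "nat \<Rightarrow> nat \<Rightarrow> real" where
  "pass_cost sr dr = real (clen (pass sr dr)) + bcost (WL (WR 14) (WR 11))"

lemma pass_runs:
  fixes key :: "nat \<Rightarrow> real"
  assumes regs: "sr \<notin> {13, 14, 15, 16, 17, 18}" "dr \<notin> {13, 14, 15, 16, 17, 18}" "sr < 50" "dr < 50"
    and n: "rw s 11 = n" "rw s 13 = w" "1 \<le> w" "rw s 2 = N"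
    and src: "seg (mw s) (rw s sr) n = xs" and key: "\<And>p. key p = mx s (2 * N + p)"
    and disj: "rw s sr + n \<le> rw s dr \<or> rw s dr + n \<le> rw s sr"
    and bound: "rw s sr + n \<le> M" "rw s dr + n \<le> M" "n + w + 1 \<le> M" "2 * N \<le> M" "\<And>p. p \<in> set xs \<Longrightarrow> 2 * N + p \<le> M"
    and t: "(real n + 1) * pass_cost sr dr \<le> t"
  shows "runs M (pass sr dr) s t (\<lambda>s'. seg (mw s') (rw s dr) n = passf key w xs \<and>
     (\<forall>a. a < rw s dr \<or> rw s dr + n \<le> a \<longrightarrow> mw s' a = mw s a) \<and> mx s' = mx s \<and> rx s' = rx s \<and>
     (\<forall>i. i \<notin> {14, 15, 16, 17, 18} \<longrightarrow> rw s' i = rw s i))"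
proof -
  \<comment> \<open>The words written so far, the merge of the two unread rests and the pass over
    the untouched remainder always concatenate to the final result. The equation between registers
    14 to 17 says that the output position counts the words consumed.\<close>
  define J where "J u \<longleftrightarrow> (\<forall>a. a < rw s dr \<or> rw s dr + n \<le> a \<longrightarrow> mw u a = mw s a) \<and> mx u = mx s \<and> rx u = rx s \<and>
     (\<forall>i. i \<notin> {14, 15, 16, 17, 18} \<longrightarrow> rw u i = rw s i) \<and>
     rw u 15 \<le> rw u 16 \<and> rw u 16 \<le> rw u 17 \<and> rw u 17 \<le> rw u 18 \<and> rw u 18 \<le> n \<and>
     rw u 14 + rw u 16 = rw u 15 + rw u 17 \<and>
     seg (mw u) (rw s dr) (rw u 14) @ mrg key (slice (rw u 15) (rw u 16) xs) (slice (rw u 17) (rw u 18) xs)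
       @ passf key w (drop (rw u 18) xs) = passf key w xs" for u :: mst
  have lxs: "length xs = n" using src by auto
  have nthx: "mw s (rw s sr + k) = xs ! k" if "k < n" for k using src that by auto
  let ?K = "real (clen (pass_block ;; pass_choose sr dr))"
  have block: "wp M pass_block u (\<lambda>v. J v \<and> rw v 14 = rw u 14 \<and> rw v 14 < rw v 18)"
    if J: "J u" and lt: "rw u 14 < n" for u
  proof (cases "rw u 14 < rw u 18")
    case True
    then show ?thesis using J unfolding pass_block_def by simp
  next
    case False
    have g: "rw u 11 = n" "rw u 13 = w" using J n unfolding J_def by auto
    have e: "rw u 18 = rw u 14" "rw u 15 = rw u 16" "rw u 17 = rw u 18" using J False unfolding J_def by auto
    let ?e = "rw u 14"
    have eq: "seg (mw u) (rw s dr) ?e @ passf key w (drop ?e xs) = passf key w xs"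
      using J unfolding J_def e by simp
    have sl: "slice ?e (min (?e + w) n) xs = take w (drop ?e xs)"
      unfolding slice_def using lxs by (simp add: min_def)
    have sl2: "slice (min (?e + w) n) (min (min (?e + w) n + w) n) xs = take w (drop w (drop ?e xs))"
      unfolding slice_def using lxs by (cases "?e + w \<le> n") (auto simp: min_def add.commute)
    have dr2: "drop (min (min (?e + w) n + w) n) xs = drop (2 * w) (drop ?e xs)"
    proof -
      have d: "drop (2 * w) (drop ?e xs) = drop (?e + w + w) xs"
        unfolding drop_drop by (rule arg_cong[where f = "\<lambda>k. drop k xs"]) simp
      show ?thesis unfolding d using lxs by (auto simp: min_def)
    qed
    have "drop ?e xs \<noteq> []" using lt lxs by simp
    then have "passf key w (drop ?e xs) = mrg key (slice ?e (min (?e + w) n) xs)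
      (slice (min (?e + w) n) (min (min (?e + w) n + w) n) xs) @ passf key w (drop (min (min (?e + w) n + w) n) xs)"
      unfolding sl sl2 dr2 using n(3) by (subst passf.simps) simp
    then have "seg (mw u) (rw s dr) ?e @ mrg key (slice ?e (min (?e + w) n) xs)
      (slice (min (?e + w) n) (min (min (?e + w) n + w) n) xs) @ passf key w (drop (min (min (?e + w) n + w) n) xs)
      = passf key w xs" using eq by simp
    note eq2 = this
    let ?m = "min (?e + w) n" let ?f = "min (?m + w) n"
    let ?v = "u\<lparr>rw := (rw u)(15 := ?e, 16 := ?m, 17 := ?m, 18 := ?f)\<rparr>"
    have "J ?v" unfolding J_def
    proof (intro conjI)
      show "\<forall>a. a < rw s dr \<or> rw s dr + n \<le> a \<longrightarrow> mw ?v a = mw s a" using J unfolding J_def by auto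
      show "mx ?v = mx s" "rx ?v = rx s" using J unfolding J_def by auto
      show "\<forall>k. k \<notin> {14, 15, 16, 17, 18} \<longrightarrow> rw ?v k = rw s k" using J unfolding J_def by auto
      show "rw ?v 15 \<le> rw ?v 16" "rw ?v 16 \<le> rw ?v 17" "rw ?v 17 \<le> rw ?v 18" "rw ?v 18 \<le> n"
        "rw ?v 14 + rw ?v 16 = rw ?v 15 + rw ?v 17" using lt by auto
      show "seg (mw ?v) (rw s dr) (rw ?v 14) @ mrg key (slice (rw ?v 15) (rw ?v 16) xs) (slice (rw ?v 17) (rw ?v 18) xs)
       @ passf key w (drop (rw ?v 18) xs) = passf key w xs" using eq2(1) by simp
    qed
    moreover have "?e < ?f" using lt n(3) by auto
    moreover have "rw u 18 + w \<le> M" "?m + w \<le> M" using bound(3) lt e by auto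
    moreover have "a - (a - b) = min a b" for a b :: nat by auto
    ultimately show ?thesis using False g e unfolding pass_block_def wmin_def by simp
  qed
  have takei: "wp M (pass_take sr dr i) u (\<lambda>v. J v \<and> rw v 14 = Suc (rw u 14))"
    if J: "J u" and i: "i = 15 \<or> i = 17" and lt: "rw u 14 < rw u 18" "rw u i < rw u (Suc i)"
      and m: "mrg key (slice (rw u 15) (rw u 16) xs) (slice (rw u 17) (rw u 18) xs) =
        xs ! rw u i # mrg key (slice (if i = 15 then Suc (rw u 15) else rw u 15) (rw u 16) xs)
          (slice (if i = 17 then Suc (rw u 17) else rw u 17) (rw u 18) xs)" for u i
  proof -
    have r: "rw u sr = rw s sr" "rw u dr = rw s dr" using J regs unfolding J_def by auto
    have in_n: "rw u i < n" "rw u 14 < n" using J lt i unfolding J_def by auto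
    have "mw u (rw s sr + rw u i) = mw s (rw s sr + rw u i)" using J disj in_n unfolding J_def by auto
    then have val: "mw u (rw s sr + rw u i) = xs ! rw u i" using nthx in_n by simp
    have "seg (mw u) (rw s dr) (rw u 14) @ (xs ! rw u i # mrg key (slice (if i = 15 then Suc (rw u 15) else rw u 15) (rw u 16) xs)
          (slice (if i = 17 then Suc (rw u 17) else rw u 17) (rw u 18) xs)) @ passf key w (drop (rw u 18) xs) = passf key w xs"
      using J unfolding m[symmetric] J_def by blast
    moreover have "seg ((mw u)(rw s dr + rw u 14 := xs ! rw u i)) (rw s dr) (Suc (rw u 14)) = seg (mw u) (rw s dr) (rw u 14) @ [xs ! rw u i]"
      by (simp add: seg_Suc)
    ultimately have eq: "seg ((mw u)(rw s dr + rw u 14 := xs ! rw u i)) (rw s dr) (Suc (rw u 14)) @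
        mrg key (slice (if i = 15 then Suc (rw u 15) else rw u 15) (rw u 16) xs)
          (slice (if i = 17 then Suc (rw u 17) else rw u 17) (rw u 18) xs) @ passf key w (drop (rw u 18) xs) = passf key w xs"
      by simp
    let ?v = "u\<lparr>mw := (mw u)(rw s dr + rw u 14 := xs ! rw u i), rw := (rw u)(i := Suc (rw u i), 14 := Suc (rw u 14))\<rparr>"
    have o: "rw u 15 \<le> rw u 16" "rw u 16 \<le> rw u 17" "rw u 17 \<le> rw u 18" "rw u 18 \<le> n"
      "rw u 14 + rw u 16 = rw u 15 + rw u 17" using J unfolding J_def by auto
    have "J ?v" unfolding J_def
    proof (intro conjI)
      show "\<forall>a. a < rw s dr \<or> rw s dr + n \<le> a \<longrightarrow> mw ?v a = mw s a" using J in_n unfolding J_def by auto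
      show "mx ?v = mx s" "rx ?v = rx s" using J unfolding J_def by auto
      show "\<forall>k. k \<notin> {14, 15, 16, 17, 18} \<longrightarrow> rw ?v k = rw s k" using J i unfolding J_def by auto
      show "rw ?v 15 \<le> rw ?v 16" "rw ?v 16 \<le> rw ?v 17" "rw ?v 17 \<le> rw ?v 18" "rw ?v 18 \<le> n"
        "rw ?v 14 + rw ?v 16 = rw ?v 15 + rw ?v 17" using i o lt by auto
      show "seg (mw ?v) (rw s dr) (rw ?v 14) @ mrg key (slice (rw ?v 15) (rw ?v 16) xs) (slice (rw ?v 17) (rw ?v 18) xs)
       @ passf key w (drop (rw ?v 18) xs) = passf key w xs" using eq i by (elim disjE) simp_all
    qed
    moreover have "i \<noteq> sr" "i \<noteq> dr" "i \<noteq> 14" "i < 50" "sr \<noteq> 14" "dr \<noteq> 14" using i regs by auto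
    moreover have "rw s dr + rw u 14 \<le> M" "rw s sr + rw u i \<le> M" "Suc (rw u i) \<le> M" "Suc (rw u 14) \<le> M" "1 \<le> M"
      using bound in_n n(3) by linarith+
    ultimately show ?thesis using r val regs(3,4) unfolding pass_take_def by simp
  qed
  have choose: "wp M (pass_choose sr dr) u (\<lambda>v. J v \<and> rw v 14 = Suc (rw u 14))"
    if J: "J u" and lt: "rw u 14 < rw u 18" for u
  proof -
    have r: "rw u sr = rw s sr" "rw u 2 = N" using J regs n unfolding J_def by auto
    have o: "rw u 15 \<le> rw u 16" "rw u 16 \<le> rw u 17" "rw u 17 \<le> rw u 18" "rw u 18 \<le> n"
      "rw u 14 + rw u 16 = rw u 15 + rw u 17" using J unfolding J_def by auto
    have mem: "mw u (rw s sr + k) = xs ! k" if "k < n" for k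
      using J disj that nthx[OF that] unfolding J_def by auto
    have kv: "2 * N + xs ! k \<le> M" if "k < n" for k using bound(5) that lxs by (metis nth_mem)
    have kx: "mx u = mx s" using J unfolding J_def by blast
    show ?thesis
    proof (cases "rw u 15 < rw u 16")
      case i: True
      then have si: "slice (rw u 15) (rw u 16) xs = xs ! rw u 15 # slice (Suc (rw u 15)) (rw u 16) xs"
        using slice_Cons lxs o by (metis le_trans)
      show ?thesis
      proof (cases "rw u 17 < rw u 18")
        case j: True
        then have sj: "slice (rw u 17) (rw u 18) xs = xs ! rw u 17 # slice (Suc (rw u 17)) (rw u 18) xs"
          using slice_Cons lxs o by metis
        have ij: "rw u 15 < n" "rw u 17 < n" using i j o by linarith+
        have kk: "mx u (2 * N + mw u (rw u sr + rw u 17)) = key (xs ! rw u 17)"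
           "mx u (2 * N + mw u (rw u sr + rw u 15)) = key (xs ! rw u 15)"
          using mem ij r kx key by simp_all
        have okk: "rw u sr + rw u 17 \<le> M" "rw u sr + rw u 15 \<le> M" "N + N \<le> M"
          "N + N + mw u (rw u sr + rw u 17) \<le> M" "N + N + mw u (rw u sr + rw u 15) \<le> M"
          using r bound ij mem kv[OF ij(1)] kv[OF ij(2)] by (simp_all add: mult_2)
        have a1: "wp M (pass_take sr dr 17) u (\<lambda>v. J v \<and> rw v 14 = Suc (rw u 14))" if "key (xs ! rw u 17) < key (xs ! rw u 15)"
          by (rule takei) (use J lt j si sj that in auto)
        have a2: "wp M (pass_take sr dr 15) u (\<lambda>v. J v \<and> rw v 14 = Suc (rw u 14))" if "\<not> key (xs ! rw u 17) < key (xs ! rw u 15)"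
          by (rule takei) (use J lt i si sj that in auto)
        show ?thesis unfolding pass_choose_def key_at_def using i j a1 a2 kk okk r regs by (simp add: mult_2)
      next
        case j: False
        have "wp M (pass_take sr dr 15) u (\<lambda>v. J v \<and> rw v 14 = Suc (rw u 14))"
          by (rule takei) (use J lt i j si in auto)
        then show ?thesis unfolding pass_choose_def using i j by simp
      qed
    next
      case i: False
      then have j: "rw u 17 < rw u 18" using o lt by linarith
      then have sj: "slice (rw u 17) (rw u 18) xs = xs ! rw u 17 # slice (Suc (rw u 17)) (rw u 18) xs"
        using slice_Cons lxs o by metis
      have "wp M (pass_take sr dr 17) u (\<lambda>v. J v \<and> rw v 14 = Suc (rw u 14))"
        by (rule takei) (use J lt i j sj in auto)
      then show ?thesis unfolding pass_choose_def using i by simp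
    qed
  qed
  have body: "runs M (pass_block ;; pass_choose sr dr) u ?K (\<lambda>v. J v \<and> rw v 14 = Suc k)"
    if "J u" "rw u 14 = k" "k < n" for u k
  proof (rule runs_wp)
    have "wp M pass_block u (\<lambda>v. wp M (pass_choose sr dr) v (\<lambda>v. J v \<and> rw v 14 = Suc k))"
    proof (rule wp_mono[OF block])
      show "wp M (pass_choose sr dr) v (\<lambda>v. J v \<and> rw v 14 = Suc k)"
        if "J v \<and> rw v 14 = rw u 14 \<and> rw v 14 < rw v 18" for v
        using choose[of v] that \<open>rw u 14 = k\<close> by simp
    qed (use that in auto)
    then show "wp M (pass_block ;; pass_choose sr dr) u (\<lambda>v. J v \<and> rw v 14 = Suc k)" by simp
  qed simp
  define L where "L = While (WL (WR 14) (WR 11)) (pass_block ;; pass_choose sr dr)"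
  have loop: "runs M L u (real n * (?K + bcost (WL (WR 14) (WR 11))) + bcost (WL (WR 14) (WR 11))) (\<lambda>v. J v \<and> rw v 14 = n)"
    if "J u" "rw u 14 = 0" for u unfolding L_def
    by (rule runs_for[where I = "\<lambda>k v. J v" and a = 0 and n = n and K = "?K"])
      (use that body n in \<open>auto simp: J_def\<close>)
  have "runs M (pass sr dr) s t (\<lambda>v. J v \<and> rw v 14 = n)"
  proof -
    let ?i = "SetW 14 (WC 0) ;; SetW 15 (WC 0) ;; SetW 16 (WC 0) ;; SetW 17 (WC 0) ;; SetW 18 (WC 0)"
    have c: "real (clen ?i) + real (clen L) = real (clen (pass sr dr))" unfolding pass_def L_def by simp
    have "?K \<le> real (clen L)" unfolding L_def by simp
    then have "real n * (?K + bcost (WL (WR 14) (WR 11))) \<le> real n * pass_cost sr dr"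
      unfolding pass_cost_def using c by (intro mult_left_mono) auto
    moreover have "real (clen ?i) + bcost (WL (WR 14) (WR 11)) \<le> pass_cost sr dr" unfolding pass_cost_def using c by simp
    ultimately have tt: "real (clen ?i) + (real n * (?K + bcost (WL (WR 14) (WR 11))) + bcost (WL (WR 14) (WR 11))) \<le> t"
      using t by (simp add: algebra_simps)
    have J0: "J (s\<lparr>rw := (rw s)(14 := 0, 15 := 0, 16 := 0, 17 := 0, 18 := 0)\<rparr>)" unfolding J_def by simp
    show ?thesis unfolding pass_def L_def[symmetric]
      by (rule runs_Seq_wp[OF _ tt]) (use J0 loop in \<open>simp add: loop\<close>)
  qed
  then show ?thesis
  proof (rule runs_conseq)
    fix v assume v: "J v \<and> rw v 14 = n"
    then have e: "rw v 18 = n" "rw v 15 = rw v 16" "rw v 17 = n" "rw v 14 = n" unfolding J_def by auto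
    have "seg (mw v) (rw s dr) (rw v 14) @ mrg key (slice (rw v 15) (rw v 16) xs) (slice (rw v 17) (rw v 18) xs)
       @ passf key w (drop (rw v 18) xs) = passf key w xs" using v unfolding J_def by blast
    then have "seg (mw v) (rw s dr) n = passf key w xs" using lxs by (simp add: e)
    then show "seg (mw v) (rw s dr) n = passf key w xs \<and>
     (\<forall>a. a < rw s dr \<or> rw s dr + n \<le> a \<longrightarrow> mw v a = mw s a) \<and> mx v = mx s \<and> rx v = rx s \<and>
     (\<forall>i. i \<notin> {14, 15, 16, 17, 18} \<longrightarrow> rw v i = rw s i)" using v unfolding J_def by blast
  qed simp
qed

text \<open>Two passes per round bring the data back to the array at register 10 and quadruple the
  width of the runs. This is why lengths are compared with powers of four.\<close>

definition msort :: com where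
  "msort = SetW 13 (WC 1) ;; While (WL (WR 13) (WR 11))
     (pass 10 12 ;; SetW 13 (wadd (WR 13) (WR 13)) ;; pass 12 10 ;; SetW 13 (wadd (WR 13) (WR 13)))"

definition msort_cost :: real where
  "msort_cost = pass_cost 10 12 + pass_cost 12 10 + real (clen msort) + bcost (WL (WR 13) (WR 11))"

lemma pass_cost_ge: "0 \<le> pass_cost sr dr"
  unfolding pass_cost_def bcost_def by simp

lemma msort_cost_ge: "0 \<le> msort_cost"
  unfolding msort_cost_def using pass_cost_ge[of 10 12] pass_cost_ge[of 12 10] bcost_ge[of "WL (WR 13) (WR 11)"] by simp

lemma msort_runs:
  fixes key :: "nat \<Rightarrow> real"
  assumes n: "rw s 10 = a" "rw s 11 = n" "rw s 12 = c" "rw s 2 = N" "n \<le> 4 ^ L"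
    and src: "seg (mw s) a n = xs" and key: "\<And>p. key p = mx s (2 * N + p)"
    and disj: "a + n \<le> c"
    and bound: "c + n \<le> M" "4 * n + 1 \<le> M" "2 * N \<le> M" "\<And>p. p \<in> set xs \<Longrightarrow> 2 * N + p \<le> M"
    and t: "(real n + 1) * (real L + 1) * msort_cost \<le> t"
  shows "runs M msort s t (\<lambda>s'. sorted (map key (seg (mw s') a n)) \<and> mset (seg (mw s') a n) = mset xs \<and>
     (\<forall>i. (i < a \<or> a + n \<le> i) \<and> (i < c \<or> c + n \<le> i) \<longrightarrow> mw s' i = mw s i) \<and> mx s' = mx s \<and> rx s' = rx s \<and>
     (\<forall>i. i \<notin> {13, 14, 15, 16, 17, 18} \<longrightarrow> rw s' i = rw s i))"
proof -
  let ?b = "WL (WR 13) (WR 11)"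
  let ?c = "pass 10 12 ;; SetW 13 (wadd (WR 13) (WR 13)) ;; pass 12 10 ;; SetW 13 (wadd (WR 13) (WR 13))"
  let ?d = "SetW 13 (wadd (WR 13) (WR 13))"
  define F where "F u \<longleftrightarrow> (\<forall>i. (i < a \<or> a + n \<le> i) \<and> (i < c \<or> c + n \<le> i) \<longrightarrow> mw u i = mw s i) \<and> mx u = mx s \<and> rx u = rx s \<and>
     (\<forall>i. i \<notin> {13, 14, 15, 16, 17, 18} \<longrightarrow> rw u i = rw s i)" for u :: mst
  define I where "I k u \<longleftrightarrow> F u \<and> rw u 13 = 4 ^ k \<and> mset (seg (mw u) a n) = mset xs \<and> bsorted key (4 ^ k) (seg (mw u) a n)" for k u
  define T where "T = (real n + 1) * pass_cost 10 12 + (real n + 1) * pass_cost 12 10 + 2 * real (clen ?d)"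
  have T0: "0 \<le> T" unfolding T_def using pass_cost_ge by simp
  have body: "runs M ?c u T (I (Suc k))" if I: "I k u" and lt: "bv ?b u" for k u
  proof -
    have r: "rw u 10 = a" "rw u 11 = n" "rw u 12 = c" "rw u 2 = N" "mx u = mx s" using I n unfolding I_def F_def by auto
    have w: "rw u 13 = 4 ^ k" "4 ^ k < n" using I lt r unfolding I_def by auto
    have st: "set (seg (mw u) a n) = set xs" using I unfolding I_def by (metis mset_eq_setD)
    let ?ys = "passf key (4 ^ k) (seg (mw u) a n)"
    have sy: "set ?ys = set xs" using mset_passf[of key "4 ^ k"] st by (metis mset_eq_setD)
    have p1: "runs M (pass 10 12) u ((real n + 1) * pass_cost 10 12) (\<lambda>s'. seg (mw s') c n = ?ys \<and>
       (\<forall>i. i < c \<or> c + n \<le> i \<longrightarrow> mw s' i = mw u i) \<and> mx s' = mx u \<and> rx s' = rx u \<and>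
       (\<forall>i. i \<notin> {14, 15, 16, 17, 18} \<longrightarrow> rw s' i = rw u i))"
      using pass_runs[of 10 12 u n "4 ^ k" N "seg (mw u) a n" key M] r w st bound disj key by simp
    have p2: "runs M (?d ;; pass 12 10 ;; ?d) v (2 * real (clen ?d) + (real n + 1) * pass_cost 12 10) (I (Suc k))"
      if v: "seg (mw v) c n = ?ys" "\<forall>i. i < c \<or> c + n \<le> i \<longrightarrow> mw v i = mw u i" "mx v = mx u" "rx v = rx u"
        "\<forall>i. i \<notin> {14, 15, 16, 17, 18} \<longrightarrow> rw v i = rw u i" for v
    proof -
      have r2: "rw v 10 = a" "rw v 11 = n" "rw v 12 = c" "rw v 2 = N" "rw v 13 = 4 ^ k" using r w v by auto
      let ?v = "v\<lparr>rw := (rw v)(13 := rw v 13 + rw v 13)\<rparr>"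
      have p3: "runs M (pass 12 10) ?v ((real n + 1) * pass_cost 12 10) (\<lambda>s'. seg (mw s') a n = passf key (2 * 4 ^ k) ?ys \<and>
       (\<forall>i. i < a \<or> a + n \<le> i \<longrightarrow> mw s' i = mw v i) \<and> mx s' = mx v \<and> rx s' = rx v \<and>
       (\<forall>i. i \<notin> {14, 15, 16, 17, 18} \<longrightarrow> rw s' i = rw ?v i))"
        using pass_runs[of 12 10 ?v n "2 * 4 ^ k" N ?ys key M] r2 w v sy bound disj key r by simp
      have p4: "runs M ?d x (real (clen ?d)) (I (Suc k))"
        if x: "seg (mw x) a n = passf key (2 * 4 ^ k) ?ys \<and>
       (\<forall>i. i < a \<or> a + n \<le> i \<longrightarrow> mw x i = mw v i) \<and> mx x = mx v \<and> rx x = rx v \<and>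
       (\<forall>i. i \<notin> {14, 15, 16, 17, 18} \<longrightarrow> rw x i = rw ?v i)" for x
      proof (rule runs_wp)
        have "rw x 13 = 2 * 4 ^ k" using x r2 by (simp add: mult_2)
        moreover have "mset (seg (mw x) a n) = mset xs" using x mset_passf I unfolding I_def by metis
        moreover have "bsorted key (2 * (2 * 4 ^ k)) (seg (mw x) a n)"
          using x I bsorted_passf unfolding I_def by metis
        moreover have "F x" unfolding F_def
        proof (intro conjI allI impI)
          fix i assume "(i < a \<or> a + n \<le> i) \<and> (i < c \<or> c + n \<le> i)"
          then show "mw x i = mw s i" using x v(2) I unfolding I_def F_def by metis
        next
          show "mx x = mx s" "rx x = rx s" using x v I unfolding I_def F_def by metis+
        next
          fix i :: nat assume i: "i \<notin> {13, 14, 15, 16, 17, 18}"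
          then have "rw x i = rw v i" using x by auto
          also have "\<dots> = rw u i" using i v(5) by auto
          also have "\<dots> = rw s i" using i I unfolding I_def F_def by blast
          finally show "rw x i = rw s i" .
        qed
        ultimately show "wp M ?d x (I (Suc k))" using w bound unfolding I_def F_def by simp
      qed simp
      show ?thesis
      proof (rule runs_Seq_wp)
        have "runs M (pass 12 10 ;; ?d) ?v ((real n + 1) * pass_cost 12 10 + real (clen ?d)) (I (Suc k))"
          by (rule runs_Seq[OF runs_conseq[OF p3 order_refl p4]]) auto
        then show "wp M ?d v (\<lambda>s'. runs M (pass 12 10 ;; ?d) s' ((real n + 1) * pass_cost 12 10 + real (clen ?d)) (I (Suc k)))"
          using r2 w bound by simp
      qed simp
    qed
    show ?thesis
      by (rule runs_Seq[OF runs_conseq[OF p1 order_refl p2]]) (auto simp: T_def)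
  qed
  have loop: "runs M (While ?b ?c) u (real L * (T + bcost ?b) + bcost ?b) (\<lambda>s'. (\<exists>k. 0 \<le> k \<and> k \<le> L \<and> I k s') \<and> \<not> bv ?b s')"
    if "I 0 u" for u
  proof (rule runs_iter[where K = T])
    fix k v assume Iv: "I k v" and k: "k \<le> L"
    have "rw v 11 = n" "rw v 13 = 4 ^ k" using Iv n unfolding I_def F_def by auto
    then show "okb M ?b v \<and> (bv ?b v \<longrightarrow> k < L)" using n(5) k by (cases "k = L") auto
  qed (use that T0 body in auto)
  have "runs M msort s t (\<lambda>s'. (\<exists>k. 0 \<le> k \<and> k \<le> L \<and> I k s') \<and> \<not> bv ?b s')"
    unfolding msort_def
  proof (rule runs_Seq_wp)
    have "I 0 (s\<lparr>rw := (rw s)(13 := 1)\<rparr>)" unfolding I_def F_def using src bsorted_1 by simp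
    then show "wp M (SetW 13 (WC 1)) s (\<lambda>u. runs M (While ?b ?c) u (real L * (T + bcost ?b) + bcost ?b) (\<lambda>s'. (\<exists>k. 0 \<le> k \<and> k \<le> L \<and> I k s') \<and> \<not> bv ?b s'))"
      using loop bound by simp
    let ?P = "pass_cost 10 12 + pass_cost 12 10"
    have "T + bcost ?b \<le> (real n + 1) * msort_cost"
    proof -
      have "2 * real (clen ?d) + bcost ?b \<le> real (clen msort) + bcost ?b" unfolding msort_def by simp
      also have "\<dots> \<le> (real n + 1) * (real (clen msort) + bcost ?b)"
        using bcost_ge[of ?b] by (simp add: algebra_simps)
      finally have "2 * real (clen ?d) + bcost ?b \<le> (real n + 1) * (real (clen msort) + bcost ?b)" .
      then show ?thesis unfolding T_def msort_cost_def by (simp add: algebra_simps)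
    qed
    then have "real L * (T + bcost ?b) \<le> real L * ((real n + 1) * msort_cost)" by (rule mult_left_mono) simp
    moreover have "real (clen (SetW 13 (WC 1))) + bcost ?b \<le> (real n + 1) * msort_cost"
    proof -
      have "real (clen (SetW 13 (WC 1))) + bcost ?b \<le> msort_cost"
        unfolding msort_cost_def msort_def using pass_cost_ge[of 10 12] pass_cost_ge[of 12 10] by simp
      also have "\<dots> \<le> (real n + 1) * msort_cost" using msort_cost_ge by (simp add: algebra_simps)
      finally show ?thesis .
    qed
    ultimately show "real (clen (SetW 13 (WC 1))) + (real L * (T + bcost ?b) + bcost ?b) \<le> t"
      using t by (simp add: algebra_simps)
  qed
  then show ?thesis
  proof (rule runs_conseq)
    fix v assume v: "(\<exists>k. 0 \<le> k \<and> k \<le> L \<and> I k v) \<and> \<not> bv ?b v"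
    then obtain k where k: "I k v" by blast
    have "n \<le> 4 ^ k" using v k n unfolding I_def F_def by auto
    then have "sorted (map key (seg (mw v) a n))" using k bsorted_ge[of key "4 ^ k"] unfolding I_def by simp
    then show "sorted (map key (seg (mw v) a n)) \<and> mset (seg (mw v) a n) = mset xs \<and>
     (\<forall>i. (i < a \<or> a + n \<le> i) \<and> (i < c \<or> c + n \<le> i) \<longrightarrow> mw v i = mw s i) \<and> mx v = mx s \<and> rx v = rx s \<and>
     (\<forall>i. i \<notin> {13, 14, 15, 16, 17, 18} \<longrightarrow> rw v i = rw s i)" using k unfolding I_def F_def by blast
  qed simp
qed

section \<open>Cutting a cell\<close>

lemma sorted_counts:
  fixes k :: "'a \<Rightarrow> real"
  assumes "distinct xs" "sorted (map k xs)" "i < length xs"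
  shows "Suc i \<le> card {p \<in> set xs. k p \<le> k (xs ! i)}" "length xs - i \<le> card {p \<in> set xs. k (xs ! i) \<le> k p}"
    "card {p \<in> set xs. k p < k (xs ! i)} \<le> i"
proof -
  have mono: "k (xs ! a) \<le> k (xs ! b)" if "a \<le> b" "b < length xs" for a b
    using assms(2) that by (simp add: sorted_iff_nth_mono)
  have "k p \<le> k (xs ! i)" if "p \<in> set (take (Suc i) xs)" for p
    using that mono assms(3) by (auto simp: in_set_conv_nth)
  then have "set (take (Suc i) xs) \<subseteq> {p \<in> set xs. k p \<le> k (xs ! i)}" by (auto dest: in_set_takeD)
  then have "card (set (take (Suc i) xs)) \<le> card {p \<in> set xs. k p \<le> k (xs ! i)}" by (intro card_mono) auto
  then show "Suc i \<le> card {p \<in> set xs. k p \<le> k (xs ! i)}"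
    using distinct_card[OF distinct_take[OF assms(1), of "Suc i"]] assms(3) by simp
  have "k (xs ! i) \<le> k p" if "p \<in> set (drop i xs)" for p
    using that mono assms(3) by (auto simp: in_set_conv_nth)
  then have "set (drop i xs) \<subseteq> {p \<in> set xs. k (xs ! i) \<le> k p}" by (auto dest: in_set_dropD)
  then have "card (set (drop i xs)) \<le> card {p \<in> set xs. k (xs ! i) \<le> k p}" by (intro card_mono) auto
  then show "length xs - i \<le> card {p \<in> set xs. k (xs ! i) \<le> k p}"
    using distinct_card[OF distinct_drop[OF assms(1), of i]] by simp
  have "{p \<in> set xs. k p < k (xs ! i)} \<subseteq> set (take i xs)"
  proof
    fix p assume p: "p \<in> {p \<in> set xs. k p < k (xs ! i)}"
    then obtain j where j: "j < length xs" "xs ! j = p" by (auto simp: in_set_conv_nth)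
    then have "j < i" using p mono[of i j] by (cases "j < i") auto
    then show "p \<in> set (take i xs)" using j assms(3) by (auto simp: in_set_conv_nth intro!: exI[of _ j])
  qed
  then have "card {p \<in> set xs. k p < k (xs ! i)} \<le> card (set (take i xs))" by (intro card_mono) auto
  also have "\<dots> \<le> i" using card_length[of "take i xs"] by simp
  finally show "card {p \<in> set xs. k p < k (xs ! i)} \<le> i" .
qed

lemma card_split: "finite A \<Longrightarrow> card {p \<in> A. P p} + card {p \<in> A. \<not> P p} = card A"
  by (subst card_Un_disjoint[symmetric]) (auto intro!: arg_cong[where f = card])

text \<open>Half of the slopes of the pairs \<open>(p, \<pi> p)\<close> are at least \<open>\<mu>\<close> and half are at most \<open>\<mu>\<close>.
  In the sheared coordinate \<open>\<eta>\<close> a pair of the first kind is increasing and one of the second kind is decreasing,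
  which carries points above \<open>y0\<close> from one side of the vertical line at \<open>x0\<close> to the other.\<close>

lemma quadrants:
  fixes x y :: "nat \<Rightarrow> real" and \<pi> :: "nat \<Rightarrow> nat"
  defines "\<sigma> \<equiv> \<lambda>p. (y (\<pi> p) - y p) / (x (\<pi> p) - x p)"
  assumes fin: "finite L" "finite R" and cL: "card L = h" and cR: "h \<le> card R"
    and pi: "inj_on \<pi> L" "\<pi> ` L \<subseteq> R" and xL: "\<And>p. p \<in> L \<Longrightarrow> x p \<le> x0" and xR: "\<And>p. p \<in> R \<Longrightarrow> x0 \<le> x p"
    and vert: "card {p \<in> L. x p = x0} \<le> 2"
    and slopes: "h \<le> 2 * card {p \<in> L. \<sigma> p \<le> \<mu>}" "h \<le> 2 * card {p \<in> L. \<mu> \<le> \<sigma> p}"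
    and eta: "\<And>p. \<eta> p = y p - \<mu> * x p"
    and qL: "h \<le> 4 * card {p \<in> L. \<eta> p \<le> qL}" "4 * card {p \<in> L. \<eta> p < qL} \<le> h"
    and qR: "h \<le> 4 * card {p \<in> R. \<eta> p \<le> qR}" "4 * card {p \<in> R. \<eta> p < qR} \<le> h"
    and y0: "y0 = max qL qR"
  shows "h \<le> 4 * card {p \<in> L. \<eta> p \<le> y0} + 8" "h \<le> 4 * card {p \<in> R. \<eta> p \<le> y0} + 8"
    "h \<le> 4 * card {p \<in> L. y0 \<le> \<eta> p} + 8" "h \<le> 4 * card {p \<in> R. y0 \<le> \<eta> p} + 8"
proof -
  have "card {p \<in> L. \<eta> p \<le> qL} \<le> card {p \<in> L. \<eta> p \<le> y0}" using fin y0 by (intro card_mono) auto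
  then show "h \<le> 4 * card {p \<in> L. \<eta> p \<le> y0} + 8" using qL by linarith
  have "card {p \<in> R. \<eta> p \<le> qR} \<le> card {p \<in> R. \<eta> p \<le> y0}" using fin y0 by (intro card_mono) auto
  then show "h \<le> 4 * card {p \<in> R. \<eta> p \<le> y0} + 8" using qR by linarith
  have line: "\<eta> (\<pi> p) - \<eta> p = (\<sigma> p - \<mu>) * (x (\<pi> p) - x p)" if "x p < x (\<pi> p)" for p
    using that unfolding eta \<sigma>_def by (simp add: field_simps)
  have lt: "x p < x (\<pi> p)" if "p \<in> L" "x p \<noteq> x0" for p
    using xL[OF that(1)] xR[of "\<pi> p"] that pi by force
  let ?Z = "{p \<in> L. x p = x0}"
  \<comment> \<open>A pair can be vertical only if its left point has abscissa \<open>x0\<close>.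
    There are at most two such points; they cause the summand 2 here and, multiplied by four, the 8
    in the conclusions.\<close>
  have inter: "card L \<le> card (A \<inter> C - ?Z) + card (L - A) + card (L - C) + 2" if "A \<subseteq> L" "C \<subseteq> L" for A C
  proof -
    have "L \<subseteq> (A \<inter> C - ?Z) \<union> (L - A) \<union> (L - C) \<union> ?Z" by blast
    then have "card L \<le> card ((A \<inter> C - ?Z) \<union> (L - A) \<union> (L - C) \<union> ?Z)"
      using fin that by (intro card_mono) (auto intro: finite_subset)
    also have "\<dots> \<le> card (A \<inter> C - ?Z) + card (L - A) + card (L - C) + card ?Z"
      by (meson add_le_mono card_Un_le order_refl order_trans)
    finally show ?thesis using vert by linarith
  qed
  have diff: "card (L - {p \<in> L. P p}) = card L - card {p \<in> L. P p}" for P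
    using fin by (intro card_Diff_subset) auto
  have le_L: "card {p \<in> L. P p} \<le> card L" for P using fin by (intro card_mono) auto
  consider "y0 = qL" | "y0 = qR" using y0 by linarith
  then show "h \<le> 4 * card {p \<in> L. y0 \<le> \<eta> p} + 8"
  proof cases
    case 1
    have "card {p \<in> L. \<eta> p < qL} + card {p \<in> L. \<not> \<eta> p < qL} = h" using card_split[OF fin(1), of "\<lambda>p. \<eta> p < qL"] cL by simp
    then show ?thesis using qL(2) 1 by (simp add: not_less)
  next
    case 2
    \<comment> \<open>The quartile of the right half is the higher one. At most a quarter of the
      mates lie below it, and at least half of the pairs descend towards their mate. So for about a
      quarter of \<open>L\<close> the mate, and with it the point itself, lies above
      \<open>y0\<close>.\<close>
    let ?A = "{p \<in> L. \<sigma> p \<le> \<mu>}" and ?C = "{p \<in> L. y0 \<le> \<eta> (\<pi> p)}"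
    have "?A \<inter> ?C - ?Z \<subseteq> {p \<in> L. y0 \<le> \<eta> p}"
    proof
      fix p assume p: "p \<in> ?A \<inter> ?C - ?Z"
      have "\<eta> (\<pi> p) - \<eta> p \<le> 0" using p line[of p] lt[of p] by (auto simp: mult_le_0_iff)
      then show "p \<in> {p \<in> L. y0 \<le> \<eta> p}" using p by auto
    qed
    then have c1: "card (?A \<inter> ?C - ?Z) \<le> card {p \<in> L. y0 \<le> \<eta> p}" using fin by (intro card_mono) auto
    have "\<pi> ` (L - ?C) \<subseteq> {p \<in> R. \<eta> p < qR}" using pi(2) 2 by auto
    then have "card (\<pi> ` (L - ?C)) \<le> card {p \<in> R. \<eta> p < qR}" using fin by (intro card_mono) auto
    moreover have "card (\<pi> ` (L - ?C)) = card (L - ?C)" using pi(1) by (intro card_image) (auto simp: inj_on_def)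
    ultimately have "4 * card (L - ?C) \<le> h" using qR(2) by linarith
    then show ?thesis using inter[of ?A ?C] c1 diff[of "\<lambda>p. \<sigma> p \<le> \<mu>"] le_L[of "\<lambda>p. \<sigma> p \<le> \<mu>"] slopes(1) cL by auto
  qed
  consider "y0 = qL" | "y0 = qR" using y0 by linarith
  then show "h \<le> 4 * card {p \<in> R. y0 \<le> \<eta> p} + 8"
  proof cases
    case 2
    have "card {p \<in> R. \<eta> p < qR} + card {p \<in> R. \<not> \<eta> p < qR} = card R" using card_split[OF fin(2), of "\<lambda>p. \<eta> p < qR"] .
    then show ?thesis using qR(2) 2 cR by (simp add: not_less)
  next
    case 1
    \<comment> \<open>The mirror image: at most a quarter of \<open>L\<close> lies below
      \<open>y0\<close>, and at least half of the pairs ascend and so carry height over to their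
      mates.\<close>
    let ?A = "{p \<in> L. \<mu> \<le> \<sigma> p}" and ?C = "{p \<in> L. y0 \<le> \<eta> p}"
    have "\<pi> ` (?A \<inter> ?C - ?Z) \<subseteq> {p \<in> R. y0 \<le> \<eta> p}"
    proof
      fix r assume "r \<in> \<pi> ` (?A \<inter> ?C - ?Z)"
      then obtain p where p: "p \<in> ?A \<inter> ?C - ?Z" "r = \<pi> p" by blast
      have "0 \<le> \<eta> (\<pi> p) - \<eta> p" using p line[of p] lt[of p] by auto
      then show "r \<in> {p \<in> R. y0 \<le> \<eta> p}" using p pi(2) by auto
    qed
    then have "card (\<pi> ` (?A \<inter> ?C - ?Z)) \<le> card {p \<in> R. y0 \<le> \<eta> p}" using fin by (intro card_mono) auto
    moreover have "card (\<pi> ` (?A \<inter> ?C - ?Z)) = card (?A \<inter> ?C - ?Z)" using pi(1) by (intro card_image) (auto simp: inj_on_def)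
    ultimately have c1: "card (?A \<inter> ?C - ?Z) \<le> card {p \<in> R. y0 \<le> \<eta> p}" by simp
    have "L - ?C = {p \<in> L. \<eta> p < qL}" using 1 by auto
    then have "4 * card (L - ?C) \<le> h" using qL(2) by simp
    then show ?thesis using inter[of ?A ?C] c1 diff[of "\<lambda>p. \<mu> \<le> \<sigma> p"] le_L[of "\<lambda>p. \<mu> \<le> \<sigma> p"] slopes(2) cL by auto
  qed
qed

text \<open>The vertical line and the line of slope \<open>\<mu>\<close> through the center form
  four sectors, each with about a quarter of \<open>h\<close> points. A line that is steeper than
  \<open>\<mu>\<close> has the lower right sector below it and the upper left one above it; a
  flatter line has the lower left and the upper right sector.\<close>

lemma halfplane_depth:
  fixes x y :: "nat \<Rightarrow> real"
  assumes fin: "finite L" "finite R" and eta: "\<And>p. \<eta> p = y p - \<mu> * x p"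
    and xL: "\<And>p. p \<in> L \<Longrightarrow> x p \<le> x0" and xR: "\<And>p. p \<in> R \<Longrightarrow> x0 \<le> x p"
    and q: "h \<le> 4 * card {p \<in> L. \<eta> p \<le> y0} + 8" "h \<le> 4 * card {p \<in> R. \<eta> p \<le> y0} + 8"
    "h \<le> 4 * card {p \<in> L. y0 \<le> \<eta> p} + 8" "h \<le> 4 * card {p \<in> R. y0 \<le> \<eta> p} + 8"
  shows "h \<le> 4 * card {p \<in> L \<union> R. y p - s * x p \<le> y0 + \<mu> * x0 - s * x0} + 8"
    "h \<le> 4 * card {p \<in> L \<union> R. y0 + \<mu> * x0 - s * x0 \<le> y p - s * x p} + 8"
proof -
  have g: "y p - s * x p - (y0 + \<mu> * x0 - s * x0) = (\<eta> p - y0) - (s - \<mu>) * (x p - x0)" for p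
    unfolding eta by (simp add: algebra_simps)
  let ?D = "{p \<in> L \<union> R. y p - s * x p \<le> y0 + \<mu> * x0 - s * x0}"
  let ?U = "{p \<in> L \<union> R. y0 + \<mu> * x0 - s * x0 \<le> y p - s * x p}"
  have fDU: "finite ?D" "finite ?U" using fin by auto
  have *: "h \<le> 4 * card ?D + 8 \<and> h \<le> 4 * card ?U + 8"
  proof (cases "\<mu> \<le> s")
    case True
    have "{p \<in> R. \<eta> p \<le> y0} \<subseteq> ?D"
    proof
      fix p assume p: "p \<in> {p \<in> R. \<eta> p \<le> y0}"
      have "0 \<le> (s - \<mu>) * (x p - x0)" using True xR p by auto
      then show "p \<in> ?D" using p g[of p] by auto
    qed
    moreover have "{p \<in> L. y0 \<le> \<eta> p} \<subseteq> ?U"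
    proof
      fix p assume p: "p \<in> {p \<in> L. y0 \<le> \<eta> p}"
      have "(s - \<mu>) * (x p - x0) \<le> 0" using True xL p by (auto simp: mult_le_0_iff)
      then show "p \<in> ?U" using p g[of p] by auto
    qed
    ultimately have "card {p \<in> R. \<eta> p \<le> y0} \<le> card ?D" "card {p \<in> L. y0 \<le> \<eta> p} \<le> card ?U"
      using card_mono[OF fDU(1)] card_mono[OF fDU(2)] by blast+
    then show ?thesis using q by linarith
  next
    case False
    have "{p \<in> L. \<eta> p \<le> y0} \<subseteq> ?D"
    proof
      fix p assume p: "p \<in> {p \<in> L. \<eta> p \<le> y0}"
      have "0 \<le> (s - \<mu>) * (x p - x0)" using False xL p by (auto simp: zero_le_mult_iff)
      then show "p \<in> ?D" using p g[of p] by auto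
    qed
    moreover have "{p \<in> R. y0 \<le> \<eta> p} \<subseteq> ?U"
    proof
      fix p assume p: "p \<in> {p \<in> R. y0 \<le> \<eta> p}"
      have "(s - \<mu>) * (x p - x0) \<le> 0" using False xR p by (auto simp: mult_le_0_iff)
      then show "p \<in> ?U" using p g[of p] by auto
    qed
    ultimately have "card {p \<in> L. \<eta> p \<le> y0} \<le> card ?D" "card {p \<in> R. y0 \<le> \<eta> p} \<le> card ?U"
      using card_mono[OF fDU(1)] card_mono[OF fDU(2)] by blast+
    then show ?thesis using q by linarith
  qed
  then show "h \<le> 4 * card ?D + 8" "h \<le> 4 * card ?U + 8" by blast+
qed

text \<open>The points below the line through \<open>(x0, y0)\<close> after it has rotated counterclockwise from the
  downward vertical past the first \<open>t\<close> points of \<open>xs\<close>, which is sorted by slope about \<open>(x0, y0)\<close>.\<close>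

definition swept :: "(nat \<Rightarrow> real) \<Rightarrow> real \<Rightarrow> nat list \<Rightarrow> nat \<Rightarrow> nat set" where
  "swept x x0 xs t = {p \<in> set (drop t xs). x p < x0} \<union> {p \<in> set (take t xs). \<not> x p < x0}"

lemma swept_subset: "swept x x0 xs t \<subseteq> set xs"
  unfolding swept_def by (auto dest: in_set_dropD in_set_takeD)

text \<open>The height of \<open>p\<close> over the line of slope \<open>s\<close> through the
  center is the product of its slope difference and \<open>x p - x0\<close>. To the left of
  \<open>x0\<close> a later place in the slope order therefore means below, to the right an earlier
  one, which is how \<open>swept\<close> is defined.\<close>

lemma swept_side:
  assumes "distinct xs" "sorted (map (\<lambda>p. (y p - y0) / (x p - x0)) xs)" "t < length xs" "p \<in> set xs" "x p \<noteq> x0"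
    and s: "s = (y (xs ! t) - y0) / (x (xs ! t) - x0)"
  shows "p \<in> swept x x0 xs t \<Longrightarrow> y p - s * x p \<le> y0 - s * x0"
    "p \<notin> swept x x0 xs t \<Longrightarrow> y0 - s * x0 \<le> y p - s * x p"
proof -
  let ?k = "\<lambda>p. (y p - y0) / (x p - x0)"
  have mono: "?k (xs ! a) \<le> ?k (xs ! b)" if "a \<le> b" "b < length xs" for a b
    using assms(2) that by (simp add: sorted_iff_nth_mono)
  have g: "y p - s * x p - (y0 - s * x0) = (?k p - s) * (x p - x0)" using assms(5) by (simp add: field_simps)
  have ge: "s \<le> ?k p" if "p \<in> set (drop t xs)"
    using that mono unfolding s by (auto simp: in_set_conv_nth)
  have le: "?k p \<le> s" if "p \<in> set (take t xs)"
    using that mono assms(3) unfolding s by (auto simp: in_set_conv_nth)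
  have cases: "p \<in> set (take t xs) \<or> p \<in> set (drop t xs)" using assms(4) by (metis Un_iff append_take_drop_id set_append)
  show "y p - s * x p \<le> y0 - s * x0" if p: "p \<in> swept x x0 xs t"
  proof -
    have "(?k p - s) * (x p - x0) \<le> 0"
      using p ge le unfolding swept_def by (auto simp: mult_le_0_iff)
    then show ?thesis using g by linarith
  qed
  show "y0 - s * x0 \<le> y p - s * x p" if p: "p \<notin> swept x x0 xs t"
  proof -
    have "0 \<le> (?k p - s) * (x p - x0)"
      using p ge le cases unfolding swept_def by (auto simp: zero_le_mult_iff)
    then show ?thesis using g by linarith
  qed
qed

text \<open>\<open>H\<close> and the closed half-plane can differ only in points with abscissa
  \<open>x0\<close> and in points on the line, two of each kind at most.\<close>

lemma swept_size:
  fixes g :: "nat \<Rightarrow> real"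
  assumes fin: "finite A" and H: "H \<subseteq> A" and Z: "card {p \<in> A. x p = x0} \<le> 2" and line: "card {p \<in> A. g p = v} \<le> 2"
    and inH: "\<And>p. p \<in> H \<Longrightarrow> x p \<noteq> x0 \<Longrightarrow> g p \<le> v" and outH: "\<And>p. p \<in> A - H \<Longrightarrow> x p \<noteq> x0 \<Longrightarrow> v \<le> g p"
  shows "card {p \<in> A. g p \<le> v} \<le> card H + 4" "card {p \<in> A. v \<le> g p} \<le> card (A - H) + 4"
proof -
  let ?Z = "{p \<in> A. x p = x0}" and ?V = "{p \<in> A. g p = v}"
  have fH: "finite H" using H fin finite_subset by blast
  have "{p \<in> A. g p \<le> v} \<subseteq> H \<union> ?Z \<union> ?V"
  proof
    fix p assume "p \<in> {p \<in> A. g p \<le> v}"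
    then show "p \<in> H \<union> ?Z \<union> ?V" using outH[of p] by force
  qed
  then have "card {p \<in> A. g p \<le> v} \<le> card (H \<union> ?Z \<union> ?V)" using fin fH by (intro card_mono) auto
  also have "\<dots> \<le> card H + card ?Z + card ?V" by (meson add_le_mono card_Un_le order_refl order_trans)
  finally show "card {p \<in> A. g p \<le> v} \<le> card H + 4" using Z line by linarith
  have "{p \<in> A. v \<le> g p} \<subseteq> (A - H) \<union> ?Z \<union> ?V"
  proof
    fix p assume "p \<in> {p \<in> A. v \<le> g p}"
    then show "p \<in> (A - H) \<union> ?Z \<union> ?V" using inH[of p] by force
  qed
  then have "card {p \<in> A. v \<le> g p} \<le> card ((A - H) \<union> ?Z \<union> ?V)" using fin fH by (intro card_mono) auto
  also have "\<dots> \<le> card (A - H) + card ?Z + card ?V" by (meson add_le_mono card_Un_le order_refl order_trans)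
  finally show "card {p \<in> A. v \<le> g p} \<le> card (A - H) + 4" using Z line by linarith
qed

text \<open>A swept set need not be cut off by a line exactly, so a prefix in the order
  perpendicular to the line takes its place. Here 6 is four prefix points not strictly below the
  line plus two with abscissa \<open>x0\<close>. The 23 is this 6 plus 17, the loss from rounding
  the size down to a multiple of 18.\<close>

lemma prefix_near_swept:
  fixes g :: "nat \<Rightarrow> real"
  assumes ys: "distinct ys" "sorted (map g ys)" "set ys = A"
    and H: "H \<subseteq> A" and Z: "card {p \<in> A. x p = x0} \<le> 2" and line: "card {p \<in> A. g p = v} \<le> 2"
    and inH: "\<And>p. p \<in> H \<Longrightarrow> x p \<noteq> x0 \<Longrightarrow> g p \<le> v" and outH: "\<And>p. p \<in> A - H \<Longrightarrow> x p \<noteq> x0 \<Longrightarrow> v \<le> g p"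
    and m: "m \<le> card H" "card H \<le> m + 17"
  shows "card (set (take m ys) - H) \<le> 6" "card (H - set (take m ys)) \<le> 23"
proof -
  let ?P = "set (take m ys)" and ?Z = "{p \<in> A. x p = x0}" and ?V = "{p \<in> A. g p = v}" and ?N = "{p \<in> A. g p < v}"
  have fin: "finite A" using ys(3) by auto
  have fH: "finite H" using H fin finite_subset by blast
  have "H \<subseteq> ?N \<union> ?Z \<union> ?V"
  proof
    fix p assume "p \<in> H" then show "p \<in> ?N \<union> ?Z \<union> ?V" using inH[of p] H by force
  qed
  then have "card H \<le> card (?N \<union> ?Z \<union> ?V)" using fin by (intro card_mono) auto
  also have "\<dots> \<le> card ?N + card ?Z + card ?V" by (meson add_le_mono card_Un_le order_refl order_trans)
  finally have cN: "card H \<le> card ?N + 4" using Z line by linarith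
  have mlen: "m \<le> length ys" using m(1) card_mono[OF fin H] distinct_card[OF ys(1)] ys(3) by simp
  have cP: "card ?P = m" using distinct_card[OF distinct_take[OF ys(1)]] mlen by simp
  have PA: "?P \<subseteq> A" using ys(3) by (metis set_take_subset)
  have split: "card (?P \<inter> ?N) + card (?P - ?N) = m" using cP card_Int_Diff[of ?P ?N] by simp
  \<comment> \<open>A prefix that contains a point not strictly below the line contains all points
    strictly below it, and these are at least \<open>card H - 4\<close>.\<close>
  have PN: "card (?P - ?N) \<le> 4"
  proof (cases "?P \<subseteq> ?N")
    case True then show ?thesis by (metis Diff_eq_empty_iff card.empty zero_le)
  next
    case False
    then obtain q where q: "q \<in> ?P" "\<not> g q < v" using PA by blast
    have "?N \<subseteq> ?P"
    proof
      fix p assume p: "p \<in> ?N"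
      show "p \<in> ?P"
      proof (rule ccontr)
        assume "p \<notin> ?P"
        then have "p \<in> set (drop m ys)" using p ys(3) by (metis (no_types, lifting) Un_iff append_take_drop_id mem_Collect_eq set_append)
        moreover have "sorted (map g (take m ys) @ map g (drop m ys))" using ys(2) by (metis append_take_drop_id map_append)
        ultimately have "g q \<le> g p" using q(1) by (auto simp: sorted_append)
        then show False using p q by auto
      qed
    qed
    then have "card ?N \<le> card (?P \<inter> ?N)" by (intro card_mono) auto
    then show ?thesis using split cN m(1) by linarith
  qed
  have "?P - H \<subseteq> (?P - ?N) \<union> ?Z"
  proof
    fix p assume p: "p \<in> ?P - H"
    then have "p \<in> A - H" using PA by blast
    then show "p \<in> (?P - ?N) \<union> ?Z" using outH[of p] p by force
  qed
  then have "card (?P - H) \<le> card ((?P - ?N) \<union> ?Z)" using fin by (intro card_mono) auto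
  also have "\<dots> \<le> card (?P - ?N) + card ?Z" by (rule card_Un_le)
  finally show PH: "card (?P - H) \<le> 6" using PN Z by linarith
  have "card (?P \<inter> H) + card (?P - H) = m" using cP card_Int_Diff[of ?P H] by simp
  moreover have "card (H \<inter> ?P) + card (H - ?P) = card H" using card_Int_Diff[OF fH, of ?P] by simp
  ultimately show "card (H - ?P) \<le> 23" using PH m(2) by (simp add: Int_commute)
qed

text \<open>Values outside the band from \<open>-n\<close> to \<open>n\<close> keep their sign,
  because a step of size at most \<open>n\<close> cannot cross the band. The witness is strictly
  less than \<open>n\<close>: if \<open>f n\<close> lies in the band, so does \<open>f 0\<close>.
  The program needs this, since position \<open>t\<close> must name a point of the list.\<close>

lemma discrete_ivt:
  fixes f :: "nat \<Rightarrow> int"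
  assumes "f n = - f 0" "\<And>t. t < n \<Longrightarrow> \<bar>f (Suc t) - f t\<bar> \<le> int n" "0 < n"
  shows "\<exists>t<n. \<bar>f t\<bar> \<le> int n"
proof (rule ccontr)
  assume "\<not> ?thesis"
  then have out: "int n < \<bar>f t\<bar>" if "t < n" for t using that by force
  have out': "int n < \<bar>f t\<bar>" if "t \<le> n" for t
    using out[of t] out[of 0] assms(1,3) that by (cases "t = n") auto
  have "(0 < f t) = (0 < f 0)" if "t \<le> n" for t using that
  proof (induction t)
    case (Suc t)
    then show ?case using assms(2)[of t] out'[of t] out'[of "Suc t"] by (auto simp: abs_if split: if_splits)
  qed simp
  from this[of n] show False using assms(1) out'[of 0] by (auto simp: abs_if split: if_splits)
qed

section \<open>Loops for computing keys, sorting by a key and counting\<close>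

abbreviation "incr i \<equiv> SetW i (wadd (WR i) (WC 1))"

text \<open>In the bodies of the next two loops, register 20 is the address of the current point and
  register 22 is the point; \<open>px\<close> and \<open>py\<close> are its coordinates.\<close>

definition px :: rexp where "px = RM (wadd (WR 22) (WR 22))"
definition py :: rexp where "py = RM (wadd (wadd (WR 22) (WR 22)) (WC 1))"

abbreviation "in_range \<equiv> WL (WR 20) (WR 21)"

definition setkeys_body :: "rexp \<Rightarrow> com" where
  "setkeys_body e = SetW 22 (WM (WR 20)) ;; StoreR (wadd (wadd (WR 2) (WR 2)) (WR 22)) e ;; incr 20"

definition setkeys :: "rexp \<Rightarrow> com" where
  "setkeys e = While in_range (setkeys_body e)"

definition setkeys_cost :: "rexp \<Rightarrow> real" where
  "setkeys_cost e = real (clen (setkeys_body e)) + bcost in_range"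

lemma setkeys_runs:
  assumes r: "rw s 20 = a" "rw s 21 = a + m" "rw s 2 = N"
    and val: "\<And>u i. i < m \<Longrightarrow> rw u 20 = a + i \<Longrightarrow> rw u 22 = mw s (a + i) \<Longrightarrow>
      (\<And>j. j \<noteq> 20 \<Longrightarrow> j \<noteq> 22 \<Longrightarrow> rw u j = rw s j) \<Longrightarrow> mw u = mw s \<Longrightarrow> rx u = rx s \<Longrightarrow>
      (\<And>j. j < 2 * N \<Longrightarrow> mx u j = mx s j) \<Longrightarrow> okr M e u \<and> rv e u = kf (mw s (a + i))"
    and bound: "a + m + 1 \<le> M" "2 * N \<le> M" "\<And>i. i < m \<Longrightarrow> 2 * N + mw s (a + i) \<le> M"
    and t: "(real m + 1) * setkeys_cost e \<le> t"
  shows "runs M (setkeys e) s t (\<lambda>u. (\<forall>p\<in>set (seg (mw s) a m). mx u (2 * N + p) = kf p) \<and>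
     (\<forall>j<2 * N. mx u j = mx s j) \<and> mw u = mw s \<and> rx u = rx s \<and> (\<forall>j. j \<noteq> 20 \<and> j \<noteq> 22 \<longrightarrow> rw u j = rw s j))"
proof -
  define I where "I k u \<longleftrightarrow> (\<forall>i. a + i < k \<longrightarrow> mx u (2 * N + mw s (a + i)) = kf (mw s (a + i))) \<and>
     (\<forall>j<2 * N. mx u j = mx s j) \<and> mw u = mw s \<and> rx u = rx s \<and> (\<forall>j. j \<noteq> 20 \<and> j \<noteq> 22 \<longrightarrow> rw u j = rw s j)" for k and u :: mst
  let ?K = "real (clen (setkeys_body e))"
  have body: "runs M (setkeys_body e) u ?K (\<lambda>v. I (Suc k) v \<and> rw v 20 = Suc k)"
    if I: "I k u" and k: "rw u 20 = k" "a \<le> k" "k < a + m" for k u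
  proof (rule runs_wp)
    obtain i where i: "k = a + i" "i < m" using k by (metis le_add_diff_inverse nat_add_left_cancel_less)
    let ?p = "mw s (a + i)"
    let ?u = "u\<lparr>rw := (rw u)(22 := ?p)\<rparr>"
    have v: "okr M e ?u \<and> rv e ?u = kf ?p"
      by (rule val) (use I i k in \<open>auto simp: I_def\<close>)
    have g: "mw u = mw s" "rw u 2 = N" "rw u 20 = a + i" using I r i k unfolding I_def by auto
    have "N + N + ?p \<le> M" "N + N \<le> M" "Suc (a + i) \<le> M" "1 \<le> M" using bound i bound(3)[OF i(2)] by linarith+
    moreover have "I (Suc k) (u\<lparr>mx := (mx u)(N + N + ?p := kf ?p), rw := (rw u)(22 := ?p, 20 := Suc (a + i))\<rparr>)"
    proof -
      have "mx u (2 * N + mw s (a + j)) = kf (mw s (a + j))" if "j < i" for j using I i that unfolding I_def by auto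
      then have "((mx u)(N + N + ?p := kf ?p)) (2 * N + mw s (a + j)) = kf (mw s (a + j))" if "j \<le> i" for j
        using that by (cases "j = i") (auto simp: mult_2)
      then show ?thesis using I unfolding I_def i(1) by (auto simp: mult_2)
    qed
    ultimately show "wp M (setkeys_body e) u (\<lambda>v. I (Suc k) v \<and> rw v 20 = Suc k)"
      using v g i(1) unfolding setkeys_body_def by simp
  qed simp
  have "runs M (setkeys e) s t (\<lambda>u. I (a + m) u \<and> rw u 20 = a + m)" unfolding setkeys_def
  proof (rule runs_for[where K = "?K" and a = a])
    have "bcost in_range \<le> setkeys_cost e" "?K + bcost in_range = setkeys_cost e" unfolding setkeys_cost_def by simp_all
    then show "real (a + m - a) * (?K + bcost in_range) + bcost in_range \<le> t"
      using t by (simp add: algebra_simps)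
  qed (use r body in \<open>auto simp: I_def\<close>)
  then show ?thesis
    by (rule runs_conseq) (auto simp: I_def set_seg)
qed

text \<open>All keys are stored before any point moves, so a key may depend on the address of the
  point as well as on the point; \<open>slope_to_mate\<close> makes use of this.\<close>

definition sortby :: "wexp \<Rightarrow> wexp \<Rightarrow> rexp \<Rightarrow> com" where
  "sortby A m e = (SetW 10 A ;; SetW 11 m ;; SetW 20 (WR 10) ;; SetW 21 (wadd (WR 10) (WR 11))) ;; setkeys e ;; msort"

definition sortby_cost :: "wexp \<Rightarrow> wexp \<Rightarrow> rexp \<Rightarrow> real" where
  "sortby_cost A m e = real (clen (sortby A m e)) + setkeys_cost e + msort_cost"

lemma sortby_runs:
  assumes r: "rw s 2 = N" "rw s 12 = 2 * N"
    and A: "okw M A s" "wv A s = a" "okw M m (s\<lparr>rw := (rw s)(10 := a)\<rparr>)" "wv m (s\<lparr>rw := (rw s)(10 := a)\<rparr>) = n"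
    and range: "N \<le> a" "a + n \<le> 2 * N" "n \<le> 4 ^ L" "\<And>p. p \<in> set (seg (mw s) a n) \<Longrightarrow> p < N"
    and val: "\<And>u i. i < n \<Longrightarrow> rw u 20 = a + i \<Longrightarrow> rw u 22 = mw s (a + i) \<Longrightarrow>
      (\<And>j. j \<notin> {10, 11, 20, 21, 22} \<Longrightarrow> rw u j = rw s j) \<Longrightarrow> mw u = mw s \<Longrightarrow> rx u = rx s \<Longrightarrow>
      (\<And>j. j < 2 * N \<Longrightarrow> mx u j = mx s j) \<Longrightarrow> okr M e u \<and> rv e u = kf (mw s (a + i))"
    and bound: "4 * N + 1 \<le> M"
    and t: "(real n + 1) * (real L + 1) * sortby_cost A m e \<le> t"
  shows "runs M (sortby A m e) s t (\<lambda>u. sorted (map kf (seg (mw u) a n)) \<and> mset (seg (mw u) a n) = mset (seg (mw s) a n) \<and>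
     (\<forall>p\<in>set (seg (mw u) a n). mx u (2 * N + p) = kf p) \<and> (\<forall>j<2 * N. mx u j = mx s j) \<and> rx u = rx s \<and>
     (\<forall>i. (i < a \<or> a + n \<le> i) \<and> (i < 2 * N \<or> 3 * N \<le> i) \<longrightarrow> mw u i = mw s i) \<and>
     (\<forall>i. i \<notin> {10, 11, 13, 14, 15, 16, 17, 18, 20, 21, 22} \<longrightarrow> rw u i = rw s i))" (is "runs M _ s t ?Q")
proof -
  let ?ini = "SetW 10 A ;; SetW 11 m ;; SetW 20 (WR 10) ;; SetW 21 (wadd (WR 10) (WR 11))"
  let ?s1 = "s\<lparr>rw := (rw s)(10 := a, 11 := n, 20 := a, 21 := a + n)\<rparr>"
  define t1 where "t1 = (real n + 1) * setkeys_cost e"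
  define t2 where "t2 = (real n + 1) * (real L + 1) * msort_cost"
  have entry: "mw s (a + i) < N" if "i < n" for i using range(4) that by (auto simp: set_seg)
  have k: "runs M (setkeys e) ?s1 t1 (\<lambda>u. (\<forall>p\<in>set (seg (mw ?s1) a n). mx u (2 * N + p) = kf p) \<and>
     (\<forall>j<2 * N. mx u j = mx ?s1 j) \<and> mw u = mw ?s1 \<and> rx u = rx ?s1 \<and> (\<forall>j. j \<noteq> 20 \<and> j \<noteq> 22 \<longrightarrow> rw u j = rw ?s1 j))"
  proof (rule setkeys_runs[where M = M])
    fix u :: mst and i assume h: "i < n" "rw u 20 = a + i" "rw u 22 = mw ?s1 (a + i)" "\<And>j. j \<noteq> 20 \<Longrightarrow> j \<noteq> 22 \<Longrightarrow> rw u j = rw ?s1 j"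
      "mw u = mw ?s1" "rx u = rx ?s1" "\<And>j. j < 2 * N \<Longrightarrow> mx u j = mx ?s1 j"
    then show "okr M e u \<and> rv e u = kf (mw ?s1 (a + i))" using val[of i u] by simp
  next
    show "2 * N + mw ?s1 (a + i) \<le> M" if "i < n" for i using entry[OF that] bound by simp
  qed (use r range bound in \<open>auto simp: t1_def\<close>)
  have srt: "runs M msort u t2 ?Q"
    if u: "(\<forall>p\<in>set (seg (mw ?s1) a n). mx u (2 * N + p) = kf p) \<and>
     (\<forall>j<2 * N. mx u j = mx ?s1 j) \<and> mw u = mw ?s1 \<and> rx u = rx ?s1 \<and> (\<forall>j. j \<noteq> 20 \<and> j \<noteq> 22 \<longrightarrow> rw u j = rw ?s1 j)" for u
  proof -
    let ?key = "\<lambda>p. mx u (2 * N + p)"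
    have "runs M msort u t2 (\<lambda>s'. sorted (map ?key (seg (mw s') a n)) \<and> mset (seg (mw s') a n) = mset (seg (mw u) a n) \<and>
     (\<forall>i. (i < a \<or> a + n \<le> i) \<and> (i < 2 * N \<or> 2 * N + n \<le> i) \<longrightarrow> mw s' i = mw u i) \<and> mx s' = mx u \<and> rx s' = rx u \<and>
     (\<forall>i. i \<notin> {13, 14, 15, 16, 17, 18} \<longrightarrow> rw s' i = rw u i))"
    proof (rule msort_runs[where M = M and L = L and N = N])
      show "2 * N + p \<le> M" if "p \<in> set (seg (mw u) a n)" for p
      proof -
        have "p < N" using range(4) that u by simp
        then show ?thesis using bound by simp
      qed
    qed (use u r range bound in \<open>auto simp: t2_def\<close>)
    then show ?thesis
    proof (rule runs_conseq)
      fix v :: mst assume v: "sorted (map ?key (seg (mw v) a n)) \<and> mset (seg (mw v) a n) = mset (seg (mw u) a n) \<and>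
     (\<forall>i. (i < a \<or> a + n \<le> i) \<and> (i < 2 * N \<or> 2 * N + n \<le> i) \<longrightarrow> mw v i = mw u i) \<and> mx v = mx u \<and> rx v = rx u \<and>
     (\<forall>i. i \<notin> {13, 14, 15, 16, 17, 18} \<longrightarrow> rw v i = rw u i)"
      have mu: "mw u = mw s" using u by simp
      have st: "set (seg (mw v) a n) = set (seg (mw s) a n)" using v mu by (metis mset_eq_setD)
      have keys: "mx v (2 * N + p) = kf p" if "p \<in> set (seg (mw v) a n)" for p using that st u v by simp
      have "map kf (seg (mw v) a n) = map ?key (seg (mw v) a n)" using keys v by (intro map_cong) auto
      then have "sorted (map kf (seg (mw v) a n))" using v by metis
      moreover have "mw v i = mw s i" if "(i < a \<or> a + n \<le> i) \<and> (i < 2 * N \<or> 3 * N \<le> i)" for i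
        using v that range mu by auto
      moreover have "rw v i = rw s i" if "i \<notin> {10, 11, 13, 14, 15, 16, 17, 18, 20, 21, 22}" for i
        using v that u by auto
      moreover have "mset (seg (mw v) a n) = mset (seg (mw s) a n)" using v mu by simp
      moreover have "\<forall>j<2 * N. mx v j = mx s j" "rx v = rx s" using v u by simp_all
      ultimately show "?Q v" using keys by blast
    qed simp
  qed
  have "runs M (setkeys e ;; msort) ?s1 (t1 + t2) ?Q"
    by (rule runs_Seq[OF runs_conseq[OF k order_refl srt]]) auto
  moreover have "a + n \<le> M" using range bound by linarith
  ultimately have w: "wp M ?ini s (\<lambda>u. runs M (setkeys e ;; msort) u (t1 + t2) ?Q)" using A by simp
  show ?thesis unfolding sortby_def
  proof (rule runs_Seq_wp[OF w])
    let ?c = "real (clen (sortby A m e))"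
    have "real (clen ?ini) \<le> ?c" unfolding sortby_def by simp
    also have "?c * 1 \<le> ?c * ((real n + 1) * (real L + 1))" by (intro mult_left_mono) (auto simp: algebra_simps)
    finally have "real (clen ?ini) \<le> (real n + 1) * (real L + 1) * ?c" by (simp add: mult.commute)
    moreover have "t1 \<le> (real n + 1) * (real L + 1) * setkeys_cost e"
    proof -
      have "0 \<le> (real n + 1) * setkeys_cost e" unfolding setkeys_cost_def using bcost_ge[of in_range] by simp
      then have "(real n + 1) * setkeys_cost e * 1 \<le> (real n + 1) * setkeys_cost e * (real L + 1)" by (intro mult_left_mono) auto
      then show ?thesis unfolding t1_def by (simp add: mult.commute mult.left_commute)
    qed
    ultimately show "real (clen ?ini) + (t1 + t2) \<le> t" using t unfolding t2_def sortby_cost_def by (simp add: algebra_simps)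
  qed
qed

definition count_body :: "bexp \<Rightarrow> bexp \<Rightarrow> com" where
  "count_body b1 b2 = SetW 22 (WM (WR 20)) ;; Cond b1 (Cond b2 (incr 23) (SetW 22 (WR 22))) (SetW 22 (WR 22)) ;; incr 20"

definition count :: "bexp \<Rightarrow> bexp \<Rightarrow> com" where
  "count b1 b2 = SetW 23 (WC 0) ;; While in_range (count_body b1 b2)"

definition count_cost :: "bexp \<Rightarrow> bexp \<Rightarrow> real" where
  "count_cost b1 b2 = real (clen (count b1 b2)) + bcost in_range"

lemma count_runs:
  assumes r: "rw s 20 = a" "rw s 21 = a + m"
    and val: "\<And>u i. i < m \<Longrightarrow> rw u 22 = mw s (a + i) \<Longrightarrow>
      (\<And>j. j \<noteq> 20 \<Longrightarrow> j \<noteq> 22 \<Longrightarrow> j \<noteq> 23 \<Longrightarrow> rw u j = rw s j) \<Longrightarrow> mw u = mw s \<Longrightarrow> rx u = rx s \<Longrightarrow> mx u = mx s \<Longrightarrow>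
      okb M b1 u \<and> okb M b2 u \<and> (bv b1 u \<and> bv b2 u \<longleftrightarrow> P (mw s (a + i)))"
    and bound: "a + m + 1 \<le> M"
    and t: "(real m + 1) * count_cost b1 b2 \<le> t"
  shows "runs M (count b1 b2) s t (\<lambda>u. rw u 23 = length (filter P (seg (mw s) a m)) \<and>
     mx u = mx s \<and> mw u = mw s \<and> rx u = rx s \<and> (\<forall>j. j \<notin> {20, 22, 23} \<longrightarrow> rw u j = rw s j))"
proof -
  define I where "I k u \<longleftrightarrow> rw u 23 = length (filter P (seg (mw s) a (k - a))) \<and>
     mx u = mx s \<and> mw u = mw s \<and> rx u = rx s \<and> (\<forall>j. j \<notin> {20, 22, 23} \<longrightarrow> rw u j = rw s j)" for k and u :: mst
  let ?K = "real (clen (count_body b1 b2))"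
  have body: "runs M (count_body b1 b2) u ?K (\<lambda>v. I (Suc k) v \<and> rw v 20 = Suc k)"
    if I: "I k u" and k: "rw u 20 = k" "a \<le> k" "k < a + m" for k u
  proof (rule runs_wp)
    obtain i where i: "k = a + i" "i < m" using k by (metis le_add_diff_inverse nat_add_left_cancel_less)
    let ?p = "mw s (a + i)"
    let ?u = "u\<lparr>rw := (rw u)(22 := ?p)\<rparr>"
    have v: "okb M b1 ?u \<and> okb M b2 ?u \<and> (bv b1 ?u \<and> bv b2 ?u \<longleftrightarrow> P ?p)"
      by (rule val) (use I i k in \<open>auto simp: I_def\<close>)
    have g: "mw u = mw s" "rw u 20 = a + i" "rw u 23 = length (filter P (seg (mw s) a i))"
      using I i k unfolding I_def by auto
    have "length (filter P (seg (mw s) a i)) \<le> i" by (metis length_filter_le length_seg)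
    then have bb: "Suc (rw u 23) \<le> M" "Suc (a + i) \<le> M" "1 \<le> M" using bound i g by linarith+
    have I1: "I (Suc k) (u\<lparr>rw := (rw u)(22 := ?p, 23 := Suc (rw u 23), 20 := Suc (a + i))\<rparr>)" if "P ?p"
      using I that g(3) unfolding I_def i(1) by (auto simp: seg_Suc Suc_diff_le)
    have I2: "I (Suc k) (u\<lparr>rw := (rw u)(22 := ?p, 20 := Suc (a + i))\<rparr>)" if "\<not> P ?p"
      using I that g(3) unfolding I_def i(1) by (auto simp: seg_Suc Suc_diff_le)
    show "wp M (count_body b1 b2) u (\<lambda>v. I (Suc k) v \<and> rw v 20 = Suc k)"
      using v g i(1) bb I1 I2 unfolding count_body_def by auto
  qed simp
  have loop: "runs M (While in_range (count_body b1 b2)) u (real m * (?K + bcost in_range) + bcost in_range) (\<lambda>u. I (a + m) u \<and> rw u 20 = a + m)"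
    if "I a u" "rw u 20 = a" for u
    by (rule runs_for[where K = "?K" and a = a]) (use r body that in \<open>auto simp: I_def\<close>)
  have "runs M (count b1 b2) s t (\<lambda>u. I (a + m) u \<and> rw u 20 = a + m)" unfolding count_def
  proof (rule runs_Seq_wp)
    show "wp M (SetW 23 (WC 0)) s (\<lambda>u. runs M (While in_range (count_body b1 b2)) u (real m * (?K + bcost in_range) + bcost in_range) (\<lambda>u. I (a + m) u \<and> rw u 20 = a + m))"
      using loop r by (auto simp: I_def)
    have c: "?K + real (clen (SetW 23 (WC 0))) + bcost in_range \<le> count_cost b1 b2" unfolding count_cost_def count_def by simp
    have "real m * (?K + bcost in_range) \<le> real m * count_cost b1 b2" using c by (intro mult_left_mono) auto
    then show "real (clen (SetW 23 (WC 0))) + (real m * (?K + bcost in_range) + bcost in_range) \<le> t"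
      using t c by (simp add: algebra_simps)
  qed
  then show ?thesis
    by (rule runs_conseq) (auto simp: I_def)
qed

lemma swept_Suc:
  assumes "distinct xs" "t < length xs"
  shows "swept x x0 xs (Suc t) = (if x (xs ! t) < x0 then swept x x0 xs t - {xs ! t} else insert (xs ! t) (swept x x0 xs t))"
    "xs ! t \<in> swept x x0 xs t \<longleftrightarrow> x (xs ! t) < x0"
proof -
  have d: "drop t xs = xs ! t # drop (Suc t) xs" using assms(2) by (simp add: Cons_nth_drop_Suc)
  have e: "take (Suc t) xs = take t xs @ [xs ! t]" using assms(2) by (simp add: take_Suc_conv_app_nth)
  have "distinct (take t xs @ xs ! t # drop (Suc t) xs)" using assms(1) d by (metis append_take_drop_id)
  then have n: "xs ! t \<notin> set (take t xs)" "xs ! t \<notin> set (drop (Suc t) xs)" by auto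
  show "swept x x0 xs (Suc t) = (if x (xs ! t) < x0 then swept x x0 xs t - {xs ! t} else insert (xs ! t) (swept x x0 xs t))"
    unfolding swept_def d e using n by auto
  show "xs ! t \<in> swept x x0 xs t \<longleftrightarrow> x (xs ! t) < x0" unfolding swept_def d using n by auto
qed

text \<open>For \<open>H\<close> inside the cell this equals
  \<open>n * card (H \<inter> Bl) - card Bl * card H\<close>, so it is zero exactly if
  \<open>H\<close> has the color ratio of the cell. In the form given, moving one point changes it
  by \<open>card Bl\<close> or by \<open>n - card Bl\<close>, hence by at most
  \<open>n\<close>.\<close>

definition imbalance :: "nat \<Rightarrow> nat set \<Rightarrow> nat set \<Rightarrow> int" where
  "imbalance n Bl H = int (n - card Bl) * int (card (H \<inter> Bl)) - int (card Bl) * int (card (H - Bl))"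

text \<open>The whole cell has imbalance zero and imbalance is additive. After a half turn the swept
  set is the complement of the initial one, so the sign is reversed and \<open>discrete_ivt\<close>
  applies.\<close>

lemma swept_balanced:
  assumes xs: "distinct xs" "length xs = n" "0 < n" and Bl: "Bl \<subseteq> set xs"
  shows "\<exists>t<n. \<bar>imbalance n Bl (swept x x0 xs t)\<bar> \<le> int n"
proof (rule discrete_ivt)
  let ?H = "swept x x0 xs"
  have fin: "finite (?H t)" for t using finite_subset[OF swept_subset] by blast
  have fB: "finite Bl" using Bl finite_subset by blast
  have cB: "card Bl \<le> n" using card_mono[OF _ Bl] distinct_card[OF xs(1)] xs(2) by simp
  have cx: "card (set xs) = n" using distinct_card[OF xs(1)] xs(2) by simp
  have compl: "?H n = set xs - ?H 0" unfolding swept_def using xs(2) by auto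
  have "card (?H n \<inter> Bl) + card (?H 0 \<inter> Bl) = card Bl"
  proof -
    have "card Bl = card (Bl \<inter> ?H 0) + card (Bl - ?H 0)" using card_Int_Diff[OF fB] .
    moreover have "?H n \<inter> Bl = Bl - ?H 0" unfolding compl using Bl by blast
    ultimately show ?thesis by (simp add: Int_commute)
  qed
  moreover have "card (?H n - Bl) + card (?H 0 - Bl) = n - card Bl"
  proof -
    have "n - card Bl = card (set xs - Bl)" using cx fB Bl by (simp add: card_Diff_subset)
    also have "\<dots> = card ((set xs - Bl) \<inter> ?H 0) + card ((set xs - Bl) - ?H 0)" by (rule card_Int_Diff) simp
    also have "(set xs - Bl) \<inter> ?H 0 = ?H 0 - Bl" using swept_subset[of x x0 xs 0] by blast
    also have "(set xs - Bl) - ?H 0 = ?H n - Bl" unfolding compl by blast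
    finally show ?thesis by simp
  qed
  ultimately have eq: "int (card (?H n \<inter> Bl)) = int (card Bl) - int (card (?H 0 \<inter> Bl))"
    "int (card (?H n - Bl)) = int (n - card Bl) - int (card (?H 0 - Bl))" by linarith+
  show "imbalance n Bl (?H n) = - imbalance n Bl (?H 0)"
    unfolding imbalance_def eq by (simp add: algebra_simps)
  show "\<bar>imbalance n Bl (?H (Suc t)) - imbalance n Bl (?H t)\<bar> \<le> int n" if t: "t < n" for t
  proof -
    let ?q = "xs ! t"
    note S = swept_Suc[OF xs(1), of t x x0]
    have tl: "t < length xs" using t xs(2) by simp
    show ?thesis
    proof (cases "x ?q < x0")
      case True
      then have H: "?H (Suc t) = ?H t - {?q}" "?q \<in> ?H t" using S[OF tl] by auto
      show ?thesis
      proof (cases "?q \<in> Bl")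
        case b: True
        have "(?H t - {?q}) \<inter> Bl = (?H t \<inter> Bl) - {?q}" "(?H t - {?q}) - Bl = ?H t - Bl" using b by blast+
        moreover have "card (?H t \<inter> Bl) = Suc (card ((?H t \<inter> Bl) - {?q}))" using H(2) b fin by (metis Int_iff card_Suc_Diff1 finite_Int)
        ultimately show ?thesis unfolding imbalance_def H(1) using cB by (simp add: algebra_simps)
      next
        case b: False
        have "(?H t - {?q}) \<inter> Bl = ?H t \<inter> Bl" "(?H t - {?q}) - Bl = (?H t - Bl) - {?q}" using b by blast+
        moreover have "card (?H t - Bl) = Suc (card ((?H t - Bl) - {?q}))" using H(2) b fin by (metis Diff_iff card_Suc_Diff1 finite_Diff)
        ultimately show ?thesis unfolding imbalance_def H(1) using cB by (simp add: algebra_simps)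
      qed
    next
      case False
      then have H: "?H (Suc t) = insert ?q (?H t)" "?q \<notin> ?H t" using S[OF tl] by auto
      show ?thesis
      proof (cases "?q \<in> Bl")
        case b: True
        have "insert ?q (?H t) \<inter> Bl = insert ?q (?H t \<inter> Bl)" "insert ?q (?H t) - Bl = ?H t - Bl" using b by blast+
        moreover have "card (insert ?q (?H t \<inter> Bl)) = Suc (card (?H t \<inter> Bl))" using H(2) fin by simp
        ultimately show ?thesis unfolding imbalance_def H(1) using cB by (simp add: algebra_simps)
      next
        case b: False
        have "insert ?q (?H t) \<inter> Bl = ?H t \<inter> Bl" "insert ?q (?H t) - Bl = insert ?q (?H t - Bl)" using b by blast+
        moreover have "card (insert ?q (?H t - Bl)) = Suc (card (?H t - Bl))" using H(2) fin by simp
        ultimately show ?thesis unfolding imbalance_def H(1) using cB by (simp add: algebra_simps)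
      qed
    qed
  qed
qed (use assms in simp)

lemma card_level_le_2:
  fixes u :: point
  assumes "u \<noteq> 0" "general_position X"
  shows "card {p \<in> X. u \<bullet> p = v} \<le> 2"
proof (rule ccontr)
  assume "\<not> ?thesis"
  then have "3 \<le> card {p \<in> X. u \<bullet> p = v}" by simp
  then obtain T where T: "T \<subseteq> {p \<in> X. u \<bullet> p = v}" "card T = 3" using ex_subset_card by blast
  obtain a b c where abc: "T = {a, b, c}" "a \<noteq> b" "b \<noteq> c" "a \<noteq> c" using T(2) by (auto simp: card_3_iff)
  have m: "a \<in> X" "b \<in> X" "c \<in> X" "u \<bullet> a = v" "u \<bullet> b = v" "u \<bullet> c = v" using T abc by blast+
  show False using general_positionD[OF assms(2) m(1,2,3) abc(2,3,4)] collinear_level[OF assms(1) m(4,5,6)] by blast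
qed

section \<open>The input points and the memory layout\<close>

locale points =
  fixes rs bs :: "point list"
  assumes distinct_points: "distinct (rs @ bs)" and gp: "general_position (set (rs @ bs))"
begin

abbreviation "ps \<equiv> rs @ bs"
definition N :: nat where "N = length ps"
definition X :: "nat \<Rightarrow> real" where "X p = fst (ps ! p)"
definition Y :: "nat \<Rightarrow> real" where "Y p = snd (ps ! p)"
definition blue :: "nat \<Rightarrow> bool" where "blue p \<longleftrightarrow> length rs \<le> p"

text \<open>Word memory holds the output in \<open>[0, N)\<close>, the permuted points in \<open>[N, 2N)\<close>, the merge buffer in
  \<open>[2N, 3N)\<close>, and at \<open>3N + i\<close> the end of the cell that starts at position \<open>i\<close>. Points are numbered with the
  red ones first.\<close>

definition base :: "mst \<Rightarrow> bool" where
  "base s \<longleftrightarrow> rw s 0 = length rs \<and> rw s 2 = N \<and> rw s 12 = 2 * N \<and> (\<forall>p<N. mx s (2 * p) = X p \<and> mx s (2 * p + 1) = Y p)"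

lemma inj_points: "A \<subseteq> {..<N} \<Longrightarrow> inj_on ((!) ps) A"
  unfolding inj_on_def using nth_eq_iff_index_eq[OF distinct_points] by (metis N_def lessThan_iff subsetD)

lemma card_index_level:
  assumes "u \<noteq> 0" "A \<subseteq> {..<N}"
  shows "card {p \<in> A. u \<bullet> (ps ! p) = v} \<le> 2"
proof -
  have f: "finite {q \<in> set ps. u \<bullet> q = v}" by simp
  have "card {p \<in> A. u \<bullet> (ps ! p) = v} = card ((!) ps ` {p \<in> A. u \<bullet> (ps ! p) = v})"
    using inj_points[of "{p \<in> A. u \<bullet> (ps ! p) = v}"] assms(2) by (intro card_image[symmetric]) blast
  also have "\<dots> \<le> card {q \<in> set ps. u \<bullet> q = v}"
  proof (rule card_mono[OF f])
    have "ps ! p \<in> set ps" if "p \<in> A" for p using that assms(2) unfolding N_def by (metis lessThan_iff nth_mem subsetD)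
    then show "(!) ps ` {p \<in> A. u \<bullet> (ps ! p) = v} \<subseteq> {q \<in> set ps. u \<bullet> q = v}" by blast
  qed
  also have "\<dots> \<le> 2" using card_level_le_2[OF assms(1) gp] .
  finally show ?thesis .
qed

lemma inner_X: "(1, 0) \<bullet> (ps ! p) = X p"
  unfolding X_def by (cases "ps ! p") (simp add: inner_Pair)

lemma inner_XY: "(- s, 1) \<bullet> (ps ! p) = Y p - s * X p"
  unfolding X_def Y_def by (cases "ps ! p") (simp add: inner_Pair)

lemma card_X_level: "A \<subseteq> {..<N} \<Longrightarrow> card {p \<in> A. X p = v} \<le> 2"
  using card_index_level[of "(1, 0)" A v] unfolding inner_X by (simp add: zero_prod_def)

lemma card_XY_level: "A \<subseteq> {..<N} \<Longrightarrow> card {p \<in> A. Y p - s * X p = v} \<le> 2"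
  using card_index_level[of "(- s, 1)" A v] unfolding inner_XY by (simp add: zero_prod_def)

text \<open>Points before and after position \<open>m\<close> may have equal keys; general position
  makes the weak separation sufficient.\<close>

lemma hull_disjoint_sorted:
  assumes ys: "distinct ys" "set ys \<subseteq> {..<N}" "sorted (map (\<lambda>p. Y p - s * X p) ys)"
  shows "convex hull ((!) ps ` set (take m ys)) \<inter> convex hull ((!) ps ` set (drop m ys)) = {}"
proof (rule hull_disjoint_weak[of "(- s, 1)", OF _ gp])
  have inP: "ps ! p \<in> set ps" if "p \<in> set ys" for p using that ys(2) unfolding N_def by (metis lessThan_iff nth_mem subsetD)
  show "(!) ps ` set (take m ys) \<subseteq> set ps" "(!) ps ` set (drop m ys) \<subseteq> set ps"
    using inP by (auto simp del: set_append dest: in_set_takeD in_set_dropD)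
  have "set (take m ys) \<inter> set (drop m ys) = {}" using ys(1) by (metis append_take_drop_id distinct_append)
  moreover have "set (take m ys) \<subseteq> {..<N}" "set (drop m ys) \<subseteq> {..<N}" using ys(2) in_set_takeD in_set_dropD by fast+
  ultimately show "(!) ps ` set (take m ys) \<inter> (!) ps ` set (drop m ys) = {}"
    using inj_points[OF ys(2)] by (metis append_take_drop_id image_empty inj_on_image_Int set_append sup_ge1 sup_ge2)
  fix a c assume "a \<in> (!) ps ` set (take m ys)" "c \<in> (!) ps ` set (drop m ys)"
  then obtain p q where pq: "a = ps ! p" "c = ps ! q" "p \<in> set (take m ys)" "q \<in> set (drop m ys)" by blast
  have "sorted (map (\<lambda>p. Y p - s * X p) (take m ys) @ map (\<lambda>p. Y p - s * X p) (drop m ys))"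
    using ys(3) by (metis append_take_drop_id map_append)
  then have "Y p - s * X p \<le> Y q - s * X q" using pq(3,4) by (auto simp: sorted_append)
  then show "(- s, 1) \<bullet> a \<le> (- s, 1) \<bullet> c" unfolding pq(1,2) inner_XY .
qed (simp_all add: zero_prod_def)

end

text \<open>Each part of a larger cell keeps a tenth of it, hence more than 12000 points, above the
  10800 that \<open>cell_ok\<close> asks for. The additive constants lost in a cut are negligible at
  this size. Smaller cells are searched exhaustively.\<close>

definition big :: nat where "big = 120000"

section \<open>Cutting one cell: the setting\<close>

locale split_cell = points +
  fixes M L :: nat and s :: mst and lo hi n :: nat and cs :: "nat list"
  assumes base: "base s" and regs: "rw s 3 = lo" "rw s 4 = hi"
    and range: "lo < hi" "hi \<le> N" "n = hi - lo" "big < n"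
    and cs: "cs = seg (mw s) (N + lo) n" "distinct cs" "set cs \<subseteq> {..<N}"
    and bound: "N * N + 4 * N + 1 \<le> M" and logN: "N \<le> 4 ^ L"
begin

definition "h = n div 2"
definition "nb = card {p \<in> set cs. blue p}"
text \<open>The unit of cost: a sort of the cell takes a constant multiple of \<open>W\<close>, and
  every other phase of a cut takes no more. Time bounds then add up as constants in front of
  \<open>W\<close>.\<close>

definition "W = (real n + 1) * (real L + 1)"

text \<open>What every phase of a cut preserves: the cell is only permuted, and apart from the cell
  and the merge buffer the word memory is unchanged.\<close>

definition fr :: "mst \<Rightarrow> bool" where
  "fr u \<longleftrightarrow> base u \<and> rw u 3 = lo \<and> rw u 4 = hi \<and> rw u 1 = rw s 1 \<and> rw u 5 = rw s 5 \<and>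
     rw u 6 = n \<and> rw u 7 = h \<and> rw u 8 = nb \<and> rw u 9 = n - nb \<and> rw u 19 = N + lo \<and>
     mset (seg (mw u) (N + lo) n) = mset cs \<and>
     (\<forall>i. (i < N + lo \<or> N + hi \<le> i) \<and> (i < 2 * N \<or> 3 * N \<le> i) \<longrightarrow> mw u i = mw s i)"

text \<open>Divisibility by 18 makes \<open>star_count\<close> additive over the two parts, the
  tenths keep the depth of the recursion logarithmic, and the last clause limits the drift of the
  color ratio. Disjoint hulls allow the packings of the parts to be combined.\<close>

definition split_post :: "mst \<Rightarrow> bool" where
  "split_post u \<longleftrightarrow> (\<exists>mid. lo < mid \<and> mid < hi \<and> 18 dvd (mid - lo) \<and> n \<le> 10 * (mid - lo) \<and> n \<le> 10 * (hi - mid) \<and>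
     base u \<and> rw u 1 = rw s 1 \<and> rw u 3 = lo \<and> rw u 5 = rw s 5 \<and> mw u (3 * N + lo) = mid \<and> mw u (3 * N + mid) = hi \<and>
     (\<forall>i. (i < N + lo \<or> N + hi \<le> i) \<and> (i < 2 * N \<or> 3 * N \<le> i) \<and> i \<noteq> 3 * N + lo \<and> i \<noteq> 3 * N + mid \<longrightarrow> mw u i = mw s i) \<and>
     mset (seg (mw u) (N + lo) (mid - lo) @ seg (mw u) (N + mid) (hi - mid)) = mset cs \<and>
     convex hull ((!) ps ` set (seg (mw u) (N + lo) (mid - lo))) \<inter> convex hull ((!) ps ` set (seg (mw u) (N + mid) (hi - mid))) = {} \<and>
     \<bar>int n * int (length (filter blue (seg (mw u) (N + lo) (mid - lo)))) - int nb * int (mid - lo)\<bar> \<le> 30 * int n)"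

lemma W_ge: "1 \<le> W"
  unfolding W_def by (simp add: algebra_simps)

lemma runs_Seq_W:
  assumes "runs M c u (W * k1) (\<lambda>v. runs M d v (W * k2) Q)" "k1 + k2 \<le> k"
  shows "runs M (c ;; d) u (W * k) Q"
proof (rule runs_Seq[OF assms(1)])
  have "W * (k1 + k2) \<le> W * k" using assms(2) W_ge by (intro mult_left_mono) auto
  then show "W * k1 + W * k2 \<le> W * k" by (simp add: distrib_left)
qed

lemma runs_wp_W:
  assumes "wp M c u Q" "real (clen c) \<le> k"
  shows "runs M c u (W * k) Q"
proof (rule runs_wp[OF assms(1)])
  have "0 \<le> k" using assms(2) by (meson of_nat_0_le_iff order_trans)
  then have "1 * k \<le> W * k" using W_ge by (intro mult_right_mono) auto
  then show "real (clen c) \<le> W * k" using assms(2) by simp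
qed

lemma runs_Seq_wp_W:
  assumes "wp M c u (\<lambda>v. runs M d v (W * k2) Q)" "real (clen c) + k2 \<le> k"
  shows "runs M (c ;; d) u (W * k) Q"
  by (rule runs_Seq_W[OF runs_wp_W[OF assms(1) order_refl] assms(2)])

lemma bound': "4 * N + 1 \<le> M" "big < N" "n \<le> N" "N * N \<le> M" "big \<le> M"
proof -
  show "4 * N + 1 \<le> M" "N * N \<le> M" using bound by linarith+
  show "n \<le> N" "big < N" using range by linarith+
  then show "big \<le> M" using bound by linarith
qed

lemma frD:
  assumes "fr u"
  shows "base u" "rw u 2 = N" "rw u 12 = 2 * N" "rw u 3 = lo" "rw u 4 = hi" "rw u 6 = n" "rw u 7 = h" "rw u 8 = nb"
    "rw u 9 = n - nb" "rw u 19 = N + lo" "rw u 0 = length rs" "mset (seg (mw u) (N + lo) n) = mset cs"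
    "distinct (seg (mw u) (N + lo) n)" "set (seg (mw u) (N + lo) n) = set cs" "\<And>i. i < n \<Longrightarrow> mw u (N + lo + i) < N"
    "\<And>i. i < n \<Longrightarrow> mw u (N + lo + i) \<in> set cs"
proof -
  show m: "mset (seg (mw u) (N + lo) n) = mset cs" using assms unfolding fr_def by blast
  show "distinct (seg (mw u) (N + lo) n)" using m cs(2) mset_eq_imp_distinct_iff by blast
  show st: "set (seg (mw u) (N + lo) n) = set cs" using m by (metis mset_eq_setD)
  show i: "mw u (N + lo + i) \<in> set cs" if "i < n" for i using st that by (auto simp: set_seg)
  show "mw u (N + lo + i) < N" if "i < n" for i using i[OF that] cs(3) by auto
qed (use assms in \<open>simp_all add: fr_def base_def\<close>)

lemma coords:
  assumes "rw v 22 = p" "p < N" "\<And>j. j < 2 * N \<Longrightarrow> mx v j = mx u j" "base u"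
  shows "okr M px v" "okr M py v" "rv px v = X p" "rv py v = Y p"
proof -
  have "2 * p + 1 < 2 * N" using assms(2) by linarith
  then have "mx v (2 * p) = X p" "mx v (2 * p + 1) = Y p" using assms unfolding base_def by auto
  moreover have "p + p + 1 \<le> M" using assms(2) bound' by linarith
  ultimately show "okr M px v" "okr M py v" "rv px v = X p" "rv py v = Y p"
    using assms(1) unfolding px_def py_def by (simp_all add: mult_2)
qed

text \<open>\<open>off\<close> and \<open>k\<close> select a subrange, because the two halves of a
  cell are sorted separately. The clause on addresses below \<open>2 * N\<close> guarantees that
  sorting one half leaves the other in place.\<close>

lemma sortby_cell:
  assumes u: "fr u" and A: "wv A u = N + lo + off" "okw M A u" "wv m (u\<lparr>rw := (rw u)(10 := N + lo + off)\<rparr>) = k"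
      "okw M m (u\<lparr>rw := (rw u)(10 := N + lo + off)\<rparr>)" "off + k \<le> n"
    and val: "\<And>v i. i < k \<Longrightarrow> rw v 20 = N + lo + off + i \<Longrightarrow> rw v 22 = mw u (N + lo + off + i) \<Longrightarrow>
      (\<And>j. j \<notin> {10, 11, 20, 21, 22} \<Longrightarrow> rw v j = rw u j) \<Longrightarrow> mw v = mw u \<Longrightarrow> rx v = rx u \<Longrightarrow>
      (\<And>j. j < 2 * N \<Longrightarrow> mx v j = mx u j) \<Longrightarrow> okr M e v \<and> rv e v = kf (mw u (N + lo + off + i))"
  shows "runs M (sortby A m e) u (W * sortby_cost A m e) (\<lambda>v. fr v \<and> sorted (map kf (seg (mw v) (N + lo + off) k)) \<and>
     mset (seg (mw v) (N + lo + off) k) = mset (seg (mw u) (N + lo + off) k) \<and>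
     (\<forall>p\<in>set (seg (mw v) (N + lo + off) k). mx v (2 * N + p) = kf p) \<and> rx v = rx u \<and>
     (\<forall>i. (i < N + lo + off \<or> N + lo + off + k \<le> i) \<and> i < 2 * N \<longrightarrow> mw v i = mw u i) \<and>
     rw v 24 = rw u 24 \<and> rw v 25 = rw u 25 \<and> rw v 26 = rw u 26)"
proof (rule runs_conseq[OF sortby_runs[where N = N and a = "N + lo + off" and n = k and L = L and kf = kf and M = M]])
  have entry: "mw u (N + lo + off + i) < N" if "i < k" for i
    using frD(15)[OF u, of "off + i"] that A(5) by (simp add: add.assoc)
  show "N \<le> N + lo + off" "N + lo + off + k \<le> 2 * N" using A(5) range by linarith+
  have "k \<le> N" using A(5) bound'(3) by linarith
  then show "k \<le> 4 ^ L" using logN by linarith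
  show "p < N" if "p \<in> set (seg (mw u) (N + lo + off) k)" for p using that entry by (auto simp: set_seg)
  have c0: "0 \<le> sortby_cost A m e"
    unfolding sortby_cost_def setkeys_cost_def using msort_cost_ge bcost_ge[of in_range] by simp
  have "(real k + 1) * (real L + 1) \<le> W" unfolding W_def using A(5) by (intro mult_right_mono) auto
  then show "(real k + 1) * (real L + 1) * sortby_cost A m e \<le> W * sortby_cost A m e" using c0 by (intro mult_right_mono)
  fix v :: mst
  assume v: "sorted (map kf (seg (mw v) (N + lo + off) k)) \<and> mset (seg (mw v) (N + lo + off) k) = mset (seg (mw u) (N + lo + off) k) \<and>
     (\<forall>p\<in>set (seg (mw v) (N + lo + off) k). mx v (2 * N + p) = kf p) \<and> (\<forall>j<2 * N. mx v j = mx u j) \<and> rx v = rx u \<and>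
     (\<forall>i. (i < N + lo + off \<or> N + lo + off + k \<le> i) \<and> (i < 2 * N \<or> 3 * N \<le> i) \<longrightarrow> mw v i = mw u i) \<and>
     (\<forall>i. i \<notin> {10, 11, 13, 14, 15, 16, 17, 18, 20, 21, 22} \<longrightarrow> rw v i = rw u i)"
  have split: "seg f (N + lo) n = seg f (N + lo) off @ seg f (N + lo + off) k @ seg f (N + lo + off + k) (n - off - k)" for f :: "nat \<Rightarrow> nat"
    using seg_add[of f "N + lo" off "k + (n - off - k)"] seg_add[of f "N + lo + off" k "n - off - k"] A(5) by simp
  have vm: "mw v i = mw u i" if "i < N + lo + off \<or> N + lo + off + k \<le> i" "i < 2 * N \<or> 3 * N \<le> i" for i
    using v that by blast
  have "seg (mw v) (N + lo) off = seg (mw u) (N + lo) off" by (rule seg_cong, rule vm) (use A(5) range in linarith)+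
  moreover have "seg (mw v) (N + lo + off + k) (n - off - k) = seg (mw u) (N + lo + off + k) (n - off - k)"
    by (rule seg_cong, rule vm) (use A(5) range in linarith)+
  ultimately have ms: "mset (seg (mw v) (N + lo) n) = mset (seg (mw u) (N + lo) n)" using v split[of "mw v"] split[of "mw u"] by simp
  have "base v" using frD(1)[OF u] v unfolding base_def by simp
  moreover have "mw v i = mw s i" if "(i < N + lo \<or> N + hi \<le> i) \<and> (i < 2 * N \<or> 3 * N \<le> i)" for i
  proof -
    have "mw v i = mw u i" by (rule vm) (use that A(5) range in linarith)+
    then show ?thesis using u that unfolding fr_def by simp
  qed
  ultimately have "fr v" using v u ms unfolding fr_def by simp
  then show "fr v \<and> sorted (map kf (seg (mw v) (N + lo + off) k)) \<and>
     mset (seg (mw v) (N + lo + off) k) = mset (seg (mw u) (N + lo + off) k) \<and>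
     (\<forall>p\<in>set (seg (mw v) (N + lo + off) k). mx v (2 * N + p) = kf p) \<and> rx v = rx u \<and>
     (\<forall>i. (i < N + lo + off \<or> N + lo + off + k \<le> i) \<and> i < 2 * N \<longrightarrow> mw v i = mw u i) \<and>
     rw v 24 = rw u 24 \<and> rw v 25 = rw u 25 \<and> rw v 26 = rw u 26" using v by simp
qed (use frD[OF u] A val bound' in auto)

end

lemma take_seg: "m \<le> n \<Longrightarrow> seg f a m = take m (seg f a n)"
  using seg_add[of f a m "n - m"] by simp

lemma drop_seg: "m \<le> n \<Longrightarrow> seg f (a + m) (n - m) = drop m (seg f a n)"
  using seg_add[of f a m "n - m"] by simp

definition is_blue :: bexp where "is_blue = WL (WR 0) (wadd (WR 22) (WC 1))"
definition is_left :: bexp where "is_left = RL px (RR 1)"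

definition shear :: "nat \<Rightarrow> rexp" where
  "shear i = RB RSub py (RB RMul (RR i) px)"

text \<open>Register 7 holds \<open>h\<close>, so \<open>q\<close> is the point \<open>h\<close>
  addresses further on: the counterpart of the current point in the right half.\<close>

definition slope_to_mate :: rexp where
  "slope_to_mate = (let q = WM (wadd (WR 20) (WR 7)) in
     RB RDiv (RB RSub (RM (wadd (wadd q q) (WC 1))) py) (RB RSub (RM (wadd q q)) px))"

definition slope_at_center :: rexp where
  "slope_at_center = RB RDiv (RB RSub py (RR 3)) (RB RSub px (RR 1))"

definition ends :: "wexp \<Rightarrow> wexp" where
  "ends a = wadd (wadd (wadd (WR 2) (WR 2)) (WR 2)) a"

text \<open>Register 24 holds the size of the balanced swept set; it is rounded down to a multiple
  of 18 to give the size of the first part.\<close>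

definition split_at :: com where
  "split_at = SetW 27 (wadd (WR 3) (wmul (WC 18) (WB WDiv (WR 24) (WC 18)))) ;;
     StoreW (ends (WR 27)) (WR 4) ;; StoreW (ends (WR 3)) (WR 27)"

definition cut_at_slope :: com where
  "cut_at_slope = SetR 5 (key_at (wadd (WR 19) (WR 26))) ;; sortby (WR 19) (WR 6) (shear 5) ;; split_at"

definition cut_at_slope_cost :: real where
  "cut_at_slope_cost = real (clen (SetR 5 (key_at (wadd (WR 19) (WR 26))))) + (sortby_cost (WR 19) (WR 6) (shear 5) + real (clen split_at))"

context split_cell
begin

definition "Bl = {p \<in> set cs. blue p}"
text \<open>Points with abscissa \<open>x0\<close> get the value 0, since division by zero yields
  zero. There are at most two of them, and the estimates for swept sets allow for these.\<close>

definition "angle x0 y0 p = (Y p - y0) / (X p - x0)"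
text \<open>An approximate centerpoint: on both closed sides of every nonvertical line through it
  there is about an eighth of the cell.\<close>

definition "deep x0 y0 \<longleftrightarrow> (\<forall>t. h \<le> 4 * card {p \<in> set cs. Y p - t * X p \<le> y0 - t * x0} + 8 \<and>
    h \<le> 4 * card {p \<in> set cs. y0 - t * x0 \<le> Y p - t * X p} + 8)"

lemma nb_Bl: "nb = card Bl" "finite Bl" "nb \<le> n"
proof -
  show "nb = card Bl" "finite Bl" unfolding nb_def Bl_def by simp_all
  have "card Bl \<le> card (set cs)" unfolding Bl_def by (intro card_mono) auto
  then show "nb \<le> n" using distinct_card[OF cs(2)] cs(1) unfolding nb_def Bl_def by simp
qed

lemma card_cs: "card (set cs) = n"
  using distinct_card[OF cs(2)] cs(1) by simp

lemma fr_cong: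
  assumes "fr u" "\<And>i. i < 10 \<or> i = 12 \<or> i = 19 \<Longrightarrow> rw v i = rw u i" "mw v = mw u" "mx v = mx u"
  shows "fr v"
proof -
  have r: "rw v 0 = rw u 0" "rw v 1 = rw u 1" "rw v 2 = rw u 2" "rw v 3 = rw u 3" "rw v 4 = rw u 4" "rw v 5 = rw u 5"
    "rw v 6 = rw u 6" "rw v 7 = rw u 7" "rw v 8 = rw u 8" "rw v 9 = rw u 9" "rw v 12 = rw u 12" "rw v 19 = rw u 19"
    by (rule assms(2); simp)+
  show ?thesis using assms(1) unfolding fr_def base_def r assms(3,4) .
qed

text \<open>A deep point leaves an eighth of the cell on either side. The swept set differs from a
  side by at most four points and rounding costs at most 17 more; for cells larger than
  \<open>big\<close> a tenth remains.\<close>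

lemma split_numbers:
  assumes H: "H \<subseteq> set cs" and Z: "\<And>p. p \<in> H \<Longrightarrow> X p \<noteq> x0 \<Longrightarrow> Y p - t * X p \<le> y0 - t * x0"
    "\<And>p. p \<in> set cs - H \<Longrightarrow> X p \<noteq> x0 \<Longrightarrow> y0 - t * x0 \<le> Y p - t * X p" and deep: "deep x0 y0"
    and m: "m = 18 * (card H div 18)"
  shows "n \<le> 10 * m" "n \<le> 10 * (n - m)" "m < n" "0 < m" "m \<le> card H" "card H \<le> m + 17"
proof -
  have 1: "card {p \<in> set cs. Y p - t * X p \<le> y0 - t * x0} \<le> card H + 4"
    "card {p \<in> set cs. y0 - t * x0 \<le> Y p - t * X p} \<le> card (set cs - H) + 4"
    using swept_size[of "set cs" H X x0 "\<lambda>p. Y p - t * X p" "y0 - t * x0"] H Z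
      card_X_level[OF cs(3)] card_XY_level[OF cs(3)] by auto
  have d: "h \<le> 4 * card {p \<in> set cs. Y p - t * X p \<le> y0 - t * x0} + 8"
    "h \<le> 4 * card {p \<in> set cs. y0 - t * x0 \<le> Y p - t * X p} + 8" using deep unfolding deep_def by blast+
  have c: "card (set cs - H) = n - card H" "card H \<le> n"
    using card_cs H card_mono[OF _ H] by (auto simp: card_Diff_subset finite_subset)
  have hn: "n \<le> 2 * h + 1" "120000 < n" unfolding h_def using range(4) unfolding big_def by linarith+
  show mH: "m \<le> card H" "card H \<le> m + 17" unfolding m by linarith+
  show "n \<le> 10 * m" "n \<le> 10 * (n - m)" "m < n" "0 < m" using 1 d c hn mH by linarith+
qed

text \<open>The cell is sorted again, now perpendicular to the line of the balanced position, so
  that a prefix is genuinely cut off by a line. By \<open>prefix_near_swept\<close> this changes the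
  color count only by a constant.\<close>

lemma cut_at_slope_runs:
  assumes u: "fr u" and xs: "xs = seg (mw u) (N + lo) n" "sorted (map (angle x0 y0) xs)"
    and key: "mx u (2 * N + xs ! t) = angle x0 y0 (xs ! t)" and t: "t < n" "rw u 26 = t"
    and H: "rw u 24 = card (swept X x0 xs t)" and bal: "\<bar>imbalance n Bl (swept X x0 xs t)\<bar> \<le> int n"
    and deep: "deep x0 y0"
  shows "runs M cut_at_slope u (W * cut_at_slope_cost) split_post"
proof -
  define g where "g = angle x0 y0 (xs ! t)"
  define Hs where "Hs = swept X x0 xs t"
  define m where "m = 18 * (card Hs div 18)"
  have dx: "distinct xs" "set xs = set cs" "length xs = n" using frD[OF u] xs(1) by auto
  have HA: "Hs \<subseteq> set cs" unfolding Hs_def using swept_subset dx by metis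
  have side: "p \<in> Hs \<Longrightarrow> Y p - g * X p \<le> y0 - g * x0" "p \<notin> Hs \<Longrightarrow> y0 - g * x0 \<le> Y p - g * X p"
    if "p \<in> set cs" "X p \<noteq> x0" for p
    using swept_side[OF dx(1), of Y y0 X x0 t p g] xs(2) t(1) dx that unfolding Hs_def g_def angle_def by auto
  have "Y p - g * X p \<le> y0 - g * x0" if "p \<in> Hs" "X p \<noteq> x0" for p using side(1)[of p] that HA by blast
  moreover have "y0 - g * x0 \<le> Y p - g * X p" if "p \<in> set cs - Hs" "X p \<noteq> x0" for p using side(2)[of p] that by blast
  ultimately have num: "n \<le> 10 * m" "n \<le> 10 * (n - m)" "m < n" "0 < m" "m \<le> card Hs" "card Hs \<le> m + 17"
    using split_numbers[OF HA _ _ deep m_def, of g] by simp_all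
  let ?kf = "\<lambda>p. Y p - g * X p"
  let ?u = "u\<lparr>rx := (rx u)(5 := g)\<rparr>"
  have fu: "fr ?u" by (rule fr_cong[OF u]) auto
  have fin: "runs M split_at v (W * real (clen split_at)) split_post"
    if v: "fr v" "sorted (map ?kf (seg (mw v) (N + lo) n))" "rw v 24 = card Hs" for v
  proof (rule runs_wp_W)
    note f = frD[OF v(1)]
    let ?ys = "seg (mw v) (N + lo) n"
    define w where "w = v\<lparr>rw := (rw v)(27 := lo + m), mw := (mw v)(3 * N + (lo + m) := hi, 3 * N + lo := lo + m)\<rparr>"
    have inr: "lo + m < hi" using num(3) range by linarith
    have sl: "seg (mw w) (N + lo) m = seg (mw v) (N + lo) m" "seg (mw w) (N + lo + m) (n - m) = seg (mw v) (N + lo + m) (n - m)"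
      unfolding w_def by (rule seg_cong; use num inr range in \<open>auto\<close>)+
    have c12: "seg (mw w) (N + lo) m = take m ?ys" "seg (mw w) (N + lo + m) (n - m) = drop m ?ys"
      unfolding sl using num(3) take_seg[of m n] drop_seg[of m n] by (simp_all add: less_imp_le)
    have ys: "distinct ?ys" "set ?ys = set cs" "set ?ys \<subseteq> {..<N}" using f cs(3) by auto
    have near: "card (set (take m ?ys) - Hs) \<le> 6" "card (Hs - set (take m ?ys)) \<le> 23"
      using prefix_near_swept[of ?ys ?kf "set cs" Hs X x0 "y0 - g * x0" m] ys v(2) HA side num
        card_X_level[OF cs(3)] card_XY_level[OF cs(3)] by auto
    let ?P = "set (take m ?ys)"
    have fP: "finite ?P" "finite Hs" using HA finite_subset by auto
    have bP: "length (filter blue (take m ?ys)) = card (?P \<inter> Bl)"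
    proof -
      have "length (filter blue (take m ?ys)) = card (set (filter blue (take m ?ys)))"
        using distinct_card[OF distinct_filter[OF distinct_take[OF ys(1)]]] by simp
      moreover have "set (filter blue (take m ?ys)) = ?P \<inter> Bl" unfolding Bl_def using ys(2) by (auto dest: in_set_takeD)
      ultimately show ?thesis by simp
    qed
    have b1: "card (?P \<inter> Bl) \<le> card (Hs \<inter> Bl) + 6"
    proof -
      have "card (?P \<inter> Bl) \<le> card ((Hs \<inter> Bl) \<union> (?P - Hs))" using fP by (intro card_mono) auto
      also have "\<dots> \<le> card (Hs \<inter> Bl) + card (?P - Hs)" by (rule card_Un_le)
      finally show ?thesis using near by linarith
    qed
    have b2: "card (Hs \<inter> Bl) \<le> card (?P \<inter> Bl) + 23"
    proof -
      have "card (Hs \<inter> Bl) \<le> card ((?P \<inter> Bl) \<union> (Hs - ?P))" using fP by (intro card_mono) auto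
      also have "\<dots> \<le> card (?P \<inter> Bl) + card (Hs - ?P)" by (rule card_Un_le)
      finally show ?thesis using near by linarith
    qed
    have col: "\<bar>int n * int (card (?P \<inter> Bl)) - int nb * int m\<bar> \<le> 30 * int n"
    proof -
      define bp bh ch where "bp = int (card (?P \<inter> Bl))" and "bh = int (card (Hs \<inter> Bl))" and "ch = int (card Hs)"
      have split: "card Hs = card (Hs \<inter> Bl) + card (Hs - Bl)" using card_Int_Diff[OF fP(2)] .
      have "imbalance n Bl Hs = (int n - int nb) * bh - int nb * (ch - bh)"
        unfolding imbalance_def bh_def ch_def using split nb_Bl by (simp add: of_nat_diff)
      then have im: "\<bar>int n * bh - int nb * ch\<bar> \<le> int n" using bal unfolding Hs_def[symmetric] by (simp add: algebra_simps)
      \<comment> \<open>Three errors: the imbalance of the swept set, at most \<open>n\<close>; its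
        exchange for a prefix, between \<open>-23 * n\<close> and \<open>6 * n\<close>; and the
        rounding of its size, between 0 and \<open>17 * n\<close>.\<close>
      have e: "int n * bp - int nb * int m = (int n * bh - int nb * ch) + int n * (bp - bh) + int nb * (ch - int m)"
        by (simp add: algebra_simps)
      have "int n * (bp - bh) \<le> int n * 6" "int n * (-23) \<le> int n * (bp - bh)"
        using b1 b2 unfolding bp_def bh_def by (intro mult_left_mono; linarith)+
      moreover have "0 \<le> int nb * (ch - int m)" "int nb * (ch - int m) \<le> int n * 17"
        using num(5,6) nb_Bl(3) unfolding ch_def by (auto intro!: mult_mono)
      ultimately have "\<bar>int n * bp - int nb * int m\<bar> \<le> 30 * int n" unfolding e using im by linarith
      then show ?thesis unfolding bp_def .
    qed
    have hull: "convex hull ((!) ps ` ?P) \<inter> convex hull ((!) ps ` set (drop m ?ys)) = {}"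
      using hull_disjoint_sorted[OF ys(1,3) v(2)] .
    have post: "split_post w" unfolding split_post_def
    proof (intro exI[of _ "lo + m"] conjI)
      show "lo < lo + m" "lo + m < hi" using num inr by simp_all
      show "18 dvd (lo + m - lo)" unfolding m_def by simp
      show "n \<le> 10 * (lo + m - lo)" "n \<le> 10 * (hi - (lo + m))" using num range by auto
      show "base w" using f(1) unfolding w_def base_def by simp
      show "rw w 1 = rw s 1" "rw w 3 = lo" "rw w 5 = rw s 5" using v(1) unfolding w_def fr_def by simp_all
      show "mw w (3 * N + lo) = lo + m" "mw w (3 * N + (lo + m)) = hi" unfolding w_def using num(4) by simp_all
      show "\<forall>i. (i < N + lo \<or> N + hi \<le> i) \<and> (i < 2 * N \<or> 3 * N \<le> i) \<and> i \<noteq> 3 * N + lo \<and> i \<noteq> 3 * N + (lo + m) \<longrightarrow> mw w i = mw s i"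
        using v(1) unfolding w_def fr_def by simp
      have e: "hi - (lo + m) = n - m" "lo + m - lo = m" "N + (lo + m) = N + lo + m" using range by auto
      show "mset (seg (mw w) (N + lo) (lo + m - lo) @ seg (mw w) (N + (lo + m)) (hi - (lo + m))) = mset cs"
        unfolding e c12 using f(12) by simp
      show "convex hull ((!) ps ` set (seg (mw w) (N + lo) (lo + m - lo))) \<inter>
        convex hull ((!) ps ` set (seg (mw w) (N + (lo + m)) (hi - (lo + m)))) = {}"
        unfolding e c12 using hull .
      show "\<bar>int n * int (length (filter blue (seg (mw w) (N + lo) (lo + m - lo)))) - int nb * int (lo + m - lo)\<bar> \<le> 30 * int n"
        unfolding e c12 bP using col .
    qed
    have mm: "18 * (card Hs div 18) = m" unfolding m_def ..
    have ok: "18 \<le> M" "m \<le> M" "lo + m \<le> M" "N + N \<le> M" "N + N + N \<le> M" "N + N + N + (lo + m) \<le> M" "N + N + N + lo \<le> M"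
      using bound' inr range(2) unfolding big_def by linarith+
    have e3: "N + N + N = 3 * N" by simp
    show "wp M split_at v split_post"
      unfolding split_at_def ends_def using f(2,4,5) v(3) ok mm post[unfolded w_def] by (simp add: e3)
  qed simp
  have srt: "runs M (sortby (WR 19) (WR 6) (shear 5)) ?u (W * sortby_cost (WR 19) (WR 6) (shear 5))
    (\<lambda>v. runs M split_at v (W * real (clen split_at)) split_post)"
  proof (rule runs_conseq[OF sortby_cell[of ?u "WR 19" 0 "WR 6" n "shear 5" ?kf]])
    fix v :: mst and i assume h: "i < n" "rw v 22 = mw ?u (N + lo + 0 + i)" "rx v = rx ?u" "\<And>j. j < 2 * N \<Longrightarrow> mx v j = mx ?u j"
    have "mw ?u (N + lo + i) < N" using frD(15)[OF fu h(1)] .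
    then show "okr M (shear 5) v \<and> rv (shear 5) v = ?kf (mw ?u (N + lo + 0 + i))"
      using coords[of v "mw ?u (N + lo + i)" ?u] h frD(1)[OF fu] unfolding shear_def by simp
  qed (use fu frD[OF fu] fin H Hs_def in auto)
  have mu: "mw u (N + lo + t) = xs ! t" using xs(1) t(1) by simp
  have "xs ! t < N" using frD(15)[OF u t(1)] mu by simp
  then have ok: "N + N + xs ! t \<le> M" "N + N \<le> M" "N + lo + t \<le> M" using bound' range t by linarith+
  show ?thesis unfolding cut_at_slope_def cut_at_slope_cost_def
    by (rule runs_Seq_wp_W[OF _ order_refl])
      (use frD[OF u] t mu ok key runs_Seq_W[OF srt order_refl] in \<open>simp add: key_at_def g_def mult_2\<close>)
qed

end

text \<open>Words are natural numbers, so the absolute value of a difference is the sum of the two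
  truncated differences.\<close>

definition unbalanced :: bexp where
  "unbalanced = WL (WR 6) (let a = wmul (WR 9) (WR 25); b = wmul (WR 8) (wsub (WR 24) (WR 25)) in wadd (wsub a b) (wsub b a))"

definition sweep_body :: com where
  "sweep_body = SetW 22 (WM (wadd (WR 19) (WR 26))) ;;
     Cond is_left (SetW 24 (wsub (WR 24) (WC 1)) ;; Cond is_blue (SetW 25 (wsub (WR 25) (WC 1))) (SetW 25 (WR 25)))
       (incr 24 ;; Cond is_blue (incr 25) (SetW 25 (WR 25))) ;; incr 26"

definition sweep_then_cut :: com where
  "sweep_then_cut = While unbalanced sweep_body ;; cut_at_slope"

definition sweep_then_cut_cost :: real where
  "sweep_then_cut_cost = (real (clen sweep_body) + bcost unbalanced) + cut_at_slope_cost"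

definition scan :: com where
  "scan = SetW 20 (WR 19) ;; SetW 21 (wadd (WR 19) (WR 6))"

definition cut_about_center :: com where
  "cut_about_center = scan ;; count is_left is_left ;; (SetW 24 (WR 23) ;; scan) ;; count is_left is_blue ;; SetW 25 (WR 23) ;;
     sortby (WR 19) (WR 6) slope_at_center ;; SetW 26 (WC 0) ;; sweep_then_cut"

definition cut_about_center_cost :: real where
  "cut_about_center_cost = real (clen scan) + (count_cost is_left is_left + (real (clen (SetW 24 (WR 23) ;; scan)) + (count_cost is_left is_blue +
     (real (clen (SetW 25 (WR 23))) + (sortby_cost (WR 19) (WR 6) slope_at_center + (real (clen (SetW 26 (WC 0))) + sweep_then_cut_cost))))))"

definition lower_quartile :: "wexp \<Rightarrow> rexp" where
  "lower_quartile a = key_at (wadd a (WB WDiv (WR 7) (WC 4)))"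

definition set_center :: com where
  "set_center = SetR 4 (lower_quartile (wadd (WR 19) (WR 7))) ;; Cond (RL (RR 3) (RR 4)) (SetR 3 (RR 4)) (SetR 3 (RR 3)) ;;
     SetR 3 (RB RAdd (RR 3) (RB RMul (RR 2) (RR 1)))"

definition cut_sheared :: com where
  "cut_sheared = sortby (WR 19) (WR 7) (shear 2) ;; SetR 3 (lower_quartile (WR 19)) ;;
     sortby (wadd (WR 19) (WR 7)) (wsub (WR 6) (WR 7)) (shear 2) ;; set_center ;; cut_about_center"

definition cut_sheared_cost :: real where
  "cut_sheared_cost = sortby_cost (WR 19) (WR 7) (shear 2) + (real (clen (SetR 3 (lower_quartile (WR 19)))) +
     (sortby_cost (wadd (WR 19) (WR 7)) (wsub (WR 6) (WR 7)) (shear 2) + (real (clen set_center) + cut_about_center_cost)))"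

context split_cell
begin

lemma blueI:
  assumes "rw v 22 = p" "p < N" "rw v 0 = length rs"
  shows "okb M is_blue v" "bv is_blue v \<longleftrightarrow> blue p"
proof -
  have "p + 1 \<le> M" "1 \<le> M" using assms(2) bound' by linarith+
  then show "okb M is_blue v" "bv is_blue v \<longleftrightarrow> blue p" using assms unfolding is_blue_def blue_def by auto
qed

lemma leftI:
  assumes "rw v 22 = p" "p < N" "mx v = mx u" "base u" "rx v 1 = x0"
  shows "okb M is_left v" "bv is_left v \<longleftrightarrow> X p < x0"
  using coords[of v p u] assms unfolding is_left_def by auto

lemma n_le_W: "0 \<le> c \<Longrightarrow> (real n + 1) * c \<le> W * c"
  unfolding W_def by (intro mult_right_mono) (auto simp: algebra_simps)

lemma sweep_runs:
  assumes u: "fr u" and xs: "xs = seg (mw u) (N + lo) n"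
    and x0: "rx u 1 = x0" and H: "rw u 24 = card (swept X x0 xs 0)" "rw u 25 = card (swept X x0 xs 0 \<inter> Bl)" "rw u 26 = 0"
  shows "runs M (While unbalanced sweep_body) u (W * (real (clen sweep_body) + bcost unbalanced))
    (\<lambda>v. \<exists>t<n. fr v \<and> mw v = mw u \<and> mx v = mx u \<and> rx v = rx u \<and> rw v 26 = t \<and> rw v 24 = card (swept X x0 xs t) \<and>
       \<bar>imbalance n Bl (swept X x0 xs t)\<bar> \<le> int n)"
proof -
  let ?H = "swept X x0 xs"
  have dx: "distinct xs" "set xs = set cs" "length xs = n" using frD[OF u] xs by auto
  have nth: "mw u (N + lo + i) = xs ! i" if "i < n" for i using xs that by simp
  have BX: "Bl \<subseteq> set xs" unfolding Bl_def dx by blast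
  have n0: "0 < n" using range unfolding big_def by simp
  \<comment> \<open>The loop stops at the first balanced position it meets; \<open>T\<close> serves
    only to bound the number of rounds.\<close>
  obtain T where T: "T < n" "\<bar>imbalance n Bl (?H T)\<bar> \<le> int n" using swept_balanced[OF dx(1,3) n0 BX] by blast
  have fin: "finite (?H t)" for t using finite_subset[OF swept_subset] by blast
  have cH: "card (?H t) \<le> n" for t using card_mono[OF _ swept_subset[of X x0 xs t]] distinct_card[OF dx(1)] dx(3) by simp
  have csplit: "card (?H t) = card (?H t \<inter> Bl) + card (?H t - Bl)" for t using card_Int_Diff[OF fin] .
  define I where "I k v \<longleftrightarrow> mw v = mw u \<and> mx v = mx u \<and> rx v = rx u \<and> (\<forall>i. i < 10 \<or> i = 12 \<or> i = 19 \<longrightarrow> rw v i = rw u i) \<and>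
    rw v 26 = k \<and> rw v 24 = card (?H k) \<and> rw v 25 = card (?H k \<inter> Bl)" for k and v :: mst
  have Ifr: "fr v" if "I k v" for k v by (rule fr_cong[OF u]) (use that in \<open>auto simp: I_def\<close>)
  have cond: "okb M unbalanced v \<and> (bv unbalanced v \<longleftrightarrow> int n < \<bar>imbalance n Bl (?H k)\<bar>)" if I: "I k v" for k v
  proof -
    let ?a = "(n - nb) * card (?H k \<inter> Bl)" and ?b = "nb * card (?H k - Bl)"
    have r: "rw v 6 = n" "rw v 8 = nb" "rw v 9 = n - nb" "rw v 24 - rw v 25 = card (?H k - Bl)" "rw v 25 = card (?H k \<inter> Bl)"
      using frD[OF Ifr[OF I]] I csplit[of k] unfolding I_def by auto
    \<comment> \<open>The products in the balance test are of quadratic size; this is where the word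
      bound has to admit \<open>N * N\<close>.\<close>
    have "?a \<le> N * N" "?b \<le> N * N"
      using cH[of k] csplit[of k] bound'(3) nb_Bl(3) by (auto intro!: mult_mono)
    then have "?a \<le> M" "?b \<le> M" "?a - ?b + (?b - ?a) \<le> M" using bound'(4) by linarith+
    moreover have "n < ?a - ?b + (?b - ?a) \<longleftrightarrow> int n < \<bar>int ?a - int ?b\<bar>" by linarith
    moreover have "int ?a - int ?b = imbalance n Bl (?H k)" unfolding imbalance_def nb_Bl(1) by simp
    ultimately show ?thesis using r unfolding unbalanced_def Let_def by simp
  qed
  have body: "runs M sweep_body v (real (clen sweep_body)) (I (Suc k))" if I: "I k v" and k: "k < T" for k v
  proof (rule runs_wp)
    have kn: "k < n" using k T by simp
    let ?q = "xs ! k"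
    note f = frD[OF Ifr[OF I]]
    have q: "mw v (N + lo + k) = ?q" "?q < N" "?q \<in> set cs"
      using I nth[OF kn] f(15)[OF kn] f(16)[OF kn] unfolding I_def by auto
    have Bq: "?q \<in> Bl \<longleftrightarrow> blue ?q" unfolding Bl_def using q by blast
    let ?v = "v\<lparr>rw := (rw v)(22 := ?q)\<rparr>"
    have bl: "okb M is_blue (?v\<lparr>rw := (rw ?v)(24 := c)\<rparr>)" "bv is_blue (?v\<lparr>rw := (rw ?v)(24 := c)\<rparr>) \<longleftrightarrow> blue ?q" for c
      using blueI[of "?v\<lparr>rw := (rw ?v)(24 := c)\<rparr>" ?q] q f(11) by auto
    have lf: "okb M is_left ?v" "bv is_left ?v \<longleftrightarrow> X ?q < x0" using leftI[of ?v ?q v x0] q f(1) I x0 unfolding I_def by auto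
    note S = swept_Suc[OF dx(1), of k X x0]
    have kl: "k < length xs" using kn dx by simp
    have vr: "rw v 24 = card (?H k)" "rw v 25 = card (?H k \<inter> Bl)" "rw v 26 = k" using I unfolding I_def by auto
    have ok: "N + lo + k \<le> M" "1 \<le> M" "Suc (card (?H k)) \<le> M" "Suc (card (?H k \<inter> Bl)) \<le> M" "Suc k \<le> M"
      using bound' range kn cH[of k] csplit[of k] by linarith+
    have J: "I (Suc k) (v\<lparr>rw := (rw v)(22 := ?q, 24 := a, 25 := b, 26 := Suc k)\<rparr>)"
      if "a = card (?H (Suc k))" "b = card (?H (Suc k) \<inter> Bl)" for a b using I that unfolding I_def by auto
    show "wp M sweep_body v (I (Suc k))"
    proof (cases "X ?q < x0")
      case True
      then have HS: "?H (Suc k) = ?H k - {?q}" "?q \<in> ?H k" using S[OF kl] by auto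
      have "card (?H (Suc k)) = card (?H k) - 1" unfolding HS(1) using HS(2) by (simp add: fin)
      moreover have "card (?H (Suc k) \<inter> Bl) = (if blue ?q then card (?H k \<inter> Bl) - 1 else card (?H k \<inter> Bl))"
      proof -
        have "?H (Suc k) \<inter> Bl = (?H k \<inter> Bl) - {?q}" unfolding HS(1) by blast
        then show ?thesis using HS(2) Bq fin[of k] by (auto simp: card_Diff_singleton_if)
      qed
      ultimately show ?thesis unfolding sweep_body_def using True lf bl[of "card (?H k) - 1"] q f(10) vr ok J by auto
    next
      case False
      then have HS: "?H (Suc k) = insert ?q (?H k)" "?q \<notin> ?H k" using S[OF kl] by auto
      have "card (?H (Suc k)) = Suc (card (?H k))" unfolding HS(1) using HS(2) by (simp add: fin)
      moreover have "card (?H (Suc k) \<inter> Bl) = (if blue ?q then Suc (card (?H k \<inter> Bl)) else card (?H k \<inter> Bl))"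
      proof -
        have "?H (Suc k) \<inter> Bl = (if blue ?q then insert ?q (?H k \<inter> Bl) else ?H k \<inter> Bl)" unfolding HS(1) using Bq by auto
        then show ?thesis using HS(2) fin[of k] by auto
      qed
      ultimately show ?thesis unfolding sweep_body_def using False lf bl[of "Suc (card (?H k))"] q f(10) vr ok J by auto
    qed
  qed simp
  have I0: "I 0 u" unfolding I_def using H by simp
  have "runs M (While unbalanced sweep_body) u (W * (real (clen sweep_body) + bcost unbalanced))
    (\<lambda>v. (\<exists>k. 0 \<le> k \<and> k \<le> T \<and> I k v) \<and> \<not> bv unbalanced v)"
  proof (rule runs_iter[where K = "real (clen sweep_body)"])
    show "okb M unbalanced v \<and> (bv unbalanced v \<longrightarrow> k < T)" if "I k v" "0 \<le> k" "k \<le> T" for k v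
      using cond[OF that(1)] T that(3) by (cases "k = T") auto
    let ?c = "real (clen sweep_body) + bcost unbalanced"
    have "real (T - 0) * ?c + bcost unbalanced \<le> (real n + 1) * ?c"
    proof -
      have "real (T - 0) * ?c \<le> real n * ?c" using T bcost_ge[of unbalanced] by (intro mult_right_mono) auto
      then show ?thesis by (simp add: algebra_simps)
    qed
    also have "\<dots> \<le> W * ?c" using bcost_ge[of unbalanced] by (intro n_le_W) auto
    finally show "real (T - 0) * ?c + bcost unbalanced \<le> W * ?c" .
  qed (use I0 body in auto)
  then show ?thesis
  proof (rule runs_conseq)
    fix v :: mst assume v: "(\<exists>k. 0 \<le> k \<and> k \<le> T \<and> I k v) \<and> \<not> bv unbalanced v"
    then obtain k where k: "k \<le> T" "I k v" by blast
    then have "\<bar>imbalance n Bl (?H k)\<bar> \<le> int n" using cond[of k v] v by linarith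
    then show "\<exists>t<n. fr v \<and> mw v = mw u \<and> mx v = mx u \<and> rx v = rx u \<and> rw v 26 = t \<and> rw v 24 = card (?H t) \<and>
       \<bar>imbalance n Bl (?H t)\<bar> \<le> int n" using k T Ifr[OF k(2)] by (intro exI[of _ k]) (auto simp: I_def)
  qed simp
qed

lemma sweep_then_cut_runs:
  assumes u: "fr u" and xs: "xs = seg (mw u) (N + lo) n" "sorted (map (angle x0 y0) xs)"
    and key: "\<And>p. p \<in> set xs \<Longrightarrow> mx u (2 * N + p) = angle x0 y0 p"
    and x0: "rx u 1 = x0" and H: "rw u 24 = card (swept X x0 xs 0)" "rw u 25 = card (swept X x0 xs 0 \<inter> Bl)" "rw u 26 = 0"
    and deep: "deep x0 y0"
  shows "runs M sweep_then_cut u (W * sweep_then_cut_cost) split_post"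
  unfolding sweep_then_cut_def sweep_then_cut_cost_def
proof (rule runs_Seq_W[OF runs_conseq[OF sweep_runs[OF u xs(1) x0 H] order_refl] order_refl])
  fix v :: mst assume "\<exists>t<n. fr v \<and> mw v = mw u \<and> mx v = mx u \<and> rx v = rx u \<and> rw v 26 = t \<and> rw v 24 = card (swept X x0 xs t) \<and>
       \<bar>imbalance n Bl (swept X x0 xs t)\<bar> \<le> int n"
  then obtain t where t: "t < n" "fr v" "mw v = mw u" "mx v = mx u" "rw v 26 = t" "rw v 24 = card (swept X x0 xs t)"
       "\<bar>imbalance n Bl (swept X x0 xs t)\<bar> \<le> int n" by blast
  have "xs ! t \<in> set xs" using t(1) xs(1) by (intro nth_mem) simp
  then show "runs M cut_at_slope v (W * cut_at_slope_cost) split_post"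
    using cut_at_slope_runs[of v xs x0 y0 t] t xs key deep by simp
qed

lemma count_cell:
  assumes u: "fr u" and r: "rw u 20 = N + lo" "rw u 21 = N + lo + n"
    and val: "\<And>v p. rw v 22 = p \<Longrightarrow> p < N \<Longrightarrow> mx v = mx u \<Longrightarrow> rx v = rx u \<Longrightarrow> rw v 0 = length rs \<Longrightarrow>
      okb M b1 v \<and> okb M b2 v \<and> (bv b1 v \<and> bv b2 v \<longleftrightarrow> P p)"
  shows "runs M (count b1 b2) u (W * count_cost b1 b2) (\<lambda>v. fr v \<and> rw v 23 = card {p \<in> set cs. P p} \<and>
     mx v = mx u \<and> mw v = mw u \<and> rx v = rx u \<and> rw v 24 = rw u 24 \<and> rw v 25 = rw u 25)"
proof (rule runs_conseq[OF count_runs[where a = "N + lo" and m = n and P = P and M = M]])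
  show "N + lo + n + 1 \<le> M" using range bound' by linarith
  show "(real n + 1) * count_cost b1 b2 \<le> W * count_cost b1 b2"
    by (rule n_le_W) (use bcost_ge[of in_range] in \<open>auto simp: count_cost_def\<close>)
  fix v :: mst assume v: "rw v 23 = length (filter P (seg (mw u) (N + lo) n)) \<and>
     mx v = mx u \<and> mw v = mw u \<and> rx v = rx u \<and> (\<forall>j. j \<notin> {20, 22, 23} \<longrightarrow> rw v j = rw u j)"
  have "fr v" by (rule fr_cong[OF u]) (use v in auto)
  moreover have "length (filter P (seg (mw u) (N + lo) n)) = card {p \<in> set cs. P p}"
    using distinct_card[OF distinct_filter[OF frD(13)[OF u], of P]] frD(14)[OF u] by simp
  ultimately show "fr v \<and> rw v 23 = card {p \<in> set cs. P p} \<and> mx v = mx u \<and> mw v = mw u \<and> rx v = rx u \<and> rw v 24 = rw u 24 \<and> rw v 25 = rw u 25"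
    using v by simp
next
  fix v :: mst and i assume "i < n" "rw v 22 = mw u (N + lo + i)" "\<And>j. j \<noteq> 20 \<Longrightarrow> j \<noteq> 22 \<Longrightarrow> j \<noteq> 23 \<Longrightarrow> rw v j = rw u j"
    "mw v = mw u" "rx v = rx u" "mx v = mx u"
  then show "okb M b1 v \<and> okb M b2 v \<and> (bv b1 v \<and> bv b2 v \<longleftrightarrow> P (mw u (N + lo + i)))"
    using val[of v "mw u (N + lo + i)"] frD(11,15)[OF u] by simp
qed (use r in auto)

lemma cut_about_center_runs:
  assumes u: "fr u" and x0: "rx u 1 = x0" "rx u 3 = y0" and deep: "deep x0 y0"
  shows "runs M cut_about_center u (W * cut_about_center_cost) split_post"
proof -
  have okn: "N + lo + n \<le> M" using range bound' by linarith
  have S0: "swept X x0 xs 0 = {p \<in> set xs. X p < x0}" for xs unfolding swept_def by auto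
  have last: "runs M (SetW 26 (WC 0) ;; sweep_then_cut) v (W * (real (clen (SetW 26 (WC 0))) + sweep_then_cut_cost)) split_post"
    if v: "fr v" "sorted (map (angle x0 y0) (seg (mw v) (N + lo) n))" "\<forall>p\<in>set (seg (mw v) (N + lo) n). mx v (2 * N + p) = angle x0 y0 p"
      "rx v 1 = x0" "rw v 24 = card {p \<in> set cs. X p < x0}" "rw v 25 = card {p \<in> set cs. X p < x0 \<and> blue p}" for v
  proof (rule runs_Seq_wp_W[OF _ order_refl])
    let ?v = "v\<lparr>rw := (rw v)(26 := 0)\<rparr>"
    have f: "fr ?v" by (rule fr_cong[OF v(1)]) auto
    have "{p \<in> set cs. X p < x0} \<inter> Bl = {p \<in> set cs. X p < x0 \<and> blue p}" unfolding Bl_def by blast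
    then have "runs M sweep_then_cut ?v (W * sweep_then_cut_cost) split_post"
      using sweep_then_cut_runs[OF f refl, of x0 y0] v deep S0 frD(14)[OF v(1)] by simp
    then show "wp M (SetW 26 (WC 0)) v (\<lambda>v. runs M sweep_then_cut v (W * sweep_then_cut_cost) split_post)" by simp
  qed
  have srt: "runs M (sortby (WR 19) (WR 6) slope_at_center ;; SetW 26 (WC 0) ;; sweep_then_cut) v
      (W * (sortby_cost (WR 19) (WR 6) slope_at_center + (real (clen (SetW 26 (WC 0))) + sweep_then_cut_cost))) split_post"
    if v: "fr v" "rx v = rx u" "rw v 24 = card {p \<in> set cs. X p < x0}" "rw v 25 = card {p \<in> set cs. X p < x0 \<and> blue p}" for v
  proof (rule runs_Seq_W[OF runs_conseq[OF sortby_cell[of v "WR 19" 0 "WR 6" n slope_at_center "angle x0 y0"] order_refl last] order_refl])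
    fix w :: mst and i assume h: "i < n" "rw w 22 = mw v (N + lo + 0 + i)" "rx w = rx v" "\<And>j. j < 2 * N \<Longrightarrow> mx w j = mx v j"
    have "mw v (N + lo + i) < N" using frD(15)[OF v(1) h(1)] .
    then show "okr M slope_at_center w \<and> rv slope_at_center w = angle x0 y0 (mw v (N + lo + 0 + i))"
      using coords[of w "mw v (N + lo + i)" v] h frD(1)[OF v(1)] v(2) x0 unfolding slope_at_center_def angle_def by simp
  qed (use v frD[OF v(1)] x0 in auto)
  have cnt2: "runs M (count is_left is_blue ;; SetW 25 (WR 23) ;; sortby (WR 19) (WR 6) slope_at_center ;; SetW 26 (WC 0) ;; sweep_then_cut) v
      (W * (count_cost is_left is_blue + (real (clen (SetW 25 (WR 23))) + (sortby_cost (WR 19) (WR 6) slope_at_center + (real (clen (SetW 26 (WC 0))) + sweep_then_cut_cost))))) split_post"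
    if v: "fr v" "rx v = rx u" "rw v 24 = card {p \<in> set cs. X p < x0}" "rw v 20 = N + lo" "rw v 21 = N + lo + n" for v
  proof (rule runs_Seq_W[OF runs_conseq[OF count_cell[of v is_left is_blue "\<lambda>p. X p < x0 \<and> blue p"] order_refl] order_refl])
    fix w :: mst and p assume h: "rw w 22 = p" "p < N" "mx w = mx v" "rx w = rx v" "rw w 0 = length rs"
    then show "okb M is_left w \<and> okb M is_blue w \<and> (bv is_left w \<and> bv is_blue w \<longleftrightarrow> X p < x0 \<and> blue p)"
      using leftI[of w p v x0] blueI[of w p] frD(1)[OF v(1)] v(2) x0 by simp
  next
    fix w :: mst assume w: "fr w \<and> rw w 23 = card {p \<in> set cs. X p < x0 \<and> blue p} \<and>
     mx w = mx v \<and> mw w = mw v \<and> rx w = rx v \<and> rw w 24 = rw v 24 \<and> rw w 25 = rw v 25"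
    have f: "fr (w\<lparr>rw := (rw w)(25 := rw w 23)\<rparr>)" by (rule fr_cong[of w]) (use w in auto)
    show "runs M (SetW 25 (WR 23) ;; sortby (WR 19) (WR 6) slope_at_center ;; SetW 26 (WC 0) ;; sweep_then_cut) w
      (W * (real (clen (SetW 25 (WR 23))) + (sortby_cost (WR 19) (WR 6) slope_at_center + (real (clen (SetW 26 (WC 0))) + sweep_then_cut_cost)))) split_post"
      by (rule runs_Seq_wp_W[OF _ order_refl]) (use f w v srt in simp)
  qed (use v in auto)
  have cnt1: "runs M (count is_left is_left ;; (SetW 24 (WR 23) ;; scan) ;; count is_left is_blue ;; SetW 25 (WR 23) ;; sortby (WR 19) (WR 6) slope_at_center ;; SetW 26 (WC 0) ;; sweep_then_cut) v
      (W * (count_cost is_left is_left + (real (clen (SetW 24 (WR 23) ;; scan)) + (count_cost is_left is_blue + (real (clen (SetW 25 (WR 23))) + (sortby_cost (WR 19) (WR 6) slope_at_center + (real (clen (SetW 26 (WC 0))) + sweep_then_cut_cost))))))) split_post"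
    if v: "fr v" "rx v = rx u" "rw v 20 = N + lo" "rw v 21 = N + lo + n" for v
  proof (rule runs_Seq_W[OF runs_conseq[OF count_cell[of v is_left is_left "\<lambda>p. X p < x0"] order_refl] order_refl])
    fix w :: mst and p assume h: "rw w 22 = p" "p < N" "mx w = mx v" "rx w = rx v" "rw w 0 = length rs"
    then show "okb M is_left w \<and> okb M is_left w \<and> (bv is_left w \<and> bv is_left w \<longleftrightarrow> X p < x0)"
      using leftI[of w p v x0] frD(1)[OF v(1)] v(2) x0 by simp
  next
    fix w :: mst assume w: "fr w \<and> rw w 23 = card {p \<in> set cs. X p < x0} \<and>
     mx w = mx v \<and> mw w = mw v \<and> rx w = rx v \<and> rw w 24 = rw v 24 \<and> rw w 25 = rw v 25"
    have f: "fr (w\<lparr>rw := (rw w)(24 := rw w 23, 20 := N + lo, 21 := N + lo + n)\<rparr>)" by (rule fr_cong[of w]) (use w in auto)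
    show "runs M ((SetW 24 (WR 23) ;; scan) ;; count is_left is_blue ;; SetW 25 (WR 23) ;; sortby (WR 19) (WR 6) slope_at_center ;; SetW 26 (WC 0) ;; sweep_then_cut) w
      (W * (real (clen (SetW 24 (WR 23) ;; scan)) + (count_cost is_left is_blue + (real (clen (SetW 25 (WR 23))) + (sortby_cost (WR 19) (WR 6) slope_at_center + (real (clen (SetW 26 (WC 0))) + sweep_then_cut_cost)))))) split_post"
      by (rule runs_Seq_wp_W[OF _ order_refl]) (use f w v cnt2 frD[of w] okn in \<open>simp add: scan_def\<close>)
  qed (use v in auto)
  have f: "fr (u\<lparr>rw := (rw u)(20 := N + lo, 21 := N + lo + n)\<rparr>)" by (rule fr_cong[OF u]) auto
  show ?thesis unfolding cut_about_center_def cut_about_center_cost_def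
    by (rule runs_Seq_wp_W[OF _ order_refl]) (use f cnt1 frD[OF u] okn in \<open>simp add: scan_def\<close>)
qed

end

definition cut_halved :: com where
  "cut_halved = sortby (WR 19) (WR 7) slope_to_mate ;; SetR 2 (key_at (wadd (WR 19) (WB WDiv (WR 7) (WC 2)))) ;; cut_sheared"

definition cut_halved_cost :: real where
  "cut_halved_cost = sortby_cost (WR 19) (WR 7) slope_to_mate + (real (clen (SetR 2 (key_at (wadd (WR 19) (WB WDiv (WR 7) (WC 2)))))) + cut_sheared_cost)"

definition middle_x :: rexp where
  "middle_x = (let q = WM (wadd (WR 19) (WR 7)) in RM (wadd q q))"

definition cut_cell :: com where
  "cut_cell = sortby (WR 19) (WR 6) px ;; SetR 1 middle_x ;; cut_halved"

definition cut_cell_cost :: real where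
  "cut_cell_cost = sortby_cost (WR 19) (WR 6) px + (real (clen (SetR 1 middle_x)) + cut_halved_cost)"

definition split_init :: com where
  "split_init = SetW 6 (wsub (WR 4) (WR 3)) ;; SetW 7 (WB WDiv (WR 6) (WC 2)) ;; SetW 19 (wadd (WR 2) (WR 3)) ;; scan"

definition split :: com where
  "split = split_init ;; count is_blue is_blue ;; (SetW 8 (WR 23) ;; SetW 9 (wsub (WR 6) (WR 8))) ;; cut_cell"

definition split_cost :: real where
  "split_cost = real (clen split_init) + (count_cost is_blue is_blue + (real (clen (SetW 8 (WR 23) ;; SetW 9 (wsub (WR 6) (WR 8)))) + cut_cell_cost))"

context split_cell
begin

lemma h_facts: "h \<le> n" "h \<le> n - h" "0 < h" "n \<le> N" "lo + n \<le> N"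
  unfolding h_def using range unfolding big_def by linarith+

lemma shear_val:
  assumes "fr v" "i < n" "rw w 22 = mw v (N + lo + i)" "rx w = rx v" "\<And>j. j < 2 * N \<Longrightarrow> mx w j = mx v j" "rx v 2 = \<mu>"
  shows "okr M (shear 2) w \<and> rv (shear 2) w = Y (mw v (N + lo + i)) - \<mu> * X (mw v (N + lo + i))"
  using coords[of w "mw v (N + lo + i)" v] assms frD(1,15)[OF assms(1)] unfolding shear_def by simp

lemma key_at_ok:
  assumes "fr v" "i < n" "okw M a v" "wv a v = N + lo + i"
  shows "okr M (key_at a) v" "rv (key_at a) v = mx v (2 * N + mw v (N + lo + i))"
proof -
  have "N + N + mw v (N + lo + i) \<le> M" "N + N \<le> M" using frD(15)[OF assms(1,2)] bound' by linarith+
  then show "okr M (key_at a) v" "rv (key_at a) v = mx v (2 * N + mw v (N + lo + i))"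
    using assms frD(2)[OF assms(1)] unfolding key_at_def by (simp_all add: mult_2)
qed

text \<open>The quartile values are known only when both halves are sorted, so \<open>ready\<close>
  asks for a deep center for all values with the quartile property. The geometry can thus be
  supplied by \<open>cut_halved_runs\<close>. In both halves the quartile sits at index
  \<open>h div 4\<close>, relative to \<open>h\<close> and not to the possibly larger right
  half.\<close>

lemma cut_sheared_runs:
  fixes \<mu> x0 :: real
  defines "\<eta> \<equiv> \<lambda>p. Y p - \<mu> * X p"
  assumes u: "fr u" and x0: "rx u 1 = x0" "rx u 2 = \<mu>"
    and LR: "Ls = set (seg (mw u) (N + lo) h)" "Rs = set (seg (mw u) (N + lo + h) (n - h))"
    and ready: "\<And>qL qR. h \<le> 4 * card {p \<in> Ls. \<eta> p \<le> qL} \<Longrightarrow> 4 * card {p \<in> Ls. \<eta> p < qL} \<le> h \<Longrightarrow>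
      h \<le> 4 * card {p \<in> Rs. \<eta> p \<le> qR} \<Longrightarrow> 4 * card {p \<in> Rs. \<eta> p < qR} \<le> h \<Longrightarrow> deep x0 (max qL qR + \<mu> * x0)"
  shows "runs M cut_sheared u (W * cut_sheared_cost) split_post"
proof -
  have quart: "h \<le> 4 * card {p \<in> set xs. \<eta> p \<le> \<eta> (xs ! (h div 4))}" "4 * card {p \<in> set xs. \<eta> p < \<eta> (xs ! (h div 4))} \<le> h"
    if "distinct xs" "sorted (map \<eta> xs)" "h \<le> length xs" for xs
    using sorted_counts[OF that(1,2), of "h div 4"] that(3) h_facts by linarith+
  have dseg: "distinct (seg (mw v) (N + lo) h)" "distinct (seg (mw v) (N + lo + h) (n - h))" if "fr v" for v
    using frD(13)[OF that] take_seg[OF h_facts(1), of "mw v" "N + lo"] drop_seg[OF h_facts(1), of "mw v" "N + lo"] by simp_all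
  define qi where "qi = h div 4"
  have qi: "qi < h" "qi < n - h" "qi < n" "h + qi < n" unfolding qi_def using h_facts by linarith+
  have okd: "4 \<le> M" "N + lo + qi \<le> M" "N + lo + h \<le> M" "N + lo + h + qi \<le> M" using bound' qi h_facts unfolding big_def by linarith+
  have fin: "runs M (set_center ;; cut_about_center) v (W * (real (clen set_center) + cut_about_center_cost)) split_post"
    if v: "fr v" "sorted (map \<eta> (seg (mw v) (N + lo + h) (n - h)))" "set (seg (mw v) (N + lo + h) (n - h)) = Rs"
      "\<forall>p\<in>Rs. mx v (2 * N + p) = \<eta> p" "rx v 1 = x0" "rx v 2 = \<mu>" "rx v 3 = qL"
      and qL: "h \<le> 4 * card {p \<in> Ls. \<eta> p \<le> qL}" "4 * card {p \<in> Ls. \<eta> p < qL} \<le> h" for v qL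
  proof (rule runs_Seq_wp_W[OF _ order_refl])
    let ?ys = "seg (mw v) (N + lo + h) (n - h)"
    define qR where "qR = \<eta> (?ys ! qi)"
    have "h \<le> 4 * card {p \<in> Rs. \<eta> p \<le> qR}" "4 * card {p \<in> Rs. \<eta> p < qR} \<le> h"
      using quart[OF dseg(2)[OF v(1)] v(2)] h_facts(2) v(3) unfolding qR_def qi_def by simp_all
    then have deep: "deep x0 (max qL qR + \<mu> * x0)" using ready qL by blast
    have y: "?ys ! qi = mw v (N + lo + (h + qi))" using qi by (simp add: add.assoc)
    have "?ys ! qi \<in> Rs" using v(3) qi by (metis length_seg nth_mem)
    then have kq: "mx v (2 * N + mw v (N + lo + (h + qi))) = qR" using v(4) y unfolding qR_def by metis
    have rr: "okr M (lower_quartile (wadd (WR 19) (WR 7))) v" "rv (lower_quartile (wadd (WR 19) (WR 7))) v = qR"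
      using key_at_ok[OF v(1) qi(4), of "wadd (wadd (WR 19) (WR 7)) (WB WDiv (WR 7) (WC 4))"] frD[OF v(1)] okd kq
      unfolding lower_quartile_def qi_def by (simp_all add: add.assoc)
    have r4: "runs M cut_about_center w (W * cut_about_center_cost) split_post" if "w = v\<lparr>rx := f\<rparr>" "f 1 = x0" "f 3 = max qL qR + \<mu> * x0" for w f
    proof (rule cut_about_center_runs)
      show "fr w" by (rule fr_cong[OF v(1)]) (use that in auto)
    qed (use that deep in auto)
    show "wp M set_center v (\<lambda>w. runs M cut_about_center w (W * cut_about_center_cost) split_post)"
      unfolding set_center_def using rr v(5,6,7) by (auto intro!: r4 simp: max_def)
  qed
  have srt2: "runs M (sortby (wadd (WR 19) (WR 7)) (wsub (WR 6) (WR 7)) (shear 2) ;; set_center ;; cut_about_center) v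
      (W * (sortby_cost (wadd (WR 19) (WR 7)) (wsub (WR 6) (WR 7)) (shear 2) + (real (clen set_center) + cut_about_center_cost))) split_post"
    if v: "fr v" "set (seg (mw v) (N + lo + h) (n - h)) = Rs" "rx v 1 = x0" "rx v 2 = \<mu>" "rx v 3 = qL"
      and qL: "h \<le> 4 * card {p \<in> Ls. \<eta> p \<le> qL}" "4 * card {p \<in> Ls. \<eta> p < qL} \<le> h" for v qL
  proof (rule runs_Seq_W[OF runs_conseq[OF sortby_cell[of v "wadd (WR 19) (WR 7)" h "wsub (WR 6) (WR 7)" "n - h" "shear 2" \<eta>] order_refl] order_refl])
    fix w :: mst assume w: "fr w \<and> sorted (map \<eta> (seg (mw w) (N + lo + h) (n - h))) \<and>
     mset (seg (mw w) (N + lo + h) (n - h)) = mset (seg (mw v) (N + lo + h) (n - h)) \<and>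
     (\<forall>p\<in>set (seg (mw w) (N + lo + h) (n - h)). mx w (2 * N + p) = \<eta> p) \<and> rx w = rx v \<and>
     (\<forall>i. (i < N + lo + h \<or> N + lo + h + (n - h) \<le> i) \<and> i < 2 * N \<longrightarrow> mw w i = mw v i) \<and>
     rw w 24 = rw v 24 \<and> rw w 25 = rw v 25 \<and> rw w 26 = rw v 26"
    have "set (seg (mw w) (N + lo + h) (n - h)) = Rs" using w v(2) by (metis mset_eq_setD)
    then show "runs M (set_center ;; cut_about_center) w (W * (real (clen set_center) + cut_about_center_cost)) split_post"
      using fin[of w qL] w v qL by simp
  next
    fix w :: mst and i assume h: "i < n - h" "rw w 22 = mw v (N + lo + h + i)" "rx w = rx v" "\<And>j. j < 2 * N \<Longrightarrow> mx w j = mx v j"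
    then show "okr M (shear 2) w \<and> rv (shear 2) w = \<eta> (mw v (N + lo + h + i))"
      using shear_val[OF v(1), of "h + i" w \<mu>] v(4) unfolding \<eta>_def by (simp add: add.assoc)
  qed (use v frD[OF v(1)] okd h_facts in auto)
  show ?thesis unfolding cut_sheared_def cut_sheared_cost_def
  proof (rule runs_Seq_W[OF runs_conseq[OF sortby_cell[of u "WR 19" 0 "WR 7" h "shear 2" \<eta>] order_refl] order_refl])
    fix w :: mst assume w: "fr w \<and> sorted (map \<eta> (seg (mw w) (N + lo + 0) h)) \<and>
     mset (seg (mw w) (N + lo + 0) h) = mset (seg (mw u) (N + lo + 0) h) \<and>
     (\<forall>p\<in>set (seg (mw w) (N + lo + 0) h). mx w (2 * N + p) = \<eta> p) \<and> rx w = rx u \<and>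
     (\<forall>i. (i < N + lo + 0 \<or> N + lo + 0 + h \<le> i) \<and> i < 2 * N \<longrightarrow> mw w i = mw u i) \<and>
     rw w 24 = rw u 24 \<and> rw w 25 = rw u 25 \<and> rw w 26 = rw u 26"
    have fw: "fr w" using w by blast
    let ?xs = "seg (mw w) (N + lo) h"
    have sx: "set ?xs = Ls" using w LR(1) by (metis add_0_right mset_eq_setD)
    have sr: "seg (mw w) (N + lo + h) (n - h) = seg (mw u) (N + lo + h) (n - h)"
      by (rule seg_cong) (use w h_facts in auto)
    define qL where "qL = \<eta> (?xs ! qi)"
    have "sorted (map \<eta> ?xs)" using w by simp
    then have q: "h \<le> 4 * card {p \<in> Ls. \<eta> p \<le> qL}" "4 * card {p \<in> Ls. \<eta> p < qL} \<le> h"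
      using quart[OF dseg(1)[OF fw]] sx unfolding qL_def qi_def by simp_all
    have "?xs ! qi \<in> Ls" using sx qi by (metis length_seg nth_mem)
    then have kq: "mx w (2 * N + mw w (N + lo + qi)) = qL" using w sx qi unfolding qL_def by simp
    have rr: "okr M (lower_quartile (WR 19)) w" "rv (lower_quartile (WR 19)) w = qL"
      using key_at_ok[OF fw qi(3), of "wadd (WR 19) (WB WDiv (WR 7) (WC 4))"] frD[OF fw] okd kq
      unfolding lower_quartile_def qi_def by simp_all
    let ?w = "w\<lparr>rx := (rx w)(3 := qL)\<rparr>"
    have f: "fr ?w" by (rule fr_cong[OF fw]) auto
    show "runs M (SetR 3 (lower_quartile (WR 19)) ;; sortby (wadd (WR 19) (WR 7)) (wsub (WR 6) (WR 7)) (shear 2) ;; set_center ;; cut_about_center) w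
      (W * (real (clen (SetR 3 (lower_quartile (WR 19)))) + (sortby_cost (wadd (WR 19) (WR 7)) (wsub (WR 6) (WR 7)) (shear 2) + (real (clen set_center) + cut_about_center_cost)))) split_post"
      by (rule runs_Seq_wp_W[OF _ order_refl]) (use rr srt2[OF f, of qL] q sr LR(2) w x0 in simp)
  next
    fix w :: mst and i assume h: "i < h" "rw w 22 = mw u (N + lo + 0 + i)" "rx w = rx u" "\<And>j. j < 2 * N \<Longrightarrow> mx w j = mx u j"
    then show "okr M (shear 2) w \<and> rv (shear 2) w = \<eta> (mw u (N + lo + 0 + i))"
      using shear_val[OF u, of i w \<mu>] x0 h_facts unfolding \<eta>_def by simp
  qed (use u frD[OF u] h_facts in auto)
qed

lemma cut_halved_runs:
  assumes u: "fr u" and xs: "xs = seg (mw u) (N + lo) n" "sorted (map X xs)" and x0: "rx u 1 = x0" "x0 = X (xs ! h)"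
  shows "runs M cut_halved u (W * cut_halved_cost) split_post"
proof -
  have dx: "distinct xs" "set xs = set cs" "length xs = n" using frD[OF u] xs(1) by auto
  define Ls Rs where "Ls = set (take h xs)" and "Rs = set (drop h xs)"
  have LR: "Ls = set (seg (mw u) (N + lo) h)" "Rs = set (seg (mw u) (N + lo + h) (n - h))"
    unfolding Ls_def Rs_def xs(1) using take_seg[OF h_facts(1)] drop_seg[OF h_facts(1)] by metis+
  \<comment> \<open>In the order by abscissa the point at position \<open>i\<close> of the left half
    is paired with the one at position \<open>h + i\<close>. The pairing is fixed in terms of this
    order, since later sorts permute the halves.\<close>
  define idx where "idx p = (THE i. i < n \<and> xs ! i = p)" for p
  have idx: "idx (xs ! i) = i" if "i < n" for i unfolding idx_def
    by (rule the_equality) (use that dx in \<open>auto simp: nth_eq_iff_index_eq\<close>)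
  define mate where "mate p = xs ! (h + idx p)" for p
  define \<sigma> where "\<sigma> p = (Y (mate p) - Y p) / (X (mate p) - X p)" for p
  have nthL: "\<exists>i<h. p = xs ! i" if "p \<in> Ls" for p using that h_facts dx unfolding Ls_def by (auto simp: in_set_conv_nth)
  have nthR: "\<exists>i. h \<le> i \<and> i < n \<and> p = xs ! i" if pR: "p \<in> Rs" for p
  proof -
    obtain i where "i < n - h" "p = xs ! (h + i)" using pR dx unfolding Rs_def by (auto simp: in_set_conv_nth)
    then show ?thesis by (intro exI[of _ "h + i"]) auto
  qed
  have mono: "X (xs ! a) \<le> X (xs ! b)" if "a \<le> b" "b < n" for a b
    using xs(2) dx that by (simp add: sorted_iff_nth_mono)
  have un: "Ls \<union> Rs = set cs" unfolding Ls_def Rs_def using dx(2) by (metis append_take_drop_id set_append)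
  have cL: "card Ls = h" unfolding Ls_def using distinct_card[OF distinct_take[OF dx(1)]] dx(3) h_facts by simp
  have cR: "card Rs = n - h" unfolding Rs_def using distinct_card[OF distinct_drop[OF dx(1)]] dx(3) by simp
  have xL: "X p \<le> x0" if "p \<in> Ls" for p using nthL[OF that] mono[of _ h] h_facts unfolding x0(2) by auto
  have xR: "x0 \<le> X p" if "p \<in> Rs" for p using nthR[OF that] mono[of h] unfolding x0(2) by auto
  have inj: "inj_on mate Ls"
  proof (rule inj_onI)
    fix p q assume "p \<in> Ls" "q \<in> Ls" "mate p = mate q"
    then obtain i j where ij: "i < h" "j < h" "p = xs ! i" "q = xs ! j" using nthL by metis
    have hh: "i < n" "j < n" "h + i < n" "h + j < n" using ij h_facts by linarith+
    then have "xs ! (h + i) = xs ! (h + j)" using \<open>mate p = mate q\<close> ij idx unfolding mate_def by simp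
    then have "i = j" using hh dx by (auto simp: nth_eq_iff_index_eq)
    then show "p = q" using ij by simp
  qed
  have mR: "mate ` Ls \<subseteq> Rs"
  proof
    fix q assume "q \<in> mate ` Ls"
    then obtain i where i: "i < h" "q = mate (xs ! i)" using nthL by blast
    have "i < n" "i < n - h" using i h_facts by linarith+
    then have "q = drop h xs ! i" using i idx dx h_facts unfolding mate_def by simp
    then show "q \<in> Rs" unfolding Rs_def using \<open>i < n - h\<close> dx by (auto simp: in_set_conv_nth)
  qed
  have Zc: "card {p \<in> Ls. X p = x0} \<le> 2" by (rule card_X_level) (use un cs(3) in blast)
  have mid: "h div 2 < h" "h div 2 < n" using h_facts by linarith+
  have okd: "2 \<le> M" "N + lo + h div 2 \<le> M" using bound' mid h_facts unfolding big_def by linarith+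
  show ?thesis unfolding cut_halved_def cut_halved_cost_def
  proof (rule runs_Seq_W[OF runs_conseq[OF sortby_cell[of u "WR 19" 0 "WR 7" h slope_to_mate \<sigma>] order_refl] order_refl])
    fix w :: mst assume w: "fr w \<and> sorted (map \<sigma> (seg (mw w) (N + lo + 0) h)) \<and>
     mset (seg (mw w) (N + lo + 0) h) = mset (seg (mw u) (N + lo + 0) h) \<and>
     (\<forall>p\<in>set (seg (mw w) (N + lo + 0) h). mx w (2 * N + p) = \<sigma> p) \<and> rx w = rx u \<and>
     (\<forall>i. (i < N + lo + 0 \<or> N + lo + 0 + h \<le> i) \<and> i < 2 * N \<longrightarrow> mw w i = mw u i) \<and>
     rw w 24 = rw u 24 \<and> rw w 25 = rw u 25 \<and> rw w 26 = rw u 26"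
    have fw: "fr w" using w by blast
    let ?ys = "seg (mw w) (N + lo) h"
    have sx: "set ?ys = Ls" using w LR(1) by (metis add_0_right mset_eq_setD)
    have sr: "seg (mw w) (N + lo + h) (n - h) = seg (mw u) (N + lo + h) (n - h)"
      by (rule seg_cong) (use w h_facts in auto)
    have dy: "distinct ?ys" using frD(13)[OF fw] take_seg[OF h_facts(1), of "mw w" "N + lo"] by simp
    define \<mu> where "\<mu> = \<sigma> (?ys ! (h div 2))"
    have "sorted (map \<sigma> ?ys)" using w by simp
    from sorted_counts(1,2)[OF dy this, of "h div 2"]
    \<comment> \<open>Register 2 gets the median slope. Both non-strict sides contain at least half
      of the pairs, also when slopes coincide.\<close>
    have sl: "h \<le> 2 * card {p \<in> Ls. \<sigma> p \<le> \<mu>}" "h \<le> 2 * card {p \<in> Ls. \<mu> \<le> \<sigma> p}"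
      using mid sx unfolding \<mu>_def by simp_all
    have kq: "mx w (2 * N + mw w (N + lo + h div 2)) = \<mu>"
    proof -
      have "?ys ! (h div 2) \<in> Ls" using sx mid by (metis length_seg nth_mem)
      then show ?thesis using w sx mid unfolding \<mu>_def by simp
    qed
    let ?w = "w\<lparr>rx := (rx w)(2 := \<mu>)\<rparr>"
    have f: "fr ?w" by (rule fr_cong[OF fw]) auto
    have "runs M cut_sheared ?w (W * cut_sheared_cost) split_post"
    proof (rule cut_sheared_runs[OF f, of x0 \<mu> Ls Rs])
      fix qL qR
      assume q: "h \<le> 4 * card {p \<in> Ls. Y p - \<mu> * X p \<le> qL}" "4 * card {p \<in> Ls. Y p - \<mu> * X p < qL} \<le> h"
        "h \<le> 4 * card {p \<in> Rs. Y p - \<mu> * X p \<le> qR}" "4 * card {p \<in> Rs. Y p - \<mu> * X p < qR} \<le> h"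
      have fin: "finite Ls" "finite Rs" unfolding Ls_def Rs_def by simp_all
      have cR': "h \<le> card Rs" using cR h_facts by simp
      note Q = quadrants[OF fin cL cR' inj mR xL xR Zc sl[unfolded \<sigma>_def] refl q refl]
      have "h \<le> 4 * card {p \<in> set cs. Y p - s * X p \<le> max qL qR + \<mu> * x0 - s * x0} + 8 \<and>
        h \<le> 4 * card {p \<in> set cs. max qL qR + \<mu> * x0 - s * x0 \<le> Y p - s * X p} + 8" for s
        using halfplane_depth[OF fin refl xL xR Q, of s] unfolding un by blast
      then show "deep x0 (max qL qR + \<mu> * x0)" unfolding deep_def by blast
    qed (use w x0 sx sr LR in auto)
    then show "runs M (SetR 2 (key_at (wadd (WR 19) (WB WDiv (WR 7) (WC 2)))) ;; cut_sheared) w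
        (W * (real (clen (SetR 2 (key_at (wadd (WR 19) (WB WDiv (WR 7) (WC 2)))))) + cut_sheared_cost)) split_post"
      by (intro runs_Seq_wp_W[OF _ order_refl])
        (use key_at_ok[OF fw mid(2), of "wadd (WR 19) (WB WDiv (WR 7) (WC 2))"] frD[OF fw] okd kq in simp)
  next
    fix w :: mst and i assume h: "i < h" "rw w 20 = N + lo + 0 + i" "rw w 22 = mw u (N + lo + 0 + i)" "mw w = mw u"
      "rx w = rx u" "\<And>j. j < 2 * N \<Longrightarrow> mx w j = mx u j" "\<And>j. j \<notin> {10, 11, 20, 21, 22} \<Longrightarrow> rw w j = rw u j"
    let ?p = "xs ! i" and ?q = "xs ! (h + i)"
    have i: "i < n" "h + i < n" using h(1) h_facts by linarith+
    have p: "mw u (N + lo + i) = ?p" "mw u (N + lo + (h + i)) = ?q" using xs(1) i by simp_all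
    have pN: "?p < N" "?q < N" using frD(15)[OF u i(1)] frD(15)[OF u i(2)] p by simp_all
    have ad: "rw w 20 + rw w 7 = N + lo + (h + i)" using h frD(7)[OF u] by simp
    have m: "mate ?p = ?q" unfolding mate_def using idx i by simp
    have "2 * ?q + 1 < 2 * N" using pN by linarith
    then have "mx w (?q + ?q) = X ?q" "mx w (Suc (?q + ?q)) = Y ?q" using h(6) frD(1)[OF u] pN unfolding base_def by (simp_all flip: mult_2)
    moreover have "N + lo + i + h = N + lo + (h + i)" by simp
    then have "mw u (N + lo + i + h) = ?q" using p(2) by metis
    moreover have "?q + ?q \<le> M" "Suc (?q + ?q) \<le> M" "N + lo + i + h \<le> M" "1 \<le> M" using pN bound' i h_facts by linarith+
    ultimately show "okr M slope_to_mate w \<and> rv slope_to_mate w = \<sigma> (mw u (N + lo + 0 + i))"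
      using coords[of w ?p u] h p(1) pN m frD(1,7)[OF u] unfolding slope_to_mate_def \<sigma>_def Let_def by simp
  qed (use u frD[OF u] h_facts in auto)
qed

lemma cut_cell_runs:
  assumes u: "fr u"
  shows "runs M cut_cell u (W * cut_cell_cost) split_post"
  unfolding cut_cell_def cut_cell_cost_def
proof (rule runs_Seq_W[OF runs_conseq[OF sortby_cell[of u "WR 19" 0 "WR 6" n px X] order_refl] order_refl])
  fix w :: mst assume w: "fr w \<and> sorted (map X (seg (mw w) (N + lo + 0) n)) \<and>
     mset (seg (mw w) (N + lo + 0) n) = mset (seg (mw u) (N + lo + 0) n) \<and>
     (\<forall>p\<in>set (seg (mw w) (N + lo + 0) n). mx w (2 * N + p) = X p) \<and> rx w = rx u \<and>
     (\<forall>i. (i < N + lo + 0 \<or> N + lo + 0 + n \<le> i) \<and> i < 2 * N \<longrightarrow> mw w i = mw u i) \<and>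
     rw w 24 = rw u 24 \<and> rw w 25 = rw u 25 \<and> rw w 26 = rw u 26"
  have fw: "fr w" using w by blast
  have hn: "h < n" using h_facts by linarith
  let ?q = "mw w (N + lo + h)"
  have q: "?q < N" using frD(15)[OF fw hn] .
  then have "mx w (?q + ?q) = X ?q" using frD(1)[OF fw] unfolding base_def by (simp flip: mult_2)
  moreover have "?q + ?q \<le> M" "N + lo + h \<le> M" using q bound' h_facts by linarith+
  ultimately have mx: "okr M middle_x w" "rv middle_x w = X ?q" using frD[OF fw] unfolding middle_x_def Let_def by simp_all
  let ?w = "w\<lparr>rx := (rx w)(1 := X ?q)\<rparr>"
  have f: "fr ?w" by (rule fr_cong[OF fw]) auto
  have "runs M cut_halved ?w (W * cut_halved_cost) split_post"
    by (rule cut_halved_runs[OF f refl, of "X ?q"]) (use w hn in auto)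
  then show "runs M (SetR 1 middle_x ;; cut_halved) w (W * (real (clen (SetR 1 middle_x)) + cut_halved_cost)) split_post"
    by (intro runs_Seq_wp_W[OF _ order_refl]) (use mx in simp)
next
  fix w :: mst and i assume h: "i < n" "rw w 22 = mw u (N + lo + 0 + i)" "\<And>j. j < 2 * N \<Longrightarrow> mx w j = mx u j"
  then show "okr M px w \<and> rv px w = X (mw u (N + lo + 0 + i))"
    using coords[of w "mw u (N + lo + i)" u] frD(1,15)[OF u] by simp
qed (use u frD[OF u] h_facts in auto)

lemma split_runs: "runs M split s (W * split_cost) split_post"
proof -
  have okn: "N + lo + n \<le> M" "N + lo \<le> M" "2 \<le> M" using range bound' unfolding big_def by linarith+
  let ?u = "s\<lparr>rw := (rw s)(6 := n, 7 := h, 19 := N + lo, 20 := N + lo, 21 := N + lo + n)\<rparr>"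
  have entry: "mw s (N + lo + i) < N" if "i < n" for i using cs(1,3) that by (auto simp: set_seg)
  have cnt: "runs M (count is_blue is_blue ;; (SetW 8 (WR 23) ;; SetW 9 (wsub (WR 6) (WR 8))) ;; cut_cell) ?u
    (W * (count_cost is_blue is_blue + (real (clen (SetW 8 (WR 23) ;; SetW 9 (wsub (WR 6) (WR 8)))) + cut_cell_cost))) split_post"
  proof (rule runs_Seq_W[OF runs_conseq[OF count_runs[where a = "N + lo" and m = n and P = blue and M = M]] order_refl])
    show "N + lo + n + 1 \<le> M" using range bound' by linarith
    show "(real n + 1) * count_cost is_blue is_blue \<le> W * count_cost is_blue is_blue"
      by (rule n_le_W) (use bcost_ge[of in_range] in \<open>auto simp: count_cost_def\<close>)
    fix w :: mst assume w: "rw w 23 = length (filter blue (seg (mw ?u) (N + lo) n)) \<and>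
       mx w = mx ?u \<and> mw w = mw ?u \<and> rx w = rx ?u \<and> (\<forall>j. j \<notin> {20, 22, 23} \<longrightarrow> rw w j = rw ?u j)"
    have "length (filter blue (seg (mw ?u) (N + lo) n)) = nb"
      using distinct_card[OF distinct_filter[OF cs(2), of blue]] cs(1) unfolding nb_def by simp
    then have w8: "rw w 23 = nb" using w by simp
    let ?w = "w\<lparr>rw := (rw w)(8 := nb, 9 := n - nb)\<rparr>"
    have f: "fr ?w" using w base regs cs(1) unfolding fr_def base_def by simp
    show "runs M ((SetW 8 (WR 23) ;; SetW 9 (wsub (WR 6) (WR 8))) ;; cut_cell) w
      (W * (real (clen (SetW 8 (WR 23) ;; SetW 9 (wsub (WR 6) (WR 8)))) + cut_cell_cost)) split_post"
      by (rule runs_Seq_wp_W[OF _ order_refl]) (use cut_cell_runs[OF f] w8 w in simp)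
  next
    fix v :: mst and i assume h: "i < n" "rw v 22 = mw ?u (N + lo + i)" "\<And>j. j \<noteq> 20 \<Longrightarrow> j \<noteq> 22 \<Longrightarrow> j \<noteq> 23 \<Longrightarrow> rw v j = rw ?u j"
    then show "okb M is_blue v \<and> okb M is_blue v \<and> (bv is_blue v \<and> bv is_blue v \<longleftrightarrow> blue (mw ?u (N + lo + i)))"
      using blueI[of v "mw s (N + lo + i)"] entry base unfolding base_def by simp
  qed auto
  show ?thesis unfolding split_def split_cost_def
    by (rule runs_Seq_wp_W[OF _ order_refl])
      (use cnt okn base regs in \<open>simp add: split_init_def scan_def base_def range(3)[symmetric] h_def[symmetric]\<close>)
qed

end

section \<open>Exhaustive search in small cells\<close>

definition orient :: "point \<Rightarrow> point \<Rightarrow> point \<Rightarrow> real" where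
  "orient a b c = (fst b - fst a) * (snd c - snd a) - (snd b - snd a) * (fst c - fst a)"

lemma orient_level: "orient a b c = (snd a - snd b, fst b - fst a) \<bullet> c - (snd a - snd b, fst b - fst a) \<bullet> a"
  unfolding orient_def by (cases a; cases c) (simp add: inner_Pair algebra_simps)

lemma orient_nonzero:
  assumes "\<not> collinear {a, b, c}"
  shows "orient a b c \<noteq> 0"
proof
  assume z: "orient a b c = 0"
  let ?u = "(snd a - snd b, fst b - fst a)"
  have ab: "a \<noteq> b" using assms by auto
  have "?u \<noteq> 0" using ab by (auto simp: zero_prod_def prod_eq_iff)
  moreover have "?u \<bullet> c = ?u \<bullet> a" using z orient_level[of a b c] by simp
  moreover have "?u \<bullet> b = ?u \<bullet> a" using orient_level[of a b b] by (simp add: orient_def)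
  ultimately show False using collinear_level[of ?u a _ b c] assms by blast
qed

lemma orient_affine: "orient a b ((1 - t) *\<^sub>R c + t *\<^sub>R d) = (1 - t) * orient a b c + t * orient a b d"
  unfolding orient_def by (simp add: algebra_simps)

text \<open>\<open>orient a b\<close> is affine along the segment from \<open>c\<close> to
  \<open>d\<close>. With equal strict signs at both ends it has no zero there, while it vanishes on
  the line through \<open>a\<close> and \<open>b\<close>.\<close>

lemma segments_disjoint_if_same_side:
  assumes "0 < orient a b c * orient a b d"
  shows "closed_segment a b \<inter> closed_segment c d = {}"
proof (rule ccontr)
  assume "\<not> ?thesis"
  then obtain z where z: "z \<in> closed_segment a b" "z \<in> closed_segment c d" by blast
  obtain t where t: "z = (1 - t) *\<^sub>R c + t *\<^sub>R d" "0 \<le> t" "t \<le> 1" using z(2) unfolding closed_segment_def by blast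
  obtain r where r: "z = (1 - r) *\<^sub>R a + r *\<^sub>R b" using z(1) unfolding closed_segment_def by blast
  have "orient a b z = 0" unfolding r orient_affine by (simp add: orient_def)
  then have e: "(1 - t) * orient a b c + t * orient a b d = 0" unfolding t(1) orient_affine .
  have pos: "0 < (1 - t) * x + t * y" if "0 < x" "0 < y" for x y
    using that t by (cases "t = 0") (auto intro: add_nonneg_pos)
  have "0 < (1 - t) * orient a b c + t * orient a b d \<or> (1 - t) * orient a b c + t * orient a b d < 0"
  proof (cases "0 < orient a b c")
    case True
    then have "0 < orient a b d" using assms by (simp add: zero_less_mult_iff)
    then have "0 < (1 - t) * orient a b c + t * orient a b d" using pos True by blast
    then show ?thesis by simp
  next
    case False
    then have "orient a b c < 0" "orient a b d < 0" using assms by (auto simp: zero_less_mult_iff)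
    then have "0 < (1 - t) * - orient a b c + t * - orient a b d" by (intro pos) auto
    then have "0 < - ((1 - t) * orient a b c) + - (t * orient a b d)" by (simp only: mult_minus_right)
    then show ?thesis by linarith
  qed
  then show False using e by linarith
qed

text \<open>The two lines meet at parameter \<open>t = p / (p - q)\<close> on the second segment and
  \<open>v = r / (r - w)\<close> on the first. Opposite signs put both parameters between 0 and 1.
  Up to sign the denominators are the same \<open>D\<close>, so equality of the two points becomes a
  polynomial identity after multiplication by \<open>D\<close>.\<close>

lemma segments_cross:
  assumes "orient a b c * orient a b d < 0" "orient c d a * orient c d b < 0"
  shows "closed_segment a b \<inter> closed_segment c d \<noteq> {}"
proof -
  define p q where "p = orient a b c" and "q = orient a b d"
  define r w where "r = orient c d a" and "w = orient c d b"
  define D where "D = q - p"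
  have rw: "r - w = D" unfolding r_def w_def D_def p_def q_def orient_def by (simp add: algebra_simps)
  have D: "D \<noteq> 0" using assms(1) unfolding D_def p_def q_def by (auto simp: mult_less_0_iff)
  have frac: "0 \<le> x / (x - y) \<and> x / (x - y) \<le> 1" if "x * y < 0" for x y :: real
    using that by (cases "0 < x") (auto simp: mult_less_0_iff field_simps)
  define t where "t = p / (p - q)"
  define v where "v = r / (r - w)"
  have t: "0 \<le> t" "t \<le> 1" using frac[of p q] assms(1) unfolding t_def p_def q_def by blast+
  have v: "0 \<le> v" "v \<le> 1" using frac[of r w] assms(2) unfolding v_def r_def w_def by blast+
  have "p - q = - D" unfolding D_def by simp
  then have tD: "t * D = - p" "v * D = r" unfolding t_def v_def rw using D by simp_all
  have "D * ((1 - t) * fst c + t * fst d) = D * ((1 - v) * fst a + v * fst b)"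
  proof -
    have "D * ((1 - t) * fst c + t * fst d) = D * fst c + (t * D) * (fst d - fst c)" by (simp add: algebra_simps)
    moreover have "D * ((1 - v) * fst a + v * fst b) = D * fst a + (v * D) * (fst b - fst a)" by (simp add: algebra_simps)
    ultimately show ?thesis unfolding tD unfolding D_def p_def q_def r_def orient_def by (simp add: algebra_simps)
  qed
  then have x: "(1 - t) * fst c + t * fst d = (1 - v) * fst a + v * fst b" using D by simp
  have "D * ((1 - t) * snd c + t * snd d) = D * ((1 - v) * snd a + v * snd b)"
  proof -
    have "D * ((1 - t) * snd c + t * snd d) = D * snd c + (t * D) * (snd d - snd c)" by (simp add: algebra_simps)
    moreover have "D * ((1 - v) * snd a + v * snd b) = D * snd a + (v * D) * (snd b - snd a)" by (simp add: algebra_simps)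
    ultimately show ?thesis unfolding tD unfolding D_def p_def q_def r_def orient_def by (simp add: algebra_simps)
  qed
  then have y: "(1 - t) * snd c + t * snd d = (1 - v) * snd a + v * snd b" using D by simp
  have "(1 - t) *\<^sub>R c + t *\<^sub>R d = (1 - v) *\<^sub>R a + v *\<^sub>R b" using x y by (simp add: prod_eq_iff)
  moreover have "(1 - t) *\<^sub>R c + t *\<^sub>R d \<in> closed_segment c d" using t unfolding closed_segment_def by blast
  moreover have "(1 - v) *\<^sub>R a + v *\<^sub>R b \<in> closed_segment a b" using v unfolding closed_segment_def by blast
  ultimately show ?thesis by force
qed

text \<open>General position excludes zero orientations, so strict comparisons of products decide
  the crossing, and these are operations the machine has.\<close>

lemma segments_disjoint_iff:
  assumes "\<not> collinear {a, b, c}" "\<not> collinear {a, b, d}" "\<not> collinear {c, d, a}" "\<not> collinear {c, d, b}"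
  shows "closed_segment a b \<inter> closed_segment c d = {} \<longleftrightarrow>
    0 < orient a b c * orient a b d \<or> 0 < orient c d a * orient c d b"
proof
  assume "closed_segment a b \<inter> closed_segment c d = {}"
  then have "\<not> (orient a b c * orient a b d < 0 \<and> orient c d a * orient c d b < 0)" using segments_cross by blast
  moreover have "orient a b c * orient a b d \<noteq> 0" "orient c d a * orient c d b \<noteq> 0" using assms by (simp_all add: orient_nonzero)
  ultimately show "0 < orient a b c * orient a b d \<or> 0 < orient c d a * orient c d b" by linarith
next
  assume "0 < orient a b c * orient a b d \<or> 0 < orient c d a * orient c d b"
  then show "closed_segment a b \<inter> closed_segment c d = {}"
    using segments_disjoint_if_same_side[of a b c d] segments_disjoint_if_same_side[of c d a b] by blast
qed

text \<open>Every vertex of a star lies on one of its edges, the center on all of them.\<close>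

lemma apart_disjoint:
  assumes "apart s t" "length s = 4" "length t = 4"
  shows "set s \<inter> set t = {}"
proof (rule ccontr)
  assume "\<not> ?thesis"
  then obtain z where z: "z \<in> set s" "z \<in> set t" by blast
  have edge: "\<exists>p\<in>set (tl s). z \<in> closed_segment (hd s) p" if "z \<in> set s" "length s = 4" for s :: "point list"
  proof -
    have "s \<noteq> [] \<and> tl s \<noteq> []" using \<open>length s = 4\<close> by (cases s; cases "tl s") auto
    then obtain c p xs where s: "s = c # p # xs" by (metis list.collapse)
    show ?thesis
    proof (cases "z = c")
      case True then show ?thesis unfolding s by (intro bexI[of _ p]) auto
    next
      case False then show ?thesis using that(1) unfolding s by (intro bexI[of _ z]) auto
    qed
  qed
  show False using edge[OF z(1) assms(2)] edge[OF z(2) assms(3)] assms(1) unfolding apart_def by blast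
qed

lemma nth_concat4:
  assumes "\<And>x. x \<in> set xss \<Longrightarrow> length x = 4" "i < length xss" "a < 4"
  shows "concat xss ! (4 * i + a) = xss ! i ! a"
  using assms
proof (induction xss arbitrary: i)
  case (Cons x xss)
  show ?case
  proof (cases i)
    case 0 then show ?thesis using Cons.prems by (simp add: nth_append)
  next
    case (Suc i')
    have "4 * i + a = length x + (4 * i' + a)" using Suc Cons.prems by simp
    then show ?thesis using Cons Suc by (simp add: nth_append)
  qed
qed simp

lemma length_concat4: "(\<And>x. x \<in> set xss \<Longrightarrow> length x = 4) \<Longrightarrow> length (concat xss) = 4 * length xss"
  by (induction xss) auto

text \<open>Numbers in base \<open>n\<close> enumerate all lists of positions in a cell, so a single
  counter can drive the exhaustive search.\<close>

lemma ex_digits: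
  fixes ds :: "nat list"
  assumes "\<And>d. d \<in> set ds \<Longrightarrow> d < n"
  shows "\<exists>x < n ^ length ds. \<forall>j<length ds. x div n ^ j mod n = ds ! j"
  using assms
proof (induction ds)
  case (Cons d ds)
  then obtain x where x: "x < n ^ length ds" "\<And>j. j < length ds \<Longrightarrow> x div n ^ j mod n = ds ! j" by auto
  have d: "d < n" using Cons.prems by simp
  have "d + n * x < n * Suc x" using d by simp
  also have "\<dots> \<le> n * n ^ length ds" using x(1) by (intro mult_left_mono) auto
  finally have "d + n * x < n ^ length (d # ds)" by simp
  moreover have "(d + n * x) div n ^ j mod n = (d # ds) ! j" if "j < length (d # ds)" for j
  proof (cases j)
    case (Suc i)
    have "(d + n * x) div n ^ j = ((d + n * x) div n) div n ^ i" unfolding Suc by (simp add: div_mult2_eq)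
    also have "(d + n * x) div n = x" using d by simp
    finally show ?thesis using x(2)[of i] that Suc by simp
  qed (use d in simp)
  ultimately show ?case by blast
qed (auto intro: exI[of _ 0])

section \<open>Packings as arrays of point indices\<close>

context points
begin

definition separated :: "nat \<Rightarrow> nat \<Rightarrow> nat \<Rightarrow> nat \<Rightarrow> bool" where
  "separated a b c d \<longleftrightarrow> 0 < orient (ps ! a) (ps ! b) (ps ! c) * orient (ps ! a) (ps ! b) (ps ! d) \<or>
     0 < orient (ps ! c) (ps ! d) (ps ! a) * orient (ps ! c) (ps ! d) (ps ! b)"

definition center :: "nat \<Rightarrow> nat" where "center j = j - j mod 4"

text \<open>A list of point indices encodes stars as blocks of four, the center first.\<close>

definition compatible :: "nat list \<Rightarrow> nat \<Rightarrow> nat \<Rightarrow> bool" where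
  "compatible w j k \<longleftrightarrow> (j < k \<longrightarrow> w ! j \<noteq> w ! k) \<and>
     (j mod 4 \<noteq> 0 \<longrightarrow> blue (w ! j) \<noteq> blue (w ! center j)) \<and>
     (j mod 4 \<noteq> 0 \<and> k mod 4 \<noteq> 0 \<and> j div 4 < k div 4 \<longrightarrow> separated (w ! center j) (w ! j) (w ! center k) (w ! k))"

definition valid :: "nat list \<Rightarrow> bool" where
  "valid w \<longleftrightarrow> (\<forall>j<length w. \<forall>k<length w. compatible w j k)"

definition block :: "nat list \<Rightarrow> nat \<Rightarrow> point list" where
  "block w i = [ps ! (w ! (4 * i)), ps ! (w ! (4 * i + 1)), ps ! (w ! (4 * i + 2)), ps ! (w ! (4 * i + 3))]"

definition blocks :: "nat list \<Rightarrow> point list list" where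
  "blocks w = map (block w) [0..<length w div 4]"

lemma blue_iff: "p < N \<Longrightarrow> blue p \<longleftrightarrow> ps ! p \<in> set bs" "p < N \<Longrightarrow> \<not> blue p \<longleftrightarrow> ps ! p \<in> set rs"
proof -
  assume p: "p < N"
  have "ps ! p \<in> set bs" if "blue p" using that p unfolding blue_def N_def by (simp add: nth_append)
  moreover have "ps ! p \<in> set rs" if "\<not> blue p" using that unfolding blue_def by (simp add: nth_append)
  moreover have "set rs \<inter> set bs = {}" using distinct_points by simp
  ultimately show "blue p \<longleftrightarrow> ps ! p \<in> set bs" "\<not> blue p \<longleftrightarrow> ps ! p \<in> set rs" by blast+
qed

lemma point_eq_iff: "p < N \<Longrightarrow> q < N \<Longrightarrow> ps ! p = ps ! q \<longleftrightarrow> p = q"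
  using nth_eq_iff_index_eq[OF distinct_points] unfolding N_def by blast

lemma separated_iff:
  assumes "a < N" "b < N" "c < N" "d < N" "distinct [a, b, c, d]"
  shows "separated a b c d \<longleftrightarrow> closed_segment (ps ! a) (ps ! b) \<inter> closed_segment (ps ! c) (ps ! d) = {}"
proof -
  have m: "ps ! p \<in> set ps" if "p < N" for p using that unfolding N_def by (rule nth_mem)
  have nc: "\<not> collinear {ps ! p, ps ! q, ps ! r}" if "p < N" "q < N" "r < N" "p \<noteq> q" "q \<noteq> r" "p \<noteq> r" for p q r
    using general_positionD[OF gp m[OF that(1)] m[OF that(2)] m[OF that(3)]] that point_eq_iff by blast
  show ?thesis unfolding separated_def
    by (rule segments_disjoint_iff[symmetric]) (rule nc; use assms in simp)+
qed

lemma valid_packing: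
  assumes "valid w" "length w = 4 * m" "set w \<subseteq> {..<N}"
  shows "packing (set rs) (set bs) (blocks w)"
proof -
  have lt: "w ! j < N" if "j < 4 * m" for j using that assms(2,3) by (metis lessThan_iff nth_mem subsetD)
  have ne: "w ! j \<noteq> w ! k" if "j < k" "k < 4 * m" for j k using assms(1,2) that unfolding valid_def compatible_def by simp
  have cm: "compatible w j k" if "j < 4 * m" "k < 4 * m" for j k using assms(1,2) that unfolding valid_def by simp
  have ctr: "center (4 * i + a) = 4 * i" "(4 * i + a) mod 4 = a" "(4 * i + a) div 4 = i" if "a < 4" for i a
    using that unfolding center_def by simp_all
  have star: "star_on (set rs) (set bs) (block w i)" if i: "i < m" for i
  proof -
    have l: "4 * i + a < 4 * m" if "a < 4" for a using that i by simp
    have col: "blue (w ! (4 * i + a)) \<noteq> blue (w ! (4 * i))" if "a < 4" "a \<noteq> 0" for a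
      using cm[OF l l, of a a] that ctr[OF that(1), of i] unfolding compatible_def by simp
    have nn: "ps ! (w ! (4 * i + a)) \<noteq> ps ! (w ! (4 * i + b))" if "a < b" "b < 4" for a b
      using ne[of "4 * i + a" "4 * i + b"] l[of a] l[of b] lt that point_eq_iff by simp
    have "distinct (block w i)"
      using nn[of 0 1] nn[of 0 2] nn[of 0 3] nn[of 1 2] nn[of 1 3] nn[of 2 3] unfolding block_def by simp
    moreover have "hd (block w i) \<in> set rs \<and> set (tl (block w i)) \<subseteq> set bs \<or> hd (block w i) \<in> set bs \<and> set (tl (block w i)) \<subseteq> set rs"
      using col[of 1] col[of 2] col[of 3] blue_iff[OF lt[OF l[of 0]]] blue_iff[OF lt[OF l[of 1]]]
        blue_iff[OF lt[OF l[of 2]]] blue_iff[OF lt[OF l[of 3]]] unfolding block_def by auto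
    ultimately show ?thesis unfolding star_on_def by (simp add: block_def)
  qed
  have ap: "apart (block w i) (block w k)" if ik: "i < k" "k < m" for i k
  proof -
    have dis: "closed_segment (ps ! (w ! (4 * i))) (ps ! (w ! (4 * i + a))) \<inter> closed_segment (ps ! (w ! (4 * k))) (ps ! (w ! (4 * k + b))) = {}"
      if ab: "a < 4" "a \<noteq> 0" "b < 4" "b \<noteq> 0" for a b
    proof -
      have l: "4 * i < 4 * m" "4 * i + a < 4 * m" "4 * k < 4 * m" "4 * k + b < 4 * m" "4 * i < 4 * i + a" "4 * i + a < 4 * k" "4 * k < 4 * k + b"
        using ik ab by linarith+
      have "separated (w ! (4 * i)) (w ! (4 * i + a)) (w ! (4 * k)) (w ! (4 * k + b))"
        using cm[OF l(2) l(4)] ctr[OF ab(1), of i] ctr[OF ab(3), of k] ab ik unfolding compatible_def by simp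
      moreover have "distinct [w ! (4 * i), w ! (4 * i + a), w ! (4 * k), w ! (4 * k + b)]"
        using ne[of "4 * i" "4 * i + a"] ne[of "4 * i" "4 * k"] ne[of "4 * i" "4 * k + b"] ne[of "4 * i + a" "4 * k"]
          ne[of "4 * i + a" "4 * k + b"] ne[of "4 * k" "4 * k + b"] l by simp
      ultimately show ?thesis using separated_iff[OF lt[OF l(1)] lt[OF l(2)] lt[OF l(3)] lt[OF l(4)]] by blast
    qed
    show ?thesis unfolding apart_def block_def
      using dis[of 1 1] dis[of 1 2] dis[of 1 3] dis[of 2 1] dis[of 2 2] dis[of 2 3] dis[of 3 1] dis[of 3 2] dis[of 3 3] by simp
  qed
  show ?thesis unfolding packing_def blocks_def using star ap assms(2) by (auto simp: sorted_wrt_iff_nth_less)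
qed

text \<open>Completeness of the search, the converse of \<open>valid_packing\<close>: a packing of
  the cell, read back as indices star by star, passes all the tests. Distinctness of entries in
  different stars comes from \<open>apart_disjoint\<close>.\<close>

lemma ex_valid:
  assumes cs: "set cs \<subseteq> {..<N}" and packs: "packs m ((!) ps ` {p \<in> set cs. \<not> blue p}) ((!) ps ` {p \<in> set cs. blue p})"
  shows "\<exists>w. length w = 4 * m \<and> set w \<subseteq> set cs \<and> valid w"
proof -
  let ?R = "(!) ps ` {p \<in> set cs. \<not> blue p}" and ?B = "(!) ps ` {p \<in> set cs. blue p}"
  obtain qs where qs: "length qs = m" "packing ?R ?B qs" using packs unfolding packs_def by blast
  define g where "g = inv_into (set cs) ((!) ps)"
  have g: "g z \<in> set cs \<and> ps ! g z = z" if "z \<in> ?R \<union> ?B" for z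
  proof -
    have "z \<in> (!) ps ` set cs" using that by blast
    then show ?thesis unfolding g_def using inv_into_into f_inv_into_f by metis
  qed
  have st: "star_on ?R ?B (qs ! i)" if "i < m" for i using qs that unfolding packing_def by auto
  have l4: "length (qs ! i) = 4" if "i < m" for i using st[OF that] unfolding star_on_def by blast
  have mem: "qs ! i ! a \<in> ?R \<union> ?B" if "i < m" "a < 4" for i a
  proof -
    have "qs ! i ! a \<in> set (qs ! i)" by (rule nth_mem) (use l4[OF that(1)] that(2) in simp)
    then show ?thesis using star_on_subset[OF st[OF that(1)]] by blast
  qed
  have ap: "apart (qs ! i) (qs ! k)" if "i < k" "k < m" for i k
    using qs that unfolding packing_def by (auto simp: sorted_wrt_iff_nth_less)
  define w where "w = concat (map (map g) qs)"
  have all4: "length x = 4" if "x \<in> set (map (map g) qs)" for x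
    using that qs unfolding packing_def star_on_def by auto
  have lw: "length w = 4 * m" unfolding w_def using length_concat4[of "map (map g) qs"] all4 qs(1) by simp
  have nth: "w ! (4 * i + a) = g (qs ! i ! a)" if "i < m" "a < 4" for i a
    unfolding w_def using nth_concat4[of "map (map g) qs" i a] all4 that qs(1) l4[OF that(1)] by simp
  have pt: "ps ! (w ! (4 * i + a)) = qs ! i ! a" "w ! (4 * i + a) \<in> set cs" if "i < m" "a < 4" for i a
    using nth[OF that] g[OF mem[OF that]] by simp_all
  have lt: "w ! (4 * i + a) < N" if "i < m" "a < 4" for i a using pt(2)[OF that] cs by blast
  have "compatible w j k" if jk: "j < 4 * m" "k < 4 * m" for j k
  proof -
    define i a where "i = j div 4" and "a = j mod 4"
    define i' b where "i' = k div 4" and "b = k mod 4"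
    have j: "j = 4 * i + a" "a < 4" "i < m" using jk unfolding i_def a_def by auto
    have k: "k = 4 * i' + b" "b < 4" "i' < m" using jk unfolding i'_def b_def by auto
    have cj: "center j = 4 * i + 0" "center k = 4 * i' + 0" unfolding center_def using j k unfolding a_def b_def by simp_all
    have hd: "qs ! x ! 0 = hd (qs ! x)" "\<And>c. c \<noteq> 0 \<Longrightarrow> c < 4 \<Longrightarrow> qs ! x ! c \<in> set (tl (qs ! x))" if "x < m" for x
    proof -
      show "qs ! x ! 0 = hd (qs ! x)" using l4[OF that] by (metis hd_conv_nth list.size(3) zero_neq_numeral)
      fix c :: nat assume c: "c \<noteq> 0" "c < 4"
      have "qs ! x ! c = tl (qs ! x) ! (c - 1)" using c l4[OF that] by (simp add: nth_tl)
      moreover have "c - 1 < length (tl (qs ! x))" using c l4[OF that] by simp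
      ultimately show "qs ! x ! c \<in> set (tl (qs ! x))" using nth_mem by metis
    qed
    have dj: "qs ! i ! c \<noteq> qs ! i' ! d" if "i < i'" "c < 4" "d < 4" for c d
    proof -
      have "set (qs ! i) \<inter> set (qs ! i') = {}" using apart_disjoint[OF ap[OF that(1) k(3)]] l4 j k by blast
      moreover have "qs ! i ! c \<in> set (qs ! i)" "qs ! i' ! d \<in> set (qs ! i')" using l4 j k that by (auto intro!: nth_mem)
      ultimately show ?thesis by (metis disjoint_iff)
    qed
    have "w ! j \<noteq> w ! k" if "j < k"
    proof (cases "i = i'")
      case True
      then have "a < b" using that j k by simp
      then have "qs ! i ! a \<noteq> qs ! i' ! b" using st[OF j(3)] True l4[OF j(3)] k(2) unfolding star_on_def by (simp add: nth_eq_iff_index_eq)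
      then show ?thesis unfolding j(1) k(1) using pt(1)[OF j(3,2)] pt(1)[OF k(3,2)] by metis
    next
      case False
      then have "i < i'" using that unfolding i_def i'_def by (meson div_le_mono le_neq_implies_less less_imp_le)
      then have "qs ! i ! a \<noteq> qs ! i' ! b" using dj j k by blast
      then show ?thesis unfolding j(1) k(1) using pt(1)[OF j(3,2)] pt(1)[OF k(3,2)] by metis
    qed
    moreover have "blue (w ! j) \<noteq> blue (w ! center j)" if "j mod 4 \<noteq> 0"
    proof -
      have a0: "a \<noteq> 0" using that unfolding a_def .
      have col: "blue (w ! (4 * i + c)) \<longleftrightarrow> qs ! i ! c \<in> ?B" "\<not> blue (w ! (4 * i + c)) \<longleftrightarrow> qs ! i ! c \<in> ?R" if c: "c < 4" for c
      proof -
        have b: "blue q \<longleftrightarrow> blue p" if "ps ! q = ps ! p" "p \<in> set cs" "q < N" for p q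
          using that cs point_eq_iff[of q p] by auto
        show "blue (w ! (4 * i + c)) \<longleftrightarrow> qs ! i ! c \<in> ?B" "\<not> blue (w ! (4 * i + c)) \<longleftrightarrow> qs ! i ! c \<in> ?R"
          using pt[OF j(3) c] lt[OF j(3) c] b by (auto simp: image_iff)
      qed
      have "qs ! i ! 0 \<in> ?R \<and> qs ! i ! a \<in> ?B \<or> qs ! i ! 0 \<in> ?B \<and> qs ! i ! a \<in> ?R"
        using st[OF j(3)] hd(1)[OF j(3)] hd(2)[OF j(3) a0 j(2)] unfolding star_on_def by auto
      moreover have "blue (w ! center j) \<longleftrightarrow> qs ! i ! 0 \<in> ?B" "\<not> blue (w ! center j) \<longleftrightarrow> qs ! i ! 0 \<in> ?R"
        unfolding cj(1) by (rule col; simp)+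
      moreover have "blue (w ! j) \<longleftrightarrow> qs ! i ! a \<in> ?B" "\<not> blue (w ! j) \<longleftrightarrow> qs ! i ! a \<in> ?R"
        unfolding j(1) by (rule col[OF j(2)])+
      ultimately show ?thesis by blast
    qed
    moreover have "separated (w ! center j) (w ! j) (w ! center k) (w ! k)" if h: "j mod 4 \<noteq> 0" "k mod 4 \<noteq> 0" "j div 4 < k div 4"
    proof -
      have ab: "a \<noteq> 0" "b \<noteq> 0" "i < i'" using h unfolding a_def b_def i_def i'_def by simp_all
      have s: "closed_segment (qs ! i ! 0) (qs ! i ! a) \<inter> closed_segment (qs ! i' ! 0) (qs ! i' ! b) = {}"
        using ap[OF ab(3) k(3)] hd(1)[OF j(3)] hd(2)[OF j(3) ab(1) j(2)] hd(1)[OF k(3)] hd(2)[OF k(3) ab(2) k(2)]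
        unfolding apart_def by metis
      have n1: "qs ! i ! 0 \<noteq> qs ! i ! a" "qs ! i' ! 0 \<noteq> qs ! i' ! b"
        using st[OF j(3)] st[OF k(3)] l4[OF j(3)] l4[OF k(3)] ab j k unfolding star_on_def by (auto simp: nth_eq_iff_index_eq)
      have z: "0 < (4::nat)" by simp
      have "distinct [qs ! i ! 0, qs ! i ! a, qs ! i' ! 0, qs ! i' ! b]"
        using n1 dj[OF ab(3) z z] dj[OF ab(3) z k(2)] dj[OF ab(3) j(2) z] dj[OF ab(3) j(2) k(2)] by simp
      then have "distinct [w ! (4 * i + 0), w ! (4 * i + a), w ! (4 * i' + 0), w ! (4 * i' + b)]"
        unfolding pt(1)[OF j(3) z, symmetric] pt(1)[OF j(3,2), symmetric] pt(1)[OF k(3) z, symmetric] pt(1)[OF k(3,2), symmetric]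
        by auto
      then have "separated (w ! (4 * i + 0)) (w ! (4 * i + a)) (w ! (4 * i' + 0)) (w ! (4 * i' + b))"
        using separated_iff[OF lt[OF j(3) z] lt[OF j(3,2)] lt[OF k(3) z] lt[OF k(3,2)]] s
        unfolding pt(1)[OF j(3) z] pt(1)[OF j(3,2)] pt(1)[OF k(3) z] pt(1)[OF k(3,2)] by blast
      then show ?thesis unfolding cj by (simp only: flip: j(1) k(1))
    qed
    ultimately show ?thesis unfolding compatible_def by blast
  qed
  then have "valid w" unfolding valid_def lw by blast
  moreover have "set w \<subseteq> set cs"
  proof
    fix p assume "p \<in> set w"
    then obtain j where j: "j < 4 * m" "p = w ! j" using lw by (metis in_set_conv_nth)
    have "j = 4 * (j div 4) + j mod 4" "j div 4 < m" "j mod 4 < 4" using j by auto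
    then show "p \<in> set cs" using pt(2)[of "j div 4" "j mod 4"] j(2) by metis
  qed
  ultimately show ?thesis using lw by blast
qed

end

section \<open>The search program for one small cell\<close>

definition wx :: "nat \<Rightarrow> rexp" where "wx i = RM (wadd (WR i) (WR i))"
definition wy :: "nat \<Rightarrow> rexp" where "wy i = RM (wadd (wadd (WR i) (WR i)) (WC 1))"

definition orient_exp :: "nat \<Rightarrow> nat \<Rightarrow> nat \<Rightarrow> rexp" where
  "orient_exp a b c = RB RSub (RB RMul (RB RSub (wx b) (wx a)) (RB RSub (wy c) (wy a)))
     (RB RMul (RB RSub (wy b) (wy a)) (RB RSub (wx c) (wx a)))"

text \<open>Register 30 becomes 1 when a test fails; \<open>noflag\<close> is an assignment without
  effect and serves as the empty command.\<close>

abbreviation "flag \<equiv> SetW 30 (WC 1)"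
abbreviation "noflag \<equiv> SetW 30 (WR 30)"
abbreviation "mod4 i \<equiv> WB WMod (WR i) (WC 4)"
abbreviation "div4 i \<equiv> WB WDiv (WR i) (WC 4)"

definition test_same :: com where
  "test_same = Cond (WL (WR 36) (WR 37)) (Cond (WL (WR 38) (WR 39)) noflag (Cond (WL (WR 39) (WR 38)) noflag flag)) noflag"

definition test_color :: com where
  "test_color = Cond (WL (WC 0) (mod4 36))
     (Cond (WL (WR 0) (wadd (WR 38) (WC 1)))
        (Cond (WL (WR 0) (wadd (WR 40) (WC 1))) flag noflag)
        (Cond (WL (WR 0) (wadd (WR 40) (WC 1))) noflag flag)) noflag"

definition test_cross :: com where
  "test_cross = Cond (WL (WC 0) (mod4 36)) (Cond (WL (WC 0) (mod4 37)) (Cond (WL (div4 36) (div4 37))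
     (Cond (RL (RC (WC 0)) (RB RMul (orient_exp 40 38 41) (orient_exp 40 38 39))) noflag
       (Cond (RL (RC (WC 0)) (RB RMul (orient_exp 41 39 40) (orient_exp 41 39 38))) noflag flag)) noflag) noflag) noflag"

text \<open>The counter in register 33 encodes a pair of positions as quotient and remainder by the
  length in register 28. Registers 38 and 39 get the two entries, 40 and 41 the centers of their
  blocks.\<close>

definition fetch :: com where
  "fetch = SetW 36 (WB WDiv (WR 33) (WR 28)) ;; SetW 37 (WB WMod (WR 33) (WR 28)) ;;
     SetW 38 (WM (wadd (WR 34) (WR 36))) ;; SetW 39 (WM (wadd (WR 34) (WR 37))) ;;
     SetW 40 (WM (wadd (WR 34) (wsub (WR 36) (mod4 36)))) ;; SetW 41 (WM (wadd (WR 34) (wsub (WR 37) (mod4 37))))"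

definition check_body :: com where
  "check_body = fetch ;; test_same ;; test_color ;; test_cross ;; incr 33"

definition decode_body :: com where
  "decode_body = StoreW (wadd (WR 34) (WR 32)) (WM (wadd (WR 35) (WB WMod (WR 31) (WR 6)))) ;;
     SetW 31 (WB WDiv (WR 31) (WR 6)) ;; incr 32"

abbreviation "decode_cond \<equiv> WL (WR 32) (WR 28)"
abbreviation "check_cond \<equiv> WL (WR 33) (wmul (WR 28) (WR 28))"

definition try_init :: com where "try_init = SetW 31 (WR 29) ;; SetW 32 (WC 0)"
definition check_init :: com where "check_init = SetW 30 (WC 0) ;; SetW 33 (WC 0)"

definition try_leaf :: com where
  "try_leaf = try_init ;; While decode_cond decode_body ;; check_init ;; While check_cond check_body ;; incr 29"

text \<open>Register 28 becomes four times \<open>star_count\<close> of the cell size. Register 30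
  starts at 1 so that the search loop is entered.\<close>

definition leaf_init :: com where
  "leaf_init = SetW 6 (wsub (WR 4) (WR 3)) ;;
     SetW 28 (wmul (WC 4) (wadd (wmul (WC 4) (WB WDiv (WR 6) (WC 18)))
       (WB WDiv (wsub (wmul (WC 2) (WB WMod (WR 6) (WC 18))) (WC 1)) (WC 9)))) ;;
     SetW 29 (WC 0) ;; SetW 30 (WC 1) ;; SetW 34 (wmul (WC 4) (WR 5)) ;; SetW 35 (wadd (WR 2) (WR 3))"

definition leaf_done :: com where
  "leaf_done = SetW 5 (wadd (WR 5) (div4 28)) ;; SetW 3 (WR 4)"

abbreviation "leaf_cond \<equiv> WL (WC 0) (WR 30)"

definition leaf :: com where
  "leaf = leaf_init ;; While leaf_cond try_leaf ;; leaf_done"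

definition try_cost :: real where
  "try_cost = real (clen try_leaf) + (real big * (real (clen decode_body) + bcost decode_cond) + bcost decode_cond) +
     (real (big * big) * (real (clen check_body) + bcost check_cond) + bcost check_cond)"

text \<open>A cell searched this way has at most \<open>big\<close> points and hence at most
  \<open>big ^ big\<close> candidate arrays. The cost is enormous but does not depend on the
  input.\<close>

definition leaf_cost :: real where
  "leaf_cost = real (clen leaf) + (real (big ^ big + 1) * (try_cost + bcost leaf_cond) + bcost leaf_cond)"

lemma star_count_le: "9 * star_count n \<le> 2 * n"
proof -
  define q x y where "q = n div 18" and "x = n mod 18" and "y = (2 * x - 1) div 9"
  have "n = 18 * q + x" unfolding q_def x_def by simp
  moreover have "9 * y \<le> 2 * x - 1" unfolding y_def by simp
  moreover have "star_count n = 4 * q + y" unfolding star_count_def q_def x_def y_def ..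
  ultimately show ?thesis by linarith
qed

text \<open>\<open>w0\<close> is a solution whose existence is already known; the program never sees
  it, but it guarantees that the search ends. The search counter reaches up to
  \<open>n ^ (4 * m)\<close>, which explains the bound \<open>N ^ big\<close> on words.\<close>

locale leaf_cell = points +
  fixes M :: nat and s :: mst and lo hi n cnt m :: nat and cs w0 :: "nat list"
  assumes base: "base s" and regs: "rw s 3 = lo" "rw s 4 = hi" "rw s 5 = cnt"
    and range: "lo < hi" "hi \<le> N" "n = hi - lo" "n \<le> big"
    and cs: "cs = seg (mw s) (N + lo) n" "set cs \<subseteq> {..<N}"
    and m: "m = star_count n" "4 * cnt + 4 * m \<le> N"
    and bound: "N * N \<le> M" "5 * N + 20 \<le> M" "N ^ big \<le> M"
    and w0: "length w0 = 4 * m" "set w0 \<subseteq> set cs" "valid w0"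
begin

lemma nums: "0 < n" "n \<le> N" "4 * m \<le> n" "4 * m * (4 * m) \<le> M" "n ^ (4 * m) \<le> M" "n ^ (4 * m) \<le> big ^ big" "4 * m \<le> big"
proof -
  show n: "0 < n" "n \<le> N" using range by linarith+
  show mn: "4 * m \<le> n" using star_count_le[of n] m by linarith
  then show mb: "4 * m \<le> big" using range by linarith
  have "4 * m * (4 * m) \<le> N * N" using mn n by (intro mult_mono) auto
  then show "4 * m * (4 * m) \<le> M" using bound by linarith
  have "n ^ (4 * m) \<le> N ^ (4 * m)" using n by (intro power_mono) auto
  also have "\<dots> \<le> N ^ big" using mb n by (intro power_increasing) auto
  finally show "n ^ (4 * m) \<le> M" using bound by linarith
  have "n ^ (4 * m) \<le> big ^ (4 * m)" using range by (intro power_mono) auto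
  also have "\<dots> \<le> big ^ big" using mb by (intro power_increasing) (auto simp: big_def)
  finally show "n ^ (4 * m) \<le> big ^ big" .
qed

definition lf :: "mst \<Rightarrow> bool" where
  "lf u \<longleftrightarrow> base u \<and> rw u 1 = rw s 1 \<and> rw u 3 = lo \<and> rw u 4 = hi \<and> rw u 5 = cnt \<and> rw u 6 = n \<and> rw u 28 = 4 * m \<and>
     rw u 34 = 4 * cnt \<and> rw u 35 = N + lo \<and> (\<forall>a. a < 4 * cnt \<or> 4 * cnt + 4 * m \<le> a \<longrightarrow> mw u a = mw s a)"

lemma lf_cong:
  assumes "lf u" "\<And>i. i \<in> {0, 1, 2, 3, 4, 5, 6, 12, 28, 34, 35} \<Longrightarrow> rw v i = rw u i" "mw v = mw u" "mx v = mx u"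
  shows "lf v"
proof -
  have r: "rw v 0 = rw u 0" "rw v 1 = rw u 1" "rw v 2 = rw u 2" "rw v 3 = rw u 3" "rw v 4 = rw u 4" "rw v 5 = rw u 5"
    "rw v 6 = rw u 6" "rw v 12 = rw u 12" "rw v 28 = rw u 28" "rw v 34 = rw u 34" "rw v 35 = rw u 35"
    by (rule assms(2); simp)+
  show ?thesis using assms(1) unfolding lf_def base_def r assms(3,4) .
qed

definition "out u = seg (mw u) (4 * cnt) (4 * m)"

lemma wp_test_same:
  assumes "1 \<le> M" "rw u 36 = a" "rw u 37 = b" "rw u 38 = p" "rw u 39 = q" "rw u 30 = f"
  shows "wp M test_same u (\<lambda>v. v = u\<lparr>rw := (rw u)(30 := if a < b \<and> p = q then 1 else f)\<rparr>)"
  unfolding test_same_def using assms by auto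

lemma wp_test_color:
  assumes "rw u 0 = length rs" "rw u 36 = a" "rw u 38 = p" "rw u 40 = q" "p < N" "q < N" "rw u 30 = f"
  shows "wp M test_color u (\<lambda>v. v = u\<lparr>rw := (rw u)(30 := if a mod 4 \<noteq> 0 \<and> blue p = blue q then 1 else f)\<rparr>)"
proof -
  have "Suc p \<le> M" "Suc q \<le> M" "4 \<le> M" "1 \<le> M" using assms bound by linarith+
  then show ?thesis unfolding test_color_def blue_def using assms by auto
qed

lemma orient_exp:
  assumes "base u" "a < 50" "b < 50" "c < 50" "rw u a < N" "rw u b < N" "rw u c < N"
  shows "okr M (orient_exp a b c) u" "rv (orient_exp a b c) u = orient (ps ! rw u a) (ps ! rw u b) (ps ! rw u c)"
proof -
  have e: "okr M (wx i) u \<and> okr M (wy i) u \<and> rv (wx i) u = fst (ps ! rw u i) \<and> rv (wy i) u = snd (ps ! rw u i)"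
    if "i < 50" "rw u i < N" for i
  proof -
    have "mx u (2 * rw u i) = X (rw u i)" "mx u (2 * rw u i + 1) = Y (rw u i)" using assms(1) that unfolding base_def by auto
    moreover have "rw u i + rw u i + 1 \<le> M" using that bound by linarith
    ultimately show ?thesis using that unfolding wx_def wy_def X_def Y_def by (simp add: mult_2)
  qed
  show "okr M (orient_exp a b c) u" "rv (orient_exp a b c) u = orient (ps ! rw u a) (ps ! rw u b) (ps ! rw u c)"
    unfolding orient_exp_def orient_def using e assms by simp_all
qed

lemma wp_test_cross:
  assumes "base u" "rw u 36 = a" "rw u 37 = b" "rw u 38 = p" "rw u 39 = q" "rw u 40 = c" "rw u 41 = d"
    "p < N" "q < N" "c < N" "d < N" "rw u 30 = f"
  shows "wp M test_cross u (\<lambda>v. v = u\<lparr>rw := (rw u)(30 := if a mod 4 \<noteq> 0 \<and> b mod 4 \<noteq> 0 \<and> a div 4 < b div 4 \<and>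
     \<not> separated c p d q then 1 else f)\<rparr>)"
proof -
  have "4 \<le> M" "1 \<le> M" using bound by linarith+
  then show ?thesis unfolding test_cross_def separated_def using orient_exp[OF assms(1)] assms by auto
qed

lemma check_runs:
  assumes u: "lf u" "rw u 30 = 0" "rw u 33 = 0" "set (out u) \<subseteq> {..<N}"
  shows "runs M (While check_cond check_body) u (real (big * big) * (real (clen check_body) + bcost check_cond) + bcost check_cond)
    (\<lambda>v. lf v \<and> mw v = mw u \<and> rw v 29 = rw u 29 \<and> (rw v 30 = 0 \<longleftrightarrow> valid (out u)))"
proof -
  define w where "w = out u"
  define K where "K = real (clen check_body)"
  have lw: "length w = 4 * m" unfolding w_def out_def by simp
  have wj: "w ! j = mw u (4 * cnt + j)" "w ! j < N" if "j < 4 * m" for j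
  proof -
    show "w ! j = mw u (4 * cnt + j)" unfolding w_def out_def using that by simp
    show "w ! j < N" using u(4) lw that unfolding w_def[symmetric] by (metis lessThan_iff nth_mem subsetD)
  qed
  define I where "I k v \<longleftrightarrow> lf v \<and> mw v = mw u \<and> rw v 29 = rw u 29 \<and>
     (rw v 30 = 0 \<longleftrightarrow> (\<forall>q<k. compatible w (q div (4 * m)) (q mod (4 * m))))" for k and v :: mst
  have body: "runs M check_body v K (\<lambda>v'. I (Suc k) v' \<and> rw v' 33 = Suc k)"
    if I: "I k v" "rw v 33 = k" and k: "k < 4 * m * (4 * m)" for k v
  proof (rule runs_wp)
    define a b where "a = k div (4 * m)" and "b = k mod (4 * m)"
    have m0: "0 < m" using k by (cases m) auto
    have ab: "a < 4 * m" "b < 4 * m" using k m0 unfolding a_def b_def by (simp_all add: less_mult_imp_div_less)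
    have cen: "a - a mod 4 = center a" "b - b mod 4 = center b" "center a < 4 * m" "center b < 4 * m"
      unfolding center_def using ab by simp_all
    have lv: "lf v" "mw v = mw u" using I unfolding I_def by auto
    have r: "rw v 28 = 4 * m" "rw v 34 = 4 * cnt" "rw v 0 = length rs" using lv unfolding lf_def base_def by auto
    have ok: "4 \<le> M" "4 * cnt + a \<le> M" "4 * cnt + b \<le> M" "4 * cnt + center a \<le> M" "4 * cnt + center b \<le> M" "Suc k \<le> M" "1 \<le> M"
      using bound m(2) ab cen k nums(4) by linarith+
    define R where "R = (rw v)(36 := a, 37 := b, 38 := w ! a, 39 := w ! b, 40 := w ! center a, 41 := w ! center b)"
    let ?v = "v\<lparr>rw := R\<rparr>"
    have mems: "mw v (4 * cnt + a) = w ! a" "mw v (4 * cnt + b) = w ! b" "mw v (4 * cnt + center a) = w ! center a" "mw v (4 * cnt + center b) = w ! center b"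
      using wj(1) ab cen lv(2) by simp_all
    have ca: "4 * cnt + a - a mod 4 = 4 * cnt + center a" "4 * cnt + b - b mod 4 = 4 * cnt + center b"
      unfolding center_def by simp_all
    have f: "wp M fetch v (\<lambda>v'. v' = ?v)"
      unfolding fetch_def R_def using r I(2) ok mems ca by (simp add: a_def[symmetric] b_def[symmetric])
    have Rv: "R 36 = a" "R 37 = b" "R 38 = w ! a" "R 39 = w ! b" "R 40 = w ! center a" "R 41 = w ! center b" "R 30 = rw v 30" "R 0 = length rs" "R 33 = k"
      unfolding R_def using r I(2) by simp_all
    define g1 where "g1 = (if a < b \<and> w ! a = w ! b then 1 else rw v 30)"
    define g2 where "g2 = (if a mod 4 \<noteq> 0 \<and> blue (w ! a) = blue (w ! center a) then 1 else g1)"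
    define g3 where "g3 = (if a mod 4 \<noteq> 0 \<and> b mod 4 \<noteq> 0 \<and> a div 4 < b div 4 \<and> \<not> separated (w ! center a) (w ! a) (w ! center b) (w ! b) then 1 else g2)"
    have base: "base (v\<lparr>rw := R(30 := x)\<rparr>)" for x using lv(1) unfolding lf_def base_def R_def by simp
    have t1: "wp M test_same ?v (\<lambda>v'. v' = v\<lparr>rw := R(30 := g1)\<rparr>)"
      using wp_test_same[OF ok(7), of ?v a b "w ! a" "w ! b" "rw v 30"] Rv by (simp add: g1_def)
    have t2: "wp M test_color (v\<lparr>rw := R(30 := g1)\<rparr>) (\<lambda>v'. v' = v\<lparr>rw := R(30 := g2)\<rparr>)"
      using wp_test_color[of "v\<lparr>rw := R(30 := g1)\<rparr>" a "w ! a" "w ! center a" g1] Rv wj(2) ab cen by (simp add: g2_def)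
    have t3: "wp M test_cross (v\<lparr>rw := R(30 := g2)\<rparr>) (\<lambda>v'. v' = v\<lparr>rw := R(30 := g3)\<rparr>)"
      using wp_test_cross[OF base, of g2 a b "w ! a" "w ! b" "w ! center a" "w ! center b" g2] Rv wj(2) ab cen by (simp add: g3_def)
    have g3: "g3 = 0 \<longleftrightarrow> rw v 30 = 0 \<and> compatible w a b"
      unfolding g3_def g2_def g1_def compatible_def by auto
    have fin: "I (Suc k) (v\<lparr>rw := R(30 := g3, 33 := Suc k)\<rparr>)"
    proof -
      have "lf (v\<lparr>rw := R(30 := g3, 33 := Suc k)\<rparr>)" by (rule lf_cong[OF lv(1)]) (auto simp: R_def)
      moreover have "g3 = 0 \<longleftrightarrow> (\<forall>q<Suc k. compatible w (q div (4 * m)) (q mod (4 * m)))"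
        using g3 I(1) unfolding I_def a_def b_def by (auto simp: less_Suc_eq)
      ultimately show ?thesis using I(1) unfolding I_def by (simp add: R_def)
    qed
    have t4: "wp M (incr 33) (v\<lparr>rw := R(30 := g3)\<rparr>) (\<lambda>v'. I (Suc k) v' \<and> rw v' 33 = Suc k)"
      using fin Rv(9) ok by simp
    have s3: "wp M (test_cross ;; incr 33) (v\<lparr>rw := R(30 := g2)\<rparr>) (\<lambda>v'. I (Suc k) v' \<and> rw v' 33 = Suc k)"
      unfolding wp.simps(5) by (rule wp_mono[OF t3]) (use t4 Rv(9) in simp)
    have s2: "wp M (test_color ;; test_cross ;; incr 33) (v\<lparr>rw := R(30 := g1)\<rparr>) (\<lambda>v'. I (Suc k) v' \<and> rw v' 33 = Suc k)"
      unfolding wp.simps(5)[of _ test_color] by (rule wp_mono[OF t2]) (use s3 in simp)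
    have s1: "wp M (test_same ;; test_color ;; test_cross ;; incr 33) ?v (\<lambda>v'. I (Suc k) v' \<and> rw v' 33 = Suc k)"
      unfolding wp.simps(5)[of _ test_same] by (rule wp_mono[OF t1]) (use s2 in simp)
    show "wp M check_body v (\<lambda>v'. I (Suc k) v' \<and> rw v' 33 = Suc k)"
      unfolding check_body_def wp.simps(5)[of _ fetch] by (rule wp_mono[OF f]) (use s1 in simp)
  qed (simp add: K_def)
  have "runs M (While check_cond check_body) u (real (big * big) * (real (clen check_body) + bcost check_cond) + bcost check_cond)
    (\<lambda>v. I (4 * m * (4 * m)) v \<and> rw v 33 = 4 * m * (4 * m))"
  proof (rule runs_for[where a = 0 and K = K])
    show "I 0 u" unfolding I_def using u by simp
    show "okb M check_cond v \<and> (bv check_cond v \<longleftrightarrow> k < 4 * m * (4 * m))" if "I k v" "rw v 33 = k" for k v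
    proof -
      have "rw v 28 = 4 * m" using that(1) unfolding I_def lf_def by blast
      then show ?thesis using that(2) nums(4) by simp
    qed
    have "4 * m * (4 * m) \<le> big * big" using nums(7) by (intro mult_mono) auto
    then have "real (4 * m * (4 * m)) \<le> real (big * big)" by (rule of_nat_mono)
    then have "real (4 * m * (4 * m)) * (K + bcost check_cond) \<le> real (big * big) * (K + bcost check_cond)"
      using bcost_ge[of check_cond] by (intro mult_right_mono) (auto simp: K_def)
    then show "real (4 * m * (4 * m) - 0) * (K + bcost check_cond) + bcost check_cond
      \<le> real (big * big) * (real (clen check_body) + bcost check_cond) + bcost check_cond" unfolding K_def by simp
  qed (use u body in \<open>auto simp: K_def\<close>)
  then show ?thesis
  proof (rule runs_conseq)
    fix v :: mst assume v: "I (4 * m * (4 * m)) v \<and> rw v 33 = 4 * m * (4 * m)"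
    have "(\<forall>q<4 * m * (4 * m). compatible w (q div (4 * m)) (q mod (4 * m))) \<longleftrightarrow> valid w"
    proof
      assume c: "\<forall>q<4 * m * (4 * m). compatible w (q div (4 * m)) (q mod (4 * m))"
      show "valid w" unfolding valid_def lw
      proof (intro allI impI)
        fix j k assume jk: "j < 4 * m" "k < 4 * m"
        have "j * (4 * m) + k < Suc j * (4 * m)" using jk by simp
        also have "\<dots> \<le> 4 * m * (4 * m)" using jk by (intro mult_right_mono) auto
        finally have "compatible w ((j * (4 * m) + k) div (4 * m)) ((j * (4 * m) + k) mod (4 * m))" using c by blast
        moreover have "(j * (4 * m) + k) div (4 * m) = j" "(j * (4 * m) + k) mod (4 * m) = k" using jk by simp_all
        ultimately show "compatible w j k" by simp
      qed
    next
      assume "valid w"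
      then show "\<forall>q<4 * m * (4 * m). compatible w (q div (4 * m)) (q mod (4 * m))"
        unfolding valid_def lw by (metis less_mult_imp_div_less mod_less_divisor mult_eq_0_iff not_gr_zero not_less_zero)
    qed
    then show "lf v \<and> mw v = mw u \<and> rw v 29 = rw u 29 \<and> (rw v 30 = 0 \<longleftrightarrow> valid (out u))"
      using v unfolding I_def w_def by simp
  qed simp
qed

definition decode :: "nat \<Rightarrow> nat list" where
  "decode x = map (\<lambda>j. cs ! (x div n ^ j mod n)) [0..<4 * m]"

lemma length_cs: "length cs = n" unfolding cs(1) by simp

lemma set_decode: "set (decode x) \<subseteq> set cs"
  unfolding decode_def using nums(1) length_cs by auto

lemma decode_runs:
  assumes u: "lf u" "rw u 29 = x" "rw u 31 = x" "rw u 32 = 0"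
  shows "runs M (While decode_cond decode_body) u (real big * (real (clen decode_body) + bcost decode_cond) + bcost decode_cond)
    (\<lambda>v. lf v \<and> rw v 29 = x \<and> out v = decode x)"
proof -
  define K where "K = real (clen decode_body)"
  define I where "I k v \<longleftrightarrow> lf v \<and> rw v 29 = x \<and> rw v 31 = x div n ^ k \<and> seg (mw v) (4 * cnt) k = map (\<lambda>j. cs ! (x div n ^ j mod n)) [0..<k]" for k and v :: mst
  have body: "runs M decode_body v K (\<lambda>v'. I (Suc k) v' \<and> rw v' 32 = Suc k)"
    if I: "I k v" "rw v 32 = k" and k: "k < 4 * m" for k v
  proof (rule runs_wp)
    have lv: "lf v" using I unfolding I_def by blast
    have r: "rw v 6 = n" "rw v 34 = 4 * cnt" "rw v 35 = N + lo" "rw v 31 = x div n ^ k" using I(1) unfolding I_def lf_def by auto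
    define d where "d = x div n ^ k mod n"
    have d: "d < n" unfolding d_def using nums(1) by simp
    have dv: "mw v (N + lo + d) = cs ! d"
    proof -
      have "mw v (N + lo + d) = mw s (N + lo + d)" using lv m(2) unfolding lf_def by auto
      then show ?thesis unfolding cs(1) using d by simp
    qed
    have ok: "4 * cnt + k \<le> M" "N + lo + d \<le> M" "Suc k \<le> M" "1 \<le> M" using bound m(2) k d range by linarith+
    let ?v = "v\<lparr>mw := (mw v)(4 * cnt + k := cs ! d), rw := (rw v)(31 := x div n ^ k div n, 32 := Suc k)\<rparr>"
    have "lf ?v" using lv k unfolding lf_def base_def by auto
    moreover have "x div n ^ k div n = x div n ^ Suc k" by (metis div_mult2_eq power_Suc2)
    moreover have "seg (mw ?v) (4 * cnt) (Suc k) = map (\<lambda>j. cs ! (x div n ^ j mod n)) [0..<Suc k]"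
      using I(1) unfolding I_def by (simp add: seg_Suc d_def)
    ultimately have "I (Suc k) ?v" using I(1) unfolding I_def by simp
    then show "wp M decode_body v (\<lambda>v'. I (Suc k) v' \<and> rw v' 32 = Suc k)"
      unfolding decode_body_def using r I(2) ok dv by (simp add: d_def[symmetric])
  qed (simp add: K_def)
  have "runs M (While decode_cond decode_body) u (real big * (real (clen decode_body) + bcost decode_cond) + bcost decode_cond)
    (\<lambda>v. I (4 * m) v \<and> rw v 32 = 4 * m)"
  proof (rule runs_for[where a = 0 and K = K])
    show "I 0 u" unfolding I_def using u by simp
    show "okb M decode_cond v \<and> (bv decode_cond v \<longleftrightarrow> k < 4 * m)" if "I k v" "rw v 32 = k" for k v
      using that unfolding I_def lf_def by simp
    have "real (4 * m) \<le> real big" using nums(7) by (rule of_nat_mono)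
    then have "real (4 * m) * (K + bcost decode_cond) \<le> real big * (K + bcost decode_cond)"
      using bcost_ge[of decode_cond] by (intro mult_right_mono) (auto simp: K_def)
    then show "real (4 * m - 0) * (K + bcost decode_cond) + bcost decode_cond
      \<le> real big * (real (clen decode_body) + bcost decode_cond) + bcost decode_cond" unfolding K_def by simp
  qed (use u body in \<open>auto simp: K_def\<close>)
  then show ?thesis by (rule runs_conseq) (auto simp: I_def out_def decode_def)
qed

lemma try_runs:
  assumes u: "lf u" "rw u 29 = x" "Suc x \<le> M"
  shows "runs M try_leaf u try_cost (\<lambda>v. lf v \<and> rw v 29 = Suc x \<and> out v = decode x \<and> (rw v 30 = 0 \<longleftrightarrow> valid (decode x)))"
    (is "runs M _ u _ ?Q")
proof -
  define T1 where "T1 = real big * (real (clen decode_body) + bcost decode_cond) + bcost decode_cond"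
  define T2 where "T2 = real (big * big) * (real (clen check_body) + bcost check_cond) + bcost check_cond"
  have M1: "1 \<le> M" using bound by linarith
  have c3: "runs M (While check_cond check_body ;; incr 29) v (T2 + real (clen (incr 29))) ?Q"
    if v: "lf v" "rw v 29 = x" "out v = decode x" "rw v 30 = 0" "rw v 33 = 0" for v
  proof (rule runs_Seq[OF runs_conseq[OF check_runs] order_refl])
    show "set (out v) \<subseteq> {..<N}" using v(3) set_decode[of x] cs(2) by auto
    fix y :: mst assume y: "lf y \<and> mw y = mw v \<and> rw y 29 = rw v 29 \<and> (rw y 30 = 0 \<longleftrightarrow> valid (out v))"
    have "lf (y\<lparr>rw := (rw y)(29 := Suc x)\<rparr>)" by (rule lf_cong[of y]) (use y in auto)
    then show "runs M (incr 29) y (real (clen (incr 29))) ?Q"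
      by (intro runs_wp) (use y v u(3) M1 in \<open>auto simp: out_def\<close>)
  qed (use v in \<open>auto simp: T2_def\<close>)
  have c2: "runs M (check_init ;; While check_cond check_body ;; incr 29) v (real (clen check_init) + (T2 + real (clen (incr 29)))) ?Q"
    if v: "lf v" "rw v 29 = x" "out v = decode x" for v
  proof (rule runs_Seq_wp[OF _ order_refl])
    have "lf (v\<lparr>rw := (rw v)(30 := 0, 33 := 0)\<rparr>)" by (rule lf_cong[OF v(1)]) auto
    from c3[OF this] show "wp M check_init v (\<lambda>v. runs M (While check_cond check_body ;; incr 29) v (T2 + real (clen (incr 29))) ?Q)"
      unfolding check_init_def using v by (simp add: out_def)
  qed
  have c1: "runs M (While decode_cond decode_body ;; check_init ;; While check_cond check_body ;; incr 29) v (T1 + (real (clen check_init) + (T2 + real (clen (incr 29))))) ?Q"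
    if v: "lf v" "rw v 29 = x" "rw v 31 = x" "rw v 32 = 0" for v
    by (rule runs_Seq[OF runs_conseq[OF decode_runs[OF v]] order_refl]) (use c2 in \<open>auto simp: T1_def\<close>)
  show ?thesis unfolding try_leaf_def
  proof (rule runs_Seq_wp)
    have "lf (u\<lparr>rw := (rw u)(31 := x, 32 := 0)\<rparr>)" by (rule lf_cong[OF u(1)]) auto
    from c1[OF this] show "wp M try_init u (\<lambda>v. runs M (While decode_cond decode_body ;; check_init ;; While check_cond check_body ;; incr 29) v (T1 + (real (clen check_init) + (T2 + real (clen (incr 29))))) ?Q)"
      unfolding try_init_def using u by simp
    have "real (clen try_init) + real (clen check_init) + real (clen (incr 29)) \<le> real (clen try_leaf)"
      unfolding try_leaf_def by simp
    then show "real (clen try_init) + (T1 + (real (clen check_init) + (T2 + real (clen (incr 29))))) \<le> try_cost"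
      unfolding try_cost_def T1_def T2_def by linarith
  qed
qed

definition leaf_post :: "mst \<Rightarrow> bool" where
  "leaf_post u \<longleftrightarrow> base u \<and> rw u 1 = rw s 1 \<and> rw u 3 = hi \<and> rw u 5 = cnt + m \<and>
     (\<forall>a. a < 4 * cnt \<or> 4 * cnt + 4 * m \<le> a \<longrightarrow> mw u a = mw s a) \<and>
     valid (out u) \<and> set (out u) \<subseteq> set cs"

lemma leaf_runs: "runs M leaf s leaf_cost leaf_post"
proof -
  have "\<exists>ds. length ds = 4 * m \<and> (\<forall>d\<in>set ds. d < n) \<and> (\<forall>j<4 * m. cs ! (ds ! j) = w0 ! j)"
  proof -
    have "\<exists>i. i < n \<and> cs ! i = w0 ! j" if "j < 4 * m" for j
      using w0(1,2) that length_cs by (metis in_set_conv_nth nth_mem subsetD)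
    then obtain f where f: "\<And>j. j < 4 * m \<Longrightarrow> f j < n \<and> cs ! f j = w0 ! j" by metis
    then show ?thesis by (intro exI[of _ "map f [0..<4 * m]"]) auto
  qed
  then obtain ds where ds: "length ds = 4 * m" "\<forall>d\<in>set ds. d < n" "\<forall>j<4 * m. cs ! (ds ! j) = w0 ! j" by blast
  \<comment> \<open>\<open>z\<close> is the number under which the search would decode the known
    solution \<open>w0\<close>.\<close>
  obtain z where z: "z < n ^ (4 * m)" "\<forall>j<4 * m. z div n ^ j mod n = ds ! j" using ex_digits[of ds n] ds(1,2) by auto
  have dz: "decode z = w0" unfolding decode_def using z(2) ds(3) w0(1) by (intro nth_equalityI) auto
  \<comment> \<open>While no solution has been found the counter has not passed \<open>z\<close>,
    since candidate \<open>z\<close> is \<open>w0\<close> and would have been accepted.\<close>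
  define I where "I k u \<longleftrightarrow> lf u \<and> rw u 29 = k \<and> (if rw u 30 = 0 then valid (out u) \<and> set (out u) \<subseteq> set cs else k \<le> z)" for k and u :: mst
  have body: "runs M try_leaf u try_cost (I (Suc k))" if I: "I k u" "k < Suc z" for k u
  proof (rule runs_conseq[OF try_runs[of u k] order_refl])
    show "lf u" "rw u 29 = k" using I unfolding I_def by auto
    show "Suc k \<le> M" using I(2) z(1) nums(5) by linarith
    fix v :: mst assume v: "lf v \<and> rw v 29 = Suc k \<and> out v = decode k \<and> (rw v 30 = 0 \<longleftrightarrow> valid (decode k))"
    have "k \<noteq> z" if "rw v 30 \<noteq> 0" using v that dz w0(3) by auto
    then show "I (Suc k) v" using v I(2) set_decode[of k] unfolding I_def by auto
  qed
  define T where "T = real (big ^ big + 1) * (try_cost + bcost leaf_cond) + bcost leaf_cond"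
  have loop: "runs M (While leaf_cond try_leaf) u T (\<lambda>v. (\<exists>k. 0 \<le> k \<and> k \<le> Suc z \<and> I k v) \<and> \<not> bv leaf_cond v)"
    if "I 0 u" for u
  proof (rule runs_iter[where K = try_cost and n = "Suc z"])
    show tc: "0 \<le> try_cost" unfolding try_cost_def using bcost_ge[of decode_cond] bcost_ge[of check_cond] by simp
    show "okb M leaf_cond v \<and> (bv leaf_cond v \<longrightarrow> k < Suc z)" if "I k v" for k v using that unfolding I_def by auto
    have "Suc z \<le> big ^ big + 1" using z(1) nums(6) by linarith
    then have "real (Suc z) \<le> real (big ^ big + 1)" by (rule of_nat_mono)
    then show "real (Suc z - 0) * (try_cost + bcost leaf_cond) + bcost leaf_cond \<le> T"
      unfolding T_def diff_zero using tc bcost_ge[of leaf_cond] by (intro add_right_mono mult_right_mono) auto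
  qed (use that body in auto)
  have M20: "20 \<le> M" using bound by linarith
  have finish: "runs M leaf_done v (real (clen leaf_done)) leaf_post"
    if v: "(\<exists>k. 0 \<le> k \<and> k \<le> Suc z \<and> I k v) \<and> \<not> bv leaf_cond v" for v
  proof (rule runs_wp)
    have z: "lf v" "valid (out v)" "set (out v) \<subseteq> set cs" using v unfolding I_def by auto
    have r: "rw v 28 = 4 * m" "rw v 5 = cnt" "rw v 4 = hi" using z(1) unfolding lf_def by auto
    have "cnt + m \<le> M" "4 \<le> M" using m(2) bound by linarith+
    moreover have "leaf_post (v\<lparr>rw := (rw v)(5 := cnt + m, 3 := hi)\<rparr>)"
      using z unfolding leaf_post_def lf_def base_def out_def by simp
    ultimately show "wp M leaf_done v leaf_post" unfolding leaf_done_def using r by simp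
  qed simp
  have sc: "4 * (4 * (n div 18) + (2 * (n mod 18) - 1) div 9) = 4 * m" unfolding m(1) star_count_def ..
  let ?u = "s\<lparr>rw := (rw s)(6 := n, 28 := 4 * m, 29 := 0, 30 := 1, 34 := 4 * cnt, 35 := N + lo)\<rparr>"
  have I0: "I 0 ?u" unfolding I_def lf_def using base regs unfolding base_def by simp
  have ok: "4 * (n div 18) \<le> M" "2 * (n mod 18) \<le> M" "4 * (n div 18) + (2 * (n mod 18) - 1) div 9 \<le> M" "4 * m \<le> M"
    "4 * cnt \<le> M" "N + lo \<le> M"
  proof -
    have mm: "4 * (n div 18) + (2 * (n mod 18) - 1) div 9 = m" using sc by simp
    have nM: "5 * n \<le> M" using nums(2) bound by linarith
    show "4 * (n div 18) \<le> M" "2 * (n mod 18) \<le> M" using nM mod_less_eq_dividend[of n 18] div_le_dividend[of n 18] by linarith+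
    show "4 * (n div 18) + (2 * (n mod 18) - 1) div 9 \<le> M" "4 * m \<le> M" unfolding mm using nM nums(3) by linarith+
    show "4 * cnt \<le> M" "N + lo \<le> M" using m(2) bound range by linarith+
  qed
  have seq: "runs M (While leaf_cond try_leaf ;; leaf_done) ?u (T + real (clen leaf_done)) leaf_post"
    by (rule runs_Seq[OF runs_conseq[OF loop[OF I0] order_refl finish] order_refl]) auto
  show ?thesis unfolding leaf_def
  proof (rule runs_Seq_wp)
    show "wp M leaf_init s (\<lambda>u. runs M (While leaf_cond try_leaf ;; leaf_done) u (T + real (clen leaf_done)) leaf_post)"
      using seq ok M20 regs base unfolding leaf_init_def base_def
      by (simp add: sc[unfolded One_nat_def] range(3)[symmetric] del: distrib_left_numeral)
    show "real (clen leaf_init) + (T + real (clen leaf_done)) \<le> leaf_cost"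
      unfolding leaf_cost_def T_def leaf_def by simp
  qed
qed

end

section \<open>The whole algorithm\<close>

text \<open>The amortized rule: the drop of the potential \<open>p\<close> pays for the body and the
  test. A test costs at least one step and potentials are nonnegative, so the loop
  terminates.\<close>

lemma runs_While_potential:
  fixes I :: "mst \<Rightarrow> real \<Rightarrow> bool"
  assumes "I s p" "p + bcost b \<le> t"
    and ok: "\<And>s p. I s p \<Longrightarrow> okb M b s \<and> 0 \<le> p"
    and body: "\<And>s p. I s p \<Longrightarrow> bv b s \<Longrightarrow> \<exists>t\<ge>0. runs M c s t (\<lambda>s'. \<exists>p'. I s' p' \<and> p' + t + bcost b \<le> p)"
  shows "runs M (While b c) s t (\<lambda>s'. (\<exists>p'. I s' p') \<and> \<not> bv b s')"
proof -
  let ?Q = "\<lambda>s'. (\<exists>p'. I s' p') \<and> \<not> bv b s'"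
  have main: "runs M (While b c) s (p + bcost b) ?Q" if "p \<le> real n" "I s p" for n s p
    using that
  proof (induction n arbitrary: s p rule: less_induct)
    case (less n)
    show ?case
    proof (cases "bv b s")
      case False
      then show ?thesis using less ok by (intro runs_While_unfold) auto
    next
      case True
      obtain t1 where t1: "0 \<le> t1" "runs M c s t1 (\<lambda>s'. \<exists>p'. I s' p' \<and> p' + t1 + bcost b \<le> p)"
        using body less.prems True by blast
      have rec: "runs M (While b c) s' (p - t1) ?Q" if s': "\<exists>p'. I s' p' \<and> p' + t1 + bcost b \<le> p" for s'
      proof -
        obtain p' where p': "I s' p'" "p' + t1 + bcost b \<le> p" using s' by blast
        have "0 \<le> p'" using ok p' by blast
        then have "1 \<le> real n" "p' \<le> real n - 1" using p' t1(1) bcost_ge[of b] less.prems(1) by linarith+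
        then have "n - 1 < n" "p' \<le> real (n - 1)" by (auto simp: of_nat_diff)
        from runs_conseq[OF less.IH[OF this p'(1)], of "p - t1" ?Q] show ?thesis using p'(2) by simp
      qed
      have "runs M c s t1 (\<lambda>s'. runs M (While b c) s' (p - t1) ?Q)"
        by (rule runs_conseq[OF t1(2)]) (use rec in auto)
      then show ?thesis using True ok less.prems by (intro runs_While_unfold[where ?t1.0 = t1 and ?t2.0 = "p - t1"]) auto
    qed
  qed
  obtain n where "p \<le> real n" using real_arch_simple by blast
  from runs_conseq[OF main[OF this assms(1)] assms(2)] show ?thesis by simp
qed

section \<open>Potential of the pending cells\<close>

definition cell_step :: com where
  "cell_step = SetW 4 (WM (ends (WR 3))) ;; Cond (WL (WC big) (wsub (WR 4) (WR 3))) split leaf"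

abbreviation "cells_left \<equiv> WL (WR 3) (WR 2)"

definition step_overhead :: real where
  "step_overhead = real (clen (SetW 4 (WM (ends (WR 3))))) + real (length (cb (WL (WC big) (wsub (WR 4) (WR 3))) 0) + 1) + bcost cells_left"

definition pot_factor :: real where
  "pot_factor = 10 * (2 * split_cost + step_overhead) + leaf_cost + step_overhead"

text \<open>\<open>L + 1\<close> is the logarithm spent on sorting, fixed for the whole input;
  \<open>ln n\<close> measures the levels of cuts still to come. The summand 1 lets even a single
  point pay for its search.\<close>

definition pot :: "nat \<Rightarrow> nat \<Rightarrow> real" where
  "pot L n = pot_factor * (real L + 1) * (real n * (1 + ln (real n)))"

lemma cost_nonneg: "0 \<le> split_cost" "0 \<le> leaf_cost" "0 \<le> step_overhead" "0 \<le> pot_factor"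
proof -
  have c: "0 \<le> count_cost b1 b2" for b1 b2 unfolding count_cost_def using bcost_ge[of in_range] by simp
  have s: "0 \<le> sortby_cost A m e" for A m e
    unfolding sortby_cost_def setkeys_cost_def using msort_cost_ge bcost_ge[of in_range] by simp
  show "0 \<le> split_cost"
    unfolding split_cost_def cut_cell_cost_def cut_halved_cost_def cut_sheared_cost_def cut_about_center_cost_def sweep_then_cut_cost_def cut_at_slope_cost_def
    using c s bcost_ge[of unbalanced] by (intro add_nonneg_nonneg) (auto intro: order_trans[OF zero_le_one])
  show "0 \<le> leaf_cost" unfolding leaf_cost_def try_cost_def
    using bcost_ge[of leaf_cond] bcost_ge[of decode_cond] bcost_ge[of check_cond] by simp
  show "0 \<le> step_overhead" unfolding step_overhead_def using bcost_ge[of cells_left] by simp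
  then show "0 \<le> pot_factor" unfolding pot_factor_def using \<open>0 \<le> split_cost\<close> \<open>0 \<le> leaf_cost\<close> by simp
qed

lemma pot_leaf: "1 \<le> n \<Longrightarrow> leaf_cost + step_overhead \<le> pot L n"
proof -
  assume n: "1 \<le> n"
  have "0 \<le> real n * ln (real n)" using n by simp
  moreover have "1 \<le> real n" using n by simp
  ultimately have "1 \<le> real n * (1 + ln (real n))" unfolding distrib_left mult_1_right by linarith
  then have "1 * 1 \<le> (real L + 1) * (real n * (1 + ln (real n)))" by (intro mult_mono) auto
  then have "pot_factor * 1 \<le> pot_factor * ((real L + 1) * (real n * (1 + ln (real n))))"
    using cost_nonneg by (intro mult_left_mono) auto
  then show ?thesis unfolding pot_def using cost_nonneg unfolding pot_factor_def by (simp add: mult.assoc)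
qed

lemma pot_nonneg: "0 \<le> pot L n"
proof (cases "n = 0")
  case False
  then show ?thesis unfolding pot_def using cost_nonneg by (intro mult_nonneg_nonneg) auto
qed (simp add: pot_def)

text \<open>From \<open>ln (9/10) \<le> -1/10\<close> each part \<open>c\<close> satisfies
  \<open>c * (1 + ln c) \<le> c * (1 + ln n - 1/10)\<close>, so the sum falls by
  \<open>n/10\<close>. The factor 10 in \<open>pot_factor\<close> turns this into the cost of the
  cut, and the factor 2 there absorbs \<open>n + 1 \<le> 2 * n\<close>.\<close>

lemma pot_split:
  assumes "n = a + b" "10 * a \<le> 9 * n" "10 * b \<le> 9 * n" "1 \<le> a" "1 \<le> b"
  shows "pot L a + pot L b + ((real n + 1) * (real L + 1) * split_cost + step_overhead) \<le> pot L n"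
proof -
  have n1: "1 \<le> n" using assms by simp
  have part: "real c * (1 + ln (real c)) \<le> real c * (1 + ln (real n) - 1 / 10)" if "10 * c \<le> 9 * n" "1 \<le> c" for c
  proof -
    have "real c \<le> 9 / 10 * real n" using that(1) by linarith
    then have "ln (real c) \<le> ln (9 / 10 * real n)" using that(2) by (subst ln_le_cancel_iff) auto
    also have "\<dots> = ln (9 / 10) + ln (real n)" using n1 by (subst ln_mult_pos) auto
    also have "ln (9 / 10 :: real) \<le> 9 / 10 - 1" by (rule ln_le_minus_one) simp
    finally show ?thesis by (intro mult_left_mono) auto
  qed
  have "real a * (1 + ln (real a)) + real b * (1 + ln (real b))
    \<le> real a * (1 + ln (real n) - 1 / 10) + real b * (1 + ln (real n) - 1 / 10)"
    using part[of a] part[of b] assms by (intro add_mono) auto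
  also have "\<dots> = real n * (1 + ln (real n)) - real n / 10" unfolding assms(1) by (simp add: field_simps)
  finally have s: "real a * (1 + ln (real a)) + real b * (1 + ln (real b)) \<le> real n * (1 + ln (real n)) - real n / 10" .
  have f: "0 \<le> pot_factor * (real L + 1)" using cost_nonneg by simp
  have "pot L a + pot L b = pot_factor * (real L + 1) * (real a * (1 + ln (real a)) + real b * (1 + ln (real b)))"
    unfolding pot_def by (simp add: distrib_left)
  also have "\<dots> \<le> pot_factor * (real L + 1) * (real n * (1 + ln (real n)) - real n / 10)" using s f by (rule mult_left_mono)
  also have "\<dots> = pot L n - pot_factor * (real L + 1) * real n / 10" unfolding pot_def by (simp add: right_diff_distrib)
  finally have p: "pot L a + pot L b \<le> pot L n - pot_factor * (real L + 1) * real n / 10" .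
  have nL: "1 * 1 \<le> real n * (real L + 1)" using n1 by (intro mult_mono) auto
  have "(real n + 1) * (real L + 1) * split_cost \<le> (2 * real n) * (real L + 1) * split_cost"
    using n1 cost_nonneg by (intro mult_right_mono) auto
  moreover have "1 * step_overhead \<le> real n * (real L + 1) * step_overhead" using nL cost_nonneg by (intro mult_right_mono) auto
  moreover have "(10 * (2 * split_cost + step_overhead)) * ((real L + 1) * real n) \<le> pot_factor * ((real L + 1) * real n)"
    using cost_nonneg unfolding pot_factor_def by (intro mult_right_mono) auto
  ultimately have "(real n + 1) * (real L + 1) * split_cost + step_overhead \<le> pot_factor * (real L + 1) * real n / 10"
    by (simp add: algebra_simps)
  then show ?thesis using p by linarith
qed

section \<open>Additivity of the star count and the invariant of the main loop\<close>

lemma star_count_add: "18 dvd a \<Longrightarrow> star_count (a + b) = star_count a + star_count b"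
  unfolding star_count_def by (auto elim!: dvdE)

lemma star_count_ge: "2 * n \<le> 9 * star_count n + 9"
proof -
  define q x y where "q = n div 18" and "x = n mod 18" and "y = (2 * x - 1) div 9"
  have "n = 18 * q + x" unfolding q_def x_def by simp
  moreover have "2 * x - 1 < 9 * y + 9" unfolding y_def by linarith
  moreover have "star_count n = 4 * q + y" unfolding star_count_def q_def x_def y_def ..
  ultimately show ?thesis by linarith
qed

lemma seg_part:
  assumes "seg f a t = xs @ ys @ zs"
  shows "seg f a (length xs) = xs" "seg f (a + length xs) (length ys) = ys" "seg f (a + length xs + length ys) (length zs) = zs"
proof -
  have t: "t = length xs + (length ys + length zs)" using assms by (metis length_append length_seg)
  have "seg f a (length xs) @ seg f (a + length xs) (length ys) @ seg f (a + length xs + length ys) (length zs) = xs @ ys @ zs"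
    using assms unfolding t by (simp add: seg_add)
  then show "seg f a (length xs) = xs" "seg f (a + length xs) (length ys) = ys" "seg f (a + length xs + length ys) (length zs) = zs"
    by simp_all
qed

lemma length_filter_mset: "mset xs = mset ys \<Longrightarrow> length (filter P xs) = length (filter P ys)"
  by (metis mset_filter size_mset)

text \<open>Origin of 1200: the error \<open>30 * n\<close> of a cut adds 120 to the deficit, and
  the old deficit is scaled by \<open>m/n\<close>, at most \<open>9/10\<close>. So a deficit
  \<open>d\<close> becomes at most \<open>9/10 * d + 120\<close>, with fixed point 1200.\<close>

lemma color_step:
  fixes n m b B :: int
  assumes "0 < n" "\<bar>n * b - B * m\<bar> \<le> 30 * n" "n \<le> 4 * B + 1200" "10 * m \<le> 9 * n" "0 \<le> m"
  shows "m \<le> 4 * b + 1200"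
proof -
  have "0 \<le> (4 * B + 1200 - n) * m" using assms by (intro mult_nonneg_nonneg) auto
  then have "n * m \<le> 4 * (B * m) + 1200 * m" by (simp add: algebra_simps)
  moreover have "4 * (B * m) \<le> 4 * (n * b) + 120 * n" using assms(2) by linarith
  ultimately have "n * m \<le> n * (4 * b + 1200)" using assms(4) by (simp add: algebra_simps)
  then show ?thesis using assms(1) by simp
qed

fun chain :: "(nat \<Rightarrow> nat) \<Rightarrow> nat \<Rightarrow> 'a list list \<Rightarrow> bool" where
  "chain f lo [] = True"
| "chain f lo (c # ccs) = (f lo = lo + length c \<and> chain f (lo + length c) ccs)"

lemma chain_cong: "chain f lo ccs \<Longrightarrow> (\<And>i. lo \<le> i \<Longrightarrow> i < lo + length (concat ccs) \<Longrightarrow> g i = f i) \<Longrightarrow> \<forall>c\<in>set ccs. c \<noteq> [] \<Longrightarrow> chain g lo ccs"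
  by (induction ccs arbitrary: lo) auto

context points
begin

text \<open>A split scales the deficit \<open>n - 4b\<close> of a color by at most \<open>9/10\<close> and adds a bounded
  rounding error, so the deficit never exceeds 1200. In a cell of at least 10800 points that still leaves
  \<open>2n/9\<close> points of that color.\<close>

definition cell_ok :: "nat list \<Rightarrow> bool" where
  "cell_ok c \<longleftrightarrow> (let n = length c; b = length (filter blue c); r = length (filter (\<lambda>p. \<not> blue p) c) in
     0 < n \<and> n \<le> 4 * b + 1200 \<and> n \<le> 4 * r + 1200 \<and> (10800 \<le> n \<or> n \<le> 4 * b \<and> n \<le> 4 * r))"

definition far :: "nat list \<Rightarrow> nat list \<Rightarrow> bool" where
  "far c d \<longleftrightarrow> convex hull ((!) ps ` set c) \<inter> convex hull ((!) ps ` set d) = {}"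

text \<open>\<open>ds\<close> are the finished cells, \<open>ccs\<close> the pending ones.\<close>

definition progress :: "mst \<Rightarrow> nat list list \<Rightarrow> nat list list \<Rightarrow> bool" where
  "progress u ds ccs \<longleftrightarrow> base u \<and> seg (mw u) N N = concat ds @ concat ccs \<and>
     mset (concat ds @ concat ccs) = mset [0..<N] \<and> rw u 3 = length (concat ds) \<and>
     chain (\<lambda>i. mw u (3 * N + i)) (length (concat ds)) ccs \<and> (\<forall>c\<in>set ccs. cell_ok c) \<and> sorted_wrt far (ds @ ccs) \<and>
     packing (set rs) (set bs) (blocks (seg (mw u) 0 (4 * rw u 5))) \<and>
     (\<forall>t\<in>set (blocks (seg (mw u) 0 (4 * rw u 5))). \<exists>d\<in>set ds. set t \<subseteq> (!) ps ` set d) \<and>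
     set (seg (mw u) 0 (4 * rw u 5)) \<subseteq> {..<N} \<and>
     rw u 5 + (\<Sum>c\<leftarrow>ccs. star_count (length c)) = star_count N"

lemma far_subset: "far c d \<Longrightarrow> set c' \<subseteq> set c \<Longrightarrow> set d' \<subseteq> set d \<Longrightarrow> far c' d'"
  unfolding far_def using hull_mono[OF image_mono, of "set c'" "set c" convex "(!) ps"]
    hull_mono[OF image_mono, of "set d'" "set d" convex "(!) ps"] by blast

lemma progressD:
  assumes "progress u ds (c # ccs)"
  shows "base u" "cell_ok c" "rw u 3 = length (concat ds)" "mw u (3 * N + rw u 3) = rw u 3 + length c"
    "seg (mw u) (N + rw u 3) (length c) = c" "distinct c" "set c \<subseteq> {..<N}" "0 < length c" "rw u 3 + length c \<le> N"
    "rw u 5 + star_count (length c) \<le> star_count N"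
    "seg (mw u) N (rw u 3) = concat ds" "seg (mw u) (N + (rw u 3 + length c)) (length (concat ccs)) = concat ccs"
    "length (concat ds) + length c + length (concat ccs) = N"
proof -
  note p = assms[unfolded progress_def]
  show "base u" "cell_ok c" "rw u 3 = length (concat ds)" using p by auto
  then show "0 < length c" unfolding cell_ok_def Let_def by blast
  show "mw u (3 * N + rw u 3) = rw u 3 + length c" using p by auto
  have s: "seg (mw u) N N = concat ds @ c @ concat ccs" using p by auto
  note parts = seg_part[OF s]
  show "seg (mw u) (N + rw u 3) (length c) = c" "seg (mw u) N (rw u 3) = concat ds"
    "seg (mw u) (N + (rw u 3 + length c)) (length (concat ccs)) = concat ccs"
    using parts p by (auto simp: add.assoc)
  have ms: "mset (concat ds @ c @ concat ccs) = mset [0..<N]" using p by simp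
  have "distinct (concat ds @ c @ concat ccs)" using ms by (metis distinct_upt mset_eq_imp_distinct_iff)
  then show "distinct c" by simp
  have "set (concat ds @ c @ concat ccs) = set [0..<N]" using ms by (metis mset_eq_setD)
  then show "set c \<subseteq> {..<N}" by auto
  have "length (concat ds @ c @ concat ccs) = length [0..<N]" using ms by (rule mset_eq_length)
  then show l: "length (concat ds) + length c + length (concat ccs) = N" by simp
  show "rw u 3 + length c \<le> N" using l p by simp
  show "rw u 5 + star_count (length c) \<le> star_count N" using p by simp
qed

lemma progress_split:
  assumes P: "progress u ds (c # ccs)" and lo: "lo = rw u 3" and hi: "hi = lo + length c" and big: "big < length c"
    and v: "lo < mid" "mid < hi" "18 dvd (mid - lo)" "length c \<le> 10 * (mid - lo)" "length c \<le> 10 * (hi - mid)"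
      "base v" "rw v 3 = lo" "rw v 5 = rw u 5" "mw v (3 * N + lo) = mid" "mw v (3 * N + mid) = hi"
      "\<And>i. (i < N + lo \<or> N + hi \<le> i) \<and> (i < 2 * N \<or> 3 * N \<le> i) \<and> i \<noteq> 3 * N + lo \<and> i \<noteq> 3 * N + mid \<Longrightarrow> mw v i = mw u i"
    and c12: "c1 = seg (mw v) (N + lo) (mid - lo)" "c2 = seg (mw v) (N + mid) (hi - mid)" "mset (c1 @ c2) = mset c" "far c1 c2"
    and col: "\<bar>int (length c) * int (length (filter blue c1)) - int (length (filter blue c)) * int (mid - lo)\<bar> \<le> 30 * int (length c)"
  shows "progress v ds (c1 # c2 # ccs)"
proof -
  note p = P[unfolded progress_def] and d = progressD[OF P]
  have l12: "length c1 = mid - lo" "length c2 = hi - mid" unfolding c12 by simp_all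
  have hiN: "hi \<le> N" using d(9) lo hi by simp
  have s1: "set c1 \<subseteq> set c" "set c2 \<subseteq> set c" using mset_eq_setD[OF c12(3)] by auto
  have fl: "length (filter Q c1) + length (filter Q c2) = length (filter Q c)" for Q
    using length_filter_mset[OF c12(3), of Q] by simp
  have tot: "length (filter blue e) + length (filter (\<lambda>p. \<not> blue p) e) = length e" for e :: "nat list"
    by (rule sum_length_filter_compl)
  have e1: "seg (mw v) N lo = concat ds"
  proof -
    have "seg (mw v) N lo = seg (mw u) N lo" by (rule seg_cong, rule v(11)) (use hiN v(1,2) in linarith)
    then show ?thesis using d(11) lo by simp
  qed
  have e3: "seg (mw v) (N + hi) (length (concat ccs)) = concat ccs"
  proof -
    have "seg (mw v) (N + hi) (length (concat ccs)) = seg (mw u) (N + hi) (length (concat ccs))"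
      by (rule seg_cong, rule v(11)) (use d(3,13) lo hi in linarith)
    then show ?thesis using d(12) lo hi by simp
  qed
  have "N = lo + ((mid - lo) + ((hi - mid) + length (concat ccs)))" using d(3,13) lo hi v(1,2) by linarith
  then have "seg (mw v) N N = seg (mw v) N lo @ seg (mw v) (N + lo) (mid - lo) @ seg (mw v) (N + lo + (mid - lo)) (hi - mid)
      @ seg (mw v) (N + lo + (mid - lo) + (hi - mid)) (length (concat ccs))"
    by (metis seg_add)
  moreover have "N + lo + (mid - lo) = N + mid" "N + mid + (hi - mid) = N + hi" using v(1,2) by simp_all
  ultimately have seg: "seg (mw v) N N = concat ds @ c1 @ c2 @ concat ccs" using e1 e3 c12(1,2) by simp
  \<comment> \<open>The output occupies at most \<open>8/9 * N\<close> words, so it ends before the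
    permuted points, and cutting a cell leaves it untouched.\<close>
  have out: "seg (mw v) 0 (4 * rw v 5) = seg (mw u) 0 (4 * rw u 5)"
  proof -
    have "9 * rw u 5 \<le> 2 * N" using d(10) star_count_le[of N] by linarith
    then have "4 * rw u 5 \<le> N" by linarith
    then show ?thesis unfolding v(8) by (intro seg_cong v(11)) (use hiN v(1,2) in linarith)
  qed
  have ne: "\<forall>e\<in>set ccs. e \<noteq> []" using p unfolding cell_ok_def Let_def by auto
  have chain: "chain (\<lambda>i. mw v (3 * N + i)) (length (concat ds)) (c1 # c2 # ccs)"
  proof -
    have "chain (\<lambda>i. mw u (3 * N + i)) hi ccs" using p lo hi by auto
    then have "chain (\<lambda>i. mw v (3 * N + i)) hi ccs"
      by (rule chain_cong[OF _ _ ne]) (rule v(11), use v(1,2) hiN in linarith)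
    then show ?thesis using v d(3) lo l12 by simp
  qed
  have B1: "120000 < length c" using big unfolding big_def .
  \<comment> \<open>Used for either part. The colors are symmetric here, because the red error of a
    part is the negative of its blue error.\<close>
  have okc: "cell_ok e" if "length e = k" "10 * k \<le> 9 * length c" "length c \<le> 10 * k"
    "\<bar>int (length c) * int (length (filter blue e)) - int (length (filter blue c)) * int k\<bar> \<le> 30 * int (length c)" for e k
  proof -
    have C: "length c \<le> 4 * length (filter blue c) + 1200" "length c \<le> 4 * length (filter (\<lambda>p. \<not> blue p) c) + 1200"
      using d(2) unfolding cell_ok_def Let_def by blast+
    have "int k \<le> 4 * int (length (filter blue e)) + 1200"
      by (rule color_step[of "int (length c)" _ "int (length (filter blue c))"]) (use that C B1 in linarith)+
    moreover have "int k \<le> 4 * int (length (filter (\<lambda>p. \<not> blue p) e)) + 1200"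
    proof (rule color_step[of "int (length c)" _ "int (length (filter (\<lambda>p. \<not> blue p) c))"])
      have r: "int (length (filter (\<lambda>p. \<not> blue p) e)) = int k - int (length (filter blue e))"
        "int (length (filter (\<lambda>p. \<not> blue p) c)) = int (length c) - int (length (filter blue c))"
        using tot[of e] tot[of c] that(1) by linarith+
      show "\<bar>int (length c) * int (length (filter (\<lambda>p. \<not> blue p) e)) - int (length (filter (\<lambda>p. \<not> blue p) c)) * int k\<bar> \<le> 30 * int (length c)"
        unfolding r using that(4) by (simp add: algebra_simps abs_minus_commute)
    qed (use that C B1 in linarith)+
    ultimately show ?thesis unfolding cell_ok_def Let_def using that(1,3) B1 by auto
  qed
  have lc: "mid - lo + (hi - mid) = length c" using hi v(1,2) by linarith
  have ok1: "cell_ok c1" by (rule okc[OF l12(1)]) (use v lc col in linarith)+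
  have ok2: "cell_ok c2"
  proof (rule okc[OF l12(2)])
    have e: "int (length (filter blue c2)) = int (length (filter blue c)) - int (length (filter blue c1))"
      "int (hi - mid) = int (length c) - int (mid - lo)" using fl[of blue] lc by linarith+
    show "\<bar>int (length c) * int (length (filter blue c2)) - int (length (filter blue c)) * int (hi - mid)\<bar> \<le> 30 * int (length c)"
      unfolding e using col by (simp add: algebra_simps abs_minus_commute)
  qed (use v lc in linarith)+
  have "sorted_wrt far (ds @ c # ccs)" using p by blast
  then have f: "sorted_wrt far ds" "\<forall>x\<in>set ds. far x c" "\<forall>x\<in>set ds. \<forall>y\<in>set ccs. far x y" "\<forall>y\<in>set ccs. far c y" "sorted_wrt far ccs"
    by (auto simp: sorted_wrt_append)
  have "sorted_wrt far (ds @ c1 # c2 # ccs)"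
    using f c12(4) s1 far_subset by (auto simp: sorted_wrt_append)
  moreover have "star_count (length c1) + star_count (length c2) = star_count (length c)"
    using star_count_add[OF v(3), of "hi - mid"] l12 lc by simp
  moreover have "mset (concat ds @ concat (c1 # c2 # ccs)) = mset [0..<N]"
  proof -
    have "mset (concat ds @ concat (c1 # c2 # ccs)) = mset (concat ds) + (mset (c1 @ c2) + mset (concat ccs))" by (simp add: add.assoc)
    also have "\<dots> = mset (concat ds @ concat (c # ccs))" unfolding c12(3) by simp
    finally show ?thesis using p by metis
  qed
  ultimately show ?thesis unfolding progress_def out using p seg chain ok1 ok2 v(6,7) d(3) lo v(8) by auto
qed

end

section \<open>The main program and its correctness\<close>

definition psum :: "nat \<Rightarrow> nat list list \<Rightarrow> real" where
  "psum L ccs = (\<Sum>c\<leftarrow>ccs. pot L (length c))"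

lemma psum_nonneg: "0 \<le> psum L ccs"
  unfolding psum_def by (rule sum_list_nonneg) (auto simp: pot_nonneg)

definition main_init :: com where
  "main_init = SetW 2 (wadd (WR 0) (WR 1)) ;; SetW 12 (wadd (WR 2) (WR 2)) ;; SetW 20 (WC 0)"

definition number_body :: com where
  "number_body = StoreW (wadd (WR 2) (WR 20)) (WR 20) ;; incr 20"

abbreviation "number_cond \<equiv> WL (WR 20) (WR 2)"

definition first_cell :: com where "first_cell = StoreW (ends (WC 0)) (WR 2)"
definition report :: com where "report = SetW 0 (WR 5)"

definition main :: com where
  "main = main_init ;; While number_cond number_body ;; first_cell ;; While cells_left cell_step ;; report"

definition number_cost :: real where
  "number_cost = real (clen number_body) + bcost number_cond"

definition main_time :: "nat \<Rightarrow> nat \<Rightarrow> real" where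
  "main_time L N = real (clen main) + (real N + 1) * number_cost + (pot L N + bcost cells_left)"

context points
begin

lemma blocks_append:
  assumes "length w = 4 * k" "length w' = 4 * l"
  shows "blocks (w @ w') = blocks w @ blocks w'"
proof (rule nth_equalityI)
  have lb: "length (blocks w) = k" "length (blocks w') = l" "length (blocks (w @ w')) = k + l"
    unfolding blocks_def using assms by simp_all
  show "length (blocks (w @ w')) = length (blocks w @ blocks w')" using lb by simp
  fix i assume "i < length (blocks (w @ w'))"
  then have i: "i < k + l" using lb by simp
  then have l: "blocks (w @ w') ! i = block (w @ w') i" unfolding blocks_def using assms by simp
  show "blocks (w @ w') ! i = (blocks w @ blocks w') ! i"
  proof (cases "i < k")
    case True
    then have "block (w @ w') i = block w i" unfolding block_def using assms by (simp add: nth_append)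
    moreover have "(blocks w @ blocks w') ! i = block w i" using True lb assms unfolding blocks_def by (simp add: nth_append)
    ultimately show ?thesis using l by simp
  next
    case False
    then obtain j where j: "i = k + j" by (metis le_add_diff_inverse not_less)
    have "block (w @ w') i = block w' j" unfolding block_def j using assms by (simp add: nth_append)
    moreover have "(blocks w @ blocks w') ! i = block w' j" using i lb assms unfolding j blocks_def by (simp add: nth_append)
    ultimately show ?thesis using l by simp
  qed
qed

lemma set_blocks:
  assumes "t \<in> set (blocks w)"
  shows "set t \<subseteq> (!) ps ` set w" "length t = 4"
proof -
  obtain i where i: "i < length w div 4" "t = block w i" using assms unfolding blocks_def by auto
  then have "4 * i + 3 < length w" by linarith
  then show "set t \<subseteq> (!) ps ` set w" unfolding i(2) block_def by auto
  show "length t = 4" unfolding i(2) block_def by simp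
qed

text \<open>All earlier stars live in finished cells, whose hulls avoid that of \<open>c\<close>,
  and the new stars live in \<open>c\<close>. So the two packings can simply be appended.\<close>

lemma progress_leaf:
  assumes P: "progress u ds (c # ccs)" and m: "m = star_count (length c)"
    and v: "base v" "rw v 3 = rw u 3 + length c" "rw v 5 = rw u 5 + m"
      "\<And>a. a < 4 * rw u 5 \<or> 4 * rw u 5 + 4 * m \<le> a \<Longrightarrow> mw v a = mw u a"
    and out: "valid (seg (mw v) (4 * rw u 5) (4 * m))" "set (seg (mw v) (4 * rw u 5) (4 * m)) \<subseteq> set c"
  shows "progress v (ds @ [c]) ccs"
proof -
  note p = P[unfolded progress_def] and d = progressD[OF P]
  let ?w = "seg (mw u) 0 (4 * rw u 5)" and ?o = "seg (mw v) (4 * rw u 5) (4 * m)"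
  have fit: "4 * rw u 5 + 4 * m \<le> N" using d(10) star_count_le[of N] m by linarith
  have w: "seg (mw v) 0 (4 * rw v 5) = ?w @ ?o"
  proof -
    have "seg (mw v) 0 (4 * rw u 5) = ?w" by (rule seg_cong, rule v(4)) linarith
    then show ?thesis unfolding v(3) using seg_add[of "mw v" 0 "4 * rw u 5" "4 * m"] by (simp add: distrib_left)
  qed
  have bl: "blocks (seg (mw v) 0 (4 * rw v 5)) = blocks ?w @ blocks ?o" unfolding w by (rule blocks_append) simp_all
  have po: "packing (set rs) (set bs) (blocks ?o)"
    by (rule valid_packing[OF out(1)]) (use out(2) d(7) in auto)
  have pw: "packing (set rs) (set bs) (blocks ?w)" "\<forall>t\<in>set (blocks ?w). \<exists>d\<in>set ds. set t \<subseteq> (!) ps ` set d" "set ?w \<subseteq> {..<N}"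
    using p by blast+
  have far: "far x c" if "x \<in> set ds" for x using p that by (auto simp: sorted_wrt_append)
  have ap: "apart t t'" if t: "t \<in> set (blocks ?w)" "t' \<in> set (blocks ?o)" for t t'
  proof -
    obtain x where x: "x \<in> set ds" "set t \<subseteq> (!) ps ` set x" using pw(2) t(1) by blast
    have "set t' \<subseteq> (!) ps ` set c" using set_blocks(1)[OF t(2)] out(2) by blast
    moreover have "t \<noteq> []" "t' \<noteq> []" using set_blocks(2)[OF t(1)] set_blocks(2)[OF t(2)] by auto
    ultimately show ?thesis using apartI_hull[OF x(2)] far[OF x(1)] unfolding far_def by blast
  qed
  have pk: "packing (set rs) (set bs) (blocks (seg (mw v) 0 (4 * rw v 5)))"
    unfolding bl by (rule packing_append[OF pw(1) po]) (use ap in auto)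
  have "\<exists>e\<in>set (ds @ [c]). set t \<subseteq> (!) ps ` set e" if "t \<in> set (blocks (seg (mw v) 0 (4 * rw v 5)))" for t
  proof (cases "t \<in> set (blocks ?w)")
    case True then show ?thesis using pw(2) by auto
  next
    case False
    then have "set t \<subseteq> (!) ps ` set c" using set_blocks(1)[of t ?o] out(2) that unfolding bl by auto
    then show ?thesis by simp
  qed
  moreover have "set (seg (mw v) 0 (4 * rw v 5)) \<subseteq> {..<N}" unfolding w using pw(3) out(2) d(7) by auto
  moreover have "seg (mw v) N N = seg (mw u) N N" by (rule seg_cong, rule v(4)) (use fit in linarith)
  moreover have "chain (\<lambda>i. mw v (3 * N + i)) (length (concat (ds @ [c]))) ccs"
  proof -
    have "mw v (3 * N + i) = mw u (3 * N + i)" for i by (rule v(4)) (use fit in linarith)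
    then show ?thesis using p by simp
  qed
  ultimately show ?thesis unfolding progress_def using p v pk m d(3) by (simp add: add.assoc)
qed

lemma cell_solvable:
  assumes "cell_ok c" "distinct c" "set c \<subseteq> {..<N}"
  shows "\<exists>w. length w = 4 * star_count (length c) \<and> set w \<subseteq> set c \<and> valid w"
proof (rule ex_valid[OF assms(3)])
  let ?R = "(!) ps ` {p \<in> set c. \<not> blue p}" and ?B = "(!) ps ` {p \<in> set c. blue p}"
  have card: "card ((!) ps ` {p \<in> set c. Q p}) = length (filter Q c)" for Q
  proof -
    have "inj_on ((!) ps) {p \<in> set c. Q p}" by (rule inj_points) (use assms(3) in blast)
    then have "card ((!) ps ` {p \<in> set c. Q p}) = card {p \<in> set c. Q p}" by (rule card_image)
    also have "\<dots> = length (filter Q c)" using distinct_card[OF distinct_filter[OF assms(2), of Q]] by simp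
    finally show ?thesis .
  qed
  have cR: "card ?R = length (filter (\<lambda>p. \<not> blue p) c)" by (rule card)
  have cB: "card ?B = length (filter blue c)" by (rule card)
  have tot: "card ?R + card ?B = length c" unfolding cR cB using sum_length_filter_compl[of blue c] by simp
  \<comment> \<open>\<open>2n/9 \<le> (n - 1200)/4\<close> amounts to \<open>10800 \<le> n\<close>;
    in smaller cells there is no deficit.\<close>
  have le: "star_count (length c) \<le> card ?R" "star_count (length c) \<le> card ?B"
  proof -
    have "9 * star_count (length c) \<le> 2 * length c" by (rule star_count_le)
    moreover have "length c \<le> 4 * card ?B + 1200" "length c \<le> 4 * card ?R + 1200"
      "10800 \<le> length c \<or> length c \<le> 4 * card ?B \<and> length c \<le> 4 * card ?R"
      using assms(1) unfolding cell_ok_def Let_def cR cB by blast+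
    ultimately show "star_count (length c) \<le> card ?R" "star_count (length c) \<le> card ?B" by linarith+
  qed
  have "packs (star_count (card ?R + card ?B)) ?R ?B"
  proof (rule packs_star_count)
    have "ps ! p \<in> set ps" if "p \<in> set c" for p using that assms(3) unfolding N_def by (meson lessThan_iff nth_mem subsetD)
    then have "?R \<union> ?B \<subseteq> set ps" by blast
    then show "general_position (?R \<union> ?B)" using general_position_subset[OF gp] by blast
    have "?R \<subseteq> set rs" "?B \<subseteq> set bs" using blue_iff assms(3) by blast+
    then show "?R \<inter> ?B = {}" using distinct_points by auto
  qed (use le tot in simp_all)
  then show "packs (star_count (length c)) ?R ?B" using tot by simp
qed

text \<open>A cut is paid by \<open>pot_split\<close>, an exhaustive search by the whole potential
  of its cell through \<open>pot_leaf\<close>.\<close>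

lemma step_runs:
  assumes P: "progress u ds (c # ccs)" and bound: "N * N + 4 * N + 1 \<le> M" "5 * N + 20 \<le> M" "N ^ big \<le> M" "big \<le> M"
    and logN: "N \<le> 4 ^ L"
  shows "\<exists>t\<ge>0. runs M cell_step u t (\<lambda>v. \<exists>ds' ccs'. progress v ds' ccs' \<and> psum L ccs' + t + bcost cells_left \<le> psum L (c # ccs))"
proof -
  note d = progressD[OF P]
  define lo hi n where "lo = rw u 3" and "hi = lo + length c" and "n = length c"
  let ?set = "SetW 4 (WM (ends (WR 3)))" and ?b = "WL (WC big) (wsub (WR 4) (WR 3))"
  define u' where "u' = u\<lparr>rw := (rw u)(4 := hi)\<rparr>"
  have P': "progress u' ds (c # ccs)" using P unfolding progress_def base_def u'_def by simp
  have r: "rw u' 3 = lo" "rw u' 4 = hi" "mw u' = mw u" "rw u' 5 = rw u 5" "base u'"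
    using P' unfolding u'_def lo_def progress_def by simp_all
  have rng: "lo < hi" "hi \<le> N" "n = hi - lo" using d(8,9) unfolding lo_def hi_def n_def by simp_all
  have cs: "c = seg (mw u') (N + lo) n" using d(5) r unfolding lo_def n_def by simp
  define T where "T = (if big < n then (real n + 1) * (real L + 1) * split_cost else leaf_cost)"
  define t where "t = real (clen ?set) + (T + real (length (cb ?b 0) + 1))"
  have T0: "0 \<le> T" unfolding T_def using cost_nonneg by auto
  let ?Q = "\<lambda>v. \<exists>ds' ccs'. progress v ds' ccs' \<and> psum L ccs' + t + bcost cells_left \<le> psum L (c # ccs)"
  have tb: "t + bcost cells_left = T + step_overhead" unfolding t_def step_overhead_def by simp
  have sp: "runs M split u' T ?Q" if big: "big < n"
  proof -
    interpret S: split_cell rs bs M L u' lo hi n c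
      by unfold_locales (use r rng cs d(6,7) big bound logN in auto)
    have Tn: "T = S.W * split_cost" unfolding T_def S.W_def using big by simp
    show ?thesis unfolding Tn
    proof (rule runs_conseq[OF S.split_runs order_refl])
      fix v assume "S.split_post v"
      then obtain mid where mid: "lo < mid" "mid < hi" "18 dvd (mid - lo)" "n \<le> 10 * (mid - lo)" "n \<le> 10 * (hi - mid)"
        "base v" "rw v 3 = lo" "rw v 5 = rw u' 5" "mw v (3 * N + lo) = mid" "mw v (3 * N + mid) = hi"
        "\<And>i. (i < N + lo \<or> N + hi \<le> i) \<and> (i < 2 * N \<or> 3 * N \<le> i) \<and> i \<noteq> 3 * N + lo \<and> i \<noteq> 3 * N + mid \<Longrightarrow> mw v i = mw u' i"
        "mset (seg (mw v) (N + lo) (mid - lo) @ seg (mw v) (N + mid) (hi - mid)) = mset c"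
        "convex hull ((!) ps ` set (seg (mw v) (N + lo) (mid - lo))) \<inter> convex hull ((!) ps ` set (seg (mw v) (N + mid) (hi - mid))) = {}"
        "\<bar>int n * int (length (filter blue (seg (mw v) (N + lo) (mid - lo)))) - int S.nb * int (mid - lo)\<bar> \<le> 30 * int n"
        unfolding S.split_post_def by blast
      let ?c1 = "seg (mw v) (N + lo) (mid - lo)" and ?c2 = "seg (mw v) (N + mid) (hi - mid)"
      have nb: "S.nb = length (filter blue c)"
        unfolding S.nb_def using distinct_card[OF distinct_filter[OF d(6), of blue]] by simp
      have "progress v ds (?c1 # ?c2 # ccs)"
      proof (rule progress_split[OF P', of lo hi mid v ?c1 ?c2])
        show "lo = rw u' 3" using r by simp
        show "hi = lo + length c" by (fact hi_def)
        show "far ?c1 ?c2" unfolding far_def by (fact mid(13))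
        show "mw v i = mw u' i" if "(i < N + lo \<or> N + hi \<le> i) \<and> (i < 2 * N \<or> 3 * N \<le> i) \<and> i \<noteq> 3 * N + lo \<and> i \<noteq> 3 * N + mid" for i
          using mid(11) that by blast
        show "big < length c" "length c \<le> 10 * (mid - lo)" "length c \<le> 10 * (hi - mid)"
          "\<bar>int (length c) * int (length (filter blue ?c1)) - int (length (filter blue c)) * int (mid - lo)\<bar> \<le> 30 * int (length c)"
          using big mid(4,5,14) unfolding nb n_def by blast+
      qed (fact mid refl)+
      moreover have "psum L (?c1 # ?c2 # ccs) + t + bcost cells_left \<le> psum L (c # ccs)"
      proof -
        have "pot L (mid - lo) + pot L (hi - mid) + ((real n + 1) * (real L + 1) * split_cost + step_overhead) \<le> pot L n"
          by (rule pot_split) (use mid rng in linarith)+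
        then show ?thesis using tb big unfolding psum_def T_def by (simp add: n_def)
      qed
      ultimately show "?Q v" by blast
    qed
  qed
  have lf: "runs M leaf u' T ?Q" if small: "\<not> big < n"
  proof -
    obtain w0 where w0: "length w0 = 4 * star_count n" "set w0 \<subseteq> set c" "valid w0"
      using cell_solvable[OF d(2,6,7)] unfolding n_def by blast
    have fit: "4 * rw u 5 + 4 * star_count n \<le> N" using d(10) star_count_le[of N] unfolding n_def by linarith
    have NN: "N * N \<le> M" using bound(1) by linarith
    interpret F: leaf_cell rs bs M u' lo hi n "rw u 5" "star_count n" c w0
      by unfold_locales (use r rng cs d(7) small bound w0 fit NN in auto)
    have Tl: "T = leaf_cost" unfolding T_def using small by simp
    show ?thesis unfolding Tl
    proof (rule runs_conseq[OF F.leaf_runs order_refl])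
      fix v assume v: "F.leaf_post v"
      note v = v[unfolded F.leaf_post_def F.out_def]
      have "progress v (ds @ [c]) ccs"
      proof (rule progress_leaf[OF P', of "star_count n" v])
        show "rw v 3 = rw u' 3 + length c" using v r(1) unfolding hi_def by blast
        show "mw v a = mw u' a" if "a < 4 * rw u' 5 \<or> 4 * rw u' 5 + 4 * star_count n \<le> a" for a
          using v that unfolding r(4) by blast
      qed (use v in \<open>simp_all add: r(4) n_def\<close>)
      moreover have "psum L ccs + t + bcost cells_left \<le> psum L (c # ccs)"
        using pot_leaf[of n L] d(8) tb Tl unfolding psum_def by (simp add: n_def)
      ultimately show "?Q v" by blast
    qed
  qed
  have cond: "runs M (Cond ?b split leaf) u' (T + real (length (cb ?b 0) + 1)) ?Q"
  proof (rule runs_Cond[OF _ _ _ order_refl])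
    show "okb M ?b u'" using bound by simp
    have bb: "bv ?b u' \<longleftrightarrow> big < n" using r rng by simp
    show "runs M split u' T ?Q" if "bv ?b u'" using sp that bb by blast
    show "runs M leaf u' T ?Q" if "\<not> bv ?b u'" using lf that bb by blast
  qed
  have "runs M cell_step u t ?Q" unfolding cell_step_def t_def
  proof (rule runs_Seq_wp[OF _ order_refl])
    have N2: "rw u 2 = N" using d(1) unfolding base_def by blast
    have e: "mw u (3 * N + lo) = hi" using d(4) unfolding lo_def hi_def .
    have e3: "N + N + N = 3 * N" by simp
    have "3 * N + lo \<le> M" "N + N \<le> M" "3 * N \<le> M" using bound rng by linarith+
    then show "wp M ?set u (\<lambda>v. runs M (Cond ?b split leaf) v (T + real (length (cb ?b 0) + 1)) (\<lambda>v. \<exists>ds' ccs'. progress v ds' ccs' \<and>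
        psum L ccs' + (real (clen ?set) + (T + real (length (cb ?b 0) + 1))) + bcost cells_left \<le> psum L (c # ccs)))"
      using cond N2 e unfolding ends_def u'_def t_def lo_def by (simp add: e3)
  qed
  moreover have "0 \<le> t" unfolding t_def using T0 by simp
  ultimately show ?thesis by blast
qed

lemma number_runs:
  assumes u: "rw u 2 = N" "rw u 20 = 0" and bound: "5 * N + 20 \<le> M"
  shows "runs M (While number_cond number_body) u ((real N + 1) * number_cost) (\<lambda>v. seg (mw v) N N = [0..<N] \<and>
    (\<forall>a. a < N \<or> 2 * N \<le> a \<longrightarrow> mw v a = mw u a) \<and> mx v = mx u \<and> (\<forall>i. i \<noteq> 20 \<longrightarrow> rw v i = rw u i))"
proof -
  define I where "I k v \<longleftrightarrow> seg (mw v) N k = [0..<k] \<and> (\<forall>a. a < N \<or> 2 * N \<le> a \<longrightarrow> mw v a = mw u a) \<and> mx v = mx u \<and>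
    (\<forall>i. i \<noteq> 20 \<longrightarrow> rw v i = rw u i)" for k and v :: mst
  have body: "runs M number_body v (real (clen number_body)) (\<lambda>v'. I (Suc k) v' \<and> rw v' 20 = Suc k)"
    if I: "I k v" "rw v 20 = k" and k: "k < N" for k v
  proof (rule runs_wp)
    have ok: "N + k \<le> M" "Suc k \<le> M" "1 \<le> M" using k bound by linarith+
    have r: "rw v 2 = N" using I u unfolding I_def by simp
    have "I (Suc k) (v\<lparr>mw := (mw v)(N + k := k), rw := (rw v)(20 := Suc k)\<rparr>)"
      using I k unfolding I_def by (auto simp: seg_Suc)
    then show "wp M number_body v (\<lambda>v'. I (Suc k) v' \<and> rw v' 20 = Suc k)"
      unfolding number_body_def using r I(2) ok by simp
  qed simp
  have "runs M (While number_cond number_body) u ((real N + 1) * number_cost) (\<lambda>v. I N v \<and> rw v 20 = N)"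
  proof (rule runs_for[where a = 0 and K = "real (clen number_body)"])
    show "real (N - 0) * (real (clen number_body) + bcost number_cond) + bcost number_cond \<le> (real N + 1) * number_cost"
      unfolding number_cost_def by (simp add: algebra_simps)
  qed (use u body in \<open>auto simp: I_def\<close>)
  then show ?thesis by (rule runs_conseq) (auto simp: I_def)
qed

lemma main_runs:
  assumes s: "rw s 0 = length rs" "rw s 1 = length bs" "rw s 3 = 0" "rw s 5 = 0"
      "\<And>p. p < N \<Longrightarrow> mx s (2 * p) = X p \<and> mx s (2 * p + 1) = Y p"
    and bal: "N \<le> 4 * length rs" "N \<le> 4 * length bs" "0 < N"
    and bound: "N * N + 4 * N + 1 \<le> M" "5 * N + 20 \<le> M" "N ^ big \<le> M" "big \<le> M" and logN: "N \<le> 4 ^ L"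
  shows "runs M main s (main_time L N) (\<lambda>v. rw v 0 = star_count N \<and> set (seg (mw v) 0 (4 * star_count N)) \<subseteq> {..<N} \<and>
    packing (set rs) (set bs) (blocks (seg (mw v) 0 (4 * star_count N))))" (is "runs M main s _ ?Q")
proof -
  have rep: "runs M report v (real (clen report)) ?Q" if "progress v ds []" for v ds
    unfolding report_def by (rule runs_wp) (use that in \<open>auto simp: progress_def\<close>)
  have loop: "runs M (While cells_left cell_step) u (pot L N + bcost cells_left) (\<lambda>v. \<exists>ds. progress v ds [])"
    if u: "progress u [] [[0..<N]]" for u
  proof -
    define I where "I v p \<longleftrightarrow> (\<exists>ds ccs. progress v ds ccs \<and> p = psum L ccs)" for v p
    have "runs M (While cells_left cell_step) u (pot L N + bcost cells_left) (\<lambda>v. (\<exists>p. I v p) \<and> \<not> bv cells_left v)"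
    proof (rule runs_While_potential[where p = "pot L N"])
      show "I u (pot L N)" unfolding I_def using u by (intro exI[of _ "[]"] exI[of _ "[[0..<N]]"]) (simp add: psum_def)
      show "okb M cells_left v \<and> 0 \<le> p" if "I v p" for v p using that psum_nonneg unfolding I_def by auto
      fix v p assume I: "I v p" and b: "bv cells_left v"
      then obtain ds ccs where P: "progress v ds ccs" "p = psum L ccs" unfolding I_def by blast
      have "ccs \<noteq> []"
      proof
        assume e: "ccs = []"
        have "rw v 3 = length (concat ds)" "rw v 2 = N" "length (seg (mw v) N N) = length (concat ds)"
          using P(1) unfolding progress_def base_def e by simp_all
        then show False using b by simp
      qed
      then obtain c ccs' where c: "ccs = c # ccs'" by (cases ccs) auto
      obtain t where t: "0 \<le> t" "runs M cell_step v t (\<lambda>v. \<exists>ds' ccs'. progress v ds' ccs' \<and> psum L ccs' + t + bcost cells_left \<le> p)"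
        using step_runs[OF P(1)[unfolded c] bound logN] P(2) c by auto
      have "runs M cell_step v t (\<lambda>v. \<exists>p'. I v p' \<and> p' + t + bcost cells_left \<le> p)"
        by (rule runs_conseq[OF t(2) order_refl]) (auto simp: I_def)
      then show "\<exists>t\<ge>0. runs M cell_step v t (\<lambda>v. \<exists>p'. I v p' \<and> p' + t + bcost cells_left \<le> p)" using t(1) by blast
    qed simp
    then show ?thesis
    proof (rule runs_conseq)
      fix v assume "(\<exists>p. I v p) \<and> \<not> bv cells_left v"
      then obtain ds ccs where P: "progress v ds ccs" "\<not> bv cells_left v" unfolding I_def by blast
      show "\<exists>ds. progress v ds []"
      proof (cases ccs)
        case Nil then show ?thesis using P by blast
      next
        case (Cons c ccs')
        note d = progressD[OF P(1)[unfolded Cons]]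
        have "rw v 2 = N" using d(1) unfolding base_def by blast
        moreover have "rw v 3 < N" using d(8,9) by linarith
        ultimately show ?thesis using P(2) by simp
      qed
    qed simp
  qed
  have rest: "runs M (first_cell ;; While cells_left cell_step ;; report) v
      (real (clen first_cell) + ((pot L N + bcost cells_left) + real (clen report))) ?Q"
    if v: "base v" "rw v 3 = 0" "rw v 5 = 0" "seg (mw v) N N = [0..<N]" for v
  proof (rule runs_Seq_wp[OF _ order_refl])
    let ?v = "v\<lparr>mw := (mw v)(3 * N := N)\<rparr>"
    have Nrb: "N = length rs + length bs" unfolding N_def by simp
    have f: "filter blue [0..<N] = [length rs..<N]" "filter (\<lambda>p. \<not> blue p) [0..<N] = [0..<length rs]"
    proof -
      have e: "[0..<N] = [0..<length rs] @ [length rs..<N]" unfolding Nrb by (metis le_add1 upt_add_eq_append zero_le)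
      have "filter blue [0..<length rs] = []" "filter blue [length rs..<N] = [length rs..<N]"
        "filter (\<lambda>p. \<not> blue p) [0..<length rs] = [0..<length rs]" "filter (\<lambda>p. \<not> blue p) [length rs..<N] = []"
        unfolding blue_def by (auto simp: filter_empty_conv filter_id_conv)
      then show "filter blue [0..<N] = [length rs..<N]" "filter (\<lambda>p. \<not> blue p) [0..<N] = [0..<length rs]" unfolding e by simp_all
    qed
    have "cell_ok [0..<N]" unfolding cell_ok_def Let_def f using bal Nrb by simp
    moreover have "seg (mw ?v) N N = [0..<N]" using v(4) by simp
    ultimately have "progress ?v [] [[0..<N]]"
      unfolding progress_def using v(1,2,3) by (simp add: base_def blocks_def packing_def)
    from runs_Seq[OF runs_conseq[OF loop[OF this] order_refl] order_refl, of report "real (clen report)" ?Q] rep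
    have "runs M (While cells_left cell_step ;; report) ?v ((pot L N + bcost cells_left) + real (clen report)) ?Q" by blast
    moreover have e3: "N + N + N = 3 * N" by simp
    moreover have "rw v 2 = N" "3 * N \<le> M" "N + N \<le> M" using v(1) bound unfolding base_def by simp_all
    ultimately show "wp M first_cell v (\<lambda>v. runs M (While cells_left cell_step ;; report) v ((pot L N + bcost cells_left) + real (clen report)) ?Q)"
      unfolding first_cell_def ends_def by (simp add: e3)
  qed
  let ?u = "s\<lparr>rw := (rw s)(2 := N, 12 := 2 * N, 20 := 0)\<rparr>"
  have num: "runs M (While number_cond number_body ;; first_cell ;; While cells_left cell_step ;; report) ?u
      ((real N + 1) * number_cost + (real (clen first_cell) + ((pot L N + bcost cells_left) + real (clen report)))) ?Q"
  proof (rule runs_Seq[OF runs_conseq[OF number_runs[of ?u] order_refl] order_refl])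
    fix v :: mst assume v: "seg (mw v) N N = [0..<N] \<and> (\<forall>a. a < N \<or> 2 * N \<le> a \<longrightarrow> mw v a = mw ?u a) \<and> mx v = mx ?u \<and>
      (\<forall>i. i \<noteq> 20 \<longrightarrow> rw v i = rw ?u i)"
    show "runs M (first_cell ;; While cells_left cell_step ;; report) v (real (clen first_cell) + ((pot L N + bcost cells_left) + real (clen report))) ?Q"
      by (rule rest) (use v s in \<open>simp_all add: base_def\<close>)
  qed (use bound in simp_all)
  show ?thesis unfolding main_def
  proof (rule runs_Seq_wp)
    have "length rs + length bs = N" unfolding N_def by simp
    moreover have "N + N \<le> M" "N \<le> M" using bound by linarith+
    ultimately show "wp M main_init s (\<lambda>v. runs M (While number_cond number_body ;; first_cell ;; While cells_left cell_step ;; report) v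
      ((real N + 1) * number_cost + (real (clen first_cell) + ((pot L N + bcost cells_left) + real (clen report)))) ?Q)"
      unfolding main_init_def using num s by (simp add: mult_2)
    show "real (clen main_init) + ((real N + 1) * number_cost + (real (clen first_cell) + ((pot L N + bcost cells_left) + real (clen report)))) \<le> main_time L N"
      unfolding main_time_def main_def by simp
  qed
qed

end

section \<open>From packings to coverings\<close>

text \<open>Edges of different stars are disjoint by \<open>apart\<close>. Two edges of one star
  meet only in the center, because their endpoints are not collinear. Vertex sets are nonempty and
  pairwise disjoint, so they are also pairwise different, and so are the stars.\<close>

lemma packing_covering:
  fixes qs :: "point list list"
  defines "S \<equiv> map (\<lambda>s. (hd s, set (tl s))) qs"
  assumes gp: "general_position (R \<union> B)" and pk: "packing R B qs"
  shows "distinct S" "K13_covering R B (\<Union>(set ` set qs)) (set S)" "\<Union>(set ` set qs) \<subseteq> R \<union> B" "card (\<Union>(set ` set qs)) = 4 * length qs"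
proof -
  have st: "star_on R B s" if "s \<in> set qs" for s using pk that unfolding packing_def by blast
  have l4: "length s = 4" "distinct s" "s \<noteq> []" "set s = insert (hd s) (set (tl s))" if "s \<in> set qs" for s
  proof -
    show "length s = 4" "distinct s" using st[OF that] unfolding star_on_def by blast+
    then show "s \<noteq> []" by auto
    then show "set s = insert (hd s) (set (tl s))" by (metis list.exhaust_sel list.simps(15))
  qed
  have ap: "apart (qs ! i) (qs ! j)" if "i < j" "j < length qs" for i j
    using pk that unfolding packing_def by (auto simp: sorted_wrt_iff_nth_less)
  have dj: "set (qs ! i) \<inter> set (qs ! j) = {}" if "i < length qs" "j < length qs" "i \<noteq> j" for i j
  proof (cases "i < j")
    case True
    then show ?thesis using apart_disjoint[OF ap[OF True that(2)]] l4(1) that by simp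
  next
    case False
    then have "j < i" using that by simp
    then show ?thesis using apart_disjoint[OF ap[OF _ that(1)]] l4(1) that by (metis Int_commute nth_mem)
  qed
  have vert: "star_vertices (hd s, set (tl s)) = set s" if "s \<in> set qs" for s
    unfolding star_vertices_def using l4(4)[OF that] by simp
  show "distinct S"
  proof (rule ccontr)
    assume "\<not> distinct S"
    then obtain i j where ij: "i < length qs" "j < length qs" "i \<noteq> j" "S ! i = S ! j"
      unfolding S_def distinct_conv_nth by auto
    then have "star_vertices (hd (qs ! i), set (tl (qs ! i))) = star_vertices (hd (qs ! j), set (tl (qs ! j)))" unfolding S_def by simp
    then have "set (qs ! i) = set (qs ! j)" using vert ij by (metis nth_mem)
    then show False using dj[OF ij(1-3)] l4(3)[of "qs ! i"] ij(1) by simp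
  qed
  show "\<Union>(set ` set qs) \<subseteq> R \<union> B" using star_on_subset[OF st] by blast
  have un: "\<Union>(set ` set qs) = (\<Union>i\<in>{..<length qs}. set (qs ! i))" by (auto simp: set_conv_nth)
  have "card (\<Union>i\<in>{..<length qs}. set (qs ! i)) = (\<Sum>i<length qs. card (set (qs ! i)))"
    by (rule card_UN_disjoint) (use dj in auto)
  also have "\<dots> = (\<Sum>i<length qs. 4)" by (rule sum.cong) (use l4(1,2) in \<open>simp_all add: distinct_card\<close>)
  finally show "card (\<Union>(set ` set qs)) = 4 * length qs" unfolding un by simp
  have vS: "star_vertices ` set S = set ` set qs" unfolding S_def using vert by (auto simp: image_iff)
  have part: "partition_on (\<Union>(set ` set qs)) (star_vertices ` set S)"
    unfolding vS partition_on_def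
  proof (intro conjI refl disjointI)
    show "{} \<notin> set ` set qs" using l4(3) by auto
    show "p \<inter> q = {}" if pq: "p \<in> set ` set qs" "q \<in> set ` set qs" "p \<noteq> q" for p q
    proof -
      obtain i j where ij: "i < length qs" "j < length qs" "p = set (qs ! i)" "q = set (qs ! j)"
        using pq(1,2) unfolding image_iff by (metis in_set_conv_nth)
      then have "i \<noteq> j" using pq(3) by auto
      then show ?thesis using dj ij by blast
    qed
  qed
  have K: "is_K13 R B t" if tS: "t \<in> set S" for t
  proof -
    obtain s where s: "s \<in> set qs" "t = (hd s, set (tl s))" using tS unfolding S_def by auto
    have "card (set (tl s)) = 3" using l4(1,2)[OF s(1)] by (simp add: distinct_card distinct_tl)
    then show ?thesis unfolding is_K13_def s(2) using st[OF s(1)] unfolding star_on_def by auto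
  qed
  have pair: "closed_segment (fst e) (snd e) \<inter> closed_segment (fst f) (snd f) \<subseteq> {fst e, snd e} \<inter> {fst f, snd f}"
    if e: "e \<in> (\<Union>t\<in>set S. star_edges t)" and f: "f \<in> (\<Union>t\<in>set S. star_edges t)" and ne: "e \<noteq> f" for e f
  proof -
    have edge: "\<exists>i<length qs. fst g = hd (qs ! i) \<and> snd g \<in> set (tl (qs ! i))" if gS: "g \<in> (\<Union>t\<in>set S. star_edges t)" for g
    proof -
      obtain s where s: "s \<in> set qs" "g \<in> {hd s} \<times> set (tl s)" using gS unfolding S_def star_edges_def by auto
      obtain k where k: "k < length qs" "s = qs ! k" using s(1) by (metis in_set_conv_nth)
      then show ?thesis using s(2) unfolding mem_Times_iff by blast
    qed
    obtain i where i: "i < length qs" "fst e = hd (qs ! i)" "snd e \<in> set (tl (qs ! i))" using edge[OF e] by blast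
    obtain j where j: "j < length qs" "fst f = hd (qs ! j)" "snd f \<in> set (tl (qs ! j))" using edge[OF f] by blast
    show ?thesis
    proof (cases "i = j")
      case True
      let ?s = "qs ! i"
      have s: "?s \<in> set qs" using i by simp
      have m: "hd ?s \<in> R \<union> B" "snd e \<in> R \<union> B" "snd f \<in> R \<union> B"
        using star_on_subset[OF st[OF s]] l4(4)[OF s] i(3) j(3) True by auto
      have hn: "hd ?s \<notin> set (tl ?s)" using l4(2,3)[OF s] by (cases ?s) auto
      have d3: "snd e \<noteq> snd f" "hd ?s \<noteq> snd e" "hd ?s \<noteq> snd f" using ne i j True hn by (metis prod.collapse)+
      have "\<not> collinear {snd e, hd ?s, snd f}" using general_positionD[OF gp m(2,1,3)] d3 by metis
      then have "closed_segment (snd e) (hd ?s) \<inter> closed_segment (hd ?s) (snd f) = {hd ?s}" using Int_closed_segment by blast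
      then show ?thesis using i(2) j(2) True by (simp add: closed_segment_commute)
    next
      case False
      have "closed_segment (fst e) (snd e) \<inter> closed_segment (fst f) (snd f) = {}"
      proof (cases "i < j")
        case True then show ?thesis using ap[OF True j(1)] i j unfolding apart_def by metis
      next
        case ji: False
        then have "j < i" using False by simp
        from ap[OF this i(1)] show ?thesis using i j unfolding apart_def by (metis Int_commute)
      qed
      then show ?thesis by simp
    qed
  qed
  have nc: "noncrossing (\<Union>t\<in>set S. star_edges t)"
    unfolding noncrossing_def case_prod_beta using pair by (metis prod.collapse)
  show "K13_covering R B (\<Union>(set ` set qs)) (set S)" unfolding K13_covering_def using part K nc by blast
qed

text \<open>The exponent \<open>big\<close> is for the counter of the exhaustive search, the
  additional 4 for polynomial quantities and small constants: for \<open>N\<close> at least 3 the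
  fourth power exceeds \<open>9 * (N * N)\<close>.\<close>

lemma power_bounds:
  fixes N :: nat
  assumes "3 \<le> N"
  shows "N * N + 4 * N + 1 \<le> N ^ (big + 4)" "5 * N + 20 \<le> N ^ (big + 4)" "N ^ big \<le> N ^ (big + 4)" "big \<le> N ^ (big + 4)" "N \<le> N ^ (big + 4)"
proof -
  have mono: "N ^ a \<le> N ^ (big + 4)" if "a \<le> big + 4" for a using assms that by (intro power_increasing) auto
  have N4: "N ^ 4 = N * N * (N * N)" by (simp add: numeral_eq_Suc)
  have NN: "3 * N \<le> N * N" using assms by simp
  then have N9: "9 \<le> N * N" using assms by linarith
  have q: "9 * (N * N) \<le> N ^ 4" unfolding N4 using N9 by (intro mult_right_mono) auto
  have "N * N + 4 * N + 1 \<le> N ^ 4" "5 * N + 20 \<le> N ^ 4" using q NN N9 by linarith+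
  then show "N * N + 4 * N + 1 \<le> N ^ (big + 4)" "5 * N + 20 \<le> N ^ (big + 4)" using mono[of 4] by linarith+
  show p: "N ^ big \<le> N ^ (big + 4)" by (rule mono) simp
  have "big < 2 ^ big" by (rule less_exp)
  also have "(2::nat) ^ big \<le> N ^ big" using assms by (intro power_mono) auto
  finally show "big \<le> N ^ (big + 4)" using p by linarith
  show "N \<le> N ^ (big + 4)" using mono[of 1] by simp
qed

text \<open>The natural logarithm is enough for the number of sorting rounds, because
  \<open>exp 1\<close> is below the factor 4 gained per round.\<close>

lemma le_4_pow_ceiling_ln:
  assumes "1 \<le> N"
  shows "N \<le> 4 ^ nat \<lceil>ln (real N)\<rceil>" "real (nat \<lceil>ln (real N)\<rceil>) \<le> ln (real N) + 1"
proof -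
  let ?L = "nat \<lceil>ln (real N)\<rceil>"
  have l0: "0 \<le> ln (real N)" using assms by simp
  have le: "ln (real N) \<le> real ?L" by linarith
  have "real N = exp (ln (real N))" using assms by simp
  also have "\<dots> \<le> exp (real ?L * 1)" using le by simp
  also have "\<dots> = exp 1 ^ ?L" by (rule exp_of_nat_mult)
  also have "\<dots> \<le> 4 ^ ?L" using exp_le by (intro power_mono) auto
  finally have "real N \<le> real (4 ^ ?L)" by simp
  then show "N \<le> 4 ^ ?L" by linarith
  show "real ?L \<le> ln (real N) + 1" using l0 by linarith
qed

definition time_bound :: "nat \<Rightarrow> nat" where
  "time_bound N = nat \<lceil>real (clen main) + (real N + 1) * number_cost + bcost cells_left
     + pot_factor * ((ln (real N) + 2) * (real N * (1 + ln (real N))))\<rceil>"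

lemma time_bound_bigo: "(\<lambda>N. real (time_bound N)) \<in> O(\<lambda>N. real N powr (4/3) * ln (real N) ^ 3)"
proof -
  let ?g = "\<lambda>N. real N powr (4/3) * ln (real N) ^ 3"
  let ?f = "\<lambda>N. (real (clen main) + bcost cells_left + 1) * 1 + number_cost * (real N + 1)
     + pot_factor * ((ln (real N) + 2) * (real N * (1 + ln (real N))))"
  have c1: "(\<lambda>N::nat. 1 :: real) \<in> O(?g)" by real_asymp
  have c2: "(\<lambda>N::nat. real N + 1) \<in> O(?g)" by real_asymp
  have c3: "(\<lambda>N::nat. (ln (real N) + 2) * (real N * (1 + ln (real N)))) \<in> O(?g)" by real_asymp
  have cm: "(\<lambda>N. c * f N) \<in> O(?g)" if "f \<in> O(?g)" for c and f :: "nat \<Rightarrow> real"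
    using that by (cases "c = 0") auto
  have f: "?f \<in> O(?g)" by (rule sum_in_bigo(1)[OF sum_in_bigo(1)[OF cm[OF c1] cm[OF c2]] cm[OF c3]])
  have "eventually (\<lambda>N. norm (real (time_bound N)) \<le> norm (?f N)) sequentially"
  proof (rule eventually_sequentiallyI[of 1])
    fix N :: nat assume N: "1 \<le> N"
    let ?r = "real (clen main) + (real N + 1) * number_cost + bcost cells_left
     + pot_factor * ((ln (real N) + 2) * (real N * (1 + ln (real N))))"
    have "0 \<le> number_cost" unfolding number_cost_def using bcost_ge[of number_cond] by simp
    then have r0: "0 \<le> ?r" using cost_nonneg N bcost_ge[of cells_left] by (intro add_nonneg_nonneg mult_nonneg_nonneg) auto
    then have "real (time_bound N) \<le> ?r + 1" unfolding time_bound_def by linarith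
    also have "?r + 1 = ?f N" by (simp add: algebra_simps)
    finally show "norm (real (time_bound N)) \<le> norm (?f N)" by simp
  qed
  from landau_o.big_trans[OF landau_o.big_mono[OF this] f] show ?thesis .
qed

lemma main_time_le:
  assumes "1 \<le> N"
  shows "main_time (nat \<lceil>ln (real N)\<rceil>) N \<le> real (time_bound N)"
proof -
  let ?L = "nat \<lceil>ln (real N)\<rceil>" and ?x = "real N * (1 + ln (real N))"
  have "0 \<le> ?x" using assms by simp
  moreover have "real ?L + 1 \<le> ln (real N) + 2" using le_4_pow_ceiling_ln(2)[OF assms] by linarith
  ultimately have "(real ?L + 1) * ?x \<le> (ln (real N) + 2) * ?x" by (intro mult_right_mono)
  then have "pot_factor * ((real ?L + 1) * ?x) \<le> pot_factor * ((ln (real N) + 2) * ?x)"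
    using cost_nonneg by (intro mult_left_mono)
  then have "main_time ?L N \<le> real (clen main) + (real N + 1) * number_cost + bcost cells_left + pot_factor * ((ln (real N) + 2) * ?x)"
    unfolding main_time_def pot_def by (simp add: mult.assoc)
  then show ?thesis unfolding time_bound_def by linarith
qed

theorem theorem23:
  "\<exists>(P :: instr list) (k :: nat) (T :: nat \<Rightarrow> nat).
     (\<lambda>N. real (T N)) \<in> O(\<lambda>N. real N powr (4/3) * ln (real N) ^ 3) \<and>
     (\<forall>(r :: nat) (b :: nat) (rs :: point list) (bs :: point list).
        0 < b \<and> b \<le> r \<and> 1/3 \<le> real b / real r \<and> real b / real r \<le> 4/5 \<and>
        length rs = r \<and> length bs = b \<and> distinct (rs @ bs) \<and>
        general_position (set (rs @ bs)) \<longrightarrow>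
        (\<exists>s S X. computes_within P ((r + b) ^ k) (T (r + b)) (input_state rs bs) s \<and>
           outputs_stars (rs @ bs) s S \<and> distinct S \<and>
           X \<subseteq> set (rs @ bs) \<and> real (card X) \<ge> 8/9 * real (r + b) - 4 \<and>
           K13_covering (set rs) (set bs) X (set S)))"
proof (intro exI[of _ "cc main 0"] exI[of _ "big + 4"] exI[of _ time_bound] conjI allI impI)
  show "(\<lambda>N. real (time_bound N)) \<in> O(\<lambda>N. real N powr (4/3) * ln (real N) ^ 3)" by (rule time_bound_bigo)
  fix r b :: nat and rs bs :: "point list"
  assume h: "0 < b \<and> b \<le> r \<and> 1/3 \<le> real b / real r \<and> real b / real r \<le> 4/5 \<and>
        length rs = r \<and> length bs = b \<and> distinct (rs @ bs) \<and> general_position (set (rs @ bs))"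
  then interpret points rs bs by unfold_locales auto
  have N: "N = r + b" unfolding N_def using h by simp
  have rb: "real r \<le> 3 * real b" "5 * real b \<le> 4 * real r" 
  proof -
    have "0 < real r" "1/3 \<le> real b / real r" "real b / real r \<le> 4/5" using h by linarith+
    then show "real r \<le> 3 * real b" "5 * real b \<le> 4 * real r" by (simp_all add: field_simps)
  qed
  \<comment> \<open>\<open>5 * b \<le> 4 * r\<close> with positive \<open>b\<close> excludes
    \<open>r = 1\<close>, so there are at least three points.\<close>
  have N3: "3 \<le> N" using rb h unfolding N by linarith
  define L where "L = nat \<lceil>ln (real N)\<rceil>"
  let ?M = "N ^ (big + 4)" and ?\<sigma> = "input_state rs bs"
  have lg: "N \<le> 4 ^ L" unfolding L_def using le_4_pow_ceiling_ln(1)[of N] N3 by simp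
  define m where "m = star_count N"
  have "runs ?M main (view ?\<sigma>) (main_time L N) (\<lambda>v. rw v 0 = m \<and> set (seg (mw v) 0 (4 * m)) \<subseteq> {..<N} \<and>
    packing (set rs) (set bs) (blocks (seg (mw v) 0 (4 * m))))"
    unfolding m_def
  proof (rule main_runs[OF _ _ _ _ _ _ _ _ power_bounds(1-4)[OF N3] lg])
    show "mx (view ?\<sigma>) (2 * p) = X p \<and> mx (view ?\<sigma>) (2 * p + 1) = Y p" if "p < N" for p
      using that unfolding N_def X_def Y_def by (simp add: input_state_def)
    \<comment> \<open>The initial cell has no deficit: \<open>r \<le> 3 * b\<close> means that blue
      makes up at least a quarter, and red is at least half.\<close>
    show "N \<le> 4 * length rs" "N \<le> 4 * length bs" "0 < N" using rb h unfolding N by linarith+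
  qed (auto simp: view_def input_state_def)
  then have "runs ?M main (view ?\<sigma>) (real (time_bound N)) (\<lambda>v. rw v 0 = m \<and> set (seg (mw v) 0 (4 * m)) \<subseteq> {..<N} \<and>
    packing (set rs) (set bs) (blocks (seg (mw v) 0 (4 * m))))"
    by (rule runs_conseq) (use main_time_le[of N] N3 in \<open>auto simp: L_def\<close>)
  moreover have "words_bounded ?M ?\<sigma>"
    unfolding words_bounded_def input_state_def using power_bounds(5)[OF N3] h N by auto
  moreover have "pc ?\<sigma> = 0" by (simp add: input_state_def)
  ultimately obtain \<sigma>' where \<sigma>': "computes_within (cc main 0) ?M (time_bound N) ?\<sigma> \<sigma>'" "rw (view \<sigma>') 0 = m"
    "set (seg (mw (view \<sigma>')) 0 (4 * m)) \<subseteq> {..<N}" "packing (set rs) (set bs) (blocks (seg (mw (view \<sigma>')) 0 (4 * m)))"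
    using computes_within_runs by blast
  define w where "w = seg (wmem \<sigma>') 0 (4 * m)"
  have pk: "packing (set rs) (set bs) (blocks w)" and wN: "set w \<subseteq> {..<N}" using \<sigma>' unfolding w_def by simp_all
  have lb: "length (blocks w) = m" unfolding blocks_def w_def by simp
  define S where "S = map (\<lambda>s. (hd s, set (tl s))) (blocks w)"
  have gp': "general_position (set rs \<union> set bs)" using gp by simp
  note cov = packing_covering[OF gp' pk, folded S_def]
  have reg: "wreg \<sigma>' 0 = m" using \<sigma>'(2) by (simp add: view_def)
  have "outputs_stars (rs @ bs) \<sigma>' S" unfolding outputs_stars_def
  proof (intro conjI allI impI)
    show "length S = wreg \<sigma>' 0" unfolding S_def using lb reg by simp
    have lS: "length S = m" unfolding S_def using lb by simp
    show "wmem \<sigma>' a < length (rs @ bs)" if "a < 4 * length S" for a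
    proof -
      have "wmem \<sigma>' a \<in> set w" unfolding w_def set_seg using that lS by auto
      then show ?thesis using wN unfolding N_def by auto
    qed
    show "S ! j = ((rs @ bs) ! wmem \<sigma>' (4 * j), {(rs @ bs) ! wmem \<sigma>' (4 * j + 1), (rs @ bs) ! wmem \<sigma>' (4 * j + 2), (rs @ bs) ! wmem \<sigma>' (4 * j + 3)})"
      if "j < length S" for j
    proof -
      have j: "j < m" using that lS by simp
      have "S ! j = (hd (block w j), set (tl (block w j)))" unfolding S_def blocks_def w_def using j by simp
      moreover have "w ! (4 * j + a) = wmem \<sigma>' (4 * j + a)" if "a < 4" for a unfolding w_def using j that by simp
      from this[of 0] this[of 1] this[of 2] this[of 3] have "w ! (4 * j) = wmem \<sigma>' (4 * j)" "w ! (4 * j + 1) = wmem \<sigma>' (4 * j + 1)"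
        "w ! (4 * j + 2) = wmem \<sigma>' (4 * j + 2)" "w ! (4 * j + 3) = wmem \<sigma>' (4 * j + 3)" by simp_all
      ultimately show ?thesis unfolding block_def by simp
    qed
  qed
  moreover have "real (card (\<Union>(set ` set (blocks w)))) \<ge> 8/9 * real (r + b) - 4"
  proof -
    \<comment> \<open>At most one star is missing from \<open>2N/9\<close>; with four points per
      star this gives \<open>8/9\<close> of the points minus 4.\<close>
    have "2 * real N \<le> 9 * real m + 9" using star_count_ge[of N] unfolding m_def by linarith
    then show ?thesis unfolding cov(4) lb N by (simp add: field_simps)
  qed
  moreover have "\<Union>(set ` set (blocks w)) \<subseteq> set (rs @ bs)" using cov(3) by simp
  ultimately show "\<exists>s S X. computes_within (cc main 0) ((r + b) ^ (big + 4)) (time_bound (r + b)) (input_state rs bs) s \<and>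
           outputs_stars (rs @ bs) s S \<and> distinct S \<and>
           X \<subseteq> set (rs @ bs) \<and> real (card X) \<ge> 8/9 * real (r + b) - 4 \<and> K13_covering (set rs) (set bs) X (set S)"
    using \<sigma>'(1) cov(1,2) unfolding N by blast
qed

end
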